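(* Let $n\ge2$, let $\Omega\subset\mathbb R^n$ be a bounded domain with smooth boundary containing the origin $\mathbf 0$, and let $\Omega_0=\Omega\setminus\{\mathbf 0\}$. Let $s\ge1$ if $n\ge3$ and $s\ge2$ if $n=2$. Then each $f\in M^s(\Omega_0)$ has a $\sigma$-trace $\sigma f|_0\in A(\Theta)$, and the operator $f\mapsto\sigma f|_0$ continuously maps the space $M^s(\Omega_0)$ into $A(\Theta)$.
   Context: Spherical coordinates: $r=|x|$, $\vartheta=x/|x|\in\Theta$, where $\Theta$ is the unit sphere of $\mathbb R^n$; $Y_{k,l}$ ($k=0,1,\dots$; $l=1,\dots,d_k$) is an orthonormal basis of $L_2(\Theta)$ of spherical harmonics of order $k$; $f_{k,l}(r)=\int_\Theta f(r,\vartheta)Y_{k,l}(\vartheta)\,d\vartheta$. $H^s$ denotes the $L_2$-Sobolev spaces. $U_\rho$ is the ball of radius $\rho$ centered at $\mathbf 0$. One-dimensional transmutation operators. Let $\mathring C^\infty_{\{0\}}(0,\infty)$ be the set of $C^\infty$ functions on $(0,\infty)$ vanishing for all sufficiently large $y$, and $\mathring C^\infty[0,\infty)$ (resp. $\mathring C^\infty[0,R)$) the set of functions smooth up to $y=0$ and vanishing for large $y$ (resp. vanishing near $y=R$ and beyond). For $\operatorname{Re}\mu>-M$, $M$ a nonnegative integer, $I^\mu f(y)=\frac{(-1)^M}{\Gamma(\mu+M)}\int_y^\infty (t-y)^{\mu+M-1}f^{(M)}(t)\,dt$. For $\nu\ge 0$ and an integer $N\ge0$ with $\nu<N+\frac12$,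 $$S_\nu^{\nu-\frac12}f(y)=\frac{-2\Gamma(\nu+1)}{\sqrt\pi\,\Gamma(\nu+\frac12)}\frac{d}{dy}\int_y^\infty(t^2-y^2)^{\nu-\frac12}tf(t)\,dt,$$ $$P_\nu^{\frac12-\nu}f(y)=\frac{(-1)^N2^{-N}\sqrt\pi}{\Gamma(\nu+1)\Gamma(N-\nu+\frac12)}\int_y^\infty(t^2-y^2)^{N-\nu-\frac12}\Big(\frac{d}{dt}\frac1t\Big)^Nf(t)\,dt,$$ $S_\nu=I^{\frac12-\nu}S_\nu^{\nu-\frac12}$, $P_\nu=P_\nu^{\frac12-\nu}I^{\nu-\frac12}$. Let $\mathring C^\infty_\nu(0,\infty)=P_\nu(\mathring C^\infty[0,\infty))$ and $\mathring C^\infty_\nu(0,R)=P_\nu(\mathring C^\infty[0,R))$, and put $\|g\|_{\mathring H^s_\nu(0,R)}=\frac{\sqrt\pi}{2^{\nu+1/2}\Gamma(\nu+1)}\|D^sS_\nu g\|_{L_2(0,R)}$ for $g\in \mathring C^\infty_\nu(0,R)$. Space $M^s(\Omega_0)$, $s\ge0$ an integer. Fix $R_0>0$ with $\overline{U_{2R_0}}\subset\Omega$ and a smooth function $\chi(r)$ on $[0,\infty)$ with $\chi=1$ on $[0,1]$, $\chi=0$ for $r\ge2$, $\chi$ monotonously decreasing on $(1,2)$; $\chi_R(r)=\chi(r/R)$. $\mathring T^\infty(\Omega_0)$ is the set of $f\in C^\infty(\overline\Omega\setminus\{\mathbf 0\})$ such that, for $0<R<R_0$, $\chi_Rf=\sum_{k=0}^{K}\sum_{l=1}^{d_k}\chi_Rf_{k,l}Y_{k,l}$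 with some finite $K=K(f)$ and $r^{-k}\chi_Rf_{k,l}\in\mathring C^\infty_{\frac n2+k-1}(0,\infty)$. On it define the norms, $0<R<R_0$, $$\|f\|_{s,R}=\Big(\sum_{k,l}\|r^{-k}\chi_Rf_{k,l}\|^2_{\mathring H^s_{\frac n2+k-1}(0,2R)}+\|(1-\chi_R)f\|^2_{H^s(\Omega)}\Big)^{1/2}.$$ $M^s(\Omega_0)$ is the closure (completion, realized inside $H^s_{loc}(\Omega_0)=\{f:(1-\chi_R)f\in H^s(\Omega)\ \forall R\in(0,R_0)\}$) of $\mathring T^\infty(\Omega_0)$ in the topology given by all these norms; it does not depend on $\chi$. Space $A(\Theta)$: functions $\psi=\sum\psi_{k,l}Y_{k,l}$ on $\Theta$ with $\|\psi\|_h=(\sum_{k,l}|\psi_{k,l}|^2h^{-2k})^{1/2}<\infty$ for every $h\in(0,1)$, with the topology of these norms. $\sigma$-trace. For $f\in\mathring T^\infty(\Omega_0)$ and small $r$: if $n\ge3$, $\sigma f(r,\vartheta)=\sum_{k,l}r^{n+k-2}f_{k,l}(r)Y_{k,l}(\vartheta)$; if $n=2$, $\sigma f(r,\varphi)=\frac{f_0(r)}{\ln r}+\sum_{k\ge1}r^k(f_{k,1}(r)\cos k\varphi+f_{k,2}(r)\sin k\varphi)$, where $f_0,f_{k,1},f_{k,2}$ are the usual Fourier coefficients of $f(r,\cdot)$ (so $f=f_0+\sum_k (f_{k,1}\cos k\varphi+f_{k,2}\sin k\varphi)$). Then $\sigma f|_0=\lim_{r\to+0}\sigma f(r,\cdot)$.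 For $f\in M^s(\Omega_0)$: $f$ has a $\sigma$-trace $\psi=\sigma f|_0$ if, for sequences $f^j\in\mathring T^\infty(\Omega_0)$ converging to $f$ in $M^s(\Omega_0)$, the functions $\sigma f^j|_0$ converge in $A(\Theta)$ to $\psi$ and $\psi$ does not depend on the choice of the sequence. *)

theory Defs
  imports "HOL-Analysis.Analysis"
begin

section \<open>Smooth functions\<close>

fun pderiv_list :: "'a list \<Rightarrow> ('a::real_normed_vector \<Rightarrow> 'b::real_normed_vector) \<Rightarrow> 'a \<Rightarrow> 'b" where
  "pderiv_list [] f = f"
| "pderiv_list (i # is) f = (\<lambda>x. vector_derivative (\<lambda>t::real. pderiv_list is f (x + t *\<^sub>R i)) (at 0))"

text \<open>To be used for open \<open>S\<close> only: all iterated partial derivatives exist and are differentiable.\<close>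

definition smooth_on :: "'a::euclidean_space set \<Rightarrow> ('a \<Rightarrow> 'b::real_normed_vector) \<Rightarrow> bool" where
  "smooth_on S f \<longleftrightarrow> (\<forall>is. set is \<subseteq> Basis \<longrightarrow> pderiv_list is f differentiable_on S)"

definition smooth_bounded_domain :: "'a::euclidean_space set \<Rightarrow> bool" where
  "smooth_bounded_domain \<Omega> \<longleftrightarrow> open \<Omega> \<and> connected \<Omega> \<and> bounded \<Omega> \<and>
     (\<forall>p\<in>frontier \<Omega>. \<exists>U (\<rho>::'a \<Rightarrow> real). open U \<and> p \<in> U \<and> smooth_on U \<rho> \<and>
        (\<forall>x\<in>U. \<exists>i\<in>Basis. pderiv_list [i] \<rho> x \<noteq> 0) \<and>
        \<Omega> \<inter> U = {x\<in>U. \<rho> x < 0})"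

text \<open>Functions on the half-line \<open>(0,\<infinity>)\<close> are represented by functions on \<open>real\<close>;
  their values at nonpositive arguments play no role.\<close>

definition Dn :: "nat \<Rightarrow> (real \<Rightarrow> 'b::real_normed_vector) \<Rightarrow> real \<Rightarrow> 'b" where
  "Dn m = (\<lambda>f x. vector_derivative f (at x)) ^^ m"

text \<open>Smooth on \<open>(0,\<infinity>)\<close>, and smooth up to the end point \<open>0\<close>.\<close>

definition smooth_halfline :: "(real \<Rightarrow> 'b::real_normed_vector) \<Rightarrow> bool" where
  "smooth_halfline f \<longleftrightarrow>
     (\<forall>m. Dn m f differentiable_on {0<..} \<and> (\<exists>l. (Dn m f \<longlongrightarrow> l) (at_right 0)))"

definition Cinf_comp :: "(real \<Rightarrow> complex) set" where
  "Cinf_comp = {f. smooth_halfline f \<and> (\<exists>b. \<forall>y>b. f y = 0)}"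


section \<open>Transmutation operators\<close>

text \<open>The value of \<open>I\<^sup>\<mu> f\<close> does not depend on the admissible integer \<open>M\<close>;
  the least one is used. The same applies to \<open>N\<close> in \<open>P1_op\<close>.\<close>

definition I_op :: "real \<Rightarrow> (real \<Rightarrow> complex) \<Rightarrow> real \<Rightarrow> complex" where
  "I_op \<mu> f y =
     (let M = (LEAST M::nat. \<mu> > - real M)
      in ((-1) ^ M / Gamma (\<mu> + real M)) *\<^sub>R
           (LINT t:{y<..}|lborel. ((t - y) powr (\<mu> + real M - 1)) *\<^sub>R Dn M f t))"

definition S1_op :: "real \<Rightarrow> (real \<Rightarrow> complex) \<Rightarrow> real \<Rightarrow> complex" where
  "S1_op \<nu> f y =
     (- 2 * Gamma (\<nu> + 1) / (sqrt pi * Gamma (\<nu> + 1/2))) *\<^sub>R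
       vector_derivative
         (\<lambda>z. LINT t:{z<..}|lborel. ((t\<^sup>2 - z\<^sup>2) powr (\<nu> - 1/2) * t) *\<^sub>R f t) (at y)"

definition P1_op :: "real \<Rightarrow> (real \<Rightarrow> complex) \<Rightarrow> real \<Rightarrow> complex" where
  "P1_op \<nu> f y =
     (let N = (LEAST N::nat. \<nu> < real N + 1/2)
      in ((-1) ^ N * sqrt pi / (2 ^ N * Gamma (\<nu> + 1) * Gamma (real N - \<nu> + 1/2))) *\<^sub>R
           (LINT t:{y<..}|lborel. ((t\<^sup>2 - y\<^sup>2) powr (real N - \<nu> - 1/2)) *\<^sub>R
              ((\<lambda>g t. vector_derivative (\<lambda>u. g u /\<^sub>R u) (at t)) ^^ N) f t))"

definition S_op :: "real \<Rightarrow> (real \<Rightarrow> complex) \<Rightarrow> real \<Rightarrow> complex" where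
  "S_op \<nu> f = I_op (1/2 - \<nu>) (S1_op \<nu> f)"

definition P_op :: "real \<Rightarrow> (real \<Rightarrow> complex) \<Rightarrow> real \<Rightarrow> complex" where
  "P_op \<nu> f = P1_op \<nu> (I_op (\<nu> - 1/2) f)"

definition Cinf_nu :: "real \<Rightarrow> (real \<Rightarrow> complex) set" where
  "Cinf_nu \<nu> = {g. \<exists>f\<in>Cinf_comp. \<forall>y>0. g y = P_op \<nu> f y}"

definition Hnu_norm :: "nat \<Rightarrow> real \<Rightarrow> real \<Rightarrow> (real \<Rightarrow> complex) \<Rightarrow> real" where
  "Hnu_norm s \<nu> R g = sqrt pi / (2 powr (\<nu> + 1/2) * Gamma (\<nu> + 1)) *
     sqrt (LINT y:{0<..<R}|lborel. (norm (Dn s (S_op \<nu> g) y))\<^sup>2)"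


section \<open>Spherical harmonics\<close>

text \<open>Surface measure of the unit sphere: a Borel set \<open>E\<close> of the sphere has surface measure \<open>n\<close>
  times the Lebesgue measure of the cone \<open>{r\<theta>. 0 < r < 1, \<theta> \<in> E}\<close>, \<open>n\<close> the dimension.\<close>

definition sphere_measure :: "'a::euclidean_space measure" where
  "sphere_measure = scale_measure (of_nat DIM('a))
     (distr (restrict_space lborel (ball 0 1 - {0})) (restrict_space borel (sphere 0 1)) sgn)"

definition spherical_harmonic :: "nat \<Rightarrow> ('a::euclidean_space \<Rightarrow> real) \<Rightarrow> bool" where
  "spherical_harmonic k Y \<longleftrightarrow>
     (\<exists>p. real_polynomial_function p \<and> (\<forall>c x. p (c *\<^sub>R x) = c ^ k * p x) \<and>
          (\<forall>x. (\<Sum>i\<in>Basis. pderiv_list [i, i] p x) = 0) \<and>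
          (\<forall>\<theta>\<in>sphere 0 1. Y \<theta> = p \<theta>))"

definition sph_coeff :: "('a::euclidean_space \<Rightarrow> real) \<Rightarrow> ('a \<Rightarrow> 'b::{banach, second_countable_topology}) \<Rightarrow> 'b" where
  "sph_coeff Y g = (LINT \<theta>|sphere_measure. Y \<theta> *\<^sub>R g \<theta>)"

definition L2_sphere :: "('a::euclidean_space \<Rightarrow> 'b::{banach, second_countable_topology}) set" where
  "L2_sphere = {g. g \<in> borel_measurable sphere_measure \<and>
                   integrable sphere_measure (\<lambda>\<theta>. (norm (g \<theta>))\<^sup>2)}"

definition harmonic_basis :: "(nat \<Rightarrow> nat) \<Rightarrow> (nat \<Rightarrow> nat \<Rightarrow> 'a::euclidean_space \<Rightarrow> real) \<Rightarrow> bool" where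
  "harmonic_basis d Y \<longleftrightarrow>
     (\<forall>k. \<forall>l\<in>{1..d k}. spherical_harmonic k (Y k l)) \<and>
     (\<forall>k k'. \<forall>l\<in>{1..d k}. \<forall>l'\<in>{1..d k'}.
        sph_coeff (Y k l) (Y k' l') = (if k = k' \<and> l = l' then 1 else 0)) \<and>
     (\<forall>g::'a \<Rightarrow> real. g \<in> L2_sphere \<longrightarrow>
        (\<lambda>K. LINT \<theta>|sphere_measure.
               (g \<theta> - (\<Sum>k\<le>K. \<Sum>l=1..d k. sph_coeff (Y k l) g * Y k l \<theta>))\<^sup>2) \<longlonglongrightarrow> 0)"

text \<open>The coefficient functions \<open>f\<^sub>k\<^sub>,\<^sub>l(r)\<close>.\<close>

definition fkl :: "(nat \<Rightarrow> nat \<Rightarrow> 'a::euclidean_space \<Rightarrow> real) \<Rightarrow> ('a \<Rightarrow> complex) \<Rightarrow> nat \<Rightarrow> nat \<Rightarrow> real \<Rightarrow> complex" where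
  "fkl Y f k l r = sph_coeff (Y k l) (\<lambda>\<theta>. f (r *\<^sub>R \<theta>))"


section \<open>Sobolev spaces of integer order\<close>

definition L2_on :: "'a::euclidean_space set \<Rightarrow> ('a \<Rightarrow> complex) \<Rightarrow> bool" where
  "L2_on \<Omega> u \<longleftrightarrow> u \<in> borel_measurable (lebesgue_on \<Omega>) \<and>
     integrable (lebesgue_on \<Omega>) (\<lambda>x. (norm (u x))\<^sup>2)"

definition weak_pderiv :: "'a::euclidean_space set \<Rightarrow> 'a list \<Rightarrow> ('a \<Rightarrow> complex) \<Rightarrow> ('a \<Rightarrow> complex) \<Rightarrow> bool" where
  "weak_pderiv \<Omega> is u v \<longleftrightarrow>
     (\<forall>\<phi>::'a \<Rightarrow> real. smooth_on UNIV \<phi> \<and> compact (closure {x. \<phi> x \<noteq> 0}) \<and> closure {x. \<phi> x \<noteq> 0} \<subseteq> \<Omega> \<longrightarrow>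
        (LINT x|lebesgue_on \<Omega>. pderiv_list is \<phi> x *\<^sub>R u x) =
        (-1) ^ length is * (LINT x|lebesgue_on \<Omega>. \<phi> x *\<^sub>R v x))"

definition Hs :: "nat \<Rightarrow> 'a::euclidean_space set \<Rightarrow> ('a \<Rightarrow> complex) set" where
  "Hs s \<Omega> = {u. L2_on \<Omega> u \<and>
     (\<forall>is. set is \<subseteq> Basis \<and> length is \<le> s \<longrightarrow> (\<exists>v. L2_on \<Omega> v \<and> weak_pderiv \<Omega> is u v))}"

text \<open>Derivatives are indexed by lists of basis vectors, so that mixed derivatives are counted with
  their multiplicity: the norm squared is \<open>\<Sum>\<^bsub>m\<le>s\<^esub> \<parallel>D\<^sup>m u\<parallel>\<^sup>2\<close> with \<open>D\<^sup>m u\<close> the tensor of all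
  derivatives of order \<open>m\<close>. The weak derivative is unique almost everywhere.\<close>

definition Hs_norm :: "nat \<Rightarrow> 'a::euclidean_space set \<Rightarrow> ('a \<Rightarrow> complex) \<Rightarrow> real" where
  "Hs_norm s \<Omega> u = sqrt (\<Sum>is | set is \<subseteq> Basis \<and> length is \<le> s.
     LINT x|lebesgue_on \<Omega>. (norm ((SOME v. L2_on \<Omega> v \<and> weak_pderiv \<Omega> is u v) x))\<^sup>2)"


section \<open>Topology of a space of functions with a family of seminorms\<close>

definition norms_topology :: "('v::minus) set \<Rightarrow> ('v \<Rightarrow> real) set \<Rightarrow> 'v topology" where
  "norms_topology X \<N> = topology_generated_by
     {{g\<in>X. p (g - f) < \<epsilon>} | f p \<epsilon>. f \<in> X \<and> p \<in> \<N> \<and> \<epsilon> > (0::real)}"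


section \<open>The spaces \<open>T\<^sup>\<infinity>(\<Omega>\<^sub>0)\<close> and \<open>M\<^sup>s(\<Omega>\<^sub>0)\<close>\<close>

text \<open>Functions on \<open>\<Omega>\<^sub>0\<close> are represented by functions on the whole space; their values outside
  \<open>\<Omega>\<^sub>0\<close> play no role.\<close>

definition cutoff_function :: "(real \<Rightarrow> real) \<Rightarrow> bool" where
  "cutoff_function \<eta> \<longleftrightarrow> smooth_halfline \<eta> \<and> (\<forall>r\<in>{0..1}. \<eta> r = 1) \<and> (\<forall>r\<ge>2. \<eta> r = 0) \<and>
     monotone_on {1<..<2} (\<le>) (\<ge>) \<eta>"

definition radial_part :: "(real \<Rightarrow> real) \<Rightarrow> (nat \<Rightarrow> nat \<Rightarrow> 'a::euclidean_space \<Rightarrow> real) \<Rightarrow>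
    ('a \<Rightarrow> complex) \<Rightarrow> real \<Rightarrow> nat \<Rightarrow> nat \<Rightarrow> real \<Rightarrow> complex" where
  "radial_part \<eta> Y f R k l r = (\<eta> (r / R) / r ^ k) *\<^sub>R fkl Y f k l r"

definition outer_part :: "(real \<Rightarrow> real) \<Rightarrow> real \<Rightarrow> ('a::euclidean_space \<Rightarrow> complex) \<Rightarrow> 'a \<Rightarrow> complex" where
  "outer_part \<eta> R f x = (1 - \<eta> (norm x / R)) *\<^sub>R f x"

text \<open>The first two conditions say that \<open>f\<close> is smooth on \<open>\<Omega>\<^sub>0\<close> and that all its derivatives extend
  continuously to the closure of \<open>\<Omega>\<close> with the origin removed.\<close>

definition Tinf :: "'a::euclidean_space set \<Rightarrow> real \<Rightarrow> (real \<Rightarrow> real) \<Rightarrow> (nat \<Rightarrow> nat) \<Rightarrow>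
    (nat \<Rightarrow> nat \<Rightarrow> 'a \<Rightarrow> real) \<Rightarrow> ('a \<Rightarrow> complex) set" where
  "Tinf \<Omega> R0 \<eta> d Y = {f.
     smooth_on (\<Omega> - {0}) f \<and>
     (\<forall>is. set is \<subseteq> Basis \<longrightarrow>
        (\<exists>h. continuous_on (closure \<Omega> - {0}) h \<and> (\<forall>x\<in>\<Omega> - {0}. h x = pderiv_list is f x))) \<and>
     (\<exists>K. \<forall>R\<in>{0<..<R0}.
        (\<forall>x\<in>\<Omega> - {0}. \<eta> (norm x / R) *\<^sub>R f x =
           (\<Sum>k\<le>K. \<Sum>l=1..d k. (\<eta> (norm x / R) * Y k l (sgn x)) *\<^sub>R fkl Y f k l (norm x))) \<and>
        (\<forall>k\<le>K. \<forall>l\<in>{1..d k}.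
           radial_part \<eta> Y f R k l \<in> Cinf_nu (real DIM('a) / 2 + real k - 1)))}"

text \<open>The sum over \<open>k\<close> has only finitely many nonzero terms for \<open>f \<in> Tinf \<Omega> R0 \<eta> d Y\<close>.\<close>

definition T_norm :: "'a::euclidean_space set \<Rightarrow> (real \<Rightarrow> real) \<Rightarrow> (nat \<Rightarrow> nat) \<Rightarrow>
    (nat \<Rightarrow> nat \<Rightarrow> 'a \<Rightarrow> real) \<Rightarrow> nat \<Rightarrow> real \<Rightarrow> ('a \<Rightarrow> complex) \<Rightarrow> real" where
  "T_norm \<Omega> \<eta> d Y s R f = sqrt (
     (\<Sum>k. \<Sum>l=1..d k. (Hnu_norm s (real DIM('a) / 2 + real k - 1) (2 * R) (radial_part \<eta> Y f R k l))\<^sup>2) +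
     (Hs_norm s \<Omega> (outer_part \<eta> R f))\<^sup>2)"

definition Hs_loc :: "'a::euclidean_space set \<Rightarrow> real \<Rightarrow> (real \<Rightarrow> real) \<Rightarrow> nat \<Rightarrow> ('a \<Rightarrow> complex) set" where
  "Hs_loc \<Omega> R0 \<eta> s = {f. \<forall>R\<in>{0<..<R0}. outer_part \<eta> R f \<in> Hs s \<Omega>}"

text \<open>The completion is realized inside \<open>Hs_loc\<close>: its elements are the \<open>Hs_loc\<close>-limits of the
  sequences in \<open>Tinf\<close> that are Cauchy with respect to all the norms, and the norms extend by
  continuity. The limit in \<open>Hs_loc\<close> determines the class of the Cauchy sequence.\<close>

definition approximates :: "'a::euclidean_space set \<Rightarrow> real \<Rightarrow> (real \<Rightarrow> real) \<Rightarrow> (nat \<Rightarrow> nat) \<Rightarrow>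
    (nat \<Rightarrow> nat \<Rightarrow> 'a \<Rightarrow> real) \<Rightarrow> nat \<Rightarrow> (nat \<Rightarrow> 'a \<Rightarrow> complex) \<Rightarrow> ('a \<Rightarrow> complex) \<Rightarrow> bool" where
  "approximates \<Omega> R0 \<eta> d Y s F f \<longleftrightarrow>
     range F \<subseteq> Tinf \<Omega> R0 \<eta> d Y \<and> f \<in> Hs_loc \<Omega> R0 \<eta> s \<and>
     (\<forall>R\<in>{0<..<R0}. \<forall>\<epsilon>>0. \<exists>J. \<forall>i\<ge>J. \<forall>j\<ge>J. T_norm \<Omega> \<eta> d Y s R (F i - F j) < \<epsilon>) \<and>
     (\<forall>R\<in>{0<..<R0}. (\<lambda>j. Hs_norm s \<Omega> (outer_part \<eta> R (F j - f))) \<longlonglongrightarrow> 0)"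

definition Ms :: "'a::euclidean_space set \<Rightarrow> real \<Rightarrow> (real \<Rightarrow> real) \<Rightarrow> (nat \<Rightarrow> nat) \<Rightarrow>
    (nat \<Rightarrow> nat \<Rightarrow> 'a \<Rightarrow> real) \<Rightarrow> nat \<Rightarrow> ('a \<Rightarrow> complex) set" where
  "Ms \<Omega> R0 \<eta> d Y s = {f. \<exists>F. approximates \<Omega> R0 \<eta> d Y s F f}"

definition Ms_norm :: "'a::euclidean_space set \<Rightarrow> real \<Rightarrow> (real \<Rightarrow> real) \<Rightarrow> (nat \<Rightarrow> nat) \<Rightarrow>
    (nat \<Rightarrow> nat \<Rightarrow> 'a \<Rightarrow> real) \<Rightarrow> nat \<Rightarrow> real \<Rightarrow> ('a \<Rightarrow> complex) \<Rightarrow> real" where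
  "Ms_norm \<Omega> R0 \<eta> d Y s R f =
     (THE c. \<forall>F. approximates \<Omega> R0 \<eta> d Y s F f \<longrightarrow> (\<lambda>j. T_norm \<Omega> \<eta> d Y s R (F j)) \<longlonglongrightarrow> c)"

definition Ms_topology :: "'a::euclidean_space set \<Rightarrow> real \<Rightarrow> (real \<Rightarrow> real) \<Rightarrow> (nat \<Rightarrow> nat) \<Rightarrow>
    (nat \<Rightarrow> nat \<Rightarrow> 'a \<Rightarrow> real) \<Rightarrow> nat \<Rightarrow> ('a \<Rightarrow> complex) topology" where
  "Ms_topology \<Omega> R0 \<eta> d Y s =
     norms_topology (Ms \<Omega> R0 \<eta> d Y s) (Ms_norm \<Omega> R0 \<eta> d Y s ` {0<..<R0})"


section \<open>The space \<open>A(\<Theta>)\<close>\<close>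

text \<open>Membership in \<open>extensional\<close> makes a function on the sphere a unique object of type
  \<open>'a \<Rightarrow> complex\<close>.\<close>

definition A_space :: "(nat \<Rightarrow> nat) \<Rightarrow> (nat \<Rightarrow> nat \<Rightarrow> 'a::euclidean_space \<Rightarrow> real) \<Rightarrow> ('a \<Rightarrow> complex) set" where
  "A_space d Y = {\<psi>. \<psi> \<in> extensional (sphere 0 1) \<and> \<psi> \<in> L2_sphere \<and>
     (\<forall>h\<in>{0<..<1}. summable (\<lambda>k. (\<Sum>l=1..d k. (norm (sph_coeff (Y k l) \<psi>))\<^sup>2) / h ^ (2 * k))) \<and>
     (\<forall>\<theta>\<in>sphere 0 1. (\<lambda>k. \<Sum>l=1..d k. Y k l \<theta> *\<^sub>R sph_coeff (Y k l) \<psi>) sums \<psi> \<theta>)}"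

definition A_norm :: "(nat \<Rightarrow> nat) \<Rightarrow> (nat \<Rightarrow> nat \<Rightarrow> 'a::euclidean_space \<Rightarrow> real) \<Rightarrow> real \<Rightarrow> ('a \<Rightarrow> complex) \<Rightarrow> real" where
  "A_norm d Y h \<psi> = sqrt (\<Sum>k. (\<Sum>l=1..d k. (norm (sph_coeff (Y k l) \<psi>))\<^sup>2) / h ^ (2 * k))"

definition A_topology :: "(nat \<Rightarrow> nat) \<Rightarrow> (nat \<Rightarrow> nat \<Rightarrow> 'a::euclidean_space \<Rightarrow> real) \<Rightarrow> ('a \<Rightarrow> complex) topology" where
  "A_topology d Y = norms_topology (A_space d Y) (A_norm d Y ` {0<..<1})"


section \<open>The \<open>\<sigma>\<close>-trace\<close>

text \<open>In dimension two the polar angle is taken with respect to an orthonormal frame \<open>e1\<close>, \<open>e2\<close>.\<close>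

definition polar_angle :: "'a::real_inner \<Rightarrow> 'a \<Rightarrow> 'a \<Rightarrow> real" where
  "polar_angle e1 e2 \<theta> = Arg (Complex (\<theta> \<bullet> e1) (\<theta> \<bullet> e2))"

text \<open>The usual Fourier coefficients \<open>f\<^sub>0\<close>, \<open>f\<^sub>k\<^sub>,\<^sub>1\<close>, \<open>f\<^sub>k\<^sub>,\<^sub>2\<close> of \<open>f(r,\<sqdot>)\<close>; integration with respect to
  \<open>sphere_measure\<close> is integration with respect to the polar angle over a period.\<close>

definition fourier_0 :: "('a::euclidean_space \<Rightarrow> complex) \<Rightarrow> real \<Rightarrow> complex" where
  "fourier_0 f r = (1 / (2 * pi)) *\<^sub>R (LINT \<theta>|sphere_measure. f (r *\<^sub>R \<theta>))"

definition fourier_cos :: "'a::euclidean_space \<Rightarrow> 'a \<Rightarrow> ('a \<Rightarrow> complex) \<Rightarrow> nat \<Rightarrow> real \<Rightarrow> complex" where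
  "fourier_cos e1 e2 f k r =
     (1 / pi) *\<^sub>R (LINT \<theta>|sphere_measure. cos (real k * polar_angle e1 e2 \<theta>) *\<^sub>R f (r *\<^sub>R \<theta>))"

definition fourier_sin :: "'a::euclidean_space \<Rightarrow> 'a \<Rightarrow> ('a \<Rightarrow> complex) \<Rightarrow> nat \<Rightarrow> real \<Rightarrow> complex" where
  "fourier_sin e1 e2 f k r =
     (1 / pi) *\<^sub>R (LINT \<theta>|sphere_measure. sin (real k * polar_angle e1 e2 \<theta>) *\<^sub>R f (r *\<^sub>R \<theta>))"

text \<open>The function \<open>\<sigma>f(r,\<theta>)\<close>; for \<open>f \<in> Tinf\<close> and small \<open>r\<close> the series are finite sums.\<close>

definition sigma :: "(nat \<Rightarrow> nat) \<Rightarrow> (nat \<Rightarrow> nat \<Rightarrow> 'a::euclidean_space \<Rightarrow> real) \<Rightarrow> 'a \<Rightarrow> 'a \<Rightarrow>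
    ('a \<Rightarrow> complex) \<Rightarrow> real \<Rightarrow> 'a \<Rightarrow> complex" where
  "sigma d Y e1 e2 f r \<theta> =
     (if DIM('a) = 2 then
        fourier_0 f r /\<^sub>R ln r +
        (\<Sum>j. let k = Suc j in r ^ k *\<^sub>R
           (cos (real k * polar_angle e1 e2 \<theta>) *\<^sub>R fourier_cos e1 e2 f k r +
            sin (real k * polar_angle e1 e2 \<theta>) *\<^sub>R fourier_sin e1 e2 f k r))
      else
        (\<Sum>k. \<Sum>l=1..d k. (r ^ (DIM('a) + k - 2) * Y k l \<theta>) *\<^sub>R fkl Y f k l r))"

definition sigma_limit :: "(nat \<Rightarrow> nat) \<Rightarrow> (nat \<Rightarrow> nat \<Rightarrow> 'a::euclidean_space \<Rightarrow> real) \<Rightarrow> 'a \<Rightarrow> 'a \<Rightarrow>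
    ('a \<Rightarrow> complex) \<Rightarrow> ('a \<Rightarrow> complex) \<Rightarrow> bool" where
  "sigma_limit d Y e1 e2 f \<psi> \<longleftrightarrow>
     (\<forall>\<theta>\<in>sphere 0 1. ((\<lambda>r. sigma d Y e1 e2 f r \<theta>) \<longlongrightarrow> \<psi> \<theta>) (at_right 0))"

definition has_sigma_trace :: "'a::euclidean_space set \<Rightarrow> real \<Rightarrow> (real \<Rightarrow> real) \<Rightarrow> (nat \<Rightarrow> nat) \<Rightarrow>
    (nat \<Rightarrow> nat \<Rightarrow> 'a \<Rightarrow> real) \<Rightarrow> 'a \<Rightarrow> 'a \<Rightarrow> nat \<Rightarrow> ('a \<Rightarrow> complex) \<Rightarrow> ('a \<Rightarrow> complex) \<Rightarrow> bool" where
  "has_sigma_trace \<Omega> R0 \<eta> d Y e1 e2 s f \<psi> \<longleftrightarrow>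
     \<psi> \<in> A_space d Y \<and>
     (\<forall>F. range F \<subseteq> Tinf \<Omega> R0 \<eta> d Y \<and> limitin (Ms_topology \<Omega> R0 \<eta> d Y s) F f sequentially \<longrightarrow>
        (\<exists>\<Psi>. (\<forall>j. \<Psi> j \<in> A_space d Y \<and> sigma_limit d Y e1 e2 (F j) (\<Psi> j)) \<and>
             limitin (A_topology d Y) \<Psi> \<psi> sequentially))"

definition sigma_trace :: "'a::euclidean_space set \<Rightarrow> real \<Rightarrow> (real \<Rightarrow> real) \<Rightarrow> (nat \<Rightarrow> nat) \<Rightarrow>
    (nat \<Rightarrow> nat \<Rightarrow> 'a \<Rightarrow> real) \<Rightarrow> 'a \<Rightarrow> 'a \<Rightarrow> nat \<Rightarrow> ('a \<Rightarrow> complex) \<Rightarrow> ('a \<Rightarrow> complex)" where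
  "sigma_trace \<Omega> R0 \<eta> d Y e1 e2 s f = (THE \<psi>. has_sigma_trace \<Omega> R0 \<eta> d Y e1 e2 s f \<psi>)"

end

theory Submission
 imports Defs "HOL-Computational_Algebra.Polynomial" "HOL-Library.Function_Algebras"
begin

text \<open>
  Cut off near the origin, the \<open>(k,l)\<close> coefficient of \<open>f\<close> divided by \<open>r ^ k\<close> is \<open>P_op \<nu> \<phi>\<close> with
  \<open>\<nu> = n / 2 + k - 1\<close>, and \<open>S_op\<close> inverts \<open>P_op\<close>; its norm is a multiple of the \<open>L\<^sub>2\<close> norm of \<open>D\<^sup>s \<phi>\<close>
  on \<open>(0, 2R)\<close>. Multiplied by \<open>r powr (2 * \<nu>)\<close> (by \<open>1 / ln r\<close> if \<open>\<nu> = 0\<close>) it converges as \<open>r\<close> tends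
  to \<open>0\<close> to a multiple of a fractional integral of \<open>\<phi>\<close> at \<open>0\<close>, which is at most \<open>C * (4R) ^ k\<close> times
  the norm. Since \<open>R\<close> is arbitrarily small, the limits satisfy all the estimates that define \<open>A(\<Theta>)\<close>.
  The norms extend to the completion because they are closable: if the functions tend to \<open>0\<close> away
  from the origin, then so do the \<open>P_op \<nu> \<phi>\<close>, and inverting the transmutation gives \<open>D\<^sup>s \<phi> \<rightarrow> 0\<close>.
\<close>

text \<open>The completion lives in \<open>Hs_loc\<close>, where a limit is seen only away from the
  origin, while the radial norms see all of \<open>(0, 2R)\<close>. Without closability
  \<open>Ms_norm\<close>, a \<open>THE\<close> over all approximating sequences, would be
  meaningless; hence the transmutation is inverted on sequences and not only on single functions.
  The other obstacle is uniformity in \<open>k\<close>. The norms of \<open>A(\<Theta>)\<close>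
  admit only constants that grow geometrically, with a ratio tending to \<open>0\<close> with
  \<open>R\<close>, so the Gamma factors of the norm, of \<open>P_op\<close> and of the fractional
  integral must cancel up to a bounded quotient. Elements of \<open>A(\<Theta>)\<close> are
  functions, so the series of harmonics must converge at each point; as the basis is arbitrary, this
  rests on a geometric bound for the sum of squares of the harmonics of one degree, proved by finite
  differences of homogeneous polynomials. In dimension two \<open>\<nu> = 0\<close> for
  \<open>k = 0\<close>: the power weight becomes a logarithm, and \<open>I_op (-1/2)\<close>
  differentiates, which is the origin of \<open>s >= 2\<close>.\<close>

notation scaleR (infixr "*R" 75)
notation (input) LIMSEQ ("(_)/ ----> (_)" [60, 60] 60)
notation tendsto (infixr "--->" 55)

section \<open>Weyl fractional integrals\<close>

text \<open>The Weyl kernel extended by zero: every fractional integral becomes an integral over the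
  whole line that can be translated, rescaled and put into Fubini's theorem without set
  integrals.\<close>

definition pk :: "real => real => real" where
 "pk a u = (if u > 0 then u powr (a - 1) else 0)"

lemma pk_nonneg [simp]: "pk a u >= 0"
 by (simp add: pk_def)

lemma pk_measurable [measurable]: "pk a : borel_measurable borel"
 unfolding pk_def by measurable

lemma pk_integral:
 assumes a: "a > 0" and b: "b >= 0"
 shows "has_bochner_integral lborel (%u. pk a u * indicator {..b} u) (b powr a / a)"
proof -
 have "((%x. x powr (a - 1)) has_integral (b powr a / a)) {0..b}"
  using has_integral_powr_from_0[of "a - 1" b] a b by simp
 then have "((%x. pk a x * indicator {..b} x) has_integral (b powr a / a)) {0..b}"
  by (rule has_integral_spike[rotated 2, of _ _ _ "{0}"]) (auto simp: pk_def indicator_def)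
 then have "((%x. pk a x * indicator {..b} x) has_integral (b powr a / a)) UNIV"
  by (rule has_integral_on_superset) (auto simp: pk_def indicator_def)
 then have "(\<integral>\<^sup>+x. ennreal (pk a x * indicator {..b} x) \<partial>lborel) = ennreal (b powr a / a)"
  by (rule nn_integral_has_integral_lborel[rotated 2]) (auto simp: indicator_def)
 then show ?thesis
  by (intro has_bochner_integral_nn_integral) (use a in "auto simp: indicator_def")
qed

text \<open>The affine map of \<open>[y, x]\<close> onto \<open>[0, 1]\<close> gives Euler's Beta
  integral; the exponent \<open>a + b - 1\<close> collects the two kernels and the Jacobian.\<close>

lemma pk_Beta:
 assumes a: "a > 0" and b: "b > 0" and y: "y < x"
 shows "has_bochner_integral lborel (%t. pk a (t - y) * pk b (x - t)) ((x - y) powr (a + b - 1) * Beta a b)"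
proof -
 have "((%t. t powr (a - 1) * (1 - t) powr (b - 1)) has_integral Beta a b) {0..1}"
  by (rule has_integral_Beta_real[OF a b])
 then have "((%t. pk a t * pk b (1 - t)) has_integral Beta a b) {0..1}"
  by (rule has_integral_spike[rotated 2, of _ _ _ "{0,1}"]) (auto simp: pk_def indicator_def)
 then have "((%t. pk a t * pk b (1 - t)) has_integral Beta a b) UNIV"
  by (rule has_integral_on_superset) (auto simp: pk_def indicator_def)
 then have "(\<integral>\<^sup>+x. ennreal (pk a x * pk b (1 - x)) \<partial>lborel) = ennreal (Beta a b)"
  by (rule nn_integral_has_integral_lborel[rotated 2]) (auto simp: indicator_def)
 then have "has_bochner_integral lborel (%t. pk a t * pk b (1 - t)) (Beta a b)"
  by (intro has_bochner_integral_nn_integral) (use a b in "auto simp: indicator_def Beta_def")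
 then have "has_bochner_integral lborel (%t. (x - y) powr (a + b - 2) * (pk a (-y / (x-y) + (1 / (x-y)) * t) *
   pk b (1 - (-y / (x-y) + (1 / (x-y)) * t)))) ((x - y) powr (a + b - 2) * (Beta a b /\<^sub>R \<bar>1 / (x-y)\<bar>))"
  using y by (intro has_bochner_integral_mult_right iffD1[OF lborel_has_bochner_integral_real_affine_iff]) auto
 also have "(x - y) powr (a + b - 2) * (Beta a b /\<^sub>R \<bar>1 / (x-y)\<bar>) = (x - y) powr (a + b - 1) * Beta a b"
 proof -
  have "(x - y) powr (a + b - 1) = (x - y) powr (a + b - 2) * (x - y)"
   using y powr_add[of "x - y" "a + b - 2" 1] by simp
  moreover have "inverse \<bar>1 / (x - y)\<bar> = x - y" using y by simp
  ultimately show ?thesis by simp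
 qed
 also have "(%t. (x - y) powr (a + b - 2) * (pk a (-y / (x-y) + (1 / (x-y)) * t) *
   pk b (1 - (-y / (x-y) + (1 / (x-y)) * t)))) = (%t. pk a (t - y) * pk b (x - t))"
 proof
  fix t
  have 1: "-y / (x-y) + (1 / (x-y)) * t = (t - y) / (x - y)"
   by (simp add: diff_divide_distrib)
  have 2: "1 - (t - y) / (x - y) = (x - t) / (x - y)"
   using y by (simp add: field_simps)
  have "(x - y) powr (a + b - 2) = (x - y) powr (a - 1) * (x - y) powr (b - 1)"
   using y by (simp add: powr_add[symmetric] algebra_simps)
  then show "(x - y) powr (a + b - 2) * (pk a (-y / (x-y) + (1 / (x-y)) * t) *
   pk b (1 - (-y / (x-y) + (1 / (x-y)) * t))) = pk a (t - y) * pk b (x - t)"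
   unfolding 1 2 using y by (auto simp: pk_def powr_divide field_simps)
 qed
 finally show ?thesis .
qed

definition weyl :: "real => (real => complex) => real => complex" where
 "weyl a h y = (1 / Gamma a) *R (LINT t:{y<..}|lborel. ((t - y) powr (a - 1)) *R h t)"

text \<open>The class on which the Weyl integrals converge. With \<open>c = 0\<close> it contains
  \<open>Cinf_comp\<close>; with every \<open>c > 0\<close> it also covers functions singular at the
  origin, such as those that the square root substitution produces.\<close>

definition bcont :: "real => (real => complex) => bool" where
 "bcont c k \<longleftrightarrow> continuous_on {c<..} k & (EX B. ALL t>c. norm (k t) <= B) & (EX b. ALL t>b. k t = 0)"

definition tail :: "real => (real => complex) => real => complex" where
 "tail c k t = (if t > c then k t else 0)"

lemma tail_measurable: "continuous_on {c<..} k ==> tail c k : borel_measurable borel"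
 unfolding tail_def using borel_measurable_continuous_on_if[of "{c<..}" k "%_. 0"] by simp

lemma bcontE:
 assumes "bcont c k"
 obtains B b where "continuous_on {c<..} k" "!!t. t > c ==> norm (k t) <= B" "!!t. t > b ==> k t = 0" "B > 0" "b > c" "b > 0"
  "tail c k : borel_measurable borel" "!!t. norm (tail c k t) <= B * indicator {..b} t"
proof -
 obtain B b where *: "continuous_on {c<..} k" "!!t. t > c ==> norm (k t) <= B" "!!t. t > b ==> k t = 0"
  using assms unfolding bcont_def by blast
 show thesis
  by (rule that[of "max B 1" "max b (max 1 (c + 1))"])
   (use * in "force simp: tail_def indicator_def intro: tail_measurable")+
qed

lemma bcont_cong: "bcont c k ==> (!!t. t > c ==> k t = k' t) ==> bcont c k'"
 unfolding bcont_def
 by (smt (verit, ccfv_threshold) continuous_on_eq greaterThan_iff)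

lemma bcont_add: "bcont c k ==> bcont c k' ==> bcont c (%t. k t + k' t)"
proof -
 assume "bcont c k" "bcont c k'"
 then obtain B b B' b' where *: "continuous_on {c<..} k" "!!t. t > c ==> norm (k t) <= B" "!!t. t > b ==> k t = 0"
  "continuous_on {c<..} k'" "!!t. t > c ==> norm (k' t) <= B'" "!!t. t > b' ==> k' t = 0"
  unfolding bcont_def by blast
 show "bcont c (%t. k t + k' t)"
  unfolding bcont_def
 proof (intro conjI exI allI impI)
  show "continuous_on {c<..} (%t. k t + k' t)" using * by (intro continuous_intros)
  show "norm (k t + k' t) <= B + B'" if "t > c" for t using *(2,5)[OF that] by norm
  show "k t + k' t = 0" if "t > max b b'" for t using *(3,6) that by simp
 qed
qed

lemma bcont_mult_const: "bcont c k ==> bcont c (%t. z * k t)"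
proof -
 assume "bcont c k"
 then obtain B b where *: "continuous_on {c<..} k" "!!t. t > c ==> norm (k t) <= B" "!!t. t > b ==> k t = 0"
  unfolding bcont_def by blast
 show ?thesis
  unfolding bcont_def
 proof (intro conjI exI allI impI)
  show "continuous_on {c<..} (%t. z * k t)" using * by (intro continuous_intros)
  show "norm (z * k t) <= norm z * B" if "t > c" for t using *(2)[OF that] by (simp add: norm_mult mult_left_mono)
  show "z * k t = 0" if "t > b" for t using *(3) that by simp
 qed
qed

lemma weyl_tail:
 assumes "y >= c"
 shows "weyl a k y = (1 / Gamma a) *R (LINT t|lborel. pk a (t - y) *R tail c k t)"
  and "weyl a k y = (1 / Gamma a) *R (LINT u|lborel. pk a u *R tail c k (y + u))"
proof -
 show *: "weyl a k y = (1 / Gamma a) *R (LINT t|lborel. pk a (t - y) *R tail c k t)"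
  unfolding weyl_def set_lebesgue_integral_def
  by (intro arg_cong[where f="%x. (1 / Gamma a) *R x"] Bochner_Integration.integral_cong)
   (use assms in "auto simp: tail_def pk_def indicator_def")
 show "weyl a k y = (1 / Gamma a) *R (LINT u|lborel. pk a u *R tail c k (y + u))"
  unfolding * by (subst lborel_integral_real_affine[of 1 _ y]) auto
qed

lemma weyl_integrable_shift:
 assumes "bcont c k" "a > 0" "y >= c"
 shows "integrable lborel (%u. pk a u *R tail c k (y + u))"
proof -
 obtain B b where b: "tail c k : borel_measurable borel" "!!t. norm (tail c k t) <= B * indicator {..b} t" "B > 0"
  using bcontE[OF assms(1)] by metis
 note [measurable] = b(1)
 have "integrable lborel (%u. B * (pk a u * indicator {..max 0 (b - y)} u))"
  using pk_integral[of a "max 0 (b - y)"] assms by (intro integrable_mult_right) (auto simp: has_bochner_integral_iff)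
 then show ?thesis
 proof (rule Bochner_Integration.integrable_bound, goal_cases)
  case 2
  show ?case
  proof (rule AE_I2)
   fix u
   have "norm (tail c k (y + u)) <= B * indicator {..max 0 (b - y)} u" if "u > 0"
   proof (cases "y + u <= b")
    case True
    then have "u <= max 0 (b - y)" by simp
    with True b(2)[of "y + u"] show ?thesis by simp
   next
    case False
    with b(2)[of "y + u"] b(3) show ?thesis by simp
   qed
   then show "norm (pk a u *R tail c k (y + u)) <= norm (B * (pk a u * indicator {..max 0 (b - y)} u))"
    using b(3) by (auto simp: pk_def mult.commute mult_left_mono abs_mult)
  qed
 qed measurable
qed

lemma weyl_integrable:
 assumes "bcont c k" "a > 0" "y >= c"
 shows "integrable lborel (%t. pk a (t - y) *R tail c k t)"
 using weyl_integrable_shift[OF assms]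
  lborel_integrable_real_affine_iff[of 1 "%t. pk a (t - y) *R tail c k t" y] by simp

lemma weyl_norm_le:
 assumes "bcont c k" "a > 0" "y >= c" "b >= y" "!!t. t > b ==> k t = 0" "!!t. t > c ==> norm (k t) <= B"
 shows "norm (weyl a k y) <= B * (b - y) powr a / Gamma (a + 1)"
proof -
 have G: "Gamma a > 0" using assms by (simp add: Gamma_real_pos)
 have a': "a \<notin> \<int>\<^sub>\<le>\<^sub>0" using assms(2) by (auto elim!: nonpos_Ints_cases)
 have B: "B >= 0" using assms(6)[of "c+1"] norm_ge_zero[of "k (c+1)"] by linarith
 note hb = pk_integral[of a "b - y"]
 have "norm (LINT u|lborel. pk a u *R tail c k (y + u)) <= (LINT u|lborel. B * (pk a u * indicator {..b - y} u))"
 proof (rule order_trans[OF integral_norm_bound integral_mono])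
  show "integrable lborel (%u. norm (pk a u *R tail c k (y + u)))"
   by (intro integrable_norm weyl_integrable_shift[OF assms(1-3)])
  show "integrable lborel (%u. B * (pk a u * indicator {..b - y} u))"
   using hb assms by (intro integrable_mult_right) (auto simp: has_bochner_integral_iff)
  show "norm (pk a u *R tail c k (y + u)) <= B * (pk a u * indicator {..b - y} u)" for u
   using assms(5,6)[of "y + u"] B by (auto simp: tail_def indicator_def mult.commute[of B] intro!: mult_left_mono)
 qed
 also have "... = B * ((b - y) powr a / a)"
  using hb assms by (simp add: has_bochner_integral_iff)
 finally show ?thesis
  using G B assms Gamma_plus1[OF a'] unfolding weyl_tail(2)[OF assms(3)]
  by (simp add: add_nonneg_eq_0_iff divide_simps mult_ac)
qed

lemma weyl_eq_0: "(!!t. t > y ==> k t = 0) ==> weyl a k y = 0"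
 unfolding weyl_def set_lebesgue_integral_def
 by (subst Bochner_Integration.integral_cong[where g="%_. 0", OF refl]) (auto simp: indicator_def)

lemma weyl_cong: "(!!t. t > y ==> k t = k' t) ==> weyl a k y = weyl a k' y"
 unfolding weyl_def set_lebesgue_integral_def
 by (intro arg_cong[where f="%x. (1 / Gamma a) *R x"] Bochner_Integration.integral_cong) (auto simp: indicator_def)

lemma weyl_add:
 assumes "bcont c k" "bcont c k'" "a > 0" "y >= c"
 shows "weyl a (%t. k t + k' t) y = weyl a k y + weyl a k' y"
proof -
 have *: "tail c (%t. k t + k' t) = (%t. tail c k t + tail c k' t)" by (auto simp: tail_def)
 show ?thesis
  unfolding weyl_tail(1)[OF assms(4)] * scaleR_add_right
  using weyl_integrable[OF assms(1,3,4)] weyl_integrable[OF assms(2,3,4)]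
  by (simp add: scaleR_add_right)
qed

lemma weyl_mult_const: "weyl a (%t. z * k t) y = z * weyl a k y"
proof -
 have *: "(%t. indicator {y<..} t *R (((t - y) powr (a - 1)) *R (z * k t))) =
  (%t. z * (indicator {y<..} t *R (((t - y) powr (a - 1)) *R k t)))"
  by auto
 show ?thesis unfolding weyl_def set_lebesgue_integral_def *
  by (subst integral_mult_right_zero) (rule mult_scaleR_right[symmetric])
qed

text \<open>After a shift the argument \<open>y\<close> sits only in the function and the kernel is
  fixed, so dominated convergence applies. The end point \<open>c\<close> is included: with
  \<open>c = 0\<close> this yields one-sided limits at the origin.\<close>

lemma weyl_continuous:
 assumes k: "bcont c k" and a: "a > 0"
 shows "continuous_on {c..} (weyl a k)"
 unfolding continuous_on_sequentially
proof (intro allI ballI impI, goal_cases)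
 case (1 X y)
 then have X: "!!n. X n >= c" "y >= c" "X ----> y" by auto
 obtain B b where b: "continuous_on {c<..} k" "tail c k : borel_measurable borel"
  "!!t. norm (tail c k t) <= B * indicator {..b} t" "B > 0" "b > c"
  using bcontE[OF k] by metis
 note [measurable] = b(2)
 have "(%n. LINT u|lborel. pk a u *R tail c k (X n + u)) ----> (LINT u|lborel. pk a u *R tail c k (y + u))"
 proof (rule integral_dominated_convergence)
  show "integrable lborel (%u. B * (pk a u * indicator {..b - c} u))"
   using pk_integral[of a "b - c"] a b by (intro integrable_mult_right) (auto simp: has_bochner_integral_iff)
  show "AE u in lborel. (%n. pk a u *R tail c k (X n + u)) ----> pk a u *R tail c k (y + u)"
  proof (rule AE_I2)
   fix u
   show "(%n. pk a u *R tail c k (X n + u)) ----> pk a u *R tail c k (y + u)"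
   proof (cases "u > 0")
    case True
    have t: "tail c k (z + u) = k (z + u)" if "z >= c" for z using that True by (simp add: tail_def)
    have "continuous (at (y + u)) k"
     using b(1) X(2) True by (simp add: continuous_on_eq_continuous_at)
    then have "(%n. k (X n + u)) ----> k (y + u)"
     by (intro isCont_tendsto_compose[where g=k] tendsto_intros X)
    then show ?thesis
     by (simp add: t X tendsto_intros)
   qed (simp add: pk_def)
  qed
  show "AE u in lborel. norm (pk a u *R tail c k (X n + u)) <= B * (pk a u * indicator {..b - c} u)" for n
  proof (rule AE_I2)
   fix u
   have "norm (tail c k (X n + u)) <= B * indicator {..b - c} u"
   proof (cases "X n + u <= b")
    case True
    then have "u <= b - c" using X(1)[of n] by simp
    with True b(3)[of "X n + u"] show ?thesis by simp
   next
    case False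
    with b(3)[of "X n + u"] b(4) show ?thesis by simp
   qed
   then show "norm (pk a u *R tail c k (X n + u)) <= B * (pk a u * indicator {..b - c} u)"
    using mult_left_mono[of "norm (tail c k (X n + u))" "B * indicator {..b - c} u" "pk a u"]
    by (simp add: mult_ac)
  qed
 qed measurable
 then show ?case
  unfolding o_def weyl_tail(2)[OF X(1)] weyl_tail(2)[OF X(2)] by (intro tendsto_intros)
qed

lemma bcont_weyl:
 assumes k: "bcont c k" and a: "a > 0"
 shows "bcont c (weyl a k)"
 unfolding bcont_def
proof (intro conjI)
 show "continuous_on {c<..} (weyl a k)"
  using weyl_continuous[OF assms] by (rule continuous_on_subset) auto
 obtain B b where b: "!!t. t > c ==> norm (k t) <= B" "!!t. t > b ==> k t = 0" "b > c" "B > 0"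
  using bcontE[OF k] by metis
 have z: "weyl a k t = 0" if "t >= b" for t using b that by (intro weyl_eq_0) auto
 then show "EX b. ALL t>b. weyl a k t = 0" by (auto intro!: exI[of _ b])
 have G: "Gamma (a+1) > 0" using a by (intro Gamma_real_pos) auto
 have "norm (weyl a k t) <= B * (b - c) powr a / Gamma (a + 1)" if t: "t > c" for t
 proof (cases "t <= b")
  case True
  have "norm (weyl a k t) <= B * (b - t) powr a / Gamma (a + 1)"
   using True t by (intro weyl_norm_le[OF k a] b) auto
  also have "... <= B * (b - c) powr a / Gamma (a + 1)"
   using G b a t True by (intro divide_right_mono mult_left_mono powr_mono2) auto
  finally show ?thesis .
 qed (use z G b in auto)
 then show "EX B. ALL t>c. norm (weyl a k t) <= B" by blast
qed

text \<open>By Fubini the integral over the middle variable is \<open>pk_Beta\<close>, and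
  \<open>Beta a b = Gamma a * Gamma b / Gamma (a + b)\<close> absorbs the normalisations. The case
  \<open>y = c\<close> is included.\<close>

lemma weyl_semigroup:
 assumes k: "bcont c k" and a: "a > 0" and b: "b > 0" and y: "y >= c"
 shows "weyl a (weyl b k) y = weyl (a + b) k y"
proof -
 have G: "Gamma a > 0" "Gamma b > 0" "Gamma (a+b) > 0" using a b by (auto intro: Gamma_real_pos)
 obtain B b0 where b0: "tail c k : borel_measurable borel" using bcontE[OF k] by metis
 note [measurable] = b0
 define G' where "G' x t = (pk a (t - y) * pk b (x - t)) *R tail c k x" for x t
 have inner: "has_bochner_integral lborel (%t. pk a (t - y) * pk b (x - t)) (pk (a + b) (x - y) * Beta a b)" for x
 proof (cases "x > y")
  case True
  then show ?thesis using pk_Beta[OF a b True] by (simp add: pk_def)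
 next
  case False
  then have "(%t. pk a (t - y) * pk b (x - t)) = (%t. 0)" by (auto simp: pk_def)
  moreover have "pk (a + b) (x - y) = 0" using False by (simp add: pk_def)
  ultimately show ?thesis by (simp only: mult_zero_left has_bochner_integral_zero)
 qed
 have [measurable]: "(%(x, t). G' x t) : borel_measurable (lborel \<Otimes>\<^sub>M lborel)"
  unfolding G'_def by measurable
 have int: "integrable (lborel \<Otimes>\<^sub>M lborel) (%(x, t). G' x t)"
 proof (rule lborel_pair.Fubini_integrable)
  have "(\<integral> t. norm (case (x, t) of (x, t) => G' x t) \<partial>lborel) = norm ((Beta a b * pk (a + b) (x - y)) *R tail c k x)" for x
  proof -
   have "(\<integral> t. norm (case (x, t) of (x, t) => G' x t) \<partial>lborel) = (\<integral> t. (pk a (t - y) * pk b (x - t)) * norm (tail c k x) \<partial>lborel)"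
    by (intro Bochner_Integration.integral_cong) (auto simp: G'_def abs_mult)
   also have "... = (pk (a + b) (x - y) * Beta a b) * norm (tail c k x)"
    using inner[of x] by (simp add: has_bochner_integral_iff)
   also have "... = norm ((Beta a b * pk (a + b) (x - y)) *R tail c k x)"
    using G by (simp add: Beta_def abs_mult mult.commute)
   finally show ?thesis .
  qed
  moreover have "integrable lborel (%x. norm (Beta a b *R (pk (a + b) (x - y) *R tail c k x)))"
   using a b by (intro integrable_norm integrable_scaleR_right weyl_integrable[OF k _ y]) auto
  ultimately show "integrable lborel (%x. \<integral> t. norm (case (x, t) of (x, t) => G' x t) \<partial>lborel)"
   by (simp add: scaleR_scaleR)
  show "AE x in lborel. integrable lborel (%t. case (x, t) of (x, t) => G' x t)"
   unfolding G'_def using inner by (intro AE_I2) (auto simp: has_bochner_integral_iff)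
 qed measurable
 have "(LINT t|lborel. LINT x|lborel. G' x t) = (LINT x|lborel. LINT t|lborel. G' x t)"
  using lborel_pair.Fubini_integral[OF int] by simp
 also have "(LINT x|lborel. LINT t|lborel. G' x t) = (LINT x|lborel. Beta a b *R (pk (a + b) (x - y) *R tail c k x))"
  unfolding G'_def using inner by (intro Bochner_Integration.integral_cong) (auto simp: has_bochner_integral_iff mult.commute)
 also have "... = Beta a b *R (Gamma (a+b) *R weyl (a + b) k y)"
 proof -
  have "(LINT x|lborel. pk (a + b) (x - y) *R tail c k x) = Gamma (a+b) *R weyl (a + b) k y"
   unfolding weyl_tail(1)[OF y] using G by simp
  then show ?thesis by (simp del: scaleR_scaleR)
 qed
 finally have 1: "(LINT t|lborel. LINT x|lborel. G' x t) = (Gamma a * Gamma b) *R weyl (a + b) k y"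
  using G by (simp add: Beta_def)
 have 2: "(LINT x|lborel. G' x t) = Gamma b *R (pk a (t - y) *R tail c (weyl b k) t)" for t
 proof (cases "t > y")
  case True
  then have "tail c (weyl b k) t = (1 / Gamma b) *R (LINT x|lborel. pk b (x - t) *R tail c k x)"
   using y weyl_tail(1)[of c t b k] by (simp add: tail_def)
  moreover have "(LINT x|lborel. G' x t) = pk a (t - y) *R (LINT x|lborel. pk b (x - t) *R tail c k x)"
   unfolding G'_def by (simp only: scaleR_scaleR[symmetric] integral_scaleR_right)
  ultimately show ?thesis using G by (simp add: mult.commute)
 qed (simp add: G'_def pk_def)
 have "(LINT t|lborel. LINT x|lborel. G' x t) = Gamma b *R (Gamma a *R weyl a (weyl b k) y)"
 proof -
  have "(LINT t|lborel. pk a (t - y) *R tail c (weyl b k) t) = Gamma a *R weyl a (weyl b k) y"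
   unfolding weyl_tail(1)[OF y] using G by simp
  then show ?thesis unfolding 2 by (simp del: scaleR_scaleR)
 qed
 with 1 G show ?thesis
  by (simp add: mult.commute)
qed

section \<open>Derivatives and Weyl integrals on the open half-line\<close>

definition Cpos :: "(real => complex) set" where
 "Cpos = {h. (ALL m. Dn m h differentiable_on {0<..}) & (EX b. ALL y>b. h y = 0)}"

lemma Dn_0 [simp]: "Dn 0 f = f"
 by (simp add: Dn_def)

lemma Dn_Suc: "Dn (Suc m) f x = vector_derivative (Dn m f) (at x)"
 by (simp add: Dn_def)

lemma Cinf_comp_Cpos: "f : Cinf_comp ==> f : Cpos"
 by (auto simp: Cinf_comp_def Cpos_def smooth_halfline_def)

lemma Dn_deriv:
 assumes "Dn m h differentiable_on {0<..}" "y > 0"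
 shows "(Dn m h has_vector_derivative Dn (Suc m) h y) (at y)"
proof -
 have "Dn m h differentiable at y"
  using assms by (simp add: differentiable_on_eq_differentiable_at)
 then show ?thesis unfolding Dn_Suc by (simp add: vector_derivative_works)
qed

lemma Cpos_deriv:
 assumes "h : Cpos" "y > 0"
 shows "(Dn m h has_vector_derivative Dn (Suc m) h y) (at y)"
 using assms by (intro Dn_deriv) (auto simp: Cpos_def)

text \<open>\<open>Dn\<close> at a point depends only on values near it. A guessed sequence in which
  each member differentiates to the next on the open half-line therefore gives all derivatives at
  once, whatever the function does at nonpositive arguments.\<close>

lemma Dn_tower:
 assumes h: "!!y. y > 0 ==> h y = hs 0 y"
  and hs: "!!m y. y > 0 ==> (hs m has_vector_derivative hs (Suc m) y) (at y)"
 shows "y > 0 ==> Dn m h y = hs m y" and "Dn m h differentiable_on {0<..}"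
proof -
 have d: "(Dn m h has_vector_derivative hs (Suc m) y) (at y)" if "y > 0" "!!z. z > 0 ==> Dn m h z = hs m z" for m y
  using hs[OF that(1)] by (rule has_vector_derivative_transform_within_open[of _ _ _ "{0<..}"]) (use that in auto)
 have *: "Dn m h y = hs m y" if "y > 0" for m y
  using that
 proof (induction m arbitrary: y)
  case (Suc m)
  then show ?case using d[of y m] by (simp add: Dn_Suc vector_derivative_at)
 qed (use h in auto)
 then show "y > 0 ==> Dn m h y = hs m y" .
 show "Dn m h differentiable_on {0<..}"
  unfolding differentiable_on_def
  by (rule ballI, rule differentiable_at_withinI, rule differentiableI_vector, rule d) (use * in auto)
qed

lemma Dn_zero_beyond:
 assumes "!!y. y > b ==> h y = 0"
 shows "y > b ==> Dn m h y = 0"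
proof (induction m arbitrary: y)
 case (Suc m)
 have "(Dn m h has_vector_derivative 0) (at y)"
  by (rule has_vector_derivative_transform_within_open[of "%_. 0" _ _ "{b<..}"]) (use Suc in auto)
 then show ?case by (simp add: Dn_Suc vector_derivative_at)
qed (use assms in auto)

lemma Cpos_tower:
 assumes h: "!!y. y > 0 ==> h y = hs 0 y"
  and hs: "!!m y. y > 0 ==> (hs m has_vector_derivative hs (Suc m) y) (at y)"
  and b: "!!y. y > b ==> h y = 0"
 shows "h : Cpos"
 using Dn_tower(2)[of h hs, OF h hs] b by (auto simp: Cpos_def)

lemma Cpos_zero: "h : Cpos ==> EX b>0. ALL m. ALL y>b. Dn m h y = 0"
proof -
 assume "h : Cpos"
 then obtain b where "!!y. y > b ==> h y = 0" by (auto simp: Cpos_def)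
 then have "ALL m. ALL y>max b 1. Dn m h y = 0" using Dn_zero_beyond[of "max b 1" h] by auto
 then show ?thesis by (intro exI[of _ "max b 1"]) auto
qed

lemma Cpos_continuous: "h : Cpos ==> continuous_on {0<..} (Dn m h)"
 by (intro continuous_at_imp_continuous_on ballI has_vector_derivative_continuous[OF Cpos_deriv]) auto

lemma Cpos_bcont:
 assumes "h : Cpos" "c > 0"
 shows "bcont c (Dn m h)"
proof -
 obtain b where b: "b > 0" "!!y. y > b ==> Dn m h y = 0" using Cpos_zero[OF assms(1)] by blast
 have "compact (Dn m h ` {c..b})"
  using assms by (intro compact_continuous_image continuous_on_subset[OF Cpos_continuous]) auto
 then obtain B where B: "!!y. y : {c..b} ==> norm (Dn m h y) <= B"
  by (meson bounded_iff compact_imp_bounded imageI)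
 show ?thesis
  unfolding bcont_def
 proof (intro conjI exI allI impI)
  show "continuous_on {c<..} (Dn m h)"
   using assms by (intro continuous_on_subset[OF Cpos_continuous]) auto
  show "norm (Dn m h t) <= max B 0" if "t > c" for t
   using B[of t] b(2)[of t] that by (cases "t <= b") auto
 qed (use b in auto)
qed

lemma Cinf_comp_bcont:
 assumes "h : Cinf_comp"
 shows "bcont 0 (Dn m h)"
proof -
 obtain l where "(Dn m h ---> l) (at_right 0)" using assms by (auto simp: Cinf_comp_def smooth_halfline_def)
 then have "((%y. norm (Dn m h y)) ---> norm l) (at_right 0)" by (rule tendsto_norm)
 then have "\<forall>\<^sub>F y in at_right 0. norm (Dn m h y) < norm l + 1" by (rule order_tendstoD) simp
 then obtain d where d: "d > 0" "!!y. y > 0 ==> y < d ==> norm (Dn m h y) < norm l + 1"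
  unfolding eventually_at_right_field by auto
 note h = Cinf_comp_Cpos[OF assms]
 obtain B b where B: "!!y. y > d/2 ==> norm (Dn m h y) <= B" "!!y. y > b ==> Dn m h y = 0"
  using Cpos_bcont[OF h, of "d/2" m] d unfolding bcont_def by auto
 show ?thesis
  unfolding bcont_def
 proof (intro conjI exI allI impI)
  show "continuous_on {0<..} (Dn m h)" by (rule Cpos_continuous[OF h])
  show "norm (Dn m h t) <= max B (norm l + 1)" if "t > 0" for t
   using B(1)[of t] d(2)[of t] d(1) that by (cases "t < d") auto
 qed (use B in auto)
qed

lemma Cinf_compI:
 assumes "h : Cpos" "!!m. EX l. (Dn m h ---> l) (at_right 0)"
 shows "h : Cinf_comp"
 using assms by (auto simp: Cpos_def Cinf_comp_def smooth_halfline_def)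

lemma weyl_1:
 assumes k: "bcont c k" and y: "y > c" and b: "!!t. t > b ==> k t = 0"
 shows "weyl 1 k y = integral {y..b} k"
proof -
 have c: "continuous_on {y..b} k" using k y unfolding bcont_def by (meson continuous_on_subset atLeastAtMost_iff greaterThan_iff order_less_le_trans subsetI)
 then have i: "set_integrable lborel {y..b} k" by (rule borel_integrable_atLeastAtMost')
 have "weyl 1 k y = (LINT t|lborel. indicator {y<..} t *R (((t - y) powr (1 - 1)) *R k t))"
  unfolding weyl_def set_lebesgue_integral_def by simp
 also have "... = (LINT t|lborel. indicator {y..b} t *R k t)"
 proof (rule integral_cong_AE)
  have "(%t. indicator {y<..} t *R (((t - y) powr (1 - 1)) *R k t)) = tail y k"
   by (auto simp: tail_def indicator_def)
  moreover have "continuous_on {y<..} k" using k y unfolding bcont_def by (meson continuous_on_subset greaterThan_subset_iff less_imp_le)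
  ultimately show "(%t. indicator {y<..} t *R (((t - y) powr (1 - 1)) *R k t)) : borel_measurable lborel"
   using tail_measurable[of y k] by simp
  show "(%t. indicator {y..b} t *R k t) : borel_measurable lborel" using i unfolding set_integrable_def by (rule borel_measurable_integrable)
  show "AE t in lborel. indicator {y<..} t *R ((t - y) powr (1 - 1) *R k t) = indicator {y..b} t *R k t"
   using AE_lborel_singleton[of y] by eventually_elim (use b in "auto simp: indicator_def")
 qed
 also have "... = integral {y..b} k"
  using set_borel_integral_eq_integral(2)[OF i] by (simp add: set_lebesgue_integral_def)
 finally show ?thesis .
qed

lemma weyl_1_has_derivative:
 assumes k: "bcont c k" and y: "y > c"
 shows "(weyl 1 k has_vector_derivative - k y) (at y)"
proof -
 obtain b where b: "b > y" "!!t. t > b ==> k t = 0"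
 proof -
  obtain b0 where "!!t. t > b0 ==> k t = 0" using k unfolding bcont_def by blast
  then show thesis by (intro that[of "max b0 (y + 1)"]) auto
 qed
 define c' where "c' = (c + y) / 2"
 have c': "c < c'" "c' < y" using y by (auto simp: c'_def)
 have c: "continuous_on {c'..b} k" using k c' unfolding bcont_def by (meson continuous_on_subset atLeastAtMost_iff greaterThan_iff order_less_le_trans subsetI)
 then have i: "k integrable_on {c'..b}" by (rule integrable_continuous_real)
 have "((%u. integral {c'..u} k) has_vector_derivative k y) (at y within {c'..b})"
  by (rule integral_has_vector_derivative[OF c]) (use c' b in auto)
 then have "((%u. integral {c'..u} k) has_vector_derivative k y) (at y)"
  using c' b by (simp add: at_within_Icc_at)
 then have "((%u. integral {c'..b} k - integral {c'..u} k) has_vector_derivative - k y) (at y)"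
  by (auto intro!: derivative_eq_intros)
 then show ?thesis
 proof (rule has_vector_derivative_transform_within_open[of _ _ _ "{c'<..<b}"])
  fix u assume u: "u : {c'<..<b}"
  then have "integral {c'..u} k + integral {u..b} k = integral {c'..b} k"
   by (intro Henstock_Kurzweil_Integration.integral_combine i) auto
  moreover have "weyl 1 k u = integral {u..b} k" using u c' b by (intro weyl_1[OF k]) auto
  ultimately show "integral {c'..b} k - integral {c'..u} k = weyl 1 k u" by (simp add: algebra_simps)
 qed (use c' b in auto)
qed

lemma weyl_1_Dn:
 assumes h: "h : Cpos" and y: "y > 0"
 shows "weyl 1 (Dn (Suc m) h) y = - Dn m h y"
proof -
 obtain b0 where b0: "!!m y. y > b0 ==> Dn m h y = 0" using Cpos_zero[OF h] by blast
 define b where "b = max b0 y + 1"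
 have b: "b > y" "!!m y. y >= b ==> Dn m h y = 0" using b0 by (auto simp: b_def)
 have "weyl 1 (Dn (Suc m) h) y = integral {y..b} (Dn (Suc m) h)"
  using y b by (intro weyl_1[OF Cpos_bcont[OF h, of "y/2"]]) auto
 also have "... = Dn m h b - Dn m h y"
  using y b by (intro integral_unique fundamental_theorem_of_calculus has_vector_derivative_at_within[OF Cpos_deriv[OF h]]) auto
 finally show ?thesis using b by simp
qed

text \<open>Instead of differentiating under the integral sign, the semigroup law writes the
  function as \<open>- weyl 1\<close> of \<open>weyl a (Dn (Suc m) h)\<close>, and an integral of
  order one is differentiated by the fundamental theorem.\<close>

lemma weyl_has_derivative:
 assumes h: "h : Cpos" and a: "a > 0" and y: "y > 0"
 shows "(weyl a (Dn m h) has_vector_derivative weyl a (Dn (Suc m) h) y) (at y)"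
proof -
 have k: "bcont c (Dn (Suc m) h)" if "c > 0" for c using Cpos_bcont[OF h that] .
 have eq: "weyl a (Dn m h) z = - weyl 1 (weyl a (Dn (Suc m) h)) z" if "z > 0" for z
 proof -
  have "weyl a (Dn m h) z = weyl a (%t. - 1 * weyl 1 (Dn (Suc m) h) t) z"
   by (rule weyl_cong) (use that in "simp add: weyl_1_Dn[OF h]")
  also have "... = - weyl a (weyl 1 (Dn (Suc m) h)) z"
   by (subst weyl_mult_const) simp
  also have "weyl a (weyl 1 (Dn (Suc m) h)) z = weyl 1 (weyl a (Dn (Suc m) h)) z"
   using that a by (simp add: weyl_semigroup[OF k[of z]] add.commute)
  finally show ?thesis .
 qed
 have "(weyl 1 (weyl a (Dn (Suc m) h)) has_vector_derivative - weyl a (Dn (Suc m) h) y) (at y)"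
  by (rule weyl_1_has_derivative[OF bcont_weyl[OF k[of "y/2"] a]]) (use y in auto)
 then have "((%z. - weyl 1 (weyl a (Dn (Suc m) h)) z) has_vector_derivative weyl a (Dn (Suc m) h) y) (at y)"
  using has_vector_derivative_minus by fastforce
 then show ?thesis
  by (rule has_vector_derivative_transform_within_open[of _ _ _ "{0<..}"]) (use y eq in auto)
qed

lemma weyl_Cpos:
 assumes h: "h : Cpos" and a: "a > 0"
 shows "weyl a h : Cpos"
proof -
 obtain b where b: "!!y. y > b ==> h y = 0" using h by (auto simp: Cpos_def)
 show ?thesis
  by (rule Cpos_tower[of _ "%m. weyl a (Dn m h)" b]) (use weyl_has_derivative[OF h a] b in "auto intro!: weyl_eq_0")
qed

lemma Dn_weyl:
 assumes h: "h : Cpos" and a: "a > 0" and y: "y > 0"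
 shows "Dn m (weyl a h) y = weyl a (Dn m h) y"
 by (rule Dn_tower(1)[of _ "%m. weyl a (Dn m h)"]) (use weyl_has_derivative[OF h a] y in auto)

lemma weyl_Cinf_comp:
 assumes h: "h : Cinf_comp" and a: "a > 0"
 shows "weyl a h : Cinf_comp"
proof (rule Cinf_compI)
 note hp = Cinf_comp_Cpos[OF h]
 show "weyl a h : Cpos" by (rule weyl_Cpos[OF hp a])
 fix m
 have "continuous_on {0..} (weyl a (Dn m h))"
  by (rule weyl_continuous[OF Cinf_comp_bcont[OF h] a])
 then have "(weyl a (Dn m h) ---> weyl a (Dn m h) 0) (at 0 within {0..})"
  by (simp add: continuous_on_def)
 then have "(weyl a (Dn m h) ---> weyl a (Dn m h) 0) (at_right 0)"
  by (rule tendsto_within_subset) auto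
 then have "(Dn m (weyl a h) ---> weyl a (Dn m h) 0) (at_right 0)"
  by (rule Lim_transform_eventually) (rule eventually_at_rightI[of 0 1], auto simp: Dn_weyl[OF hp a])
 then show "EX l. (Dn m (weyl a h) ---> l) (at_right 0)" by blast
qed

text \<open>Repeated integration by parts. It makes \<open>I_op\<close> independent of the number of
  derivatives taken, and thus a continuation of \<open>weyl\<close> to all real orders.\<close>

lemma weyl_Dn_shift:
 assumes h: "h : Cpos" and a: "a > 0" and y: "y > 0"
 shows "(-1) ^ m * weyl (a + real m) (Dn (m + j) h) y = weyl a (Dn j h) y"
proof (induction m)
 case (Suc m)
 have k: "bcont c (Dn n h)" if "c > 0" for c n using Cpos_bcont[OF h that] .
 have "weyl (a + real (Suc m)) (Dn (Suc m + j) h) y = weyl (a + real m) (weyl 1 (Dn (Suc (m + j)) h)) y"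
  using a y by (subst weyl_semigroup[OF k[of y]]) (auto simp: algebra_simps)
 also have "... = weyl (a + real m) (%t. - 1 * Dn (m + j) h t) y"
  by (rule weyl_cong) (use y in "simp add: weyl_1_Dn[OF h]")
 also have "... = - weyl (a + real m) (Dn (m + j) h) y"
  by (subst weyl_mult_const) simp
 finally show ?case using Suc by simp
qed auto

text \<open>The case of total order zero, outside the range of \<open>weyl_Dn_shift\<close>: the
  shift leaves order one, and the fundamental theorem does the rest.\<close>

lemma weyl_Dn:
 assumes h: "h : Cpos" and y: "y > 0"
 shows "(-1) ^ Suc m * weyl (real (Suc m)) (Dn (Suc m + j) h) y = Dn j h y"
 using weyl_Dn_shift[OF h zero_less_one y, of m "Suc j"] weyl_1_Dn[OF h y, of j]
 by (simp add: algebra_simps)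

section \<open>The operators \<open>I_op\<close> of arbitrary real order\<close>

definition mexp :: "real => nat" where
 "mexp \<mu> = (LEAST M::nat. \<mu> > - real M)"

lemma mexp: "\<mu> + real (mexp \<mu>) > 0"
proof -
 obtain M :: nat where "real M > -\<mu>" using reals_Archimedean2 by blast
 then have "\<mu> > - real M" by simp
 then have "\<mu> > - real (mexp \<mu>)" unfolding mexp_def by (rule LeastI)
 then show ?thesis by simp
qed

lemma I_op_weyl: "I_op \<mu> f y = (-1) ^ mexp \<mu> * weyl (\<mu> + real (mexp \<mu>)) (Dn (mexp \<mu>) f) y"
proof -
 have *: "((-1) ^ m / c) *R z = (-1) ^ m * ((1 / c) *R z)" for m and c :: real and z :: complex
  by (cases "even m") auto
 show ?thesis unfolding I_op_def weyl_def Let_def mexp_def[symmetric] * ..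
qed

lemma I_op_cong: "(!!t. t > y ==> f t = g t) ==> I_op \<mu> f y = I_op \<mu> g y"
proof -
 assume fg: "!!t. t > y ==> f t = g t"
 have "Dn m f t = Dn m g t" if "t > y" for m t
  using that
 proof (induction m arbitrary: t)
  case (Suc m)
  have "vector_derivative (Dn m f) (at t) = vector_derivative (Dn m g) (at t)"
   by (rule vector_derivative_cong_eq[OF eventually_mono[OF eventually_nhds_in_open[of "{y<..}" t]]]) (use Suc in auto)
  then show ?case by (simp add: Dn_Suc)
 qed (use fg in auto)
 then show ?thesis unfolding I_op_weyl using weyl_cong[of y "Dn (mexp \<mu>) f" "Dn (mexp \<mu>) g"] by simp
qed

lemma I_op_Cpos: "h : Cpos ==> I_op \<mu> h : Cpos"
 and Dn_I_op: "h : Cpos ==> y > 0 ==> Dn m (I_op \<mu> h) y = (-1) ^ mexp \<mu> * weyl (\<mu> + real (mexp \<mu>)) (Dn (mexp \<mu> + m) h) y"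
proof -
 assume h: "h : Cpos"
 define hs where "hs m y = (-1) ^ mexp \<mu> * weyl (\<mu> + real (mexp \<mu>)) (Dn (mexp \<mu> + m) h) y" for m y
 have 1: "I_op \<mu> h y = hs 0 y" for y unfolding hs_def I_op_weyl by simp
 have 2: "(hs m has_vector_derivative hs (Suc m) y) (at y)" if "y > 0" for m y
  unfolding hs_def using weyl_has_derivative[OF h mexp that, of \<mu> "mexp \<mu> + m"]
  by (auto intro!: has_vector_derivative_mult_right)
 obtain b where b: "!!m y. y > b ==> Dn m h y = 0" using Cpos_zero[OF h] by blast
 show "I_op \<mu> h : Cpos"
  by (rule Cpos_tower[of _ hs b]) (use 1 2 b in "auto simp: hs_def intro!: weyl_eq_0")
 show "y > 0 ==> Dn m (I_op \<mu> h) y = (-1) ^ mexp \<mu> * weyl (\<mu> + real (mexp \<mu>)) (Dn (mexp \<mu> + m) h) y"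
  using Dn_tower(1)[of _ hs y m, OF 1 2] by (simp add: hs_def)
qed

lemma Dn_Cinf_comp:
 assumes "h : Cinf_comp" shows "Dn m h : Cinf_comp"
proof -
 have *: "Dn j (Dn m h) = Dn (j + m) h" for j by (simp add: Dn_def funpow_add)
 have "EX b. ALL y>b. Dn m h y = 0" using Cpos_zero[OF Cinf_comp_Cpos[OF assms]] by blast
 then show ?thesis using assms unfolding Cinf_comp_def smooth_halfline_def by (auto simp: *)
qed

lemma I_op_Cinf_comp:
 assumes h: "h : Cinf_comp" shows "I_op \<mu> h : Cinf_comp"
proof (rule Cinf_compI)
 show "I_op \<mu> h : Cpos" by (rule I_op_Cpos[OF Cinf_comp_Cpos[OF h]])
 fix m
 have "weyl (\<mu> + real (mexp \<mu>)) (Dn (mexp \<mu> + m) h) : Cinf_comp"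
  by (intro weyl_Cinf_comp Dn_Cinf_comp h mexp)
 then have "EX l. (Dn 0 (weyl (\<mu> + real (mexp \<mu>)) (Dn (mexp \<mu> + m) h)) ---> l) (at_right 0)"
  unfolding Cinf_comp_def smooth_halfline_def by blast
 then obtain l where "(weyl (\<mu> + real (mexp \<mu>)) (Dn (mexp \<mu> + m) h) ---> l) (at_right 0)"
  by auto
 then have "((%y. (-1) ^ mexp \<mu> * weyl (\<mu> + real (mexp \<mu>)) (Dn (mexp \<mu> + m) h) y) ---> (-1) ^ mexp \<mu> * l) (at_right 0)"
  by (intro tendsto_intros)
 then have "(Dn m (I_op \<mu> h) ---> (-1) ^ mexp \<mu> * l) (at_right 0)"
  by (rule Lim_transform_eventually) (rule eventually_at_rightI[of 0 1], auto simp: Dn_I_op[OF Cinf_comp_Cpos[OF h]])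
 then show "EX l. (Dn m (I_op \<mu> h) ---> l) (at_right 0)" by blast
qed

text \<open>The semigroup law with one factor of arbitrary real order: the derivatives inside
  \<open>I_op\<close> are absorbed by \<open>weyl_Dn_shift\<close> as long as the total order is
  positive.\<close>

lemma weyl_I_op:
 assumes h: "h : Cpos" and a: "a > 0" and y: "y > 0" and p: "a + \<mu> > 0"
 shows "weyl a (I_op \<mu> h) y = weyl (a + \<mu>) h y"
proof -
 let ?M = "mexp \<mu>"
 have k: "bcont c (Dn n h)" if "c > 0" for c n using Cpos_bcont[OF h that] .
 have "weyl a (I_op \<mu> h) y = weyl a (%t. (-1) ^ ?M * weyl (\<mu> + real ?M) (Dn ?M h) t) y"
  unfolding I_op_weyl ..
 also have "... = (-1) ^ ?M * weyl (a + \<mu> + real ?M) (Dn ?M h) y"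
  unfolding weyl_mult_const using y a mexp[of \<mu>] by (simp add: weyl_semigroup[OF k[of y]] add.assoc)
 also have "... = weyl (a + \<mu>) h y"
  using weyl_Dn_shift[OF h p y, of ?M 0] by simp
 finally show ?thesis .
qed

lemma I_op_inverse:
 assumes h: "h : Cpos" and y: "y > 0"
 shows "I_op (- \<mu>) (I_op \<mu> h) y = h y"
proof -
 let ?M = "mexp \<mu>" and ?N = "mexp (- \<mu>)"
 have k: "bcont c (Dn n h)" if "c > 0" for c n using Cpos_bcont[OF h that] .
 \<comment> \<open>The orders \<open>\<mu> + ?M\<close> and \<open>- \<mu> + ?N\<close> are both
   positive, so their sum, an integer, is at least one and \<open>weyl_Dn\<close> applies.\<close>
 have "?N + ?M ~= 0" using mexp[of \<mu>] mexp[of "-\<mu>"] by auto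
 then obtain m where m: "?N + ?M = Suc m" by (metis not0_implies_Suc)
 then have m': "real ?N + real ?M = real (Suc m)" by linarith
 have "I_op (- \<mu>) (I_op \<mu> h) y = (-1) ^ ?N * weyl (- \<mu> + real ?N) (Dn ?N (I_op \<mu> h)) y"
  by (rule I_op_weyl)
 also have "weyl (- \<mu> + real ?N) (Dn ?N (I_op \<mu> h)) y =
   weyl (- \<mu> + real ?N) (%t. (-1) ^ ?M * weyl (\<mu> + real ?M) (Dn (?M + ?N) h) t) y"
  by (rule weyl_cong) (use y in "auto simp: Dn_I_op[OF h]")
 also have "... = (-1) ^ ?M * weyl (real ?N + real ?M) (Dn (?M + ?N) h) y"
  unfolding weyl_mult_const using y mexp[of \<mu>] mexp[of "-\<mu>"] by (simp add: weyl_semigroup[OF k[of y]])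
 finally have "I_op (- \<mu>) (I_op \<mu> h) y = (-1) ^ (?N + ?M) * weyl (real ?N + real ?M) (Dn (?N + ?M) h) y"
  by (simp add: power_add add.commute)
 then show ?thesis using weyl_Dn[OF h y, of m 0] unfolding m m' by simp
qed

section \<open>The transmutation operators\<close>

text \<open>The substitution \<open>x = y\<^sup>2\<close> turns \<open>P1_op\<close> into a fractional integral of \<open>F (sqrt x) / sqrt x\<close>.\<close>

definition Hsq :: "(real => complex) => real => complex" where
 "Hsq F x = F (sqrt x) /\<^sub>R sqrt x"

text \<open>Coefficients of the \<open>m\<close>-th derivative of
  \<open>x powr (-1/2) * F (sqrt x)\<close>. The term \<open>x powr p\<close> times
  \<open>Dn j F (sqrt x)\<close>, with \<open>p = (j - 2 m - 1) / 2\<close>, differentiates into one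
  with the same \<open>j\<close> and factor \<open>p\<close>, and one with \<open>j + 1\<close> and
  factor \<open>1/2\<close>.\<close>

fun hcoef :: "nat => nat => real" where
 "hcoef 0 j = (if j = 0 then 1 else 0)"
| "hcoef (Suc m) j = hcoef m j * ((real j - 2 * real m - 1) / 2) + (case j of 0 => 0 | Suc i => hcoef m i / 2)"

lemma hcoef_zero: "j > m ==> hcoef m j = 0"
 by (induction m arbitrary: j) (auto split: nat.split)

text \<open>The product of \<open>-1/2, -3/2, ...\<close>, written with Gamma so that it cancels
  against a Beta function in \<open>I_op_Hsq_limit\<close>. Only this coefficient matters at the
  origin.\<close>

lemma hcoef_0: "hcoef m 0 = (-1) ^ m * Gamma (real m + 1/2) / sqrt pi"
proof (induction m)
 case 0
 then show ?case by (simp add: Gamma_one_half_real)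
next
 case (Suc m)
 have "real m + 1/2 \<notin> \<int>\<^sub>\<le>\<^sub>0" by (auto elim!: nonpos_Ints_cases)
 then have "Gamma (real m + 1/2 + 1) = (real m + 1/2) * Gamma (real m + 1/2)" by (rule Gamma_plus1)
 moreover have "real (Suc m) + 1/2 = real m + 1/2 + 1" by simp
 moreover have "hcoef (Suc m) 0 = - (real m + 1/2) * hcoef m 0" by (simp add: field_simps)
 moreover define a where "a = real m + 1/2"
 ultimately have "hcoef (Suc m) 0 = - a * hcoef m 0" "Gamma (real (Suc m) + 1/2) = a * Gamma a" by simp_all
 then show ?case unfolding Suc a_def[symmetric] by (simp del: hcoef.simps of_nat_Suc)
qed

definition Hder :: "(real => complex) => nat => real => complex" where
 "Hder F m x = (\<Sum>j\<le>m. (hcoef m j * x powr ((real j - 2 * real m - 1) / 2)) *R Dn j F (sqrt x))"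

lemma Hder_deriv:
 assumes F: "F : Cpos" and x: "x > 0"
 shows "(Hder F m has_vector_derivative Hder F (Suc m) x) (at x)"
proof -
 define p where "p j = (real j - 2 * real m - 1) / 2" for j :: nat
 have t: "((%x. (hcoef m j * x powr p j) *R Dn j F (sqrt x)) has_vector_derivative
   (hcoef m j * p j * x powr (p j - 1)) *R Dn j F (sqrt x) +
   (hcoef m j / 2 * x powr (p j - 1/2)) *R Dn (Suc j) F (sqrt x)) (at x)" for j
 proof -
  have 1: "((%x. hcoef m j * x powr p j) has_real_derivative hcoef m j * p j * x powr (p j - 1)) (at x)"
   using x by (auto intro!: derivative_eq_intros simp: powr_diff)
  have 2: "((%x. Dn j F (sqrt x)) has_vector_derivative (inverse (sqrt x) / 2) *R Dn (Suc j) F (sqrt x)) (at x)"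
   using vector_diff_chain_at[of sqrt "inverse (sqrt x) / 2" x "Dn j F" "Dn (Suc j) F (sqrt x)"] x Cpos_deriv[OF F, of "sqrt x" j]
    DERIV_real_sqrt[OF x] by (simp add: o_def has_real_derivative_iff_has_vector_derivative)
  have 3: "x powr (p j - 1/2) = x powr (p j) * inverse (sqrt x)"
  proof -
   have "x powr (p j) = x powr (p j - 1/2) * sqrt x"
    using x powr_add[of x "p j - 1/2" "1/2"] by (simp add: powr_half_sqrt)
   then show ?thesis using x by simp
  qed
  show ?thesis
   by (rule has_vector_derivative_eq_rhs[OF has_vector_derivative_scaleR[OF 1 2]]) (simp add: 3 algebra_simps)
 qed
 have "(Hder F m has_vector_derivative (\<Sum>j\<le>m. (hcoef m j * p j * x powr (p j - 1)) *R Dn j F (sqrt x) +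
   (hcoef m j / 2 * x powr (p j - 1/2)) *R Dn (Suc j) F (sqrt x))) (at x)"
  unfolding Hder_def p_def[symmetric] by (intro has_vector_derivative_sum t)
 moreover have "(\<Sum>j\<le>m. (hcoef m j * p j * x powr (p j - 1)) *R Dn j F (sqrt x) +
   (hcoef m j / 2 * x powr (p j - 1/2)) *R Dn (Suc j) F (sqrt x)) = Hder F (Suc m) x"
 proof -
  define q where "q j = x powr ((real j - 2 * real (Suc m) - 1) / 2) *R Dn j F (sqrt x)" for j
  have e1: "p j - 1 = (real j - 2 * real (Suc m) - 1) / 2" "p j - 1/2 = (real (Suc j) - 2 * real (Suc m) - 1) / 2" for j
   by (auto simp: p_def field_simps)
  have "Hder F (Suc m) x = (\<Sum>j\<le>Suc m. hcoef (Suc m) j *R q j)"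
   unfolding Hder_def q_def by (simp only: scaleR_scaleR)
  also have "... = (\<Sum>j\<le>Suc m. (hcoef m j * p j) *R q j) + (\<Sum>j\<le>Suc m. (case j of 0 => 0 | Suc i => hcoef m i / 2) *R q j)"
   unfolding p_def by (simp only: hcoef.simps scaleR_add_left sum.distrib)
  also have "(\<Sum>j\<le>Suc m. (hcoef m j * p j) *R q j) = (\<Sum>j\<le>m. (hcoef m j * p j) *R q j)"
   by (simp add: hcoef_zero)
  also have "(\<Sum>j\<le>Suc m. (case j of 0 => 0 | Suc i => hcoef m i / 2) *R q j) = (\<Sum>j\<le>m. (hcoef m j / 2) *R q (Suc j))"
   by (subst sum.atMost_Suc_shift) simp
  finally show ?thesis
   unfolding e1 by (simp add: q_def sum.distrib)
 qed
 ultimately show ?thesis by simp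
qed

text \<open>\<open>Hsq F\<close> is in general unbounded at the origin even if \<open>F\<close> is
  smooth up to it. This is why \<open>Cpos\<close>, which asks nothing at \<open>0\<close>, is the
  class in which the transmutation is computed.\<close>

lemma Hsq_Cpos: "F : Cpos ==> Hsq F : Cpos"
 and Dn_Hsq: "F : Cpos ==> x > 0 ==> Dn m (Hsq F) x = Hder F m x"
proof -
 assume F: "F : Cpos"
 have 1: "Hsq F y = Hder F 0 y" if "y > 0" for y
  using that by (simp add: Hsq_def Hder_def powr_minus powr_half_sqrt)
 note 2 = Hder_deriv[OF F]
 obtain b where b: "b > 0" "!!y. y > b ==> F y = 0" using Cpos_zero[OF F] Dn_0 by metis
 have "Hsq F y = 0" if "y > b\<^sup>2" for y
  unfolding Hsq_def using b that by (simp add: real_less_rsqrt)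
 then show "Hsq F : Cpos" by (intro Cpos_tower[of _ "Hder F" "b\<^sup>2"] 1 2) auto
 show "x > 0 ==> Dn m (Hsq F) x = Hder F m x"
  by (rule Dn_tower(1)[of _ "Hder F", OF 1 2])
qed

text \<open>The change of variables theorem decides integrability of both sides together, so the
  equality can be stated without it. The detour over \<open>lebesgue\<close> is undone because both
  integrands are Borel measurable.\<close>

lemma subst_sq:
 fixes k :: "real => complex"
 assumes y: "y >= 0" and k: "continuous_on {y\<^sup>2<..} k"
 shows "(LINT t:{y<..}|lborel. (2 * t) *R k (t\<^sup>2)) = (LINT x:{y\<^sup>2<..}|lborel. k x)"
proof -
 define S where "S = {y<..}"
 have im: "(%t. t\<^sup>2) ` S = {y\<^sup>2<..}"
 proof (intro equalityI subsetI)
  fix x assume "x : {y\<^sup>2<..}"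
  then have "x >= 0" using zero_le_power2[of y] unfolding greaterThan_iff by linarith
  with \<open>x : _\<close> have "sqrt x : S" "x = (sqrt x)\<^sup>2" using y by (auto simp: S_def real_less_rsqrt)
  then show "x : (%t. t\<^sup>2) ` S" by blast
 qed (use y in "auto simp: S_def intro: power_strict_mono")
 have inj: "inj_on (%t. t\<^sup>2) S" using y by (auto simp: inj_on_def S_def)
 have Sl: "S : sets lebesgue" by (simp add: S_def)
 have der: "((%t::real. t\<^sup>2) has_field_derivative 2 * t) (at t within S)" for t
  by (auto intro!: derivative_eq_intros)
 note cov = has_absolute_integral_change_of_variables_real[where f=k, OF Sl der inj, unfolded im]
 have eq: "\<bar>2 * t\<bar> *R k (t\<^sup>2) = (2 * t) *R k (t\<^sup>2)" if "t : S" for t using that y by (simp add: S_def)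
 have "(LINT t:S|lebesgue. \<bar>2 * t\<bar> *R k (t\<^sup>2)) = (LINT x:{y\<^sup>2<..}|lebesgue. k x)"
 proof (cases "k absolutely_integrable_on {y\<^sup>2<..}")
  case True
  then have "(%t. \<bar>2 * t\<bar> *R k (t\<^sup>2)) absolutely_integrable_on S" "integral S (%t. \<bar>2 * t\<bar> *R k (t\<^sup>2)) = integral {y\<^sup>2<..} k"
   using cov[of "integral {y\<^sup>2<..} k"] by blast+
  then show ?thesis using True by (simp add: set_lebesgue_integral_eq_integral)
 next
  \<comment> \<open>Neither side is integrable, and both integrals have the default value
    \<open>0\<close>.\<close>
  case False
  then have "\<not> (%t. \<bar>2 * t\<bar> *R k (t\<^sup>2)) absolutely_integrable_on S"
   using cov by blast
  then show ?thesis using False by (simp add: set_lebesgue_integral_def set_integrable_def not_integrable_integral_eq)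
 qed
 moreover have "(LINT x:{y\<^sup>2<..}|lebesgue. k x) = (LINT x:{y\<^sup>2<..}|lborel. k x)"
 proof -
  have "(%x. indicator {y\<^sup>2<..} x *R k x) = tail (y\<^sup>2) k" by (auto simp: tail_def indicator_def)
  then show ?thesis unfolding set_lebesgue_integral_def
   using integral_completion[of "tail (y\<^sup>2) k" lborel] tail_measurable[OF k] by simp
 qed
 moreover have "(LINT t:S|lebesgue. \<bar>2 * t\<bar> *R k (t\<^sup>2)) = (LINT t:S|lborel. (2 * t) *R k (t\<^sup>2))"
 proof -
  have "(%t. indicator S t *R (\<bar>2 * t\<bar> *R k (t\<^sup>2))) = tail y (%t. (2 * t) *R k (t\<^sup>2))"
    "(%t. indicator S t *R ((2 * t) *R k (t\<^sup>2))) = tail y (%t. (2 * t) *R k (t\<^sup>2))"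
   using y by (auto simp: tail_def indicator_def S_def fun_eq_iff)
  moreover have "continuous_on {y<..} (%t. (2 * t) *R k (t\<^sup>2))"
   using im by (intro continuous_intros continuous_on_compose2[OF k]) (auto simp: S_def)
  ultimately show ?thesis unfolding set_lebesgue_integral_def
   using integral_completion[of "tail y (%t. (2 * t) *R k (t\<^sup>2))" lborel] tail_measurable by simp
 qed
 ultimately show ?thesis by (simp add: S_def)
qed

lemma has_vector_derivative_comp_sq:
 assumes "(k has_vector_derivative d) (at (y\<^sup>2))"
 shows "((%u. k (u\<^sup>2)) has_vector_derivative (2 * y) *R d) (at y)"
proof -
 have "((%u::real. u\<^sup>2) has_real_derivative 2 * y) (at y)"
  by (auto intro!: derivative_eq_intros)
 then show ?thesis
  using vector_diff_chain_at[of "%u. u\<^sup>2" "2 * y" y k d] assms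
  by (simp add: o_def has_real_derivative_iff_has_vector_derivative)
qed

text \<open>Each iterate has the form \<open>t * G (t\<^sup>2)\<close>: division by \<open>t\<close>
  and differentiation turn \<open>G\<close> into twice its derivative and restore the factor
  \<open>t\<close>.\<close>

lemma P1_iter:
 assumes F: "F : Cpos" and t: "t > 0"
 shows "((%g t. vector_derivative (%u. g u /\<^sub>R u) (at t)) ^^ N) F t = (t * 2 ^ N) *R Dn N (Hsq F) (t\<^sup>2)"
 using t
proof (induction N arbitrary: t)
 case 0
 then show ?case by (simp add: Hsq_def)
next
 case (Suc N)
 define G where "G = ((%g t. vector_derivative (%u. g u /\<^sub>R u) (at t)) ^^ N) F"
 note H = Hsq_Cpos[OF F]
 have "((%u. Dn N (Hsq F) (u\<^sup>2)) has_vector_derivative (2 * t) *R Dn (Suc N) (Hsq F) (t\<^sup>2)) (at t)"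
  using Suc(2) by (intro has_vector_derivative_comp_sq Cpos_deriv[OF H]) auto
 then have "((%u. 2 ^ N *R Dn N (Hsq F) (u\<^sup>2)) has_vector_derivative 2 ^ N *R (2 * t) *R Dn (Suc N) (Hsq F) (t\<^sup>2)) (at t)"
  by (rule bounded_linear.has_vector_derivative[OF bounded_linear_scaleR_right])
 then have "((%u. G u /\<^sub>R u) has_vector_derivative 2 ^ N *R (2 * t) *R Dn (Suc N) (Hsq F) (t\<^sup>2)) (at t)"
  by (rule has_vector_derivative_transform_within_open[of _ _ _ "{0<..}"]) (use Suc in "auto simp: G_def")
 then show ?case using Suc(2) by (simp add: G_def vector_derivative_at mult_ac)
qed

text \<open>The powers \<open>2 ^ N\<close> from \<open>P1_iter\<close> cancel against the constant
  of \<open>P1_op\<close>, and the remaining \<open>1/2\<close> comes from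
  \<open>2 t dt = dx\<close>. Both operators use the same least integer, because
  \<open>\<nu> < N + 1/2\<close> says \<open>1/2 - \<nu> > - N\<close>.\<close>

lemma P1_eq:
 assumes F: "F : Cpos" and y: "y > 0"
 shows "P1_op \<nu> F y = complex_of_real (sqrt pi / (2 * Gamma (\<nu> + 1))) * I_op (1/2 - \<nu>) (Hsq F) (y\<^sup>2)"
proof -
 define N where "N = mexp (1/2 - \<nu>)"
 define b where "b = real N - \<nu> + 1/2"
 have b: "b > 0" using mexp[of "1/2 - \<nu>"] by (simp add: b_def N_def)
 have G: "Gamma b > 0" using b by (rule Gamma_real_pos)
 have N: "(LEAST N::nat. \<nu> < real N + 1/2) = N"
  unfolding N_def mexp_def by (rule arg_cong[where f=Least]) (auto simp: fun_eq_iff)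
 note H = Hsq_Cpos[OF F]
 have e0: "real N - \<nu> - 1/2 = b - 1" by (simp add: b_def)
 define k where "k x = (x - y\<^sup>2) powr (b - 1) *R Dn N (Hsq F) x" for x
 have "(LINT t:{y<..}|lborel. ((t\<^sup>2 - y\<^sup>2) powr (real N - \<nu> - 1/2)) *R
       ((%g t. vector_derivative (%u. g u /\<^sub>R u) (at t)) ^^ N) F t)
   = (LINT t:{y<..}|lborel. (2 ^ N / 2) *R (2 * t) *R k (t\<^sup>2))"
  by (rule set_lebesgue_integral_cong) (use y in "auto simp: P1_iter[OF F] k_def e0 mult_ac")
 also have "... = (2 ^ N / 2) *R (LINT t:{y<..}|lborel. (2 * t) *R k (t\<^sup>2))"
  by (rule set_integral_scaleR_right)
 also have "(LINT t:{y<..}|lborel. (2 * t) *R k (t\<^sup>2)) = (LINT x:{y\<^sup>2<..}|lborel. k x)"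
  by (rule subst_sq) (use y in \<open>auto simp: k_def intro!: continuous_intros continuous_on_subset[OF Cpos_continuous[OF H]] intro: less_trans[of _ "y\<^sup>2"]\<close>)
 also have "... = Gamma b *R weyl b (Dn N (Hsq F)) (y\<^sup>2)"
  unfolding weyl_def k_def using G by simp
 finally have eq: "(LINT t:{y<..}|lborel. ((t\<^sup>2 - y\<^sup>2) powr (real N - \<nu> - 1/2)) *R
       ((%g t. vector_derivative (%u. g u /\<^sub>R u) (at t)) ^^ N) F t)
   = (2 ^ N / 2) *R Gamma b *R weyl b (Dn N (Hsq F)) (y\<^sup>2)" .
 have e: "I_op (1/2 - \<nu>) (Hsq F) (y\<^sup>2) = (-1) ^ N * weyl b (Dn N (Hsq F)) (y\<^sup>2)"
  unfolding I_op_weyl b_def N_def by (simp add: algebra_simps)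
 have "((-1) ^ N * sqrt pi / (2 ^ N * Gamma (\<nu> + 1) * Gamma (real N - \<nu> + 1/2))) *R (2 ^ N / 2) *R Gamma b *R w
   = complex_of_real (sqrt pi / (2 * Gamma (\<nu> + 1))) * ((-1) ^ N * w)" for w
  using G unfolding b_def[symmetric] by (cases "even N") (auto simp: scaleR_conv_of_real field_simps)
 then show ?thesis unfolding P1_op_def Let_def N eq e .
qed

text \<open>In the variable \<open>z\<^sup>2\<close> the integral in \<open>S1_op\<close> is a Weyl
  integral of order \<open>\<nu> + 1/2\<close>, which raises the order \<open>1/2 - \<nu>\<close> of
  \<open>P1_op\<close> to one; the derivative outside undoes this last integral.\<close>

lemma S1_P1:
 assumes F: "F : Cpos" and nu: "\<nu> >= 0" and y: "y > 0" and g: "!!t. t > 0 ==> g t = P1_op \<nu> F t"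
 shows "z > 0 ==> (LINT t:{z<..}|lborel. ((t\<^sup>2 - z\<^sup>2) powr (\<nu> - 1/2) * t) *R g t) =
     complex_of_real (sqrt pi * Gamma (\<nu> + 1/2) / (4 * Gamma (\<nu> + 1))) * weyl 1 (Hsq F) (z\<^sup>2)"
  and "S1_op \<nu> g y = F y"
proof -
 define c where "c = sqrt pi / (2 * Gamma (\<nu> + 1))"
 have G: "Gamma (\<nu> + 1/2) > 0" "Gamma (\<nu> + 1) > 0" using nu by (auto intro: Gamma_real_pos)
 note H = Hsq_Cpos[OF F]
 have inner: "(LINT t:{z<..}|lborel. ((t\<^sup>2 - z\<^sup>2) powr (\<nu> - 1/2) * t) *R g t) =
     complex_of_real (sqrt pi * Gamma (\<nu> + 1/2) / (4 * Gamma (\<nu> + 1))) * weyl 1 (Hsq F) (z\<^sup>2)" if z: "z > 0" for z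
 proof -
  define k where "k x = (x - z\<^sup>2) powr (\<nu> - 1/2) *R (complex_of_real c * I_op (1/2 - \<nu>) (Hsq F) x)" for x
  have "(LINT t:{z<..}|lborel. ((t\<^sup>2 - z\<^sup>2) powr (\<nu> - 1/2) * t) *R g t) = (LINT t:{z<..}|lborel. (1/2) *R (2 * t) *R k (t\<^sup>2))"
   by (rule set_lebesgue_integral_cong) (use z in "auto simp: k_def g P1_eq[OF F] c_def")
  also have "... = (1/2) *R (LINT t:{z<..}|lborel. (2 * t) *R k (t\<^sup>2))"
   by (rule set_integral_scaleR_right)
  also have "(LINT t:{z<..}|lborel. (2 * t) *R k (t\<^sup>2)) = (LINT x:{z\<^sup>2<..}|lborel. k x)"
   by (rule subst_sq) (use z in \<open>auto simp: k_def intro!: continuous_intros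
     continuous_on_subset[OF Cpos_continuous[OF I_op_Cpos[OF H], of 0, unfolded Dn_0]] intro: less_trans[of _ "z\<^sup>2"]\<close>)
  also have "... = Gamma (\<nu> + 1/2) *R weyl (\<nu> + 1/2) (%x. complex_of_real c * I_op (1/2 - \<nu>) (Hsq F) x) (z\<^sup>2)"
   unfolding weyl_def k_def using G by simp
  also have "weyl (\<nu> + 1/2) (%x. complex_of_real c * I_op (1/2 - \<nu>) (Hsq F) x) (z\<^sup>2) = complex_of_real c * weyl 1 (Hsq F) (z\<^sup>2)"
   unfolding weyl_mult_const using z nu by (subst weyl_I_op[OF H]) auto
  finally show ?thesis by (simp add: c_def scaleR_conv_of_real)
 qed
 show "z > 0 ==> (LINT t:{z<..}|lborel. ((t\<^sup>2 - z\<^sup>2) powr (\<nu> - 1/2) * t) *R g t) =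
     complex_of_real (sqrt pi * Gamma (\<nu> + 1/2) / (4 * Gamma (\<nu> + 1))) * weyl 1 (Hsq F) (z\<^sup>2)"
  by (rule inner)
 define C where "C = complex_of_real (sqrt pi * Gamma (\<nu> + 1/2) / (4 * Gamma (\<nu> + 1)))"
 have "(weyl 1 (Hsq F) has_vector_derivative - Hsq F (y\<^sup>2)) (at (y\<^sup>2))"
  using weyl_1_has_derivative[OF Cpos_bcont[OF H, of "y\<^sup>2/2" 0], of "y\<^sup>2"] y by simp
 then have "((%z. weyl 1 (Hsq F) (z\<^sup>2)) has_vector_derivative (2 * y) *R (- Hsq F (y\<^sup>2))) (at y)"
  by (rule has_vector_derivative_comp_sq)
 also have "(2 * y) *R (- Hsq F (y\<^sup>2)) = - 2 * F y" using y by (simp add: Hsq_def scaleR_conv_of_real)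
 finally have "((%z. C * weyl 1 (Hsq F) (z\<^sup>2)) has_vector_derivative C * (- 2 * F y)) (at y)"
  by (rule has_vector_derivative_mult_right)
 then have "((%z. LINT t:{z<..}|lborel. ((t\<^sup>2 - z\<^sup>2) powr (\<nu> - 1/2) * t) *R g t) has_vector_derivative C * (- 2 * F y)) (at y)"
  by (rule has_vector_derivative_transform_within_open[of _ _ _ "{0<..}"]) (use y inner in "auto simp: C_def")
 then have "vector_derivative (%z. LINT t:{z<..}|lborel. ((t\<^sup>2 - z\<^sup>2) powr (\<nu> - 1/2) * t) *R g t) (at y) = C * (- 2 * F y)"
  by (rule vector_derivative_at)
 then show "S1_op \<nu> g y = F y"
  using G unfolding S1_op_def C_def by (simp add: scaleR_conv_of_real field_simps)
qed

lemma S_op_P_op: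
 assumes f: "f : Cpos" and nu: "\<nu> >= 0" and y: "y > 0" and g: "!!t. t > 0 ==> g t = P_op \<nu> f t"
 shows "S_op \<nu> g y = f y"
proof -
 note F = I_op_Cpos[OF f, of "\<nu> - 1/2"]
 have "S_op \<nu> g y = I_op (1/2 - \<nu>) (I_op (\<nu> - 1/2) f) y"
  unfolding S_op_def by (rule I_op_cong) (use y g in "auto intro!: S1_P1(2)[OF F nu] simp: P_op_def")
 then show ?thesis using I_op_inverse[OF f y, of "\<nu> - 1/2"] by simp
qed

section \<open>Square integrable functions\<close>

definition l2n :: "'a measure => ('a => complex) => real" where
 "l2n M f = sqrt (LINT x|M. (norm (f x))\<^sup>2)"

definition L2M :: "'a measure => ('a => complex) set" where
 "L2M M = {f. f : borel_measurable M & integrable M (%x. (norm (f x))\<^sup>2)}"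

lemma l2n_nonneg [simp]: "l2n M f >= 0"
 by (simp add: l2n_def)

lemma L2M_product:
 assumes "f : L2M M" "g : L2M M"
 shows "integrable M (%x. norm (f x) * norm (g x))"
  and "(LINT x|M. norm (f x) * norm (g x)) <= l2n M f * l2n M g"
proof -
 have [measurable]: "f : borel_measurable M" "g : borel_measurable M"
  and i: "integrable M (%x. (norm (f x))\<^sup>2)" "integrable M (%x. (norm (g x))\<^sup>2)" using assms by (auto simp: L2M_def)
 show int: "integrable M (%x. norm (f x) * norm (g x))"
 proof (rule Bochner_Integration.integrable_bound[OF Bochner_Integration.integrable_add[OF i]])
  show "AE x in M. norm (norm (f x) * norm (g x)) <= norm ((norm (f x))\<^sup>2 + (norm (g x))\<^sup>2)"
  proof (rule AE_I2)
   fix x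
   have "2 * (norm (f x) * norm (g x)) <= (norm (f x))\<^sup>2 + (norm (g x))\<^sup>2"
    using zero_le_power2[of "norm (f x) - norm (g x)"] by (simp add: power2_diff)
   moreover have "0 <= norm (f x) * norm (g x)" by simp
   ultimately show "norm (norm (f x) * norm (g x)) <= norm ((norm (f x))\<^sup>2 + (norm (g x))\<^sup>2)"
    by (simp only: real_norm_def abs_of_nonneg)
  qed
 qed measurable
 have "(ennreal (LINT x|M. norm (f x) * norm (g x)))\<^sup>2 <= ennreal (LINT x|M. (norm (f x))\<^sup>2) * ennreal (LINT x|M. (norm (g x))\<^sup>2)"
  using Cauchy_Schwarz_nn_integral[of "%x. ennreal (norm (f x))" M "%x. ennreal (norm (g x))"]
  by (simp add: nn_integral_eq_integral[symmetric] int i ennreal_mult ennreal_power)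
 then have "(LINT x|M. norm (f x) * norm (g x))\<^sup>2 <= (LINT x|M. (norm (f x))\<^sup>2) * (LINT x|M. (norm (g x))\<^sup>2)"
  by (simp add: ennreal_power ennreal_mult[symmetric] integral_nonneg_AE ennreal_le_iff)
 then show "(LINT x|M. norm (f x) * norm (g x)) <= l2n M f * l2n M g"
  unfolding l2n_def real_sqrt_mult[symmetric] by (rule real_le_rsqrt)
qed

lemma L2M_add:
 assumes "f : L2M M" "g : L2M M"
 shows "(%x. f x + g x) : L2M M"
  and "l2n M (%x. f x + g x) <= l2n M f + l2n M g"
proof -
 have [measurable]: "f : borel_measurable M" "g : borel_measurable M"
  and i: "integrable M (%x. (norm (f x))\<^sup>2)" "integrable M (%x. (norm (g x))\<^sup>2)" using assms by (auto simp: L2M_def)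
 note p = L2M_product[OF assms]
 have le: "(norm (f x + g x))\<^sup>2 <= (norm (f x))\<^sup>2 + 2 * (norm (f x) * norm (g x)) + (norm (g x))\<^sup>2" for x
  using power_mono[OF norm_triangle_ineq[of "f x" "g x"], of 2] by (simp add: power2_sum)
 have ib: "integrable M (%x. (norm (f x))\<^sup>2 + 2 * (norm (f x) * norm (g x)) + (norm (g x))\<^sup>2)"
  using i p by simp
 have int: "integrable M (%x. (norm (f x + g x))\<^sup>2)"
 proof (rule Bochner_Integration.integrable_bound[OF ib])
  show "AE x in M. norm ((norm (f x + g x))\<^sup>2) <= norm ((norm (f x))\<^sup>2 + 2 * (norm (f x) * norm (g x)) + (norm (g x))\<^sup>2)"
   using le by (intro AE_I2) (simp add: order_trans[OF _ abs_ge_self])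
 qed measurable
 then show "(%x. f x + g x) : L2M M" by (simp add: L2M_def)
 have "(LINT x|M. (norm (f x + g x))\<^sup>2) <= (LINT x|M. (norm (f x))\<^sup>2 + 2 * (norm (f x) * norm (g x)) + (norm (g x))\<^sup>2)"
  using int ib le by (intro integral_mono) auto
 also have "... = (LINT x|M. (norm (f x))\<^sup>2) + 2 * (LINT x|M. norm (f x) * norm (g x)) + (LINT x|M. (norm (g x))\<^sup>2)"
  using i p by simp
 also have "... <= (LINT x|M. (norm (f x))\<^sup>2) + 2 * (l2n M f * l2n M g) + (LINT x|M. (norm (g x))\<^sup>2)"
  using p by simp
 also have "... = (l2n M f + l2n M g)\<^sup>2"
  by (simp add: l2n_def power2_sum)
 finally show "l2n M (%x. f x + g x) <= l2n M f + l2n M g"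
  unfolding l2n_def[of M "%x. f x + g x"] by (simp add: real_le_lsqrt)
qed

lemma L2M_mult: "f : L2M M ==> (%x. c * f x) : L2M M"
 and l2n_mult: "l2n M (%x. c * f x) = norm c * l2n M f"
 by (auto simp: L2M_def l2n_def norm_mult power_mult_distrib real_sqrt_mult)

lemma L2M_minus: "f : L2M M ==> (%x. - f x) : L2M M"
 and l2n_minus: "l2n M (%x. - f x) = l2n M f"
 using L2M_mult[of f M "-1"] l2n_mult[of M "-1" f] by simp_all

lemma L2M_diff:
 assumes "f : L2M M" "g : L2M M"
 shows "(%x. f x - g x) : L2M M"
  and "l2n M (%x. f x - g x) <= l2n M f + l2n M g"
 using L2M_add[OF assms(1) L2M_minus[OF assms(2)]] by (simp_all add: l2n_minus)

lemma l2n_cong_AE: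
 assumes "AE x in M. f x = g x" "f : borel_measurable M" "g : borel_measurable M"
 shows "l2n M f = l2n M g"
 unfolding l2n_def using assms by (intro arg_cong[where f=sqrt] integral_cong_AE) auto

lemma L2M_L1:
 assumes "f : L2M M" "finite_measure M"
 shows "integrable M f" and "(LINT x|M. norm (f x)) <= sqrt (measure M (space M)) * l2n M f"
proof -
 interpret finite_measure M by fact
 have one: "(%x. 1) : L2M M" by (simp add: L2M_def)
 have "l2n M (%x. 1) = sqrt (measure M (space M))" by (simp add: l2n_def)
 then show "(LINT x|M. norm (f x)) <= sqrt (measure M (space M)) * l2n M f"
  using L2M_product(2)[OF one assms(1)] by simp
 have "integrable M (%x. norm (f x))" using L2M_product(1)[OF one assms(1)] by simp
 then show "integrable M f" using assms by (subst integrable_norm_cancel) (auto simp: L2M_def)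
qed

section \<open>Behaviour of \<open>P1_op\<close> at the origin\<close>

lemma Beta_infinite:
 assumes b: "b > 0" and nu: "\<nu> > 0"
 shows "has_bochner_integral lborel (%v. pk b v * (1 + v) powr (- (b + \<nu>))) (Beta \<nu> b)"
proof -
 define S :: "real set" where "S = {0<..<1}"
 define f :: "real => real" where "f v = v powr (b - 1) * (1 + v) powr (- (b + \<nu>))" for v
 define g :: "real => real" where "g w = 1 / w - 1" for w
 have im: "g ` S = {0<..}"
 proof (intro equalityI subsetI)
  fix v :: real assume "v : {0<..}"
  then have "v = g (1 / (1 + v))" "1 / (1 + v) : S" by (auto simp: g_def S_def)
  then show "v : g ` S" by blast
 qed (auto simp: g_def S_def)
 have inj: "inj_on g S" by (auto simp: inj_on_def g_def S_def)
 have Sl: "S : sets lebesgue" by (simp add: S_def)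
 have der: "(g has_field_derivative - 1 / w\<^sup>2) (at w within S)" if "w : S" for w
  unfolding g_def using that by (auto intro!: derivative_eq_intros simp: S_def power2_eq_square)
 have eq: "\<bar>- 1 / w\<^sup>2\<bar> *R f (g w) = w powr (\<nu> - 1) * (1 - w) powr (b - 1)" if "w : S" for w
 proof -
  have w: "0 < w" "w < 1" using that by (auto simp: S_def)
  have g: "g w = (1 - w) / w" "1 + g w = 1 / w" using w by (auto simp: g_def field_simps)
  have "\<bar>- 1 / w\<^sup>2\<bar> *R f (g w) = (1 - w) powr (b - 1) * (w powr (-2) * w powr (1 - b) * w powr (b + \<nu>))"
   unfolding f_def g using w by (simp add: powr_divide powr_minus field_simps powr_diff powr_add powr_numeral[symmetric] del: powr_numeral)
  also have "w powr (-2) * w powr (1 - b) * w powr (b + \<nu>) = w powr (\<nu> - 1)"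
   by (simp add: powr_add[symmetric])
  finally show ?thesis by simp
 qed
 have hi: "((%t. t powr (\<nu> - 1) * (1 - t) powr (b - 1)) has_integral Beta \<nu> b) S"
  unfolding S_def using has_integral_Beta_real[OF nu b] by (simp add: has_integral_Icc_iff_Ioo)
 then have "((%w. \<bar>- 1 / w\<^sup>2\<bar> *R f (g w)) has_integral Beta \<nu> b) S"
  by (rule has_integral_eq[rotated]) (rule eq[symmetric])
 moreover from this have "(%w. \<bar>- 1 / w\<^sup>2\<bar> *R f (g w)) absolutely_integrable_on S"
  by (intro nonnegative_absolutely_integrable_1) (auto simp: f_def has_integral_integrable)
 ultimately have "f absolutely_integrable_on {0<..} & integral {0<..} f = Beta \<nu> b"
  using has_absolute_integral_change_of_variables_real[OF Sl der inj, where f=f and b="Beta \<nu> b", unfolded im] by (auto simp: integral_unique)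
 then have "(f has_integral Beta \<nu> b) {0<..}"
  using set_lebesgue_integral_eq_integral(1) by (metis integrable_integral)
 then have "((%v. pk b v * (1 + v) powr (- (b + \<nu>))) has_integral Beta \<nu> b) {0<..}"
  by (rule has_integral_eq[rotated]) (simp add: f_def pk_def)
 then have "((%v. pk b v * (1 + v) powr (- (b + \<nu>))) has_integral Beta \<nu> b) UNIV"
  by (rule has_integral_on_superset) (auto simp: pk_def)
 then have "(\<integral>\<^sup>+v. ennreal (pk b v * (1 + v) powr (- (b + \<nu>))) \<partial>lborel) = ennreal (Beta \<nu> b)"
  by (rule nn_integral_has_integral_lborel[rotated 2]) auto
 then show ?thesis
  by (intro has_bochner_integral_nn_integral) (use b nu in "auto simp: Beta_def Gamma_real_pos less_imp_le")
qed

text \<open>The derivative of \<open>Hsq F\<close> with its singular power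
  \<open>x powr (- (m + 1/2))\<close> split off. For \<open>F\<close> in \<open>Cinf_comp\<close>
  the rest is bounded and has a limit at the origin, where the terms with \<open>j > 0\<close>
  vanish.\<close>

definition Hscal :: "(real => complex) => nat => real => complex" where
 "Hscal F m w = (\<Sum>j\<le>m. (hcoef m j * sqrt w ^ j) *R Dn j F (sqrt w))"

lemma Dn_Hsq_scal:
 assumes F: "F : Cpos" and x: "x > 0"
 shows "Dn m (Hsq F) x = x powr (- (real m + 1/2)) *R Hscal F m x"
proof -
 have "x powr ((real j - 2 * real m - 1) / 2) = x powr (- (real m + 1/2)) * sqrt x ^ j" for j
 proof -
  have "(real j - 2 * real m - 1) / 2 = - (real m + 1/2) + (1/2) * real j" by (simp add: field_simps)
  then have "x powr ((real j - 2 * real m - 1) / 2) = x powr (- (real m + 1/2)) * (x powr (1/2)) powr (real j)"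
   by (simp only: powr_add powr_powr)
  then show ?thesis using x by (simp add: powr_half_sqrt powr_realpow)
 qed
 then show ?thesis
  unfolding Dn_Hsq[OF F x] Hder_def Hscal_def by (simp add: scaleR_sum_right mult_ac)
qed

lemma Hscal_limit:
 assumes F: "F : Cinf_comp" and F0: "(F ---> F0) (at_right 0)"
 shows "(Hscal F m ---> hcoef m 0 *R F0) (at_right 0)"
proof -
 have "EX l. (Dn j F ---> l) (at_right 0)" for j
  using F unfolding Cinf_comp_def smooth_halfline_def by blast
 then obtain l where l: "!!j. (Dn j F ---> l j) (at_right 0)" by metis
 have l0: "l 0 = F0" using l[of 0] F0 tendsto_unique[of "at_right (0::real)"] by auto
 have s: "filterlim sqrt (at_right 0) (at_right 0)"
 proof -
  have "((%x. sqrt x) ---> sqrt 0) (at_right 0)" by (intro tendsto_intros)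
  then show ?thesis
   unfolding filterlim_at by (auto simp: eventually_at_filter)
 qed
 have "((%w. \<Sum>j\<le>m. (hcoef m j * sqrt w ^ j) *R Dn j F (sqrt w)) ---> (\<Sum>j\<le>m. (hcoef m j * sqrt 0 ^ j) *R l j)) (at_right 0)"
  by (intro tendsto_intros filterlim_compose[OF l s])
 also have "(\<Sum>j\<le>m. (hcoef m j * sqrt 0 ^ j) *R l j) = (\<Sum>j\<in>{0}. (hcoef m j * sqrt 0 ^ j) *R l j)"
  by (rule sum.mono_neutral_right) auto
 finally show ?thesis unfolding Hscal_def[abs_def] by (simp add: l0)
qed

lemma Hscal_bounded:
 assumes F: "F : Cinf_comp"
 shows "EX C>0. ALL w>0. norm (Hscal F m w) <= C"
proof -
 obtain b where b: "b > 0" "!!m y. y > b ==> Dn m F y = 0" using Cpos_zero[OF Cinf_comp_Cpos[OF F]] by blast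
 have "EX B. ALL t>0. norm (Dn j F t) <= B" for j using Cinf_comp_bcont[OF F, of j] unfolding bcont_def by blast
 then obtain B where B: "!!j t. t > 0 ==> norm (Dn j F t) <= B j" by metis
 have B0: "B j >= 0" for j using B[of 1 j] norm_ge_zero[of "Dn j F 1"] by linarith
 define C where "C = (\<Sum>j\<le>m. \<bar>hcoef m j\<bar> * b ^ j * B j)"
 have "norm (Hscal F m w) <= C" if w: "w > 0" for w
  unfolding Hscal_def C_def
 proof (rule sum_norm_le)
  fix j
  show "norm ((hcoef m j * sqrt w ^ j) *R Dn j F (sqrt w)) <= \<bar>hcoef m j\<bar> * b ^ j * B j"
  proof (cases "sqrt w <= b")
   case True
   have "sqrt w ^ j * norm (Dn j F (sqrt w)) <= b ^ j * B j"
    using True w b(1) by (intro mult_mono power_mono B) auto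
   then have "\<bar>hcoef m j\<bar> * (sqrt w ^ j * norm (Dn j F (sqrt w))) <= \<bar>hcoef m j\<bar> * (b ^ j * B j)"
    by (rule mult_left_mono) simp
   then show ?thesis using w by (simp add: abs_mult mult_ac)
  next
   case False
   then show ?thesis using b B0 by simp
  qed
 qed
 moreover have "C >= 0" unfolding C_def using b B0 by (intro sum_nonneg) auto
 ultimately show ?thesis by (intro exI[of _ "C + 1"]) force
qed

text \<open>The substitution \<open>u = x * v\<close> extracts the exact power
  \<open>x powr (- \<nu>)\<close> and leaves \<open>Hscal F N (x * (1 + v))\<close> against the
  integrable kernel of \<open>Beta_infinite\<close>, so dominated convergence gives the limit. The
  constant closes up because \<open>b + \<nu> = N + 1/2\<close>: the
  \<open>Gamma (b + \<nu>)\<close> in the Beta function cancels against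
  \<open>hcoef_0\<close>.\<close>

lemma I_op_Hsq_limit:
 assumes F: "F : Cinf_comp" and F0: "(F ---> F0) (at_right 0)" and nu: "\<nu> > 0"
 shows "((%x. x powr \<nu> *R I_op (1/2 - \<nu>) (Hsq F) x) ---> (Gamma \<nu> / sqrt pi) *R F0) (at_right 0)"
proof -
 note Fp = Cinf_comp_Cpos[OF F]
 define N where "N = mexp (1/2 - \<nu>)"
 define b where "b = real N - \<nu> + 1/2"
 have b: "b > 0" using mexp[of "1/2 - \<nu>"] by (simp add: b_def N_def)
 have G: "Gamma b > 0" "Gamma (b + \<nu>) > 0" using b nu by (auto intro: Gamma_real_pos)
 have bn: "b + \<nu> = real N + 1/2" by (simp add: b_def)
 obtain C where C: "C > 0" "!!w. w > 0 ==> norm (Hscal F N w) <= C" using Hscal_bounded[OF F] by blast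
 define q where "q v = pk b v * (1 + v) powr (- (b + \<nu>))" for v
 have q: "q v >= 0" for v by (simp add: q_def)
 have [measurable]: "q : borel_measurable borel" unfolding q_def by measurable
 define T where "T x = tail 0 (%v. Hscal F N (x * (1 + v)))" for x
 have cs: "continuous_on {0<..} (Hscal F N)"
  unfolding Hscal_def[abs_def] by (intro continuous_intros continuous_on_compose2[OF Cpos_continuous[OF Fp]]) auto
 have Tm: "T x : borel_measurable borel" if "x > 0" for x
  unfolding T_def using that by (intro tail_measurable continuous_on_compose2[OF cs]) (auto intro!: continuous_intros mult_pos_pos)
 have I: "x powr \<nu> *R I_op (1/2 - \<nu>) (Hsq F) x = ((-1) ^ N / Gamma b) *R (LINT v|lborel. q v *R T x v)" if x: "x > 0" for x
 proof -
  have "I_op (1/2 - \<nu>) (Hsq F) x = (-1) ^ N * weyl b (Dn N (Hsq F)) x"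
   unfolding I_op_weyl b_def N_def by (simp add: algebra_simps)
  also have "weyl b (Dn N (Hsq F)) x = (1 / Gamma b) *R (LINT u|lborel. pk b u *R tail x (Dn N (Hsq F)) (x + u))"
   by (rule weyl_tail(2)) simp
  also have "(LINT u|lborel. pk b u *R tail x (Dn N (Hsq F)) (x + u)) =
    x *R (LINT v|lborel. pk b (x * v) *R tail x (Dn N (Hsq F)) (x + x * v))"
   using x by (subst lborel_integral_real_affine[of x _ 0]) auto
  also have "(LINT v|lborel. pk b (x * v) *R tail x (Dn N (Hsq F)) (x + x * v)) =
    (LINT v|lborel. (x powr (- \<nu> - 1)) *R (q v *R T x v))"
  proof (rule Bochner_Integration.integral_cong[OF refl])
   fix v
   show "pk b (x * v) *R tail x (Dn N (Hsq F)) (x + x * v) = (x powr (- \<nu> - 1)) *R (q v *R T x v)"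
   proof (cases "v > 0")
    case True
    have xv: "x + x * v = x * (1 + v)" by (simp add: algebra_simps)
    have "x * (1 + v) > 0" using True x by simp
    then have "Dn N (Hsq F) (x + x * v) = (x * (1 + v)) powr (- (real N + 1/2)) *R Hscal F N (x * (1 + v))"
     unfolding xv by (rule Dn_Hsq_scal[OF Fp])
    moreover have "x powr (b - 1) * x powr (- (real N + 1/2)) = x powr (- \<nu> - 1)"
    proof -
     have "b - 1 + - (b + \<nu>) = - \<nu> - 1" by simp
     then show ?thesis unfolding bn[symmetric] by (simp only: powr_add[symmetric])
    qed
    ultimately show ?thesis
     using True x by (simp add: pk_def tail_def T_def q_def powr_mult bn mult_ac)
   qed (use x in "simp add: pk_def q_def zero_less_mult_iff")
  qed
  also have "... = (x powr (- \<nu> - 1)) *R (LINT v|lborel. q v *R T x v)"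
   by (rule integral_scaleR_right)
  finally have "x powr \<nu> *R I_op (1/2 - \<nu>) (Hsq F) x =
   (x powr \<nu> * x * x powr (- \<nu> - 1)) *R ((-1) ^ N * (1 / Gamma b) *R (LINT v|lborel. q v *R T x v))"
   by (simp add: mult_ac)
  also have "x powr \<nu> * x * x powr (- \<nu> - 1) = x powr (\<nu> + 1 + (- \<nu> - 1))"
   using x by (simp only: powr_add powr_one)
  also have "... = 1" using x by simp
  finally show ?thesis by (cases "even N") auto
 qed
 have lim: "((%x. LINT v|lborel. q v *R T x v) ---> (LINT v|lborel. q v *R (hcoef N 0 *R F0))) (at_right 0)"
  unfolding tendsto_at_iff_sequentially o_def
 proof (intro allI impI)
  fix X :: "nat => real" assume "ALL i. X i : {0<..} - {0}" and X0: "X ----> 0"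
  then have "X i > 0" for i by auto
  then have X: "X i > 0" "X i ~= 0" for i using less_imp_neq by metis+
  note [measurable] = Tm[OF X(1)]
  show "(%n. LINT v|lborel. q v *R T (X n) v) ----> (LINT v|lborel. q v *R (hcoef N 0 *R F0))"
  proof (rule integral_dominated_convergence)
   show "integrable lborel (%v. C * q v)"
    unfolding q_def using Beta_infinite[OF b nu] by (intro integrable_mult_right) (simp add: has_bochner_integral_iff)
   show "AE v in lborel. (%n. q v *R T (X n) v) ----> q v *R (hcoef N 0 *R F0)"
   proof (rule AE_I2)
    fix v
    show "(%n. q v *R T (X n) v) ----> q v *R (hcoef N 0 *R F0)"
    proof (cases "v > 0")
     case True
     have "(%n. X n * (1 + v)) ----> 0" using tendsto_mult[OF X0 tendsto_const[of "1 + v"]] by simp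
     then have "filterlim (%n. X n * (1 + v)) (at_right 0) sequentially"
      unfolding filterlim_at using X True by auto
     then have "(%n. Hscal F N (X n * (1 + v))) ----> hcoef N 0 *R F0"
      by (rule filterlim_compose[OF Hscal_limit[OF F F0]])
     then have "(%n. q v *R Hscal F N (X n * (1 + v))) ----> q v *R (hcoef N 0 *R F0)"
      by (rule tendsto_scaleR[OF tendsto_const])
     then show ?thesis using True by (simp add: T_def tail_def del: scaleR_scaleR)
    qed (simp add: q_def pk_def)
   qed
   show "AE v in lborel. norm (q v *R T (X n) v) <= C * q v" for n
   proof (rule AE_I2)
    fix v
    have "norm (T (X n) v) <= C" using C X(1)[of n] by (auto simp: T_def tail_def)
    then show "norm (q v *R T (X n) v) <= C * q v" using mult_left_mono[OF _ q[of v]] q[of v] by (simp add: mult.commute[of C])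
   qed
  qed measurable
 qed
 have val: "((-1) ^ N / Gamma b) *R (LINT v|lborel. q v *R (hcoef N 0 *R F0)) = (Gamma \<nu> / sqrt pi) *R F0"
 proof -
  have "(LINT v|lborel. q v *R (hcoef N 0 *R F0)) = Beta \<nu> b *R (hcoef N 0 *R F0)"
   unfolding q_def using Beta_infinite[OF b nu] by (simp add: has_bochner_integral_iff)
  also have "((-1) ^ N / Gamma b) *R \<dots> = (((-1) ^ N / Gamma b) * Beta \<nu> b * hcoef N 0) *R F0"
   by (simp add: mult.assoc)
  also have "((-1) ^ N / Gamma b) * Beta \<nu> b * hcoef N 0 = Gamma \<nu> / sqrt pi"
   using G by (cases "even N") (simp_all add: hcoef_0 bn[symmetric] Beta_def add.commute)
  finally show ?thesis .
 qed
 have "((%x. ((-1) ^ N / Gamma b) *R (LINT v|lborel. q v *R T x v)) ---> (Gamma \<nu> / sqrt pi) *R F0) (at_right 0)"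
  unfolding val[symmetric] by (intro tendsto_intros lim)
 then show ?thesis
  by (rule Lim_transform_eventually) (rule eventually_at_rightI[of 0 1], auto simp: I)
qed

lemma P1_limit_pos:
 assumes F: "F : Cinf_comp" and F0: "(F ---> F0) (at_right 0)" and nu: "\<nu> > 0"
 shows "((%y. y powr (2 * \<nu>) *R P1_op \<nu> F y) ---> (1 / (2 * \<nu>)) *R F0) (at_right 0)"
proof -
 define c where "c = sqrt pi / (2 * Gamma (\<nu> + 1))"
 have "\<nu> \<notin> \<int>\<^sub>\<le>\<^sub>0" using nu by (auto elim!: nonpos_Ints_cases)
 then have "Gamma (\<nu> + 1) = \<nu> * Gamma \<nu>" by (rule Gamma_plus1)
 moreover have "Gamma \<nu> > 0" using nu by (rule Gamma_real_pos)
 ultimately have c: "c * (Gamma \<nu> / sqrt pi) = 1 / (2 * \<nu>)" by (simp add: c_def)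
 have s: "filterlim (%y::real. y\<^sup>2) (at_right 0) (at_right 0)"
 proof -
  have "((%x::real. x\<^sup>2) ---> 0\<^sup>2) (at_right 0)" by (intro tendsto_intros)
  then show ?thesis
   unfolding filterlim_at by (auto simp: eventually_at_filter)
 qed
 have "((%y. c *R ((y\<^sup>2) powr \<nu> *R I_op (1/2 - \<nu>) (Hsq F) (y\<^sup>2))) ---> c *R ((Gamma \<nu> / sqrt pi) *R F0)) (at_right 0)"
  by (intro tendsto_intros filterlim_compose[OF I_op_Hsq_limit[OF F F0 nu] s])
 then have "((%y. c *R ((y\<^sup>2) powr \<nu> *R I_op (1/2 - \<nu>) (Hsq F) (y\<^sup>2))) ---> (1 / (2 * \<nu>)) *R F0) (at_right 0)"
  by (simp only: scaleR_scaleR c)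
 then show ?thesis
 proof (rule Lim_transform_eventually)
  show "\<forall>\<^sub>F y in at_right 0. c *R ((y\<^sup>2) powr \<nu> *R I_op (1/2 - \<nu>) (Hsq F) (y\<^sup>2)) = y powr (2 * \<nu>) *R P1_op \<nu> F y"
  proof (rule eventually_at_rightI[of 0 1])
   fix y :: real assume "y : {0<..<1}"
   then have y: "y > 0" by simp
   have "(y\<^sup>2) powr \<nu> = y powr (2 * \<nu>)" using y powr_powr[of y 2 \<nu>] by simp
   then show "c *R ((y\<^sup>2) powr \<nu> *R I_op (1/2 - \<nu>) (Hsq F) (y\<^sup>2)) = y powr (2 * \<nu>) *R P1_op \<nu> F y"
    unfolding P1_eq[OF Cinf_comp_Cpos[OF F] y] c_def by (simp add: scaleR_conv_of_real)
  qed simp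
 qed
qed

lemma mexp_pos: "\<mu> > 0 ==> mexp \<mu> = 0"
 unfolding mexp_def by (rule Least_equality) auto

lemma exp_half_integrable: "integrable lborel (%t::real. exp (t / 2) * indicator {..T} t)"
proof -
 have "((%x. exp (- (1/2) * x)) has_integral exp (- (1/2) * (- T)) / (1/2)) {- T..}"
  by (rule has_integral_exp_minus_to_infinity) simp
 then have "((%x. exp (- (1/2) * x) * indicator {-T..} x) has_integral exp (- (1/2) * (- T)) / (1/2)) {-T..}"
  by (rule has_integral_eq[rotated]) auto
 then have "((%x. exp (- (1/2) * x) * indicator {-T..} x) has_integral exp (- (1/2) * (- T)) / (1/2)) UNIV"
  by (rule has_integral_on_superset) auto
 then have "(\<integral>\<^sup>+x. ennreal (exp (- (1/2) * x) * indicator {-T..} x) \<partial>lborel) = ennreal (exp (- (1/2) * (- T)) / (1/2))"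
  by (rule nn_integral_has_integral_lborel[rotated 2]) auto
 then have "has_bochner_integral lborel (%x. exp (- (1/2) * x) * indicator {-T..} x) (exp (- (1/2) * (- T)) / (1/2))"
  by (intro has_bochner_integral_nn_integral) auto
 then have "integrable lborel (%x. exp (- (1/2) * (0 + (-1) * x)) * indicator {-T..} (0 + (-1) * x :: real))"
  by (intro lborel_integrable_real_affine) (auto simp: has_bochner_integral_iff)
 then show ?thesis by (simp add: indicator_def)
qed

text \<open>For \<open>\<nu> = 0\<close> the integral grows logarithmically at the origin. On the
  scale \<open>x = exp (- L)\<close>, \<open>u = exp (L * (t - 1))\<close> its mass is spread evenly
  over \<open>0 < t < 1\<close>, and the Jacobian contributes the factor \<open>L = - ln x\<close>.
  The first factor of \<open>g\<close> is \<open>sqrt (u / (x + u))\<close>.\<close>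

lemma weyl_half_exp:
 assumes F: "F : Cpos" and L: "L > 0"
 defines "g \<equiv> %t. (1 + exp (- L * t)) powr (-1/2) *R F (sqrt (exp (- L) + exp (L * (t - 1))))"
 shows "weyl (1/2) (Hsq F) (exp (- L)) = (L / sqrt pi) *R (LINT t|lborel. g t)" and "g : borel_measurable borel"
proof -
 define x where "x = exp (- L)"
 have x: "x > 0" by (simp add: x_def)
 note H = Hsq_Cpos[OF F]
 define f where "f u = pk (1/2) u *R tail x (Hsq F) (x + u)" for u
 have fi: "integrable lborel f" unfolding f_def
  by (rule weyl_integrable_shift[OF Cpos_bcont[OF H x, of 0, unfolded Dn_0]]) auto
 then have fl: "f absolutely_integrable_on {0<..}"
 proof -
  have "integrable lebesgue f" using fi by (subst integrable_completion) auto
  moreover have "(%u. indicator {0<..} u *R f u) = f" by (auto simp: f_def pk_def indicator_def)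
  ultimately show ?thesis by (simp add: set_integrable_def)
 qed
 have fint: "integral {0<..} f = (LINT u|lborel. f u)"
 proof -
  have "integral {0<..} f = (LINT u:{0<..}|lebesgue. f u)" using set_lebesgue_integral_eq_integral[OF fl] by simp
  also have "... = (LINT u|lebesgue. f u)" unfolding set_lebesgue_integral_def
   by (rule Bochner_Integration.integral_cong) (auto simp: f_def pk_def indicator_def)
  also have "... = (LINT u|lborel. f u)" using fi by (intro integral_completion) auto
  finally show ?thesis .
 qed
 define gg where "gg t = exp (L * (t - 1))" for t
 have im: "range gg = {0<..}"
 proof (intro equalityI subsetI)
  fix u :: real assume "u : {0<..}"
  then have "u = gg (1 + ln u / L)" using L by (simp add: gg_def)
  then show "u : range gg" by blast
 qed (auto simp: gg_def)
 have inj: "inj gg" using L by (auto simp: inj_def gg_def)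
 have der: "(gg has_field_derivative L * gg t) (at t within UNIV)" for t
  unfolding gg_def by (auto intro!: derivative_eq_intros)
 have eq: "\<bar>L * gg t\<bar> *R f (gg t) = L *R g t" for t
 proof -
  define u where "u = gg t"
  have u: "u > 0" by (simp add: u_def gg_def)
  have xu: "1 + exp (- L * t) = (x + u) / u" unfolding x_def u_def gg_def
   by (simp add: field_simps exp_diff exp_minus exp_add[symmetric] right_diff_distrib)
  have "(L * u * (u powr (-1/2))) * (1 / sqrt (x + u)) = L * ((x + u) / u) powr (-1/2)"
  proof -
   have "u * u powr (-1/2) = sqrt u" using u by (simp add: powr_minus powr_half_sqrt field_simps real_sqrt_mult_self)
   moreover have "((x + u) / u) powr (-1/2) = sqrt u / sqrt (x + u)"
    using u x by (simp add: powr_minus powr_half_sqrt real_sqrt_divide)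
   ultimately show ?thesis by simp
  qed
  moreover have "f u = (u powr (-1/2)) *R (1 / sqrt (x + u)) *R F (sqrt (x + u))"
   using u by (simp add: f_def pk_def tail_def Hsq_def field_simps)
  moreover have "g t = ((x + u) / u) powr (-1/2) *R F (sqrt (x + u))"
   unfolding g_def xu by (simp add: x_def u_def gg_def)
  ultimately show ?thesis using u L by (simp add: u_def[symmetric])
 qed
 have ne: "exp z ~= - 1" for z :: real using exp_gt_zero[of z] by linarith
 have "continuous_on UNIV g"
  unfolding g_def by (intro continuous_intros continuous_on_compose2[OF Cpos_continuous[OF F, of 0, unfolded Dn_0]])
   (auto simp: ne add_pos_pos add_eq_0_iff less_imp_neq intro: less_imp_neq[symmetric])
 then show gm: "g : borel_measurable borel" by (rule borel_measurable_continuous_onI)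
 have cov: "(%t. \<bar>L * gg t\<bar> *R f (gg t)) absolutely_integrable_on UNIV & integral UNIV (%t. \<bar>L * gg t\<bar> *R f (gg t)) = (LINT u|lborel. f u)"
  using has_absolute_integral_change_of_variables_real[of UNIV gg "%t. L * gg t" f "LINT u|lborel. f u", OF _ der inj, unfolded im] fl fint by auto
 then have i: "(%t. L *R g t) absolutely_integrable_on UNIV" and v: "integral UNIV (%t. L *R g t) = (LINT u|lborel. f u)"
  unfolding eq by auto
 have "(LINT u|lborel. f u) = (LINT t:UNIV|lebesgue. L *R g t)"
  unfolding v[symmetric] by (rule set_lebesgue_integral_eq_integral(2)[OF i, symmetric])
 also have "... = (LINT t|lborel. L *R g t)"
  unfolding set_lebesgue_integral_def using gm by (subst integral_completion) auto
 also have "... = L *R (LINT t|lborel. g t)" by simp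
 finally have "(LINT u|lborel. f u) = L *R (LINT t|lborel. g t)" .
 then show "weyl (1/2) (Hsq F) (exp (- L)) = (L / sqrt pi) *R (LINT t|lborel. g t)"
  unfolding x_def[symmetric] using weyl_tail(2)[of x x "1/2" "Hsq F"]
  by (simp add: f_def Gamma_one_half_real)
qed

lemma powr_le_exp_half:
 fixes L t :: real
 shows "(1 + exp (- L * t)) powr (-1/2) <= exp (L * t / 2)"
proof -
 have "(1 + exp (- L * t)) powr (-1/2) <= exp (- L * t) powr (-1/2)"
  by (rule powr_mono2') auto
 also have "... = exp (L * t / 2)" by (simp add: powr_def)
 finally show ?thesis .
qed

text \<open>As \<open>L\<close> tends to infinity, \<open>g L t\<close> tends to \<open>F0\<close>
  for \<open>0 < t < 1\<close>, and to \<open>0\<close> for \<open>t < 0\<close> by its first factor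
  and for \<open>t > 1\<close> by the support of \<open>F\<close>. With
  \<open>L = - 2 * ln y\<close> the prefactor is \<open>- ln y\<close>, whence the sign.\<close>

lemma P1_limit_zero:
 assumes F: "F : Cinf_comp" and F0: "(F ---> F0) (at_right 0)"
 shows "((%y. (1 / ln y) *R P1_op 0 F y) ---> - F0) (at_right 0)"
proof -
 note Fp = Cinf_comp_Cpos[OF F]
 define g where "g L t = (1 + exp (- L * t)) powr (-1/2) *R F (sqrt (exp (- L) + exp (L * (t - 1))))" for L t
 obtain b0 where b0: "!!y. y > b0 ==> F y = 0" using Fp by (auto simp: Cpos_def)
 define b where "b = max b0 1"
 have b: "b >= 1" "!!y. y > b ==> F y = 0" using b0 by (auto simp: b_def)
 obtain B where B: "!!t. t > 0 ==> norm (F t) <= B" using Cinf_comp_bcont[OF F, of 0] unfolding bcont_def by auto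
 have B0: "B >= 0" using B[of 1] norm_ge_zero[of "F 1"] by linarith
 \<comment> \<open>Chosen so that \<open>exp (T - 1) = b\<^sup>2\<close>: for \<open>L >= 1\<close>
   and \<open>t > T\<close> the argument of \<open>F\<close> exceeds \<open>b\<close>.\<close>
 define T where "T = 1 + 2 * ln b"
 have T: "T >= 1" using b by (simp add: T_def)
 have FT: "F (sqrt (exp (- L) + exp (L * (t - 1)))) = 0" if "L >= 1" "t > T" for L t
 proof (rule b(2))
  have "b\<^sup>2 = exp (T - 1)" using b(1) exp_of_nat_mult[of 2 "ln b"] by (simp add: T_def)
  also have "... < exp (t - 1)" using that by simp
  also have "... <= exp (L * (t - 1))" using that T mult_right_mono[of 1 L "t - 1"] by simp
  also have "... <= exp (- L) + exp (L * (t - 1))" by simp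
  finally show "b < sqrt (exp (- L) + exp (L * (t - 1)))" by (rule real_less_rsqrt)
 qed
 have sp: "sqrt (exp (- L) + exp (L * (t - 1))) > 0" for L t :: real by (simp add: add_pos_pos)
 have lim: "((%L. LINT t|lborel. (if L > 0 then g L t else 0)) ---> (LINT t|lborel. indicator {0..1::real} t *R F0)) at_top"
 proof (rule integral_dominated_convergence_at_top)
  show "(%t. if L > 0 then g L t else 0) : borel_measurable lborel" for L
   using weyl_half_exp(2)[OF Fp, of L] by (cases "L > 0") (auto simp: g_def)
  show "(%t. indicator {0..1::real} t *R F0) : borel_measurable lborel" by measurable
  show "integrable lborel (%t. B * (exp (t / 2) * indicator {..T} t))"
   by (intro integrable_mult_right exp_half_integrable)
  show "\<forall>\<^sub>F L in at_top. AE t in lborel. norm (if L > 0 then g L t else 0) <= B * (exp (t / 2) * indicator {..T} t)"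
   using eventually_ge_at_top[of "1::real"]
  proof eventually_elim
   case (elim L)
   show ?case
   proof (rule AE_I2)
    fix t
    show "norm (if L > 0 then g L t else 0) <= B * (exp (t / 2) * indicator {..T} t)"
    proof (cases "t > T")
     case True
     then show ?thesis using FT[OF elim True] by (simp add: g_def)
    next
     case False
     have "(1 + exp (- L * t)) powr (-1/2) <= exp (t / 2)"
     proof (cases "t >= 0")
      case True
      have "(1 + exp (- L * t)) powr (-1/2) <= 1 powr (-1/2)" by (rule powr_mono2') auto
      also have "... <= exp (t / 2)" using True by simp
      finally show ?thesis .
     next
      case False
      then have "L * t / 2 <= t / 2" using elim mult_right_mono_neg[of 1 L t] by simp
      then show ?thesis using powr_le_exp_half[of L t] by (meson exp_le_cancel_iff order_trans)
     qed
     then have "(1 + exp (- L * t)) powr (-1/2) * norm (F (sqrt (exp (- L) + exp (L * (t - 1))))) <= exp (t / 2) * B"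
      by (intro mult_mono B sp) auto
     then show ?thesis using False B0 by (simp add: g_def mult.commute)
    qed
   qed
  qed
  show "AE t in lborel. ((%L. if L > 0 then g L t else 0) ---> indicator {0..1::real} t *R F0) at_top"
   using AE_lborel_singleton[of 0] AE_lborel_singleton[of 1]
  proof eventually_elim
   case (elim t)
   have e: "\<forall>\<^sub>F L in at_top. g L t = (if L > 0 then g L t else 0)"
    using eventually_gt_at_top[of "0::real"] by eventually_elim simp
   have el: "((%L. exp (c * L)) ---> 0) at_top" if "c < 0" for c :: real
    using that by (intro filterlim_compose[OF exp_at_bot]) (auto intro!: filterlim_tendsto_neg_mult_at_bot[OF tendsto_const] filterlim_ident)
   have "((%L. g L t) ---> indicator {0..1::real} t *R F0) at_top"
   proof -
    consider "t < 0" | "0 < t" "t < 1" | "t > 1" using elim by linarith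
    then show ?thesis
    proof cases
     case 1
     have "((%L. exp ((t / 2) * L) * B) ---> 0 * B) at_top" using 1 by (intro tendsto_intros el) simp
     moreover have "norm (g L t) <= exp ((t / 2) * L) * B" for L
      unfolding g_def norm_scaleR using powr_le_exp_half[of L t]
      by (intro mult_mono) (auto intro!: B sp simp: mult.commute)
     ultimately have "((%L. g L t) ---> 0) at_top"
      by (intro Lim_null_comparison[OF always_eventually, of "%L. g L t"]) auto
     then show ?thesis using 1 by simp
    next
     case 2
     have "((%L. exp ((-1) * L) + exp ((t - 1) * L)) ---> 0 + 0) at_top"
      using 2 by (intro tendsto_add el) auto
     then have "((%L. sqrt (exp (- L) + exp (L * (t - 1)))) ---> sqrt 0) at_top"
      by (intro tendsto_intros) (simp add: mult.commute)
     then have "filterlim (%L. sqrt (exp (- L) + exp (L * (t - 1)))) (at_right 0) at_top"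
      unfolding filterlim_at using sp by (simp add: less_imp_neq[symmetric])
     then have a: "((%L. F (sqrt (exp (- L) + exp (L * (t - 1))))) ---> F0) at_top"
      by (rule filterlim_compose[OF F0])
     have "((%L. (1 + exp (- t * L)) powr (-1/2)) ---> (1 + 0) powr (-1/2)) at_top"
      using 2 by (intro tendsto_intros el) auto
     then have "((%L. g L t) ---> (1 + 0) powr (-1/2) *R F0) at_top"
      unfolding g_def using a by (intro tendsto_scaleR) (auto simp: mult.commute)
     then show ?thesis using 2 by simp
    next
     case 3
     have "\<forall>\<^sub>F L in at_top. 2 * ln b / (t - 1) < L" by (rule eventually_gt_at_top)
     then have "\<forall>\<^sub>F L in at_top. 0 = g L t"
     proof eventually_elim
      case (elim L)
      have "F (sqrt (exp (- L) + exp (L * (t - 1)))) = 0"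
      proof (rule b(2))
       have "2 * ln b < L * (t - 1)" using elim 3 by (simp add: field_simps)
       have "b\<^sup>2 = exp (2 * ln b)" using b(1) exp_of_nat_mult[of 2 "ln b"] by simp
       also have "... < exp (L * (t - 1))" using \<open>2 * ln b < _\<close> by simp
       also have "... <= exp (- L) + exp (L * (t - 1))" by simp
       finally show "b < sqrt (exp (- L) + exp (L * (t - 1)))" by (rule real_less_rsqrt)
      qed
      then show ?case by (simp add: g_def)
     qed
     then have "((%L. g L t) ---> 0) at_top" by (rule Lim_transform_eventually[OF tendsto_const])
     then show ?thesis using 3 by simp
    qed
   qed
   then show ?case by (rule Lim_transform_eventually[OF _ e])
  qed
 qed
 have lt: "filterlim (%y::real. - 2 * ln y) at_top (at_right 0)"
 proof -
  have "filterlim (%y::real. 2 * (- ln y)) at_top (at_right 0)"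
   by (rule filterlim_tendsto_pos_mult_at_top[OF tendsto_const _ iffD1[OF filterlim_uminus_at_bot ln_at_0]]) simp
  then show ?thesis by simp
 qed
 have "((%y. - (LINT t|lborel. (if - 2 * ln y > 0 then g (- 2 * ln y) t else 0))) ---> - (LINT t|lborel. indicator {0..1::real} t *R F0)) (at_right 0)"
  by (intro tendsto_minus filterlim_compose[OF lim lt])
 then have "((%y. - (LINT t|lborel. (if - 2 * ln y > 0 then g (- 2 * ln y) t else 0))) ---> - F0) (at_right 0)"
  by simp
 then show ?thesis
 proof (rule Lim_transform_eventually)
  show "\<forall>\<^sub>F y in at_right 0. - (LINT t|lborel. (if - 2 * ln y > 0 then g (- 2 * ln y) t else 0)) = (1 / ln y) *R P1_op 0 F y"
  proof (rule eventually_at_rightI[of 0 1])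
   fix y :: real assume "y : {0<..<1}"
   then have y: "y > 0" "y < 1" by auto
   define L where "L = - 2 * ln y"
   have L: "L > 0" using y by (simp add: L_def)
   have e: "exp (- L) = y\<^sup>2" unfolding L_def using y exp_of_nat_mult[of 2 "ln y"] by simp
   have "P1_op 0 F y = complex_of_real (sqrt pi / 2) * weyl (1/2) (Hsq F) (y\<^sup>2)"
    unfolding P1_eq[OF Fp y(1)] I_op_weyl by (simp add: mexp_pos)
   also have "... = complex_of_real (sqrt pi / 2) * ((L / sqrt pi) *R (LINT t|lborel. g L t))"
    using weyl_half_exp(1)[OF Fp L] unfolding e g_def by simp
   also have "... = (L / 2) *R (LINT t|lborel. g L t)" by (simp add: scaleR_conv_of_real)
   finally have "P1_op 0 F y = (- ln y) *R (LINT t|lborel. g L t)" by (simp add: L_def)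
   then show "- (LINT t|lborel. (if - 2 * ln y > 0 then g (- 2 * ln y) t else 0)) = (1 / ln y) *R P1_op 0 F y"
    unfolding L_def[symmetric] using L y by simp
  qed simp
 qed
qed

section \<open>Estimates by the norm of the highest derivative\<close>

definition segm :: "real => real measure" where
 "segm L = restrict_space lborel {0<..<L}"

lemma finite_segm: "L >= 0 ==> finite_measure (segm L)" "L >= 0 ==> measure (segm L) (space (segm L)) = L"
 by (auto simp: segm_def space_restrict_space measure_restrict_space emeasure_restrict_space intro!: finite_measureI)

lemma bcont_L2M:
 assumes k: "bcont 0 k" and L: "L >= 0"
 shows "k : L2M (segm L)"
proof -
 interpret finite_measure "segm L" using finite_segm L by auto
 obtain B where B: "!!t. t > 0 ==> norm (k t) <= B" and c: "continuous_on {0<..} k" using k unfolding bcont_def by blast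
 have "continuous_on {0<..<L} k" using c by (rule continuous_on_subset) auto
 then have "k : borel_measurable (restrict_space borel {0<..<L})" by (rule borel_measurable_continuous_on_restrict)
 moreover have "sets (segm L) = sets (restrict_space borel {0<..<L})"
  unfolding segm_def by (rule sets_restrict_space_cong) simp
 ultimately have [measurable]: "k : borel_measurable (segm L)"
  using measurable_cong_sets by blast
 have "integrable (segm L) (%x. (norm (k x))\<^sup>2)"
 proof (rule integrable_const_bound[of _ "B\<^sup>2"])
  show "AE x in segm L. norm ((norm (k x))\<^sup>2) <= B\<^sup>2"
   using B by (intro AE_I2) (auto simp: segm_def space_restrict_space intro!: power_mono)
 qed measurable
 then show ?thesis by (simp add: L2M_def)
qed

lemma Hnu_norm_eq:
 assumes f: "f : Cpos" and nu: "\<nu> >= 0" and g: "!!t. t > 0 ==> g t = P_op \<nu> f t"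
 shows "Hnu_norm s \<nu> L g = sqrt pi / (2 powr (\<nu> + 1/2) * Gamma (\<nu> + 1)) * l2n (segm L) (Dn s f)"
proof -
 have "Dn s (S_op \<nu> g) y = Dn s f y" if "y > 0" for y
  by (rule Dn_tower(1)[of "S_op \<nu> g" "%m. Dn m f"]) (use S_op_P_op[OF f nu _ g] Cpos_deriv[OF f] that in auto)
 then have "(LINT y:{0<..<L}|lborel. (norm (Dn s (S_op \<nu> g) y))\<^sup>2) = (LINT y:{0<..<L}|lborel. (norm (Dn s f y))\<^sup>2)"
  by (intro set_lebesgue_integral_cong) auto
 also have "... = (LINT y|segm L. (norm (Dn s f y))\<^sup>2)"
  unfolding segm_def set_lebesgue_integral_def by (subst integral_restrict_space) auto
 finally show ?thesis unfolding Hnu_norm_def l2n_def by simp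
qed

text \<open>Up to sign the derivative is the integral of the next one over \<open>(y, L)\<close>;
  Cauchy-Schwarz on an interval of length at most \<open>L\<close> gives
  \<open>sqrt L\<close>.\<close>

lemma Dn_sup_base:
 assumes f: "f : Cinf_comp" and L: "L > 0" "!!y. y > L ==> f y = 0" and y: "y > 0"
 shows "norm (Dn m f y) <= sqrt L * l2n (segm L) (Dn (Suc m) f)"
proof -
 define k where "k = Dn (Suc m) f"
 have bk: "bcont 0 k" unfolding k_def by (rule Cinf_comp_bcont[OF f])
 have kL: "k t = 0" if "t > L" for t unfolding k_def using Dn_zero_beyond[of L f] L(2) that by blast
 have kL': "t < L" if "k t ~= 0" "t ~= L" for t using kL[of t] that by (cases t L rule: linorder_cases) auto
 note l2 = bcont_L2M[OF bk less_imp_le[OF L(1)]]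
 have ki: "integrable lborel (%t. indicator {0<..<L} t *R k t)"
 proof -
  have "integrable (segm L) k" using L by (intro L2M_L1(1)[OF l2 finite_segm(1)]) auto
  then show ?thesis unfolding segm_def by (subst (asm) integrable_restrict_space) auto
 qed
 have "norm (Dn m f y) = norm (weyl 1 k y)"
  unfolding k_def by (simp add: weyl_1_Dn[OF Cinf_comp_Cpos[OF f] y])
 also have "... = norm (LINT t|lborel. indicator {y<..} t *R (indicator {0<..<L} t *R k t))"
 proof -
  have "weyl 1 k y = (LINT t|lborel. pk 1 (t - y) *R tail 0 k t)"
   using weyl_tail(1)[of 0 y 1 k] y by simp
  also have "... = (LINT t|lborel. indicator {y<..} t *R (indicator {0<..<L} t *R k t))"
  proof (rule integral_cong_AE)
   show "AE t in lborel. pk 1 (t - y) *R tail 0 k t = indicator {y<..} t *R (indicator {0<..<L} t *R k t)"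
    using AE_lborel_singleton[of L] by eventually_elim (use y kL kL' in "auto simp: pk_def tail_def indicator_def")
   show "(%t. pk 1 (t - y) *R tail 0 k t) : borel_measurable lborel"
    using borel_measurable_integrable[OF weyl_integrable[OF bk, of 1 y]] y by simp
   show "(%t. indicator {y<..} t *R (indicator {0<..<L} t *R k t)) : borel_measurable lborel"
    using borel_measurable_integrable[OF ki] by measurable
  qed
  finally show ?thesis by simp
 qed
 also have "... <= (LINT t|lborel. norm (indicator {0<..<L} t *R k t))"
 proof (rule order_trans[OF integral_norm_bound integral_mono])
  show "integrable lborel (%t. norm (indicator {y<..} t *R (indicator {0<..<L} t *R k t)))"
   by (rule integrable_norm, rule integrable_mult_indicator[OF _ ki]) simp
  show "integrable lborel (%t. norm (indicator {0<..<L} t *R k t))" using ki by (rule integrable_norm)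
 qed (auto simp: indicator_def)
 also have "... = (LINT t|segm L. norm (k t))"
  unfolding segm_def by (subst integral_restrict_space) auto
 also have "... <= sqrt L * l2n (segm L) k"
  using L2M_L1(2)[OF l2 finite_segm(1)] finite_segm(2)[of L] L by simp
 finally show ?thesis by (simp add: k_def)
qed

lemma Dn_sup_bound:
 assumes f: "f : Cinf_comp" and L: "L > 0" "!!y. y > L ==> f y = 0" and y: "y > 0"
 shows "norm (Dn m f y) <= L ^ j * (sqrt L * l2n (segm L) (Dn (Suc (m + j)) f))"
 using y
proof (induction j arbitrary: m y)
 case 0
 then show ?case using Dn_sup_base[OF f L] by simp
next
 case (Suc j)
 define B where "B = L ^ j * (sqrt L * l2n (segm L) (Dn (Suc (Suc m + j)) f))"
 have B: "norm (Dn (Suc m) f t) <= B" if "t > 0" for t unfolding B_def using Suc.IH[OF that] .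
 have B0: "B >= 0" unfolding B_def using L by simp
 have "norm (Dn m f y) <= B * L"
 proof (cases "y <= L")
  case True
  have "norm (Dn m f y) = norm (weyl 1 (Dn (Suc m) f) y)"
   by (simp add: weyl_1_Dn[OF Cinf_comp_Cpos[OF f] Suc.prems])
  also have "... <= B * (L - y) powr 1 / Gamma (1 + 1)"
   by (rule weyl_norm_le[OF Cinf_comp_bcont[OF f]]) (use True Suc.prems L B Dn_zero_beyond[of L f] in auto)
  also have "... = B * (L - y)" using True Gamma_fact[of 1, where 'a=real] by simp
  also have "... <= B * L" using B0 Suc.prems by (intro mult_left_mono) auto
  finally show ?thesis .
 next
  case False
  then show ?thesis using Dn_zero_beyond[of L f y m] L B0 by simp
 qed
 then show ?case by (simp add: B_def mult_ac)
qed

text \<open>The power of \<open>L\<close> is counted exactly: \<open>s - 1\<close> integrations,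
  \<open>1/2\<close> from Cauchy-Schwarz, and the order \<open>\<nu> - 1/2\<close>. Together with
  the Gamma factor this fixes the dependence on \<open>\<nu>\<close>, hence on
  \<open>k\<close>.\<close>

lemma I_op_bound:
 assumes f: "f : Cinf_comp" and L: "L > 0" "!!y. y > L ==> f y = 0" and nu: "\<nu> >= 1/2" and s: "s >= 1" and y: "y > 0"
 shows "norm (I_op (\<nu> - 1/2) f y) <= L powr (\<nu> + real s - 1) / Gamma (\<nu> + 1/2) * l2n (segm L) (Dn s f)"
proof -
 define N where "N = l2n (segm L) (Dn s f)"
 define B where "B = L ^ (s - 1) * (sqrt L * N)"
 have B: "norm (f t) <= B" if "t > 0" for t
  using Dn_sup_bound[OF f L that, of 0 "s - 1"] s by (simp add: B_def N_def)
 have B0: "B >= 0" unfolding B_def N_def using L by simp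
 have BL: "B * L powr (\<nu> - 1/2) = L powr (\<nu> + real s - 1) * N"
 proof -
  have "L ^ (s - 1) = L powr (real s - 1)" using L s by (simp add: powr_realpow[symmetric] of_nat_diff)
  then have "B * L powr (\<nu> - 1/2) = (L powr (real s - 1) * L powr (1/2) * L powr (\<nu> - 1/2)) * N"
   using L by (simp add: B_def powr_half_sqrt)
  also have "L powr (real s - 1) * L powr (1/2) * L powr (\<nu> - 1/2) = L powr (\<nu> + real s - 1)"
  proof -
   have "real s - 1 + 1/2 + (\<nu> - 1/2) = \<nu> + real s - 1" by simp
   then show ?thesis by (simp only: powr_add[symmetric])
  qed
  finally show ?thesis .
 qed
 have "norm (I_op (\<nu> - 1/2) f y) <= B * L powr (\<nu> - 1/2) / Gamma (\<nu> + 1/2)"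
 proof (cases "\<nu> = 1/2")
  case True
  \<comment> \<open>Order zero is realised as \<open>- weyl 1\<close> of one derivative, since
    \<open>mexp 0 = 1\<close>; it is the identity on the open half-line.\<close>
  have "I_op 0 (I_op (- 0) f) y = I_op 0 f y"
  proof -
   have m: "mexp 0 = 1" unfolding mexp_def
   proof (rule Least_equality)
    fix y :: nat assume "- real y < 0" then show "1 <= y" by (cases y) auto
   qed simp
   show ?thesis
    by (rule I_op_cong) (use y weyl_1_Dn[OF Cinf_comp_Cpos[OF f], of _ 0] in "simp add: I_op_weyl m")
  qed
  then have "I_op 0 f y = f y" using I_op_inverse[OF Cinf_comp_Cpos[OF f] y, of 0] by simp
  then show ?thesis using B[OF y] L unfolding True by simp
 next
  case False
  then have mu: "\<nu> - 1/2 > 0" using nu by simp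
  have G: "Gamma (\<nu> + 1/2) > 0" using nu by (intro Gamma_real_pos) auto
  have I: "I_op (\<nu> - 1/2) f y = weyl (\<nu> - 1/2) f y" using mu by (simp add: I_op_weyl mexp_pos)
  show ?thesis
  proof (cases "y <= L")
   case True
   have "norm (weyl (\<nu> - 1/2) f y) <= B * (L - y) powr (\<nu> - 1/2) / Gamma (\<nu> - 1/2 + 1)"
    by (rule weyl_norm_le[OF Cinf_comp_bcont[OF f, of 0, unfolded Dn_0]]) (use True y L B mu in auto)
   also have "... <= B * L powr (\<nu> - 1/2) / Gamma (\<nu> - 1/2 + 1)"
    using G B0 True y mu by (intro divide_right_mono mult_left_mono powr_mono2) auto
   also have "\<nu> - 1/2 + 1 = \<nu> + 1/2" by simp
   finally show ?thesis unfolding I .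
  next
   case False
   then show ?thesis unfolding I using L B0 G by (subst weyl_eq_0) auto
  qed
 qed
 then show ?thesis unfolding BL N_def by simp
qed

text \<open>\<open>Beta \<nu> (1/2)\<close> decreases in \<open>\<nu>\<close> and equals
  \<open>pi\<close> at \<open>\<nu> = 1/2\<close>. The bound keeps the trace constant free of Gamma
  factors that depend on \<open>k\<close>.\<close>

lemma Gamma_half_ratio:
 assumes "\<nu> >= (1/2::real)" shows "Gamma \<nu> <= sqrt pi * Gamma (\<nu> + 1/2)"
proof -
 have G: "Gamma (\<nu> + 1/2) > 0" using assms by (intro Gamma_real_pos) auto
 have "Beta \<nu> (1/2) <= Beta (1/2) (1/2)" by (rule Beta_real_mono) (use assms in auto)
 then have "Gamma \<nu> * sqrt pi / Gamma (\<nu> + 1/2) <= sqrt pi * sqrt pi"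
  by (simp add: Beta_def Gamma_one_half_real)
 then have "(Gamma \<nu> / Gamma (\<nu> + 1/2)) * sqrt pi <= sqrt pi * sqrt pi" by simp
 then have "Gamma \<nu> / Gamma (\<nu> + 1/2) <= sqrt pi"
  by (rule mult_right_le_imp_le) simp
 then show ?thesis using G by (simp add: field_simps)
qed

text \<open>The reciprocal of the growth of \<open>P_op \<nu> f\<close> at the origin; the logarithm
  replaces the power in the one case \<open>\<nu> = 0\<close>, that is, \<open>k = 0\<close> in
  dimension two.\<close>

definition tweight :: "real => real => real" where
 "tweight \<nu> y = (if \<nu> = 0 then 1 / ln y else y powr (2 * \<nu>))"

text \<open>The factors \<open>1 / (2 * \<nu>)\<close> from the limit,
  \<open>Gamma (\<nu> + 1) = \<nu> * Gamma \<nu>\<close> from the norm and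
  \<open>1 / Gamma (\<nu> + 1/2)\<close> from \<open>I_op_bound\<close> combine to the quotient of
  \<open>Gamma_half_ratio\<close>. Only powers of \<open>2\<close> and \<open>L\<close> survive,
  which is geometric growth in \<open>k\<close>.\<close>

lemma P_op_trace:
 assumes f: "f : Cinf_comp" and L: "L > 0" "!!y. y > L ==> f y = 0" and nu: "\<nu> >= 1/2" and s: "s >= 1"
  and g: "!!t. t > 0 ==> g t = P_op \<nu> f t"
 shows "EX \<psi>. ((%y. tweight \<nu> y *R g y) ---> \<psi>) (at_right 0) \<and>
  norm \<psi> <= (2 powr (\<nu> + 1/2) * L powr (\<nu> + real s - 1) / 2) * Hnu_norm s \<nu> L g"
proof -
 define F where "F = I_op (\<nu> - 1/2) f"
 have F: "F : Cinf_comp" unfolding F_def by (rule I_op_Cinf_comp[OF f])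
 then have "EX l. (Dn 0 F ---> l) (at_right 0)" unfolding Cinf_comp_def smooth_halfline_def by blast
 then obtain F0 where F0: "(F ---> F0) (at_right 0)" by auto
 define N where "N = l2n (segm L) (Dn s f)"
 have G: "Gamma (\<nu> + 1/2) > 0" "Gamma \<nu> > 0" using nu by (auto intro: Gamma_real_pos)
 have Fb: "norm F0 <= L powr (\<nu> + real s - 1) / Gamma (\<nu> + 1/2) * N"
 proof (rule tendsto_upperbound[OF tendsto_norm[OF F0]])
  show "\<forall>\<^sub>F y in at_right 0. norm (F y) <= L powr (\<nu> + real s - 1) / Gamma (\<nu> + 1/2) * N"
   by (rule eventually_at_rightI[of 0 1]) (use I_op_bound[OF f L nu s] in "auto simp: F_def N_def")
 qed simp
 have lim: "((%y. tweight \<nu> y *R g y) ---> (1 / (2 * \<nu>)) *R F0) (at_right 0)"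
  using P1_limit_pos[OF F F0, of \<nu>] nu
  by (rule_tac Lim_transform_eventually[of "%y. y powr (2 * \<nu>) *R P1_op \<nu> F y"]) (auto intro!: eventually_at_rightI[of 0 1] simp: tweight_def g P_op_def F_def)
 have nn: "\<nu> \<notin> \<int>\<^sub>\<le>\<^sub>0" using nu by (auto elim!: nonpos_Ints_cases)
 have "norm ((1 / (2 * \<nu>)) *R F0) <= (1 / (2 * \<nu>)) * (L powr (\<nu> + real s - 1) / Gamma (\<nu> + 1/2) * N)"
  using mult_left_mono[OF Fb, of "1 / (2 * \<nu>)"] nu by simp
 also have "N = Hnu_norm s \<nu> L g * (2 powr (\<nu> + 1/2) * (\<nu> * Gamma \<nu>)) / sqrt pi"
 proof -
  have "\<nu> >= 0" using nu by simp
  define D where "D = 2 powr (\<nu> + 1/2) * Gamma (\<nu> + 1)"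
  have "Gamma (\<nu> + 1) > 0" using nu by (intro Gamma_real_pos) auto
  then have "D ~= 0" by (simp add: D_def)
  moreover have "Hnu_norm s \<nu> L g = sqrt pi / D * N"
   unfolding D_def N_def by (rule Hnu_norm_eq[OF Cinf_comp_Cpos[OF f] \<open>\<nu> >= 0\<close> g])
  ultimately have "N = Hnu_norm s \<nu> L g * D / sqrt pi" by simp
  then show ?thesis unfolding D_def Gamma_plus1[OF nn] .
 qed
 also have "(1 / (2 * \<nu>)) * (L powr (\<nu> + real s - 1) / Gamma (\<nu> + 1/2) * (Hnu_norm s \<nu> L g * (2 powr (\<nu> + 1/2) * (\<nu> * Gamma \<nu>)) / sqrt pi)) =
   (2 powr (\<nu> + 1/2) * L powr (\<nu> + real s - 1) / 2) * Hnu_norm s \<nu> L g * (Gamma \<nu> / (sqrt pi * Gamma (\<nu> + 1/2)))"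
  using nu G by (simp add: field_simps)
 also have "... <= (2 powr (\<nu> + 1/2) * L powr (\<nu> + real s - 1) / 2) * Hnu_norm s \<nu> L g * 1"
 proof (rule mult_left_mono)
  show "Gamma \<nu> / (sqrt pi * Gamma (\<nu> + 1/2)) <= 1" using Gamma_half_ratio[OF nu] G by simp
  have "Hnu_norm s \<nu> L g >= 0" unfolding Hnu_norm_def using nu
   by (intro mult_nonneg_nonneg divide_nonneg_nonneg) (auto intro!: Gamma_real_pos less_imp_le integral_nonneg_AE simp: set_lebesgue_integral_def)
  then show "0 <= (2 powr (\<nu> + 1/2) * L powr (\<nu> + real s - 1) / 2) * Hnu_norm s \<nu> L g" by simp
 qed
 finally show ?thesis using lim by auto
qed

text \<open>Up to sign, order \<open>-1/2\<close> is the Weyl integral of order \<open>1/2\<close>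
  of the first derivative, so \<open>Dn 1 f\<close> has to be bounded; this takes
  \<open>s >= 2\<close>.\<close>

lemma I_op_bound_0:
 assumes f: "f : Cinf_comp" and L: "L > 0" "!!y. y > L ==> f y = 0" and s: "s >= 2" and y: "y > 0"
 shows "norm (I_op (- 1/2) f y) <= L ^ (s - 2) * L / Gamma (3/2) * l2n (segm L) (Dn s f)"
proof -
 define N where "N = l2n (segm L) (Dn s f)"
 define B where "B = L ^ (s - 2) * (sqrt L * N)"
 have B: "norm (Dn 1 f t) <= B" if "t > 0" for t
  using Dn_sup_bound[OF f L that, of 1 "s - 2"] s by (simp add: B_def N_def numeral_2_eq_2 Suc_diff_Suc)
 have B0: "B >= 0" unfolding B_def N_def using L by simp
 have G: "Gamma (3/2::real) > 0" by (intro Gamma_real_pos) simp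
 have m: "mexp (-1/2) = 1" unfolding mexp_def
 proof (rule Least_equality)
  fix y :: nat assume "- real y < - 1/2" then show "1 <= y" by (cases y) auto
 qed simp
 have "norm (I_op (- 1/2) f y) <= B * sqrt L / Gamma (3/2)"
 proof (cases "y <= L")
  case True
  have "norm (I_op (- 1/2) f y) = norm (weyl (1/2) (Dn 1 f) y)" unfolding I_op_weyl m by simp
  also have "... <= B * (L - y) powr (1/2) / Gamma (1/2 + 1)"
   by (rule weyl_norm_le[OF Cinf_comp_bcont[OF f]]) (use True y L B Dn_zero_beyond[of L f] in auto)
  also have "... <= B * L powr (1/2) / Gamma (1/2 + 1)"
   using G B0 True y by (intro divide_right_mono mult_left_mono powr_mono2) auto
  finally show ?thesis using L by (simp add: powr_half_sqrt)
 next
  case False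
  then have "weyl (1/2) (Dn 1 f) y = 0" using Dn_zero_beyond[of L f] L by (intro weyl_eq_0) auto
  then have "I_op (- 1/2) f y = 0" unfolding I_op_weyl m by simp
  then show ?thesis using B0 L G by simp
 qed
 also have "B * sqrt L / Gamma (3/2) = L ^ (s - 2) * (sqrt L * sqrt L) * N / Gamma (3/2)" by (simp add: B_def mult_ac)
 also have "... = L ^ (s - 2) * L / Gamma (3/2) * N" using L by simp
 finally show ?thesis unfolding N_def .
qed

lemma P_op_trace_0:
 assumes f: "f : Cinf_comp" and L: "L > 0" "!!y. y > L ==> f y = 0" and s: "s >= 2"
  and g: "!!t. t > 0 ==> g t = P_op 0 f t"
 shows "EX \<psi>. ((%y. tweight 0 y *R g y) ---> \<psi>) (at_right 0) \<and>
  norm \<psi> <= (L ^ (s - 2) * L * sqrt 2 / (Gamma (3/2) * sqrt pi)) * Hnu_norm s 0 L g"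
proof -
 define F where "F = I_op (- 1/2) f"
 have F: "F : Cinf_comp" unfolding F_def by (rule I_op_Cinf_comp[OF f])
 then have "EX l. (Dn 0 F ---> l) (at_right 0)" unfolding Cinf_comp_def smooth_halfline_def by blast
 then obtain F0 where F0: "(F ---> F0) (at_right 0)" by auto
 have Fb: "norm F0 <= L ^ (s - 2) * L / Gamma (3/2) * l2n (segm L) (Dn s f)"
 proof (rule tendsto_upperbound[OF tendsto_norm[OF F0]])
  show "\<forall>\<^sub>F y in at_right 0. norm (F y) <= L ^ (s - 2) * L / Gamma (3/2) * l2n (segm L) (Dn s f)"
   by (rule eventually_at_rightI[of 0 1]) (use I_op_bound_0[OF f L s] in "auto simp: F_def")
 qed simp
 have lim: "((%y. tweight 0 y *R g y) ---> - F0) (at_right 0)"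
  using P1_limit_zero[OF F F0]
  by (rule Lim_transform_eventually) (auto intro!: eventually_at_rightI[of 0 1] simp: tweight_def g P_op_def F_def)
 have H: "Hnu_norm s 0 L g = sqrt pi / sqrt 2 * l2n (segm L) (Dn s f)"
  using Hnu_norm_eq[OF Cinf_comp_Cpos[OF f], of 0 g s L] g by (simp add: powr_half_sqrt)
 have "L ^ (s - 2) * L / Gamma (3/2) * l2n (segm L) (Dn s f) = (L ^ (s - 2) * L * sqrt 2 / (Gamma (3/2) * sqrt pi)) * Hnu_norm s 0 L g"
  unfolding H by simp
 then show ?thesis using lim Fb by (intro exI[of _ "- F0"]) simp
qed

section \<open>Linearity of the transmutation operators\<close>

lemma Cpos_lin: "f : Cpos ==> h : Cpos ==> (%t. f t + c * h t) : Cpos"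
 and Dn_lin: "f : Cpos ==> h : Cpos ==> y > 0 ==> Dn m (%t. f t + c * h t) y = Dn m f y + c * Dn m h y"
proof -
 assume f: "f : Cpos" and h: "h : Cpos"
 define hs where "hs m t = Dn m f t + c * Dn m h t" for m t
 have 2: "(hs m has_vector_derivative hs (Suc m) y) (at y)" if "y > 0" for m y
  unfolding hs_def by (intro has_vector_derivative_add has_vector_derivative_mult_right Cpos_deriv f h that)
 obtain b b' where b: "!!y. y > b ==> f y = 0" "!!y. y > b' ==> h y = 0" using f h by (auto simp: Cpos_def)
 show "(%t. f t + c * h t) : Cpos"
  by (rule Cpos_tower[of _ hs "max b b'"]) (use 2 b in "auto simp: hs_def")
 show "y > 0 ==> Dn m (%t. f t + c * h t) y = Dn m f y + c * Dn m h y"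
  using Dn_tower(1)[of "%t. f t + c * h t" hs y m] 2 by (simp add: hs_def)
qed

lemma Cinf_comp_lin:
 assumes f: "f : Cinf_comp" and h: "h : Cinf_comp"
 shows "(%t. f t + c * h t) : Cinf_comp"
proof (rule Cinf_compI)
 note fp = Cinf_comp_Cpos[OF f] note hp = Cinf_comp_Cpos[OF h]
 show "(%t. f t + c * h t) : Cpos" by (rule Cpos_lin[OF fp hp])
 fix m
 obtain l l' where "(Dn m f ---> l) (at_right 0)" "(Dn m h ---> l') (at_right 0)"
  using f h unfolding Cinf_comp_def smooth_halfline_def by blast
 then have "((%y. Dn m f y + c * Dn m h y) ---> l + c * l') (at_right 0)" by (intro tendsto_intros)
 then have "(Dn m (%t. f t + c * h t) ---> l + c * l') (at_right 0)"
  by (rule Lim_transform_eventually) (auto intro!: eventually_at_rightI[of 0 1] simp: Dn_lin[OF fp hp])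
 then show "EX l. (Dn m (%t. f t + c * h t) ---> l) (at_right 0)" by blast
qed

lemma weyl_lin:
 assumes "bcont c k" "bcont c k'" "a > 0" "y >= c"
 shows "weyl a (%t. k t + z * k' t) y = weyl a k y + z * weyl a k' y"
 using weyl_add[OF assms(1) bcont_mult_const[OF assms(2)] assms(3,4), of z] by (simp add: weyl_mult_const)

lemma I_op_lin:
 assumes f: "f : Cpos" and h: "h : Cpos" and y: "y > 0"
 shows "I_op \<mu> (%t. f t + c * h t) y = I_op \<mu> f y + c * I_op \<mu> h y"
proof -
 have "weyl (\<mu> + real (mexp \<mu>)) (Dn (mexp \<mu>) (%t. f t + c * h t)) y =
   weyl (\<mu> + real (mexp \<mu>)) (%t. Dn (mexp \<mu>) f t + c * Dn (mexp \<mu>) h t) y"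
  by (rule weyl_cong) (use y in "simp add: Dn_lin[OF f h]")
 also have "... = weyl (\<mu> + real (mexp \<mu>)) (Dn (mexp \<mu>) f) y + c * weyl (\<mu> + real (mexp \<mu>)) (Dn (mexp \<mu>) h) y"
  by (rule weyl_lin[OF Cpos_bcont[OF f y] Cpos_bcont[OF h y] mexp]) simp
 finally show ?thesis unfolding I_op_weyl by (simp add: algebra_simps)
qed

lemma P_op_lin:
 assumes f: "f : Cpos" and h: "h : Cpos" and y: "y > 0"
 shows "P_op \<nu> (%t. f t + c * h t) y = P_op \<nu> f y + c * P_op \<nu> h y"
proof -
 let ?I = "I_op (\<nu> - 1/2)"
 note If = I_op_Cpos[OF f, of "\<nu> - 1/2"] note Ih = I_op_Cpos[OF h, of "\<nu> - 1/2"]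
 have y2: "y\<^sup>2 > 0" using y by simp
 have "I_op (1/2 - \<nu>) (Hsq (?I (%t. f t + c * h t))) (y\<^sup>2) = I_op (1/2 - \<nu>) (%x. Hsq (?I f) x + c * Hsq (?I h) x) (y\<^sup>2)"
 proof (rule I_op_cong)
  fix t assume "t > y\<^sup>2"
  then have "t > 0" using y2 by (rule less_trans[rotated])
  then have "sqrt t > 0" by simp
  then show "Hsq (?I (%t. f t + c * h t)) t = Hsq (?I f) t + c * Hsq (?I h) t"
   unfolding Hsq_def by (simp add: I_op_lin[OF f h] scaleR_add_right)
 qed
 also have "... = I_op (1/2 - \<nu>) (Hsq (?I f)) (y\<^sup>2) + c * I_op (1/2 - \<nu>) (Hsq (?I h)) (y\<^sup>2)"
  by (rule I_op_lin[OF Hsq_Cpos[OF If] Hsq_Cpos[OF Ih] y2])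
 finally show ?thesis
  unfolding P_op_def P1_eq[OF If y] P1_eq[OF Ih y] P1_eq[OF I_op_Cpos[OF Cpos_lin[OF f h]] y]
  by (simp add: algebra_simps)
qed

section \<open>Uniformly Cauchy sequences\<close>

definition ucauchy :: "real => (nat => real => complex) => bool" where
 "ucauchy c h \<longleftrightarrow> (ALL e>0. EX J. ALL i>=J. ALL j>=J. ALL y>c. norm (h i y - h j y) <= e)"

text \<open>Uniform convergence of the derivatives makes their limit the derivative of the limit
  function, which is zero.\<close>

lemma deriv_tendsto_zero:
 assumes h: "!!y. y > c ==> (%j. h j y) ----> 0"
  and d: "!!j y. y > c ==> (h j has_vector_derivative h' j y) (at y)"
  and u: "ucauchy c h'" and y: "y > c"
 shows "(%j. h' j y) ----> 0"
proof -
 have "Cauchy (%j. h' j z)" if "z > c" for z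
 proof (rule metric_CauchyI)
  fix e :: real assume e: "e > 0"
  then obtain J where "ALL i>=J. ALL j>=J. ALL y>c. norm (h' i y - h' j y) <= e / 2"
   using u unfolding ucauchy_def by (meson half_gt_zero)
  then have "norm (h' i z - h' j z) <= e / 2" if "i >= J" "j >= J" for i j using that \<open>z > c\<close> by blast
  then have "ALL i>=J. ALL j>=J. dist (h' i z) (h' j z) < e"
   using e unfolding dist_norm by (auto intro: le_less_trans[of _ "e / 2"])
  then show "EX M. ALL m>=M. ALL n>=M. dist (h' m z) (h' n z) < e" by blast
 qed
 then have "EX w. (%j. h' j z) ----> w" if "z > c" for z
  using that by (simp add: Cauchy_convergent_iff convergent_def)
 then obtain w where w: "!!z. z > c ==> (%j. h' j z) ----> w z" by metis
 have "EX g. ALL x:{c<..}. (%n. h n x) ----> g x & (g has_derivative (%t. t *R w x)) (at x within {c<..})"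
 proof (rule has_derivative_sequence)
  show "convex {c<..}" by simp
  show "(h n has_derivative (%t. t *R h' n x)) (at x within {c<..})" if "x : {c<..}" for n x
   using d[of x n] that unfolding has_vector_derivative_def by (auto intro: has_derivative_at_withinI)
  show "\<forall>\<^sub>F n in sequentially. ALL x:{c<..}. ALL t. norm (t *R h' n x - t *R w x) <= e * norm t" if e: "e > 0" for e
  proof -
   obtain J where J: "!!i j z. i >= J ==> j >= J ==> z > c ==> norm (h' i z - h' j z) <= e"
    using u e unfolding ucauchy_def by blast
   have "norm (h' i z - w z) <= e" if "i >= J" "z > c" for i z
   proof (rule tendsto_upperbound)
    show "(%j. norm (h' i z - h' j z)) ----> norm (h' i z - w z)" using that by (intro tendsto_intros w)
    show "\<forall>\<^sub>F j in sequentially. norm (h' i z - h' j z) <= e"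
     using eventually_ge_at_top[of J] by eventually_elim (use that J in auto)
   qed simp
   then show ?thesis
    unfolding scaleR_diff_right[symmetric] norm_scaleR
    by (auto intro!: eventually_sequentiallyI[of J] simp: mult.commute[of e] intro!: mult_left_mono)
  qed
  show "y : {c<..}" using y by simp
  show "(%n. h n y) ----> 0" using h y by simp
 qed
 then obtain g where g: "!!x. x > c ==> (%n. h n x) ----> g x"
  "!!x. x > c ==> (g has_derivative (%t. t *R w x)) (at x within {c<..})" by auto
 have "g x = 0" if "x > c" for x using LIMSEQ_unique[OF g(1) h] that by blast
 then have "((%_. 0) has_derivative (%t. t *R w y)) (at y within {c<..})"
  by (intro has_derivative_transform[OF _ _ g(2)[OF y]]) (use y in auto)
 then have "((%_. 0) has_derivative (%t. t *R w y)) (at y)"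
  using y by (subst (asm) at_within_open) auto
 then have "(%t. t *R w y) = (%_. 0)"
  by (rule has_derivative_unique) simp
 then have "w y = 0" by (metis scaleR_one)
 then show ?thesis using w[OF y] by simp
qed

lemma ucauchy_bound:
 assumes "!!e. e > 0 ==> EX J. ALL i>=J. ALL j>=J. N i j < e"
  and "!!i j y. y > c ==> norm (h i y - h j y) <= C * N i j" and "!!i j. N i j >= (0::real)"
 shows "ucauchy c h"
 unfolding ucauchy_def
proof (intro allI impI)
 fix e :: real assume e: "e > 0"
 define C' where "C' = \<bar>C\<bar> + 1"
 have C': "C' > 0" "C <= C'" by (auto simp: C'_def)
 obtain J where J: "!!i j. i >= J ==> j >= J ==> N i j < e / C'" using assms(1)[of "e / C'"] e C' by auto
 have "norm (h i y - h j y) <= e" if "i >= J" "j >= J" "y > c" for i j y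
 proof -
  have "norm (h i y - h j y) <= C * N i j" using assms(2) that by blast
  also have "... <= C' * N i j" using C' assms(3) by (intro mult_right_mono) auto
  also have "... <= C' * (e / C')" using C' J[of i j] that by (intro mult_left_mono) auto
  finally show ?thesis using C' by simp
 qed
 then show "EX J. ALL i>=J. ALL j>=J. ALL y>c. norm (h i y - h j y) <= e" by blast
qed

lemma ucauchy_zero_uniform:
 assumes u: "ucauchy c h" and h: "!!y. y > c ==> (%j. h j y) ----> 0" and e: "e > 0"
 shows "EX J. ALL i>=J. ALL y>c. norm (h i y) <= e"
proof -
 obtain J where J: "!!i j z. i >= J ==> j >= J ==> z > c ==> norm (h i z - h j z) <= e"
  using u e unfolding ucauchy_def by blast
 have "norm (h i z - 0) <= e" if "i >= J" "z > c" for i z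
 proof (rule tendsto_upperbound)
  show "(%j. norm (h i z - h j z)) ----> norm (h i z - 0)" using that by (intro tendsto_intros h)
  show "\<forall>\<^sub>F j in sequentially. norm (h i z - h j z) <= e"
   using eventually_ge_at_top[of J] by eventually_elim (use that J in auto)
 qed simp
 then show ?thesis by auto
qed

lemma weyl_1_FTC:
 assumes d: "!!y. y > 0 ==> (h has_vector_derivative h' y) (at y)" and h': "bcont 0 h'"
  and z: "!!y. y > b ==> h y = 0" "!!y. y > b ==> h' y = 0" and y: "y > 0"
 shows "weyl 1 h' y = - h y"
proof -
 define b' where "b' = max b y + 1"
 have b: "b' > y" "h b' = 0" "!!t. t > b' ==> h' t = 0" using z by (auto simp: b'_def)
 have "weyl 1 h' y = integral {y..b'} h'"
  using y b by (intro weyl_1[OF h']) auto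
 also have "... = h b' - h y"
  using y b by (intro integral_unique fundamental_theorem_of_calculus has_vector_derivative_at_within[OF d]) auto
 finally show ?thesis using b by simp
qed

section \<open>Closability of the radial norms\<close>

lemma bcont_integrable:
 assumes "bcont c k" shows "integrable lborel (tail c k)"
proof -
 have "(%t. pk 1 (t - c) *R tail c k t) = tail c k" by (auto simp: pk_def tail_def)
 then show ?thesis using weyl_integrable[OF assms, of 1 c] by simp
qed

lemma ucauchy_weyl:
 assumes k: "!!j. bcont c (k j)" and u: "ucauchy c k" and z: "!!j t. t > b ==> k j t = 0" and a: "a > 0"
 shows "ucauchy c (%j. weyl a (k j))"
 unfolding ucauchy_def
proof (intro allI impI)
 fix e :: real assume e: "e > 0"
 define D where "D = (\<bar>b - c\<bar> + 1) powr a / Gamma (a + 1)"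
 have G: "Gamma (a + 1) > 0" using a by (intro Gamma_real_pos) auto
 then have D: "D > 0" by (simp add: D_def)
 obtain J where J: "!!i j z. i >= J ==> j >= J ==> z > c ==> norm (k i z - k j z) <= e / D"
  using u e D unfolding ucauchy_def by (meson divide_pos_pos)
 have "norm (weyl a (k i) y - weyl a (k j) y) <= e" if ij: "i >= J" "j >= J" "y > c" for i j y
 proof -
  have b: "bcont c (%t. k i t + (-1) * k j t)" by (intro bcont_add bcont_mult_const k)
  have eq: "weyl a (k i) y - weyl a (k j) y = weyl a (%t. k i t + (-1) * k j t) y"
   using weyl_lin[OF k k a, of y i "-1" j] ij by simp
  show ?thesis
  proof (cases "y <= b")
   case True
   have "norm (weyl a (%t. k i t + (-1) * k j t) y) <= e / D * (b - y) powr a / Gamma (a + 1)"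
    by (rule weyl_norm_le[OF b a]) (use ij True z J in auto)
   also have "... <= e / D * (\<bar>b - c\<bar> + 1) powr a / Gamma (a + 1)"
    using G D e True ij a by (intro divide_right_mono mult_left_mono powr_mono2) auto
   also have "... = e / D * D" by (simp add: D_def)
   finally show ?thesis unfolding eq using D by simp
  next
   case False
   then show ?thesis using e z by (simp add: weyl_eq_0)
  qed
 qed
 then show "EX J. ALL i>=J. ALL j>=J. ALL y>c. norm (weyl a (k i) y - weyl a (k j) y) <= e" by blast
qed

lemma weyl_tendsto_zero:
 assumes k: "!!j. bcont c (k j)" and u: "ucauchy c k" and z: "!!j t. t > b ==> k j t = 0" and a: "a > 0"
  and lim: "!!y. y > c ==> (%j. k j y) ----> 0" and y: "y > c"
 shows "(%j. weyl a (k j) y) ----> 0"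
proof (rule LIMSEQ_I)
 fix e :: real assume e: "e > 0"
 define D where "D = (\<bar>b - y\<bar> + 1) powr a / Gamma (a + 1)"
 have G: "Gamma (a + 1) > 0" using a by (intro Gamma_real_pos) auto
 then have D: "D > 0" by (simp add: D_def)
 obtain J where J: "!!i z. i >= J ==> z > c ==> norm (k i z) <= e / (2 * D)"
  using ucauchy_zero_uniform[OF u lim, of "e / (2 * D)"] e D by auto
 have "norm (weyl a (k i) y - 0) < e" if i: "i >= J" for i
 proof (cases "y <= b")
  case True
  have "norm (weyl a (k i) y) <= e / (2 * D) * (b - y) powr a / Gamma (a + 1)"
   by (rule weyl_norm_le[OF k a]) (use i True z J y in auto)
  also have "... <= e / (2 * D) * (\<bar>b - y\<bar> + 1) powr a / Gamma (a + 1)"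
   using G D e True a by (intro divide_right_mono mult_left_mono powr_mono2) auto
  also have "... = e / (2 * D) * D" by (simp add: D_def)
  finally show ?thesis using D e by simp
 next
  case False
  then show ?thesis using e z by (simp add: weyl_eq_0)
 qed
 then show "EX no. ALL n>=no. norm (weyl a (k n) y - 0) < e" by blast
qed

text \<open>\<open>weyl 1\<close> is inverted by differentiation, and
  \<open>deriv_tendsto_zero\<close> permits this in the limit once the \<open>k j\<close> are
  uniformly Cauchy.\<close>

lemma weyl_1_tendsto_zero_D:
 assumes k: "!!j. bcont c (k j)" and u: "ucauchy c k"
  and lim: "!!y. y > c ==> (%j. weyl 1 (k j) y) ----> 0" and y: "y > c"
 shows "(%j. k j y) ----> 0"
proof -
 have "(%j. - weyl 1 (k j) y) ----> 0" if "y > c" for y using tendsto_minus[OF lim[OF that]] by simp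
 moreover have "((%y. - weyl 1 (k j) y) has_vector_derivative k j y) (at y)" if "y > c" for j y
  using has_vector_derivative_minus[OF weyl_1_has_derivative[OF k that, of j]] by simp
 ultimately show ?thesis using deriv_tendsto_zero[of c "%j y. - weyl 1 (k j) y" k, OF _ _ u y] by blast
qed

lemma P_op_bcont:
 assumes f: "f : Cpos" and c: "c > 0"
 shows "bcont c (P_op \<nu> f)"
proof -
 define F where "F = I_op (\<nu> - 1/2) f"
 define G where "G x = complex_of_real (sqrt pi / (2 * Gamma (\<nu> + 1))) * I_op (1/2 - \<nu>) (Hsq F) x" for x
 have F: "F : Cpos" unfolding F_def by (rule I_op_Cpos[OF f])
 have bG: "bcont d G" if "d > 0" for d
  unfolding G_def by (intro bcont_mult_const Cpos_bcont[OF I_op_Cpos[OF Hsq_Cpos[OF F]] that, of 0, unfolded Dn_0])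
 obtain B b where B: "continuous_on {c\<^sup>2<..} G" "!!t. t > c\<^sup>2 ==> norm (G t) <= B" "!!t. t > b ==> G t = 0" "b > 0"
  using bcontE[OF bG[of "c\<^sup>2"]] c by (metis zero_less_power)
 have e: "P_op \<nu> f t = G (t\<^sup>2)" if "t > 0" for t
  unfolding P_op_def F_def[symmetric] G_def by (rule P1_eq[OF F that])
 have sq: "c\<^sup>2 < t\<^sup>2" if "t > c" for t using that c by (intro power_strict_mono) auto
 have "bcont c (%t. G (t\<^sup>2))"
  unfolding bcont_def
 proof (intro conjI exI allI impI)
  show "continuous_on {c<..} (%t. G (t\<^sup>2))"
   by (intro continuous_on_compose2[OF B(1)] continuous_intros) (auto simp: sq)
  show "norm (G (t\<^sup>2)) <= B" if "t > c" for t using B(2) sq that by blast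
  show "G (t\<^sup>2) = 0" if "t > b + 1" for t
  proof (rule B(3))
   have "b < t * 1" using that by simp
   also have "t * 1 <= t * t" using that B(4) by (intro mult_left_mono) auto
   finally show "b < t\<^sup>2" by (simp add: power2_eq_square)
  qed
 qed
 then show ?thesis by (rule bcont_cong) (use e c in auto)
qed

text \<open>\<open>P_op \<nu> f t\<close> is a function \<open>G\<close> of
  \<open>t\<^sup>2\<close>, and its Weyl integral of order \<open>\<nu> + 1/2\<close> is already a
  multiple of \<open>weyl 1 (Hsq F)\<close>. One order more makes the kernel exponent
  \<open>\<nu> + 1/2\<close> nonnegative, hence the kernel bounded on the support, so that the
  \<open>L\<^sub>1\<close> norm of \<open>P_op\<close> suffices. The factor \<open>2 * L\<close>
  bounds the Jacobian \<open>2 * t\<close>.\<close>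

lemma P_op_controls_weyl:
 assumes f: "f : Cpos" and z: "!!y. y > L ==> f y = 0" and L: "L > 0" and nu: "\<nu> >= 0" and x: "x > 0"
 shows "(sqrt pi / (2 * Gamma (\<nu> + 1))) * norm (weyl 1 (weyl 1 (Hsq (I_op (\<nu> - 1/2) f))) x) \<le>
  (L\<^sup>2) powr (\<nu> + 1/2) / Gamma (\<nu> + 3/2) * (2 * L) * (LINT t|lborel. norm (tail (sqrt x) (P_op \<nu> f) t))"
proof -
 define F where "F = I_op (\<nu> - 1/2) f"
 define c where "c = complex_of_real (sqrt pi / (2 * Gamma (\<nu> + 1)))"
 define G where "G x = c * I_op (1/2 - \<nu>) (Hsq F) x" for x
 have F: "F : Cpos" unfolding F_def by (rule I_op_Cpos[OF f])
 note H = Hsq_Cpos[OF F]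
 have Fz: "F y = 0" if "y > L" for y
  unfolding F_def I_op_weyl using that Dn_zero_beyond[of L f] z by (auto intro!: weyl_eq_0)
 have Hz: "Hsq F y = 0" if "y > L\<^sup>2" for y
  unfolding Hsq_def using Fz that L by (simp add: real_less_rsqrt)
 have Gz: "G y = 0" if "y > L\<^sup>2" for y
  unfolding G_def I_op_weyl using that Dn_zero_beyond[of "L\<^sup>2" "Hsq F"] Hz by (auto intro!: weyl_eq_0)
 have IC: "I_op (1/2 - \<nu>) (Hsq F) : Cpos" by (rule I_op_Cpos[OF H])
 have bG: "bcont d G" if "d > 0" for d
  unfolding G_def by (intro bcont_mult_const Cpos_bcont[OF IC that, of 0, unfolded Dn_0])
 have e: "P_op \<nu> f t = G (t\<^sup>2)" if "t > 0" for t
  unfolding P_op_def F_def[symmetric] G_def c_def by (rule P1_eq[OF F that])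
 have Gm: "Gamma (\<nu> + 3/2) > 0" "Gamma (\<nu> + 1) > 0" using nu by (auto intro!: Gamma_real_pos)
 have c0: "c ~= 0" using Gm by (simp add: c_def)
 have w: "c * weyl 1 (weyl 1 (Hsq F)) x = weyl (\<nu> + 3/2) G x"
 proof -
  have "weyl 1 (weyl 1 (Hsq F)) x = weyl 1 (weyl (\<nu> + 1/2) (I_op (1/2 - \<nu>) (Hsq F))) x"
   by (rule weyl_cong) (use x nu in "simp add: weyl_I_op[OF H]")
  also have "... = weyl (1 + (\<nu> + 1/2)) (I_op (1/2 - \<nu>) (Hsq F)) x"
   using nu by (intro weyl_semigroup[OF Cpos_bcont[OF IC x, of 0, unfolded Dn_0]]) auto
  also have "1 + (\<nu> + 1/2) = \<nu> + 3/2" by simp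
  finally show ?thesis unfolding G_def by (simp add: weyl_mult_const)
 qed
 define a where "a = \<nu> + 3/2"
 note iG = bcont_integrable[OF bG[OF x]]
 define Q where "Q = tail (sqrt x) (P_op \<nu> f)"
 have iQ: "integrable lborel Q" unfolding Q_def using x by (intro bcont_integrable P_op_bcont[OF f]) auto
 have Qle: "2 * t * norm (Q t) <= 2 * L * norm (Q t)" and Qge: "0 <= 2 * t * norm (Q t)" for t
 proof -
  have "sqrt x > 0" using x by simp
  then have *: "t > 0 & t <= L" if "Q t ~= 0"
  proof -
   have t: "t > sqrt x" using that by (simp add: Q_def tail_def split: if_splits)
   with \<open>sqrt x > 0\<close> have t0: "t > 0" by linarith
   have "\<not> t > L"
   proof
    assume "t > L"
    then have "t\<^sup>2 > L\<^sup>2" using L by (intro power_strict_mono) auto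
    then show False using that e[OF t0] Gz t by (simp add: Q_def tail_def)
   qed
   then show ?thesis using t0 by simp
  qed
  show "2 * t * norm (Q t) <= 2 * L * norm (Q t)" by (cases "Q t = 0") (use * in "auto intro!: mult_right_mono")
  show "0 <= 2 * t * norm (Q t)" by (cases "Q t = 0") (use * in auto)
 qed
 have J: "(LINT u|lborel. norm (tail x G u)) <= 2 * L * (LINT t|lborel. norm (Q t))"
 proof -
  define k where "k u = complex_of_real (norm (G u))" for u
  have "continuous_on {x<..} k"
   unfolding k_def using bG[OF x] by (intro continuous_intros) (auto simp: bcont_def)
  then have sub: "(LINT t:{sqrt x<..}|lborel. (2 * t) *R k (t\<^sup>2)) = (LINT u:{x<..}|lborel. k u)"
   using subst_sq[of "sqrt x" k] x by simp
  have "complex_of_real (LINT u|lborel. norm (tail x G u)) = (LINT u|lborel. complex_of_real (norm (tail x G u)))" by simp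
  also have "... = (LINT u:{x<..}|lborel. k u)"
   unfolding set_lebesgue_integral_def k_def by (rule Bochner_Integration.integral_cong) (auto simp: tail_def indicator_def)
  also have "... = (LINT t|lborel. complex_of_real (2 * t * norm (Q t)))"
   unfolding sub[symmetric] unfolding set_lebesgue_integral_def
  proof (rule Bochner_Integration.integral_cong[OF refl])
   fix t
   have "sqrt x > 0" using x by simp
   then have "P_op \<nu> f t = G (t\<^sup>2)" if "t > sqrt x" using that by (intro e) linarith
   then show "indicator {sqrt x<..} t *R ((2 * t) *R k (t\<^sup>2)) = complex_of_real (2 * t * norm (Q t))"
    by (simp add: k_def Q_def tail_def indicator_def scaleR_conv_of_real)
  qed
  also have "... = complex_of_real (LINT t|lborel. 2 * t * norm (Q t))" by (rule integral_complex_of_real)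
  finally have "(LINT u|lborel. norm (tail x G u)) = (LINT t|lborel. 2 * t * norm (Q t))" by (simp only: of_real_eq_iff)
  also have "... <= (LINT t|lborel. 2 * L * norm (Q t))"
  proof (rule integral_mono)
   show i2: "integrable lborel (%t. 2 * L * norm (Q t))" using iQ by (intro integrable_mult_right integrable_norm)
   show "integrable lborel (%t. 2 * t * norm (Q t))"
   proof (rule Bochner_Integration.integrable_bound[OF i2])
    have [measurable]: "Q : borel_measurable borel" using borel_measurable_integrable[OF iQ] by simp
    show "(%t. 2 * t * norm (Q t)) : borel_measurable lborel" by measurable
    show "AE t in lborel. norm (2 * t * norm (Q t)) <= norm (2 * L * norm (Q t))"
     unfolding real_norm_def abs_of_nonneg[OF Qge] by (intro AE_I2 order_trans[OF Qle abs_ge_self])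
   qed
  qed (rule Qle)
  finally show ?thesis by simp
 qed
 have "(sqrt pi / (2 * Gamma (\<nu> + 1))) * norm (weyl 1 (weyl 1 (Hsq F)) x) = norm (weyl a G x)"
 proof -
  have "sqrt pi / (2 * Gamma (\<nu> + 1)) >= 0" using Gm by simp
  then show ?thesis unfolding a_def w[symmetric] c_def by (simp only: norm_mult norm_of_real abs_of_nonneg)
 qed
 also have "... <= (1 / Gamma a) * (LINT u|lborel. (L\<^sup>2) powr (a - 1) * norm (tail x G u))"
 proof -
  have "norm (LINT u|lborel. pk a (u - x) *R tail x G u) <= (LINT u|lborel. (L\<^sup>2) powr (a - 1) * norm (tail x G u))"
  proof (rule order_trans[OF integral_norm_bound integral_mono])
   show "integrable lborel (%u. norm (pk a (u - x) *R tail x G u))"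
    by (rule integrable_norm[OF weyl_integrable[OF bG[OF x]]]) (use nu in "auto simp: a_def")
   show "integrable lborel (%u. (L\<^sup>2) powr (a - 1) * norm (tail x G u))"
    using iG by (intro integrable_mult_right integrable_norm)
   show "norm (pk a (u - x) *R tail x G u) <= (L\<^sup>2) powr (a - 1) * norm (tail x G u)" for u
   proof (cases "u > x & u <= L\<^sup>2")
    case True
    then have "pk a (u - x) <= (L\<^sup>2) powr (a - 1)"
     unfolding pk_def using x nu by (auto simp: a_def intro!: powr_mono2)
    then show ?thesis by (simp add: mult_right_mono)
   next
    case False
    then have "tail x G u = 0" using Gz by (auto simp: tail_def)
    then show ?thesis by simp
   qed
  qed
  then show ?thesis unfolding weyl_tail(1)[of x x a G, OF order_refl] using Gm by (simp add: a_def divide_right_mono)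
 qed
 also have "... <= (1 / Gamma a) * ((L\<^sup>2) powr (a - 1) * (2 * L * (LINT t|lborel. norm (Q t))))"
 proof -
  have "(LINT u|lborel. (L\<^sup>2) powr (a - 1) * norm (tail x G u)) = (L\<^sup>2) powr (a - 1) * (LINT u|lborel. norm (tail x G u))"
   by simp
  also have "... <= (L\<^sup>2) powr (a - 1) * (2 * L * (LINT t|lborel. norm (Q t)))"
   by (rule mult_left_mono[OF J]) simp
  finally show ?thesis using Gm by (intro mult_left_mono) (auto simp: a_def)
 qed
 finally show ?thesis unfolding F_def Q_def by (simp add: a_def add.commute)
qed

lemma bcont_mult:
 assumes "bcont c k" "bcont c k'"
 shows "bcont c (%t. k t * k' t)"
proof -
 obtain B b where 1: "continuous_on {c<..} k" "!!t. t > c ==> norm (k t) <= B" "!!t. t > b ==> k t = 0" "B > 0"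
  using bcontE[OF assms(1)] by metis
 obtain B' where 2: "continuous_on {c<..} k'" "!!t. t > c ==> norm (k' t) <= B'"
  using assms(2) unfolding bcont_def by blast
 show ?thesis
  unfolding bcont_def
 proof (intro conjI exI allI impI)
  show "continuous_on {c<..} (%t. k t * k' t)" using 1 2 by (intro continuous_intros)
  show "norm (k t * k' t) <= B * B'" if "t > c" for t
   using 1(2)[OF that] 2(2)[OF that] 1(4) unfolding norm_mult by (intro mult_mono) auto
  show "k t * k' t = 0" if "t > b" for t using 1(3)[OF that] by simp
 qed
qed

lemma bcont_cnj: "bcont c k ==> bcont c (%t. cnj (k t))"
 unfolding bcont_def by (auto intro!: continuous_intros)

lemma L2M_cnj:
 assumes "f : L2M M" "g : L2M M"
 shows "integrable M (%t. f t * cnj (g t))" and "norm (LINT t|M. f t * cnj (g t)) <= l2n M f * l2n M g"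
proof -
 have m: "(%t. f t * cnj (g t)) : borel_measurable M"
 proof -
  have [measurable]: "f : borel_measurable M" "g : borel_measurable M" using assms by (auto simp: L2M_def)
  have [measurable]: "cnj : borel_measurable borel" by (intro borel_measurable_continuous_onI continuous_intros)
  show ?thesis by measurable
 qed
 have "integrable M (%t. norm (f t * cnj (g t)))" using L2M_product(1)[OF assms] by (simp add: norm_mult)
 then show "integrable M (%t. f t * cnj (g t))" using m by (rule integrable_norm_cancel)
 have "norm (LINT t|M. f t * cnj (g t)) <= (LINT t|M. norm (f t * cnj (g t)))" by (rule integral_norm_bound)
 also have "... <= l2n M f * l2n M g" using L2M_product(2)[OF assms] by (simp add: norm_mult)
 finally show "norm (LINT t|M. f t * cnj (g t)) <= l2n M f * l2n M g" .
qed

text \<open>A Weyl integral of \<open>P_op \<nu> (f j)\<close>, as a function of \<open>y\<^sup>2\<close>, is a multiple of an integer order integral of \<open>Hsq\<close>,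
 hence tends to \<open>0\<close>; the Cauchy condition gives uniform convergence of its derivatives, whose limits must then vanish.\<close>

theorem P_op_closable:
 fixes f g :: "nat => real => complex"
 assumes nu: "\<nu> = 0 & s >= 2 | \<nu> >= 1/2 & s >= 1" and L: "L > 0"
  and f: "!!j. f j : Cinf_comp" and z: "!!j y. y > L ==> f j y = 0"
  and cauchy: "!!e. e > 0 ==> EX J. ALL i>=J. ALL j>=J. l2n (segm L) (%t. Dn s (f i) t - Dn s (f j) t) < e"
  and conv: "!!c. c > 0 ==> (%j. LINT t|lborel. norm (tail c (P_op \<nu> (f j)) t)) ----> 0"
 shows "(%j. l2n (segm L) (Dn s (f j))) ----> 0"
proof -
 have nu0: "\<nu> >= 0" and s1: "s >= 1" using nu by auto
 note fp = Cinf_comp_Cpos[OF f]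
 define N where "N i j = l2n (segm L) (%t. Dn s (f i) t - Dn s (f j) t)" for i j
 have Nn: "N i j >= 0" for i j by (simp add: N_def)
 have Nc: "EX J. ALL i>=J. ALL j>=J. N i j < e" if "e > 0" for e unfolding N_def by (rule cauchy[OF that])
 define d where "d i j = (%t. f i t + (-1) * f j t)" for i j
 have dC: "d i j : Cinf_comp" for i j unfolding d_def by (intro Cinf_comp_lin f)
 have dz: "d i j y = 0" if "y > L" for i j y unfolding d_def using z that by simp
 have Dd: "Dn m (d i j) y = Dn m (f i) y - Dn m (f j) y" if "y > 0" for m i j y
  unfolding d_def using Dn_lin[OF fp fp that, of m i "-1" j] by simp
 have dN: "l2n (segm L) (Dn s (d i j)) = N i j" for i j
  unfolding N_def l2n_def by (intro arg_cong[where f=sqrt] Bochner_Integration.integral_cong) (auto simp: segm_def space_restrict_space Dd)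
 have uD: "ucauchy 0 (%j. Dn m (f j))" if m: "m < s" for m
 proof (rule ucauchy_bound[OF Nc _ Nn])
  fix i j and y :: real assume y: "y > 0"
  have sm: "Suc (m + (s - Suc m)) = s" using m by simp
  show "norm (Dn m (f i) y - Dn m (f j) y) <= (L ^ (s - Suc m) * sqrt L) * N i j"
   using Dn_sup_bound[of "d i j" L y m "s - Suc m", OF dC L dz y] unfolding sm dN Dd[OF y] by (simp add: mult.assoc)
 qed
 define F where "F j = I_op (\<nu> - 1/2) (f j)" for j
 have FC: "F j : Cinf_comp" for j unfolding F_def by (rule I_op_Cinf_comp[OF f])
 note Fp = Cinf_comp_Cpos[OF FC]
 have Fz: "F j y = 0" if "y > L" for j y
  unfolding F_def I_op_weyl using that Dn_zero_beyond[of L "f j"] z by (auto intro!: weyl_eq_0)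
 have Fd: "F i y - F j y = I_op (\<nu> - 1/2) (d i j) y" if "y > 0" for i j y
  unfolding F_def d_def using I_op_lin[OF fp fp that, of _ i "-1" j] by simp
 have uF: "ucauchy 0 F"
 proof (cases "\<nu> = 0")
  case True
  then have s2: "s >= 2" using nu by auto
  show ?thesis
  proof (rule ucauchy_bound[OF Nc _ Nn])
   fix i j and y :: real assume y: "y > 0"
   have "F i y - F j y = I_op (- 1/2) (d i j) y" using Fd[OF y, of i j] True by simp
   then show "norm (F i y - F j y) <= L ^ (s - 2) * L / Gamma (3/2) * N i j"
    using I_op_bound_0[of "d i j" L s y, OF dC L dz s2 y] unfolding dN by simp
  qed
 next
  case False
  then have n: "\<nu> >= 1/2" using nu by auto
  show ?thesis
  proof (rule ucauchy_bound[OF Nc _ Nn])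
   fix i j and y :: real assume y: "y > 0"
   show "norm (F i y - F j y) <= L powr (\<nu> + real s - 1) / Gamma (\<nu> + 1/2) * N i j"
    using I_op_bound[of "d i j" L \<nu> s y, OF dC L dz n s1 y] unfolding dN Fd[OF y] .
  qed
 qed
 define H where "H j = Hsq (F j)" for j
 have Hp: "H j : Cpos" for j unfolding H_def by (rule Hsq_Cpos[OF Fp])
 have bH: "bcont c (H j)" if "c > 0" for c j using Cpos_bcont[OF Hp that, of 0] by simp
 have Hz: "H j y = 0" if "y > L\<^sup>2" for j y
  unfolding H_def Hsq_def using Fz that L by (simp add: real_less_rsqrt)
 have uH: "ucauchy c H" if c: "c > 0" for c
  unfolding ucauchy_def
 proof (intro allI impI)
  fix e :: real assume e: "e > 0"
  obtain J where J: "!!i j y. i >= J ==> j >= J ==> y > 0 ==> norm (F i y - F j y) <= e * sqrt c"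
   using uF e c unfolding ucauchy_def by (meson mult_pos_pos real_sqrt_gt_zero)
  have "norm (H i y - H j y) <= e" if ij: "i >= J" "j >= J" "y > c" for i j y
  proof -
   have y: "sqrt y > 0" "sqrt c <= sqrt y" using ij c by auto
   have "norm (H i y - H j y) = norm (F i (sqrt y) - F j (sqrt y)) / sqrt y"
    unfolding H_def Hsq_def scaleR_diff_right[symmetric] norm_scaleR using y by (simp add: field_simps)
   also have "... <= e * sqrt c / sqrt y" using J[OF ij(1,2) y(1)] y by (intro divide_right_mono) auto
   also have "... <= e * sqrt y / sqrt y" using y e by (intro divide_right_mono mult_left_mono) auto
   finally show ?thesis using y by simp
  qed
  then show "EX J. ALL i>=J. ALL j>=J. ALL y>c. norm (H i y - H j y) <= e" by blast
 qed
 have W2: "(%j. weyl 1 (weyl 1 (H j)) x) ----> 0" if x: "x > 0" for x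
 proof -
  define C where "C = (L\<^sup>2) powr (\<nu> + 1/2) / Gamma (\<nu> + 3/2) * (2 * L)"
  define q where "q = sqrt pi / (2 * Gamma (\<nu> + 1))"
  have q: "q > 0" using nu0 by (simp add: q_def Gamma_real_pos)
  have "q * norm (weyl 1 (weyl 1 (H j)) x) <= C * (LINT t|lborel. norm (tail (sqrt x) (P_op \<nu> (f j)) t))" for j
   using P_op_controls_weyl[OF fp z L nu0 x] unfolding H_def F_def C_def q_def .
  then have le: "norm (weyl 1 (weyl 1 (H j)) x) <= (C / q) * (LINT t|lborel. norm (tail (sqrt x) (P_op \<nu> (f j)) t))" for j
   using q by (simp add: field_simps)
  have "(%j. (C / q) * (LINT t|lborel. norm (tail (sqrt x) (P_op \<nu> (f j)) t))) ----> (C / q) * 0"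
   by (rule tendsto_mult[OF tendsto_const conv]) (use x in simp)
  then have "(%j. (C / q) * (LINT t|lborel. norm (tail (sqrt x) (P_op \<nu> (f j)) t))) ----> 0" by simp
  then show ?thesis
   by (rule Lim_null_comparison[rotated]) (rule always_eventually, rule allI, rule le)
 qed
 \<comment> \<open>\<open>P_op_controls_weyl\<close> leaves two orders of integration; each is
   removed by one differentiation in the limit.\<close>
 have W1: "(%j. weyl 1 (H j) x) ----> 0" if x: "x > 0" for x
 proof -
  have "ucauchy (x/2) (%j. weyl 1 (H j))"
   using x by (intro ucauchy_weyl[OF bH uH Hz]) auto
  then show ?thesis
   using x by (intro weyl_1_tendsto_zero_D[of "x/2" "%j. weyl 1 (H j)"] bcont_weyl bH W2) auto
 qed
 have H0: "(%j. H j x) ----> 0" if x: "x > 0" for x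
  using x by (intro weyl_1_tendsto_zero_D[of "x/2" H] bH uH W1) auto
 have F0: "(%j. F j t) ----> 0" if t: "t > 0" for t
 proof -
  have "(%j. t *R H j (t\<^sup>2)) ----> t *R 0" using t by (intro tendsto_intros H0) simp
  then show ?thesis unfolding H_def Hsq_def using t by simp
 qed
 have bF: "bcont 0 (F j)" for j using Cinf_comp_bcont[OF FC, of 0] by simp
 have bf: "bcont 0 (f j)" for j using Cinf_comp_bcont[OF f, of 0] by simp
 have uf: "ucauchy 0 f" using uD[of 0] s1 by simp
 define m where "m = mexp (1/2 - \<nu>)"
 \<comment> \<open>Applied to \<open>F j = I_op (\<nu> - 1/2) (f j)\<close>, the order
   \<open>a\<close> gives the positive integer order \<open>m + 1\<close>, from which
   \<open>down\<close> descends to \<open>f j\<close> by differentiation.\<close>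
 define a where "a = 1/2 - \<nu> + real m + 1"
 have a: "a > 1" "a + (\<nu> - 1/2) = real (Suc m)" using mexp[of "1/2 - \<nu>"] by (auto simp: a_def m_def)
 have Wm: "(%j. weyl (real (Suc m)) (f j) y) ----> 0" if y: "y > 0" for y
 proof -
  have "(%j. weyl a (F j) y) ----> 0"
   using a by (intro weyl_tendsto_zero[OF bF uF Fz _ F0 y]) auto
  moreover have "weyl a (F j) y = weyl (real (Suc m)) (f j) y" for j
   unfolding F_def a(2)[symmetric] using a y by (intro weyl_I_op[OF fp]) auto
  ultimately show ?thesis by simp
 qed
 have down: "(%j. weyl (real (Suc k)) (f j) y) ----> 0" if hyp: "!!y. y > 0 ==> (%j. weyl (real (Suc (Suc k))) (f j) y) ----> 0" and y0: "y > 0" for k y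
 proof (rule weyl_1_tendsto_zero_D[of 0 "%j. weyl (real (Suc k)) (f j)"])
  show "bcont 0 (weyl (real (Suc k)) (f j))" for j by (rule bcont_weyl[OF bf]) simp
  show "ucauchy 0 (%j. weyl (real (Suc k)) (f j))" by (rule ucauchy_weyl[OF bf uf z]) auto
  have "weyl 1 (weyl (real (Suc k)) (f j)) y = weyl (real (Suc (Suc k))) (f j) y" if "y > 0" for y j
   using weyl_semigroup[OF bf, of 1 "real (Suc k)" y j] that by simp
  then show "(%j. weyl 1 (weyl (real (Suc k)) (f j)) y) ----> 0" if "y > 0" for y using that hyp[OF that] by simp
 qed (rule y0)
 have "ALL y>0. (%j. weyl (real (Suc 0)) (f j) y) ----> 0"
  using Wm
 proof (induction m)
  case (Suc m)
  show ?case by (rule Suc.IH) (use down[of m] Suc.prems in blast)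
 qed auto
 then have f0: "(%j. f j y) ----> 0" if "y > 0" for y
  using that by (intro weyl_1_tendsto_zero_D[of 0 f] bf uf) auto
 have D0: "(%j. Dn m (f j) y) ----> 0" if "m < s" "y > 0" for m y
  using that
 proof (induction m arbitrary: y)
  case (Suc m)
  show ?case
   by (rule deriv_tendsto_zero[of 0 "%j. Dn m (f j)"]) (use Suc Cpos_deriv[OF fp] uD in auto)
 qed (use f0 in auto)
 define A where "A j = Dn (s - 1) (f j)" for j
 define K where "K j = Dn s (f j)" for j
 have dA: "(A j has_vector_derivative K j y) (at y)" if "y > 0" for j y
  unfolding A_def K_def using Cpos_deriv[of "f j" y "s - 1", OF fp that] s1 by simp
 have A0: "EX J. ALL i>=J. ALL y>0. norm (A i y) <= e" if "e > 0" for e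
  unfolding A_def using s1 by (intro ucauchy_zero_uniform[OF uD D0 that]) auto
 have Kb: "bcont 0 (K j)" for j unfolding K_def by (rule Cinf_comp_bcont[OF f])
 have KL: "K j : L2M (segm L)" for j using bcont_L2M[OF Kb] L by simp
 define K' where "K' j = Dn (Suc s) (f j)" for j
 have dK: "(K j has_vector_derivative K' j y) (at y)" if "y > 0" for j y
  unfolding K'_def K_def by (rule Cpos_deriv[OF fp that])
 have K'b: "bcont 0 (K' j)" and Ab: "bcont 0 (A j)" for j unfolding K'_def A_def by (rule Cinf_comp_bcont[OF f])+
 have Kz: "K j y = 0" "A j y = 0" "K' j y = 0" if "y > L" for j y
  unfolding K_def A_def K'_def using Dn_zero_beyond[of L "f j" y] z that by blast+
 \<comment> \<open>For the order \<open>s\<close> the \<open>L\<^sub>2\<close> Cauchy condition is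
   combined with weak convergence: integration by parts moves the derivative from \<open>K i\<close>
   to the fixed \<open>K j\<close>, and the primitive \<open>A i\<close> of \<open>K i\<close> tends
   to \<open>0\<close> uniformly.\<close>
 define ip where "ip i j = (LINT t|segm L. K i t * cnj (K j t))" for i j
 have ip0: "ip i j = weyl 1 (%t. K i t * cnj (K j t)) 0" for i j
 proof -
  let ?p = "%t. K i t * cnj (K j t)"
  have bp: "bcont 0 ?p" by (intro bcont_mult bcont_cnj Kb)
  have "weyl 1 ?p 0 = (LINT t|lborel. pk 1 t *R tail 0 ?p t)" using weyl_tail(1)[of 0 0 1 ?p] by simp
  also have "... = (LINT t|lborel. indicator {0<..<L} t *R ?p t)"
  proof (rule integral_cong_AE)
   show "(%t. pk 1 t *R tail 0 ?p t) : borel_measurable lborel"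
    using borel_measurable_integrable[OF weyl_integrable[OF bp, of 1 0]] by simp
   show "(%t. indicator {0<..<L} t *R ?p t) : borel_measurable lborel"
    using L2M_cnj(1)[OF KL KL, of i j] unfolding segm_def by (subst (asm) integrable_restrict_space) auto
   show "AE t in lborel. pk 1 t *R tail 0 ?p t = indicator {0<..<L} t *R ?p t"
    using AE_lborel_singleton[of L]
   proof eventually_elim
    case (elim t)
    then show ?case using Kz[of t] by (cases t L rule: linorder_cases) (auto simp: pk_def tail_def indicator_def)
   qed
  qed
  also have "... = ip i j" unfolding ip_def segm_def by (subst integral_restrict_space) auto
  finally show ?thesis ..
 qed
 have ipb: "EX D>0. ALL i e. (ALL y>0. norm (A i y) <= e) \<longrightarrow> norm (ip i j) <= e * D" for j
 proof -
  obtain B1 where B1: "!!t. t > 0 ==> norm (K j t) <= B1" "B1 > 0" using bcontE[OF Kb] by metis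
  obtain B2 where B2: "!!t. t > 0 ==> norm (K' j t) <= B2" "B2 > 0" using bcontE[OF K'b] by metis
  have "norm (ip i j) <= e * (B1 + B2 * L)" if e: "ALL y>0. norm (A i y) <= e" for i e
  proof -
   have e0: "e >= 0" using e[rule_format, of 1] norm_ge_zero[of "A i 1"] by linarith
   let ?p = "%t. K i t * cnj (K j t)" and ?q = "%t. A i t * cnj (K' j t)"
   have bp: "bcont 0 ?p" and bq: "bcont 0 ?q" by (intro bcont_mult bcont_cnj Kb Ab K'b)+
   have le: "norm (weyl 1 ?p y) <= e * (B1 + B2 * L)" if y: "y > 0" for y
   proof -
    have "weyl 1 (%t. ?p t + ?q t) y = - (A i y * cnj (K j y))"
    proof (rule weyl_1_FTC[OF _ bcont_add[OF bp bq] _ _ y])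
     show "((%t. A i t * cnj (K j t)) has_vector_derivative ?p y + ?q y) (at y)" if "y > 0" for y
     proof -
      have "((%t. cnj (K j t)) has_vector_derivative cnj (K' j y)) (at y)"
       using dK[OF that] by (rule bounded_linear.has_vector_derivative[OF bounded_linear_cnj])
      then show ?thesis using has_vector_derivative_mult[OF dA[OF that, of i], of "%t. cnj (K j t)" "cnj (K' j y)"]
       by (simp add: add.commute)
     qed
    qed (use Kz in auto)
    then have "weyl 1 ?p y = - (A i y * cnj (K j y)) - weyl 1 ?q y"
     using weyl_add[OF bp bq, of 1 y] y by (simp add: algebra_simps)
    then have "norm (weyl 1 ?p y) <= norm (A i y * cnj (K j y)) + norm (weyl 1 ?q y)"
     by (metis norm_minus_cancel norm_triangle_ineq4)
    also have "norm (A i y * cnj (K j y)) <= e * B1"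
     unfolding norm_mult complex_mod_cnj using e B1 y e0 by (intro mult_mono) auto
    also have "norm (weyl 1 ?q y) <= e * B2 * L"
    proof (cases "y <= L")
     case True
     have "norm (weyl 1 ?q y) <= (e * B2) * (L - y) powr 1 / Gamma (1 + 1)"
     proof (rule weyl_norm_le[OF bq])
      show "norm (?q t) <= e * B2" if "t > 0" for t
       unfolding norm_mult complex_mod_cnj using e B2 that e0 by (intro mult_mono) auto
     qed (use True y Kz in auto)
     also have "... = (e * B2) * (L - y)" using True Gamma_fact[of 1, where 'a=real] by simp
     also have "... <= e * B2 * L" using e0 B2 y by (intro mult_left_mono) auto
     finally show ?thesis .
    next
     case False
     then have "weyl 1 ?q y = 0" using Kz by (intro weyl_eq_0) auto
     then show ?thesis using e0 B2 L by simp
    qed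
    finally show ?thesis by (simp add: algebra_simps)
   qed
   \<comment> \<open>The estimate holds for positive arguments; continuity up to the end point
     carries it to \<open>0\<close>, where \<open>weyl 1 ?p\<close> is the full inner
     product.\<close>
   have "(weyl 1 ?p ---> weyl 1 ?p 0) (at 0 within {0..})"
    using weyl_continuous[OF bp, of 1] by (simp add: continuous_on_def)
   then have "(weyl 1 ?p ---> weyl 1 ?p 0) (at_right 0)"
    by (rule tendsto_within_subset) auto
   then have "norm (weyl 1 ?p 0) <= e * (B1 + B2 * L)"
    by (rule tendsto_upperbound[OF tendsto_norm]) (auto intro!: eventually_at_rightI[of 0 1] le)
   then show ?thesis unfolding ip0 .
  qed
  moreover have "B1 + B2 * L > 0" using B1 B2 L by (intro add_pos_pos mult_pos_pos) auto
  ultimately show ?thesis by blast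
 qed
 have ip_lim: "(%i. ip i j) ----> 0" for j
 proof (rule LIMSEQ_I)
  fix e :: real assume e: "e > 0"
  obtain D where D: "D > 0" "!!i e. (ALL y>0. norm (A i y) <= e) ==> norm (ip i j) <= e * D" using ipb by blast
  obtain J where J: "!!i. i >= J ==> ALL y>0. norm (A i y) <= e / (2 * D)" using A0[of "e / (2 * D)"] e D by auto
  have "norm (ip i j - 0) < e" if "i >= J" for i
   using D(2)[OF J[OF that]] e D(1) by simp
  then show "EX no. ALL n>=no. norm (ip n j - 0) < e" by blast
 qed
 \<comment> \<open>\<open>n\<^sup>2\<close> is the sum of the inner products of
   \<open>K j - K i\<close> and of \<open>K i\<close> with \<open>K j\<close>. The first is at most
   \<open>e * n\<close> in modulus, the second vanishes as \<open>i\<close> grows.\<close>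
 have main: "l2n (segm L) (K j) <= e" if e: "e > 0" and J: "ALL i>=J. N j i <= e" for j e J
 proof -
  define n where "n = l2n (segm L) (K j)"
  have "n\<^sup>2 <= e * n + norm (ip i j)" if i: "i >= J" for i
  proof -
   have jj: "ip j j = complex_of_real (n\<^sup>2)"
   proof -
    have "ip j j = (LINT t|segm L. complex_of_real ((norm (K j t))\<^sup>2))"
     unfolding ip_def complex_norm_square ..
    also have "... = complex_of_real (LINT t|segm L. (norm (K j t))\<^sup>2)" by (rule integral_complex_of_real)
    finally show ?thesis unfolding n_def l2n_def by simp
   qed
   have "(LINT t|segm L. (K j t - K i t) * cnj (K j t)) = ip j j - ip i j"
    unfolding ip_def left_diff_distrib by (rule Bochner_Integration.integral_diff[OF L2M_cnj(1)[OF KL KL] L2M_cnj(1)[OF KL KL]])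
   then have "ip j j = (LINT t|segm L. (K j t - K i t) * cnj (K j t)) + ip i j" by simp
   then have "norm (ip j j) <= norm (LINT t|segm L. (K j t - K i t) * cnj (K j t)) + norm (ip i j)"
    by (metis norm_triangle_ineq)
   also have "norm (LINT t|segm L. (K j t - K i t) * cnj (K j t)) <= N j i * n"
    using L2M_cnj(2)[OF L2M_diff(1)[OF KL KL] KL] unfolding N_def n_def K_def .
   also have "N j i * n <= e * n" using J i by (intro mult_right_mono) (auto simp: n_def)
   finally show ?thesis unfolding jj by (simp add: norm_power)
  qed
  then have "n\<^sup>2 <= e * n + 0"
   by (intro tendsto_lowerbound[OF tendsto_add[OF tendsto_const tendsto_norm_zero[OF ip_lim[of j]]]])
    (auto intro!: eventually_sequentiallyI[of J])
  then have "n * n <= e * n" by (simp add: power2_eq_square)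
  then show ?thesis using e unfolding n_def[symmetric] by (cases "n > 0") auto
 qed
 show ?thesis
 proof (rule LIMSEQ_I)
  fix e :: real assume e: "e > 0"
  obtain J where J: "!!i j. i >= J ==> j >= J ==> N i j < e / 2" using Nc[of "e/2"] e by auto
  have le: "l2n (segm L) (K j) <= e / 2" if j: "j >= J" for j
  proof (rule main)
   show "ALL i>=J. N j i <= e / 2" using J[OF j] by (auto intro: less_imp_le)
  qed (use e in simp)
  have "norm (l2n (segm L) (Dn s (f n)) - 0) < e" if "n >= J" for n
   using le[OF that] e unfolding K_def by simp
  then show "EX no. ALL n>=no. norm (l2n (segm L) (Dn s (f n)) - 0) < e" by blast
 qed
qed

section \<open>Smooth functions\<close>

lemma pderiv_list_append: "pderiv_list (is @ js) f = pderiv_list is (pderiv_list js f)"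
 by (induction "is") auto

lemma pderiv_list_cong:
 assumes S: "open S" and fg: "!!x. x : S ==> f x = g x" and x: "x : S"
 shows "pderiv_list is f x = pderiv_list is g x"
 using x
proof (induction "is" arbitrary: x)
 case (Cons i "is")
 have "open ((%t::real. x + t *R i) -` S)"
  using S by (intro open_vimage continuous_intros)
 then have "\<forall>\<^sub>F t in nhds (0::real). t : (%t. x + t *R i) -` S"
  by (rule eventually_nhds_in_open) (use Cons.prems in simp)
 then have "\<forall>\<^sub>F t in nhds 0. x + t *R i : S" by simp
 then have "\<forall>\<^sub>F t in nhds 0. pderiv_list is f (x + t *R i) = pderiv_list is g (x + t *R i)"
  by eventually_elim (rule Cons.IH)
 then show ?case
  unfolding pderiv_list.simps by (intro vector_derivative_cong_eq) auto
qed (use fg in auto)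

lemma pderiv_has_derivative:
 assumes "(f has_derivative f') (at x)"
 shows "pderiv_list [i] f x = f' i"
proof -
 have "((%t::real. x + t *R i) has_derivative (%t. t *R i)) (at 0)"
  by (auto intro!: derivative_eq_intros)
 then have "((%t. f (x + t *R i)) has_derivative (%t. f' (t *R i))) (at 0)"
  using has_derivative_compose[of "%t. x + t *R i" "%t. t *R i" 0 UNIV f f'] assms by simp
 moreover have "f' (t *R i) = t *R f' i" for t
  using has_derivative_bounded_linear[OF assms] by (simp add: linear_simps(5) bounded_linear.linear linear_cmul)
 ultimately have "((%t. f (x + t *R i)) has_vector_derivative f' i) (at 0)"
  by (simp add: has_vector_derivative_def)
 then show ?thesis by (simp add: vector_derivative_at)
qed

lemma smooth_on_differentiable:
 assumes "smooth_on S f" "open S" "set is \<subseteq> Basis" "x : S"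
 shows "pderiv_list is f differentiable (at x)"
 using assms by (auto simp: smooth_on_def differentiable_on_eq_differentiable_at)

lemma smooth_on_continuous: "smooth_on S f ==> set is \<subseteq> Basis ==> continuous_on S (pderiv_list is f)"
 by (auto simp: smooth_on_def intro: differentiable_imp_continuous_on)

lemma smooth_on_pderiv: "smooth_on S f ==> set js \<subseteq> Basis ==> smooth_on S (pderiv_list js f)"
 unfolding smooth_on_def pderiv_list_append[symmetric] by auto

lemma differentiable_transform_open:
 assumes "f differentiable (at x)" "open S" "x : S" "!!y. y : S ==> f y = g y"
 shows "g differentiable (at x)"
 using assms by (meson differentiable_def has_derivative_transform_within_open)

lemma smooth_on_cong:
 assumes S: "open S" and f: "smooth_on S f" and fg: "!!x. x : S ==> f x = g x"
 shows "smooth_on S g"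
 unfolding smooth_on_def differentiable_on_eq_differentiable_at[OF S]
proof (intro allI impI ballI)
 fix "is" and x assume i: "set is \<subseteq> (Basis :: 'a set)" and x: "x : S"
 show "pderiv_list is g differentiable at x"
  by (rule differentiable_transform_open[OF smooth_on_differentiable[OF f S i x] S x])
   (rule pderiv_list_cong[OF S fg])
qed

lemma smooth_on_Un:
 assumes "open S" "open T" "smooth_on S f" "smooth_on T f"
 shows "smooth_on (S \<union> T) f"
 using assms unfolding smooth_on_def by (auto simp: differentiable_on_eq_differentiable_at open_Un)

lemma pderiv_list_diff:
 fixes f g :: "'a::euclidean_space => 'b::real_normed_vector"
 assumes S: "open S" and f: "smooth_on S f" and g: "smooth_on S g" and i: "set is \<subseteq> Basis" and x: "x : S"
 shows "pderiv_list is (%x. f x - g x) x = pderiv_list is f x - pderiv_list is g x"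
 using i x
proof (induction "is" arbitrary: x)
 case (Cons i "is")
 then have "is": "set is \<subseteq> Basis" by simp
 obtain f' g' where f': "(pderiv_list is f has_derivative f') (at x)" and g': "(pderiv_list is g has_derivative g') (at x)"
  using smooth_on_differentiable[OF f S "is" Cons.prems(2)] smooth_on_differentiable[OF g S "is" Cons.prems(2)] by (auto simp: differentiable_def)
 have "((%x. pderiv_list is f x - pderiv_list is g x) has_derivative (%h. f' h - g' h)) (at x)"
  by (rule has_derivative_diff[OF f' g'])
 then have "pderiv_list [i] (%x. pderiv_list is f x - pderiv_list is g x) x = f' i - g' i"
  by (rule pderiv_has_derivative)
 moreover have "pderiv_list [i] (pderiv_list is (%x. f x - g x)) x = pderiv_list [i] (%x. pderiv_list is f x - pderiv_list is g x) x"
  by (rule pderiv_list_cong[OF S _ Cons.prems(2)]) (use Cons.IH "is" in auto)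
 ultimately show ?case using pderiv_has_derivative[OF f', of i] pderiv_has_derivative[OF g', of i] by simp
qed simp

lemma smooth_on_diff:
 assumes S: "open S" and f: "smooth_on S f" and g: "smooth_on S g"
 shows "smooth_on S (%x. f x - g x)"
 unfolding smooth_on_def differentiable_on_eq_differentiable_at[OF S]
proof (intro allI impI ballI)
 fix "is" and x assume i: "set is \<subseteq> (Basis :: 'a set)" and x: "x : S"
 show "pderiv_list is (%x. f x - g x) differentiable at x"
  by (rule differentiable_transform_open[OF differentiable_diff[OF smooth_on_differentiable[OF f S i x] smooth_on_differentiable[OF g S i x]] S x])
   (rule pderiv_list_diff[OF S f g i, symmetric])
qed

text \<open>An algebra whose generators are closed under partial differentiation consists of smooth functions.\<close>

inductive_set alg :: "('a::euclidean_space => 'b::real_normed_algebra_1) set => ('a => 'b) set" for G where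
 gen: "g : G ==> g : alg G"
| const: "(%x. c) : alg G"
| add: "f : alg G ==> g : alg G ==> (%x. f x + g x) : alg G"
| mult: "f : alg G ==> g : alg G ==> (%x. f x * g x) : alg G"

lemma alg_deriv:
 assumes S: "open S"
  and G: "!!g x. g : G ==> x : S ==> g differentiable (at x)"
  and D: "!!g i. g : G ==> i : Basis ==> EX h:alg G. ALL x:S. pderiv_list [i] g x = h x"
  and f: "f : alg G"
 shows "(ALL x:S. f differentiable (at x)) & (ALL i:Basis. EX h:alg G. ALL x:S. pderiv_list [i] f x = h x)"
 using f
proof induction
 case (gen g)
 then show ?case using G D by blast
next
 case (const c)
 have "pderiv_list [i] (%x. c) x = 0" for i x :: 'a
  by (rule pderiv_has_derivative[where f'="%_. 0"]) simp
 then show ?case by (auto intro!: bexI[OF _ alg.const[of 0]])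
next
 case (add f g)
 have pd: "pderiv_list [i] (%x. f x + g x) x = pderiv_list [i] f x + pderiv_list [i] g x" if x: "x : S" for i x
 proof -
  obtain f' g' where f': "(f has_derivative f') (at x)" and g': "(g has_derivative g') (at x)"
   using add x by (meson differentiable_def)
  show ?thesis
   using pderiv_has_derivative[OF has_derivative_add[OF f' g'], of i] pderiv_has_derivative[OF f', of i] pderiv_has_derivative[OF g', of i] by simp
 qed
 have "EX h:alg G. ALL x:S. pderiv_list [i] (%x. f x + g x) x = h x" if i: "i : Basis" for i
 proof -
  obtain h1 h2 where "h1 : alg G" "h2 : alg G" "ALL x:S. pderiv_list [i] f x = h1 x" "ALL x:S. pderiv_list [i] g x = h2 x"
   using add.IH i by meson
  then show ?thesis using pd by (intro bexI[of _ "%x. h1 x + h2 x"] alg.add) auto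
 qed
 moreover have "ALL x:S. (%x. f x + g x) differentiable (at x)" using add.IH by (auto intro: differentiable_add)
 ultimately show ?case by blast
next
 case (mult f g)
 have pd: "pderiv_list [i] (%x. f x * g x) x = f x * pderiv_list [i] g x + pderiv_list [i] f x * g x" if x: "x : S" for i x
 proof -
  obtain f' g' where f': "(f has_derivative f') (at x)" and g': "(g has_derivative g') (at x)"
   using mult x by (meson differentiable_def)
  show ?thesis
   using pderiv_has_derivative[OF has_derivative_mult[OF f' g'], of i] pderiv_has_derivative[OF f', of i] pderiv_has_derivative[OF g', of i] by simp
 qed
 have "EX h:alg G. ALL x:S. pderiv_list [i] (%x. f x * g x) x = h x" if i: "i : Basis" for i
 proof -
  obtain h1 h2 where "h1 : alg G" "h2 : alg G" "ALL x:S. pderiv_list [i] f x = h1 x" "ALL x:S. pderiv_list [i] g x = h2 x"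
   using mult.IH i by meson
  then show ?thesis using pd mult.hyps by (intro bexI[of _ "%x. f x * h2 x + h1 x * g x"] alg.add alg.mult) auto
 qed
 moreover have "ALL x:S. (%x. f x * g x) differentiable (at x)"
  using mult.IH unfolding differentiable_def by (blast intro: has_derivative_mult)
 ultimately show ?case by blast
qed

lemma alg_smooth:
 assumes S: "open S"
  and G: "!!g x. g : G ==> x : S ==> g differentiable (at x)"
  and D: "!!g i. g : G ==> i : Basis ==> EX h:alg G. ALL x:S. pderiv_list [i] g x = h x"
  and f: "f : alg G"
 shows "set is \<subseteq> Basis ==> EX h:alg G. ALL x:S. pderiv_list is f x = h x" and "smooth_on S f"
proof -
 have dd: "(ALL x:S. f differentiable (at x)) & (ALL i:Basis. EX h:alg G. ALL x:S. pderiv_list [i] f x = h x)" if "f : alg G" for f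
  by (rule alg_deriv[OF S G D that])
 show *: "EX h:alg G. ALL x:S. pderiv_list is f x = h x" if "set is \<subseteq> Basis" for "is"
  using that
 proof (induction "is")
  case Nil
  then show ?case using f by auto
 next
  case (Cons i "is")
  then obtain h where h: "h : alg G" "!!x. x : S ==> pderiv_list is f x = h x" by auto
  then obtain h' where h': "h' : alg G" "!!x. x : S ==> pderiv_list [i] h x = h' x" using dd[OF h(1)] Cons.prems by auto
  have "pderiv_list (i # is) f x = h' x" if "x : S" for x
  proof -
   have "pderiv_list [i] (pderiv_list is f) x = pderiv_list [i] h x" by (rule pderiv_list_cong[OF S h(2) that])
   then show ?thesis using h'(2)[OF that] by simp
  qed
  then show ?case using h'(1) by blast
 qed
 show "smooth_on S f"
  unfolding smooth_on_def differentiable_on_eq_differentiable_at[OF S]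
 proof (intro allI impI ballI)
  fix "is" and x assume i: "set is \<subseteq> (Basis :: 'a set)" and x: "x : S"
  obtain h where h: "h : alg G" "!!x. x : S ==> pderiv_list is f x = h x" using *[OF i] by blast
  have "h differentiable at x" using dd[OF h(1)] x by blast
  then show "pderiv_list is f differentiable at x"
   by (rule differentiable_transform_open[OF _ S x]) (simp add: h(2))
 qed
qed

lemma alg_bounded:
 assumes G: "!!g. g : G ==> EX B. ALL x:T. norm (g x) <= B" and f: "f : alg G"
 shows "EX B. ALL x:T. norm (f x) <= B"
 using f
proof induction
 case (add f g)
 then obtain B B' where "ALL x:T. norm (f x) <= B" "ALL x:T. norm (g x) <= B'" by blast
 then show ?case by (intro exI[of _ "B + B'"]) (auto intro: norm_triangle_le add_mono)
next
 case (mult f g)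
 then obtain B B' where B: "ALL x:T. norm (f x) <= B" "ALL x:T. norm (g x) <= B'" by blast
 have "norm (f x * g x) <= B * B'" if "x : T" for x
 proof -
  have "B >= 0" using B(1) that norm_ge_zero[of "f x"] order_trans by blast
  then have "norm (f x) * norm (g x) <= B * B'" using B that by (intro mult_mono) auto
  then show ?thesis using norm_mult_ineq order_trans by blast
 qed
 then show ?case by blast
qed (use G in auto)

lemma alg_prod:
 fixes g :: "'c => 'a::euclidean_space => 'b::{real_normed_algebra_1, comm_monoid_mult}"
 assumes "finite I" "!!i. i : I ==> g i : alg G"
 shows "(%x. \<Prod>i\<in>I. g i x) : alg G"
 using assms by (induction I) (auto intro: alg.intros)

section \<open>Smooth bump functions\<close>

definition flat :: "real => nat => real => real" where
 "flat c m t = (if t > 0 then exp (- c / t) * (1 / t) ^ m else 0)"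

lemma flat_tendsto_0:
 assumes c: "c > 0" shows "(flat c m ---> 0) (at_right 0)"
proof -
 have "((%x. x ^ m / exp x) ---> (0::real)) at_top" by (rule tendsto_power_div_exp_0)
 moreover have "filterlim (%t. c / t) at_top (at_right 0)"
  using filterlim_tendsto_pos_mult_at_top[OF tendsto_const c filterlim_inverse_at_top_right] by (simp add: divide_inverse)
 ultimately have "((%t. (c / t) ^ m / exp (c / t)) ---> 0) (at_right 0)"
  by (rule filterlim_compose)
 then have "((%t. (1 / c ^ m) * ((c / t) ^ m / exp (c / t))) ---> (1 / c ^ m) * 0) (at_right 0)"
  by (intro tendsto_intros)
 then have "((%t. (1 / c ^ m) * ((c / t) ^ m / exp (c / t))) ---> 0) (at_right 0)" by simp
 then show ?thesis
  by (rule Lim_transform_eventually) (rule eventually_at_rightI[of 0 1], use c in "auto simp: flat_def exp_minus power_divide field_simps")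
qed

text \<open>The factor \<open>(1 / t) ^ m\<close> is carried along so that the family spans a space
  closed under differentiation. At the origin the right difference quotient is the member of index
  \<open>m + 1\<close>, which tends to \<open>0\<close>.\<close>

lemma flat_deriv:
 assumes c: "c > 0"
 shows "(flat c m has_real_derivative (c * flat c (m + 2) t - real m * flat c (m + 1) t)) (at t)"
proof -
 consider "t > 0" | "t < 0" | "t = 0" by linarith
 then show ?thesis
 proof cases
  case 1
  have "((%t. exp (- c / t) * (1 / t) ^ m) has_real_derivative (c * flat c (m + 2) t - real m * flat c (m + 1) t)) (at t)"
  proof -
   have 1: "((%t. 1 / t) has_real_derivative - (1 / t)\<^sup>2) (at t)"
    using \<open>t > 0\<close> by (auto intro!: derivative_eq_intros simp: power2_eq_square)
   have 2: "((%t. exp (- c / t)) has_real_derivative exp (- c / t) * (c * (1 / t)\<^sup>2)) (at t)"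
    using \<open>t > 0\<close> by (auto intro!: derivative_eq_intros simp: power2_eq_square)
   show ?thesis
    by (rule DERIV_cong[OF DERIV_mult[OF 2 DERIV_power[OF 1, of m]]])
     (use \<open>t > 0\<close> in "cases m; simp add: flat_def power2_eq_square algebra_simps")
  qed
  then show ?thesis
   by (rule has_field_derivative_transform_within_open[of _ _ _ "{0<..}"]) (use 1 in "auto simp: flat_def")
 next
  case 2
  have "((%t. 0) has_real_derivative 0) (at t)" by simp
  then have "(flat c m has_real_derivative 0) (at t)"
   by (rule has_field_derivative_transform_within_open[of _ _ _ "{..<0}"]) (use 2 in "auto simp: flat_def")
  then show ?thesis using 2 by (simp add: flat_def)
 next
  case 3
  have "((%y. (flat c m y - flat c m 0) / (y - 0)) ---> 0) (at 0)"
   unfolding filterlim_at_split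
  proof
   show "((%y. (flat c m y - flat c m 0) / (y - 0)) ---> 0) (at_left 0)"
    by (rule Lim_transform_eventually[OF tendsto_const]) (rule eventually_at_leftI[of "-1" 0], auto simp: flat_def)
   show "((%y. (flat c m y - flat c m 0) / (y - 0)) ---> 0) (at_right 0)"
    by (rule Lim_transform_eventually[OF flat_tendsto_0[OF c, of "Suc m"]]) (rule eventually_at_rightI[of 0 1], auto simp: flat_def)
  qed
  then show ?thesis using 3 by (simp add: has_field_derivative_iff flat_def)
 qed
qed

text \<open>Smooth and positive exactly on the open box; as \<open>c\<close> tends to
  \<open>0\<close> it tends to the indicator function of the box, and it never exceeds
  \<open>1\<close>.\<close>

definition bump :: "real => 'a::euclidean_space => 'a => 'a => real" where
 "bump c a b x = (\<Prod>i\<in>Basis. flat c 0 (x \<bullet> i - a \<bullet> i) * flat c 0 (b \<bullet> i - x \<bullet> i))"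

lemma bump_smooth:
 fixes a b :: "'a::euclidean_space"
 assumes c: "c > 0" shows "smooth_on UNIV (bump c a b)"
proof -
 define G :: "('a => real) set" where
  "G = {%x. flat c m (x \<bullet> i - a \<bullet> i) | m i. i : Basis} \<union> {%x. flat c m (b \<bullet> i - x \<bullet> i) | m i. i : Basis}"
 have d1: "((%x. flat c m (x \<bullet> i - a \<bullet> i)) has_derivative (%h. (h \<bullet> i) * (c * flat c (m + 2) (x \<bullet> i - a \<bullet> i) - real m * flat c (m + 1) (x \<bullet> i - a \<bullet> i)))) (at x)" for m i and x :: 'a
  by (rule DERIV_compose_FDERIV[OF flat_deriv[OF c]]) (auto intro!: derivative_eq_intros)
 have d2: "((%x. flat c m (b \<bullet> i - x \<bullet> i)) has_derivative (%h. - (h \<bullet> i) * (c * flat c (m + 2) (b \<bullet> i - x \<bullet> i) - real m * flat c (m + 1) (b \<bullet> i - x \<bullet> i)))) (at x)" for m i and x :: 'a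
  by (rule DERIV_compose_FDERIV[OF flat_deriv[OF c]]) (auto intro!: derivative_eq_intros)
 have in1: "(%x. flat c m (x \<bullet> i - a \<bullet> i)) : alg G" "(%x. flat c m (b \<bullet> i - x \<bullet> i)) : alg G" if "i : Basis" for m i
  using that by (auto intro!: alg.gen simp: G_def)
 have lin: "(%x. k * (c * u x - k' * v x)) : alg G" if "u : alg G" "v : alg G" for u v :: "'a => real" and k k'
  using alg.mult[OF alg.const[of k] alg.add[OF alg.mult[OF alg.const[of c] that(1)] alg.mult[OF alg.const[of "- k'"] that(2)]]] by simp
 show ?thesis
 proof (rule alg_smooth(2)[of UNIV G])
  show "g differentiable at x" if "g : G" for g x
   using that d1 d2 unfolding G_def differentiable_def by blast
  show "EX h:alg G. ALL x:UNIV. pderiv_list [j] g x = h x" if g: "g : G" and j: "j : Basis" for g j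
   using g[unfolded G_def]
  proof safe
   fix m i assume i: "i : (Basis :: 'a set)"
   show "EX h:alg G. ALL x:UNIV. pderiv_list [j] (%x. flat c m (x \<bullet> i - a \<bullet> i)) x = h x"
    by (rule bexI[OF _ lin[OF in1(1)[OF i] in1(1)[OF i]]]) (rule ballI, rule pderiv_has_derivative[OF d1])
   show "EX h:alg G. ALL x:UNIV. pderiv_list [j] (%x. flat c m (b \<bullet> i - x \<bullet> i)) x = h x"
    by (rule bexI[OF _ lin[OF in1(2)[OF i] in1(2)[OF i]]]) (rule ballI, rule pderiv_has_derivative[OF d2])
  qed
  show "bump c a b : alg G"
   unfolding bump_def[abs_def] by (intro alg_prod alg.mult in1) auto
 qed simp
qed

lemma flat_0_bounds: "c > 0 ==> 0 <= flat c 0 t & flat c 0 t <= 1"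
 by (auto simp: flat_def)

lemma bump_bounds: "c > 0 ==> 0 <= bump c a b x & bump c a b x <= 1"
 unfolding bump_def using flat_0_bounds[of c] by (auto intro!: prod_nonneg prod_le_1 mult_le_one)

lemma bump_support: "c > 0 ==> bump c a b x ~= 0 \<longleftrightarrow> x : box a b"
 unfolding bump_def by (auto simp: flat_def mem_box split: if_splits)

lemma bump_limit:
 fixes a b x :: "'a::euclidean_space"
 shows "(%n. bump (1 / real (Suc n)) a b x) ----> indicator (box a b) x"
proof (cases "x : box a b")
 case True
 have "(%n. flat (1 / real (Suc n)) 0 t) ----> 1" if "t > 0" for t
 proof -
  have "(%n. exp (- (1 / real (Suc n)) / t)) ----> exp (- 0 / t)"
   using LIMSEQ_inverse_real_of_nat that by (intro tendsto_intros) (auto simp: inverse_eq_divide)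
  then show ?thesis using that by (simp add: flat_def)
 qed
 then have "(%n. flat (1 / real (Suc n)) 0 (x \<bullet> i - a \<bullet> i) * flat (1 / real (Suc n)) 0 (b \<bullet> i - x \<bullet> i)) ----> 1 * 1" if "i : Basis" for i
  using True that by (intro tendsto_mult) (auto simp: mem_box)
 then have "(%n. \<Prod>i\<in>Basis. flat (1 / real (Suc n)) 0 (x \<bullet> i - a \<bullet> i) * flat (1 / real (Suc n)) 0 (b \<bullet> i - x \<bullet> i)) ----> (\<Prod>i\<in>(Basis :: 'a set). 1 * 1)"
  by (rule tendsto_prod)
 then have "(%n. bump (1 / real (Suc n)) a b x) ----> (\<Prod>i\<in>(Basis :: 'a set). 1 * 1)"
  unfolding bump_def .
 then show ?thesis using True by simp
next
 case False
 then have "bump (1 / real (Suc n)) a b x = 0" for n using bump_support[of "1 / real (Suc n)" a b x] by auto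
 then show ?thesis using False by simp
qed

section \<open>Weak derivatives\<close>

lemma L2_on_iff: "L2_on \<Omega> u \<longleftrightarrow> u : L2M (lebesgue_on \<Omega>)"
 by (auto simp: L2_on_def L2M_def)

definition testf :: "'a::euclidean_space set => ('a => real) => bool" where
 "testf \<Omega> \<phi> \<longleftrightarrow> smooth_on UNIV \<phi> & compact (closure {x. \<phi> x ~= 0}) & closure {x. \<phi> x ~= 0} \<subseteq> \<Omega>"

lemma integrable_ball_bound:
 fixes f :: "'a::euclidean_space => 'b::{banach, second_countable_topology}"
 assumes "f : borel_measurable lborel" "!!x. norm (f x) <= B" "!!x. norm x >= r ==> f x = 0"
 shows "integrable lborel f"
proof (rule Bochner_Integration.integrable_bound[of lborel "%x. B * indicator (ball (0::'a) r) x"])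
 show "integrable lborel (%x. B * indicator (ball (0::'a) r) x)"
  using emeasure_lborel_ball_finite[of "0::'a" r] by (intro integrable_mult_right) (auto simp: integrable_indicator_iff)
 show "AE x in lborel. norm (f x) <= norm (B * indicator (ball 0 r) x)"
 proof (rule AE_I2)
  fix x
  have "B >= 0" using assms(2)[of x] norm_ge_zero[of "f x"] by linarith
  then show "norm (f x) <= norm (B * indicator (ball 0 r) x)" using assms(2,3)[of x] by (cases "norm x >= r") auto
 qed
qed (use assms in auto)

text \<open>By translation invariance the difference quotients of \<open>w\<close> have integral
  zero. They are bounded by the mean value theorem, live in a fixed ball and converge to the
  derivative.\<close>

lemma integral_pderiv_zero:
 fixes w :: "'a::euclidean_space => complex"
 assumes d: "!!x. w differentiable (at x)" and D: "continuous_on UNIV (pderiv_list [i] w)"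
  and K: "compact K" "!!x. x \<notin> K ==> w x = 0"
 shows "(LINT x|lborel. pderiv_list [i] w x) = 0"
proof -
 let ?D = "pderiv_list [i] w"
 have D0: "?D x = 0" if "x \<notin> K" for x
 proof -
  have "?D x = pderiv_list [i] (%_. 0) x"
   by (rule pderiv_list_cong[of "- K"]) (use K that compact_imp_closed in auto)
  also have "... = 0" by (rule pderiv_has_derivative[where f'="%_. 0"]) simp
  finally show ?thesis .
 qed
 have "compact (?D ` K)" using D K by (intro compact_continuous_image) (auto intro: continuous_on_subset)
 then obtain B0 where B0: "!!x. x : K ==> norm (?D x) <= B0" by (meson bounded_iff compact_imp_bounded imageI)
 define B where "B = max B0 0"
 have B: "norm (?D x) <= B" "B >= 0" for x using B0[of x] D0[of x] by (cases "x : K"; force simp: B_def)+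
 obtain r where r: "!!x. x : K ==> norm x <= r" using compact_imp_bounded[OF K(1)] by (auto simp: bounded_iff)
 have cw: "continuous_on UNIV w" using d by (intro differentiable_imp_continuous_on) (auto simp: differentiable_on_def)
 then have wm[measurable]: "w : borel_measurable borel" by (rule borel_measurable_continuous_onI)
 have Dm[measurable]: "?D : borel_measurable borel" using D by (rule borel_measurable_continuous_onI)
 have vd: "((%t. w (x + t *R i)) has_vector_derivative ?D (x + s *R i)) (at s)" for x s
 proof -
  obtain w' where w': "(w has_derivative w') (at (x + s *R i))" using d by (auto simp: differentiable_def)
  have "((%t::real. x + t *R i) has_derivative (%t. t *R i)) (at s)"
   by (auto intro!: derivative_eq_intros)
  then have "((%t. w (x + t *R i)) has_derivative (%t. w' (t *R i))) (at s)"
   using has_derivative_compose[of "%t. x + t *R i" "%t. t *R i" s UNIV w w'] w' by simp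
  moreover have "w' (t *R i) = t *R w' i" for t
   using has_derivative_linear[OF w'] by (rule linear_cmul)
  ultimately show ?thesis using pderiv_has_derivative[OF w', of i] by (simp add: has_vector_derivative_def)
 qed
 define h where "h n = 1 / real (Suc n)" for n
 have h: "h n > 0" "h n <= 1" "h n ~= 0" for n by (auto simp: h_def)
 have h0: "h ----> 0" unfolding h_def using LIMSEQ_inverse_real_of_nat by (simp add: inverse_eq_divide)
 define f where "f n x = (w (x + h n *R i) - w x) /\<^sub>R h n" for n x
 have fb: "norm (f n x) <= B" for n x
 proof -
  have "norm (w (x + h n *R i) - w (x + 0 *R i)) <= B * norm (h n - 0)"
  proof (rule differentiable_bound[of "{0..h n}" "%t. w (x + t *R i)" "%s t. t *R ?D (x + s *R i)"])
   show "((%t. w (x + t *R i)) has_derivative (%t. t *R ?D (x + s *R i))) (at s within {0..h n})" for s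
    using vd[of x s] unfolding has_vector_derivative_def by (rule has_derivative_at_withinI)
   show "onorm (%t. t *R ?D (x + s *R i)) <= B" for s
    by (rule onorm_bound) (use B in "auto simp: mult.commute[of B] intro!: mult_left_mono simp del: pderiv_list.simps")
  qed (use h[of n] in auto)
  moreover have "norm (f n x) = norm (w (x + h n *R i) - w x) / h n"
   unfolding f_def norm_scaleR using h[of n] by (simp add: divide_inverse mult.commute)
  ultimately show ?thesis using h[of n] by (simp add: pos_divide_le_eq)
 qed
 have wi: "integrable lborel w"
 proof -
  have "compact (w ` K)" using cw K by (intro compact_continuous_image) (auto intro: continuous_on_subset)
  then obtain B1 where B1: "!!x. x : K ==> norm (w x) <= B1" by (meson bounded_iff compact_imp_bounded imageI)
  show ?thesis
  proof (rule integrable_ball_bound[of w "max B1 0" "r + 1"])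
   show "norm (w x) <= max B1 0" for x using B1[of x] K(2)[of x] by (cases "x : K") auto
   show "w x = 0" if "norm x >= r + 1" for x using r[of x] that K(2) by force
  qed simp
 qed
 have tr: "integrable lborel (%x. w (x + c)) & (LINT x|lborel. w (x + c)) = (LINT x|lborel. w x)" for c
 proof -
  have "lborel = distr lborel borel ((+) c)" by (rule lborel_distr_plus[symmetric])
  then have "integrable (distr lborel borel ((+) c)) w" "(LINT x|distr lborel borel ((+) c). w x) = (LINT x|lborel. w x)" using wi by simp_all
  then show ?thesis by (simp add: integrable_distr_eq integral_distr add.commute)
 qed
 have f0: "(LINT x|lborel. f n x) = 0" for n
  unfolding f_def using tr[of "h n *R i"] wi by simp
 have "(%n. LINT x|lborel. f n x) ----> (LINT x|lborel. ?D x)"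
 proof (rule integral_dominated_convergence)
  show "f n : borel_measurable lborel" for n unfolding f_def by measurable
  show "integrable lborel (%x. B * indicator (ball (0::'a) (r + 1 + norm i)) x)"
   using emeasure_lborel_ball_finite[of "0::'a"] by (intro integrable_mult_right) (auto simp: integrable_indicator_iff)
  show "AE x in lborel. norm (f n x) <= B * indicator (ball 0 (r + 1 + norm i)) x" for n
  proof (rule AE_I2)
   fix x
   show "norm (f n x) <= B * indicator (ball 0 (r + 1 + norm i)) x"
   proof (cases "norm x < r + 1 + norm i")
    case False
    have hn: "norm (h n *R i) <= norm i" using h[of n] by (simp add: mult_left_le_one_le)
    have "norm x <= norm (x + h n *R i) + norm (h n *R i)"
     using norm_triangle_ineq4[of "x + h n *R i" "h n *R i"] by simp
    then have "norm (x + h n *R i) > r" "norm x > r" using False hn norm_ge_zero[of i] by linarith+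
    then have "f n x = 0" unfolding f_def using r K(2) by (metis diff_self linorder_not_less scaleR_zero_right)
    then show ?thesis using B by simp
   qed (use fb in auto)
  qed
  show "AE x in lborel. (%n. f n x) ----> ?D x"
  proof (rule AE_I2)
   fix x
   have "((%t. norm (w (x + t *R i) - w x - t *R ?D x) / norm t) ---> 0) (at 0)"
    using vd[of x 0] unfolding has_vector_derivative_def has_derivative_at by simp
   moreover have "\<forall>\<^sub>F t in at 0. norm (w (x + t *R i) - w x - t *R ?D x) / norm t = norm ((w (x + t *R i) - w x) /\<^sub>R t - ?D x)"
   proof -
    have "norm (w (x + t *R i) - w x - t *R ?D x) / norm t = norm ((w (x + t *R i) - w x) /\<^sub>R t - ?D x)" if "t ~= 0" for t
    proof -
     have "(w (x + t *R i) - w x) /\<^sub>R t - ?D x = (w (x + t *R i) - w x - t *R ?D x) /\<^sub>R t"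
      using that by (simp only: scaleR_diff_right scaleR_scaleR) simp
     then show ?thesis by (simp only: norm_scaleR) (simp add: divide_inverse mult.commute)
    qed
    then show ?thesis by (simp add: eventually_at_filter)
   qed
   ultimately have "((%t. norm ((w (x + t *R i) - w x) /\<^sub>R t - ?D x)) ---> 0) (at 0)"
    by (rule Lim_transform_eventually)
   then have "((%t. (w (x + t *R i) - w x) /\<^sub>R t) ---> ?D x) (at 0)"
    by (rule LIM_zero_cancel[OF tendsto_norm_zero_cancel])
   moreover have "filterlim h (at 0) sequentially" unfolding filterlim_at using h h0 by auto
   ultimately show "(%n. f n x) ----> ?D x" unfolding f_def by (rule filterlim_compose)
  qed
 qed (use Dm in "simp del: pderiv_list.simps")
 then show ?thesis unfolding f0 by (simp add: LIMSEQ_const_iff del: pderiv_list.simps)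
qed

lemma lebesgue_on_integral:
 fixes f :: "'a::euclidean_space => complex"
 assumes "open \<Omega>" "continuous_on \<Omega> f"
 shows "(LINT x|lebesgue_on \<Omega>. f x) = (LINT x|lborel. (if x : \<Omega> then f x else 0))"
  and "integrable (lebesgue_on \<Omega>) f \<longleftrightarrow> integrable lborel (%x. if x : \<Omega> then f x else 0)"
proof -
 have eq: "(%x. indicator \<Omega> x *R f x) = (%x. if x : \<Omega> then f x else 0)" by (auto simp: indicator_def)
 have m: "(%x. if x : \<Omega> then f x else 0) : borel_measurable lborel"
  using borel_measurable_continuous_on_if[of \<Omega> f "%_. 0"] assms by simp
 show "(LINT x|lebesgue_on \<Omega>. f x) = (LINT x|lborel. (if x : \<Omega> then f x else 0))"
  using assms m by (subst integral_restrict_space) (auto simp: eq integral_completion)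
 show "integrable (lebesgue_on \<Omega>) f \<longleftrightarrow> integrable lborel (%x. if x : \<Omega> then f x else 0)"
  using assms m by (subst integrable_restrict_space) (auto simp: eq integrable_completion)
qed

lemma cc_integrable:
 fixes f :: "'a::euclidean_space => complex"
 assumes O: "open \<Omega>" and f: "continuous_on \<Omega> f" and K: "compact K" "K \<subseteq> \<Omega>" "!!x. x : \<Omega> - K ==> f x = 0"
 shows "integrable (lebesgue_on \<Omega>) f"
 unfolding lebesgue_on_integral(2)[OF O f]
proof -
 obtain r where r: "!!x. x : K ==> norm x <= r" using compact_imp_bounded[OF K(1)] by (auto simp: bounded_iff)
 have "compact (f ` K)" using f K by (intro compact_continuous_image) (auto intro: continuous_on_subset)
 then obtain B1 where B1: "!!x. x : K ==> norm (f x) <= B1" by (meson bounded_iff compact_imp_bounded imageI)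
 show "integrable lborel (%x. if x : \<Omega> then f x else 0)"
 proof (rule integrable_ball_bound[of _ "max B1 0" "r + 1"])
  show "(%x. if x : \<Omega> then f x else 0) : borel_measurable lborel"
   using borel_measurable_continuous_on_if[of \<Omega> f "%_. 0"] O f by simp
  show "norm (if x : \<Omega> then f x else 0) <= max B1 0" for x using B1[of x] K(3)[of x] by (cases "x : K") auto
  show "(if x : \<Omega> then f x else 0) = 0" if "norm x >= r + 1" for x using r[of x] that K(3)[of x] by force
 qed
qed

text \<open>The product of \<open>\<phi>\<close> and \<open>u\<close>, extended by zero, has a
  continuous derivative everywhere because \<open>\<Omega>\<close> and the complement of
  \<open>K\<close> cover the space; \<open>integral_pderiv_zero\<close> then applies to it.\<close>

lemma integration_by_parts:
 fixes u :: "'a::euclidean_space => complex" and \<phi> :: "'a => real"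
 assumes O: "open \<Omega>" and u: "smooth_on \<Omega> u" and p: "smooth_on UNIV \<phi>" and i: "i : Basis"
  and K: "compact K" "K \<subseteq> \<Omega>" "!!x. x \<notin> K ==> \<phi> x = 0"
 shows "(LINT x|lebesgue_on \<Omega>. pderiv_list [i] \<phi> x *R u x) = - (LINT x|lebesgue_on \<Omega>. \<phi> x *R pderiv_list [i] u x)"
proof -
 define w where "w x = (if x : \<Omega> then \<phi> x *R u x else 0)" for x
 have Kc: "open (- K)" using K(1) compact_imp_closed by auto
 have w0: "w x = 0" if "x \<notin> K" for x using K(3)[OF that] by (simp add: w_def)
 have dp: "\<phi> differentiable at x" for x using smooth_on_differentiable[OF p, of "[]" x] by simp
 have du: "u differentiable at x" if "x : \<Omega>" for x using smooth_on_differentiable[OF u O, of "[]" x] that by simp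
 define v where "v x = pderiv_list [i] \<phi> x *R u x + \<phi> x *R pderiv_list [i] u x" for x
 have wd: "w differentiable at x & pderiv_list [i] w x = v x" if x: "x : \<Omega>" for x
 proof -
  obtain p' u' where p': "(\<phi> has_derivative p') (at x)" and u': "(u has_derivative u') (at x)"
   using dp[of x] du[OF x] by (auto simp: differentiable_def)
  have "((%x. \<phi> x *R u x) has_derivative (%h. \<phi> x *R u' h + p' h *R u x)) (at x)"
   by (rule has_derivative_scaleR[OF p' u'])
  then have "(w has_derivative (%h. \<phi> x *R u' h + p' h *R u x)) (at x)"
   by (rule has_derivative_transform_within_open[OF _ O x]) (simp add: w_def)
  then show ?thesis
   using pderiv_has_derivative[of w _ x i] pderiv_has_derivative[OF p', of i] pderiv_has_derivative[OF u', of i]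
   by (auto simp: differentiable_def v_def add.commute)
 qed
 have wd0: "w differentiable at x & pderiv_list [i] w x = 0" if x: "x \<notin> K" for x
 proof -
  have "((%_. 0) has_derivative (%_. 0)) (at x)" by simp
  then have "(w has_derivative (%_. 0)) (at x)"
   by (rule has_derivative_transform_within_open[OF _ Kc]) (use x w0 in auto)
  then show ?thesis using pderiv_has_derivative[of w _ x i] by (auto simp: differentiable_def)
 qed
 have cont: "continuous_on \<Omega> u" "continuous_on \<Omega> (pderiv_list [i] u)" "continuous_on \<Omega> \<phi>" "continuous_on \<Omega> (pderiv_list [i] \<phi>)"
  using smooth_on_continuous[OF u, of "[]"] smooth_on_continuous[OF u, of "[i]"]
   smooth_on_continuous[OF p, of "[]"] smooth_on_continuous[OF p, of "[i]"] i continuous_on_subset[OF _ subset_UNIV] by auto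
 have cv: "continuous_on \<Omega> v" unfolding v_def using cont by (intro continuous_intros)
 have "continuous_on \<Omega> (pderiv_list [i] w)" using cv wd by (simp cong: continuous_on_cong)
 moreover have "continuous_on (- K) (pderiv_list [i] w)" using wd0 continuous_on_const[of "- K" "0::complex"] by (subst continuous_on_cong[OF refl, where g="%_. 0"]) auto
 ultimately have "continuous_on (\<Omega> \<union> - K) (pderiv_list [i] w)" using O Kc by (rule continuous_on_open_Un[rotated 2])
 moreover have "\<Omega> \<union> - K = UNIV" using K by auto
 ultimately have cD: "continuous_on UNIV (pderiv_list [i] w)" by simp
 have "(LINT x|lborel. pderiv_list [i] w x) = 0"
  by (rule integral_pderiv_zero[OF _ cD K(1) w0]) (use wd wd0 K in blast)
 moreover have "pderiv_list [i] w x = (if x : \<Omega> then v x else 0)" for x using wd wd0 K by auto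
 ultimately have "(LINT x|lebesgue_on \<Omega>. v x) = 0" using lebesgue_on_integral(1)[OF O cv] by simp
 moreover have D0: "pderiv_list [i] \<phi> x = 0" if "x \<notin> K" for x
 proof -
  have "((%_. 0) has_derivative (%_. 0)) (at x)" by simp
  then have "(\<phi> has_derivative (%_. 0)) (at x)"
   by (rule has_derivative_transform_within_open[OF _ Kc]) (use that K(3) in auto)
  then show ?thesis using pderiv_has_derivative[of \<phi> _ x i] by simp
 qed
 have "(LINT x|lebesgue_on \<Omega>. v x) = (LINT x|lebesgue_on \<Omega>. pderiv_list [i] \<phi> x *R u x) + (LINT x|lebesgue_on \<Omega>. \<phi> x *R pderiv_list [i] u x)"
  unfolding v_def
  by (intro Bochner_Integration.integral_add cc_integrable[OF O _ K(1,2)]) (use cont D0 K(3) in "auto intro!: continuous_intros")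
 ultimately show ?thesis by (simp add: eq_neg_iff_add_eq_0)
qed

lemma testf_pderiv:
 assumes "testf \<Omega> \<phi>" "set is \<subseteq> Basis"
 shows "smooth_on UNIV (pderiv_list is \<phi>)" and "x \<notin> closure {x. \<phi> x ~= 0} ==> pderiv_list is \<phi> x = 0"
proof -
 show "smooth_on UNIV (pderiv_list is \<phi>)" using assms smooth_on_pderiv by (auto simp: testf_def)
 have z: "pderiv_list js (%_. 0 :: real) x = 0" for js and x :: 'a
 proof (induction js arbitrary: x)
  case (Cons j js)
  then have "pderiv_list js (%_. 0 :: real) = (%_::'a. 0)" by auto
  then show ?case by simp
 qed simp
 assume "x \<notin> closure {x. \<phi> x ~= 0}"
 then have "pderiv_list is \<phi> x = pderiv_list is (%_. 0) x"
 proof (intro pderiv_list_cong[of "- closure {x. \<phi> x ~= 0}"])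
  fix y assume "y : - closure {x. \<phi> x ~= 0}"
  then show "\<phi> y = 0" using closure_subset[of "{x. \<phi> x ~= 0}"] by blast
 qed auto
 then show "pderiv_list is \<phi> x = 0" using z by simp
qed

lemma weak_pderiv_iff: "weak_pderiv \<Omega> is u v \<longleftrightarrow> (ALL \<phi>. testf \<Omega> \<phi> \<longrightarrow>
    (LINT x|lebesgue_on \<Omega>. pderiv_list is \<phi> x *R u x) = (-1) ^ length is * (LINT x|lebesgue_on \<Omega>. \<phi> x *R v x))"
 unfolding weak_pderiv_def testf_def by simp

text \<open>The outermost derivative of \<open>\<phi>\<close> is moved first and becomes the
  innermost one of \<open>u\<close>. Hence \<open>rev\<close>, which avoids any appeal to the
  symmetry of mixed derivatives.\<close>

lemma weak_pderiv_smooth: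
 fixes u :: "'a::euclidean_space => complex"
 assumes O: "open \<Omega>" and u: "smooth_on \<Omega> u" and i: "set is \<subseteq> Basis"
 shows "weak_pderiv \<Omega> is u (pderiv_list (rev is) u)"
 unfolding weak_pderiv_iff
proof (intro allI impI)
 fix \<phi> :: "'a => real" assume p: "testf \<Omega> \<phi>"
 show "(LINT x|lebesgue_on \<Omega>. pderiv_list is \<phi> x *R u x) = (-1) ^ length is * (LINT x|lebesgue_on \<Omega>. \<phi> x *R pderiv_list (rev is) u x)"
  using i u
 proof (induction "is" arbitrary: u)
  case (Cons i "is")
  note tp = testf_pderiv[OF p, of "is"]
  have "(LINT x|lebesgue_on \<Omega>. pderiv_list (i # is) \<phi> x *R u x) = (LINT x|lebesgue_on \<Omega>. pderiv_list [i] (pderiv_list is \<phi>) x *R u x)" by simp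
  also have "... = - (LINT x|lebesgue_on \<Omega>. pderiv_list is \<phi> x *R pderiv_list [i] u x)"
   using Cons.prems p tp by (intro integration_by_parts[OF O Cons.prems(2), where K="closure {x. \<phi> x ~= 0}"]) (auto simp: testf_def)
  also have "(LINT x|lebesgue_on \<Omega>. pderiv_list is \<phi> x *R pderiv_list [i] u x) =
    (-1) ^ length is * (LINT x|lebesgue_on \<Omega>. \<phi> x *R pderiv_list (rev is) (pderiv_list [i] u) x)"
   using Cons.prems by (intro Cons.IH smooth_on_pderiv) auto
  finally show ?case by (simp add: pderiv_list_append del: pderiv_list.simps)
 qed simp
qed

lemma borel_measurable_lebesgue_on:
 "f : borel_measurable borel ==> f : borel_measurable (lebesgue_on \<Omega>)"
 by (intro measurable_restrict_space1 measurable_completion) simp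

lemma finite_lebesgue_on:
 fixes \<Omega> :: "'a::euclidean_space set"
 assumes "open \<Omega>" "bounded \<Omega>"
 shows "finite_measure (lebesgue_on \<Omega>)"
proof (rule finite_measureI)
 have "emeasure lborel \<Omega> < \<infinity>" using assms(2) by (rule emeasure_bounded_finite)
 then show "emeasure (lebesgue_on \<Omega>) (space (lebesgue_on \<Omega>)) ~= \<infinity>"
  using assms by (simp add: space_restrict_space emeasure_restrict_space)
qed

lemma testf_bump:
 assumes "c > 0" "cbox a b \<subseteq> \<Omega>"
 shows "testf \<Omega> (bump c a b)"
proof -
 have "{x. bump c a b x ~= 0} = box a b" using bump_support[OF assms(1), of a b] by auto
 moreover have "closure (box a b) \<subseteq> cbox a b" by (rule closure_minimal) (auto simp: box_subset_cbox)
 ultimately show ?thesis using assms bump_smooth[OF assms(1)] by (auto simp: testf_def bounded_box)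
qed

lemma borel_eq_sigma_boxes: "sets borel = sigma_sets UNIV (range (%(a, b). box a b :: 'a::euclidean_space set))"
 by (simp add: borel_eq_box)

text \<open>Bump functions give zero integrals over boxes. Boxes generate the Borel sets and are
  stable under intersection, so the integral over every measurable part of a box vanishes; countably
  many boxes cover the domain.\<close>

lemma fundamental_lemma:
 fixes d :: "'a::euclidean_space => complex"
 assumes O: "open \<Omega>" and bd: "bounded \<Omega>" and d: "integrable (lebesgue_on \<Omega>) d"
  and z: "!!\<phi>. testf \<Omega> \<phi> ==> (LINT x|lebesgue_on \<Omega>. \<phi> x *R d x) = 0"
 shows "AE x in lebesgue_on \<Omega>. d x = 0"
proof -
 let ?M = "lebesgue_on \<Omega>"
 interpret finite_measure ?M by (rule finite_lebesgue_on[OF O bd])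
 have dm[measurable]: "d : borel_measurable ?M" using d by simp
 have Ol: "\<Omega> : sets lebesgue" using O by simp
 have sM: "A : sets ?M" if "A : sets borel" "A \<subseteq> \<Omega>" for A
  using that Ol by (auto simp: sets_restrict_space_iff)
 have box0: "(LINT x:box a b|?M. d x) = 0" if ab: "cbox a b \<subseteq> \<Omega>" for a b
 proof -
  have "(%n. LINT x|?M. bump (1 / real (Suc n)) a b x *R d x) ----> (LINT x|?M. indicator (box a b) x *R d x)"
  proof (rule integral_dominated_convergence)
   have bm: "bump (1 / real (Suc n)) a b : borel_measurable borel" for n
    using smooth_on_continuous[OF bump_smooth, of "1 / real (Suc n)" "[]" a b] by (intro borel_measurable_continuous_onI) simp
   note [measurable] = borel_measurable_lebesgue_on[OF bm]
   show "(%x. bump (1 / real (Suc n)) a b x *R d x) : borel_measurable ?M" for n by measurable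
   have [measurable]: "box a b : sets ?M" using ab by (intro sM) (auto simp: subset_iff mem_box less_imp_le)
   show "(%x. indicator (box a b) x *R d x) : borel_measurable ?M" by measurable
   show "integrable ?M (%x. norm (d x))" using d by simp
   show "AE x in ?M. (%n. bump (1 / real (Suc n)) a b x *R d x) ----> indicator (box a b) x *R d x"
    by (intro AE_I2 tendsto_intros bump_limit)
   show "AE x in ?M. norm (bump (1 / real (Suc n)) a b x *R d x) <= norm (d x)" for n
    using bump_bounds[of "1 / real (Suc n)" a b] by (intro AE_I2) (auto intro!: mult_left_le_one_le)
  qed
  then show ?thesis
   unfolding set_lebesgue_integral_def using z[OF testf_bump[OF _ ab]] by (simp add: LIMSEQ_const_iff)
 qed
 have AEbox: "AE x in ?M. indicator (box a b) x *R d x = 0" if ab: "cbox a b \<subseteq> \<Omega>" for a b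
 proof -
  let ?B = "box a b"
  have BO: "?B \<subseteq> \<Omega>" using ab by (auto simp: subset_iff mem_box less_imp_le)
  have si: "set_integrable ?M A d" if "A : sets ?M" for A
   unfolding set_integrable_def by (rule integrable_mult_indicator[OF that d])
  have bor: "(LINT x:(A \<inter> ?B)|?M. d x) = 0" if A: "A : sets borel" for A
   using A unfolding borel_eq_sigma_boxes
  proof (induction rule: sigma_sets_induct_disjoint[rotated 2, consumes 1, case_names basic empty compl union stable pow])
   case stable
   show ?case by (auto simp: Int_stable_def box_Int_box)
  next
   case pow
   show ?case by simp
  next
   case (basic A)
   then obtain p q where A: "A = box p q" by auto
   obtain l u where lu: "A \<inter> ?B = box l u" unfolding A box_Int_box by blast
   show ?case
   proof (cases "box l u = {}")
    case True
    then show ?thesis unfolding lu by (simp add: set_lebesgue_integral_def)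
   next
    case False
    have "cbox l u = closure (box l u)" using False by (simp add: closure_box)
    also have "... \<subseteq> cbox a b" unfolding lu[symmetric] by (rule closure_minimal) (use box_subset_cbox in auto)
    finally show ?thesis unfolding lu using ab by (intro box0) auto
   qed
  next
   case empty
   show ?case by (simp add: set_lebesgue_integral_def)
  next
   case (compl A)
   then have Ab: "A : sets borel" unfolding borel_eq_sigma_boxes by simp
   have "(LINT x:?B|?M. d x) = (LINT x:(A \<inter> ?B)|?M. d x) + (LINT x:((UNIV - A) \<inter> ?B)|?M. d x)"
   proof -
    have e: "?B = (A \<inter> ?B) \<union> ((UNIV - A) \<inter> ?B)" by auto
    have "UNIV - A : sets borel" using Ab by (simp add: Compl_eq_Diff_UNIV[symmetric] borel_comp)
    then have "A \<inter> ?B : sets ?M" "(UNIV - A) \<inter> ?B : sets ?M" using Ab BO by (auto intro!: sM)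
    then show ?thesis by (subst e, intro set_integral_Un si) auto
   qed
   then show ?case using compl box0[OF ab] by simp
  next
   case (union A)
   have Ab: "A i : sets borel" for i using union unfolding borel_eq_sigma_boxes by auto
   have "(LINT x:(\<Union>i. A i \<inter> ?B)|?M. d x) = (\<Sum>i. (LINT x:(A i \<inter> ?B)|?M. d x))"
   proof (rule lebesgue_integral_countable_add)
    show "A i \<inter> ?B : sets ?M" for i using Ab[of i] BO by (intro sM) auto
    show "i ~= j ==> (A i \<inter> ?B) \<inter> (A j \<inter> ?B) = {}" for i j
     using union(1) by (auto simp: disjoint_family_on_def)
    show "set_integrable ?M (\<Union>i. A i \<inter> ?B) d" using Ab BO by (intro si sM) auto
   qed
   also have "... = 0" using union by simp
   also have "(\<Union>i. A i \<inter> ?B) = (\<Union> (range A)) \<inter> ?B" by auto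
   finally show ?case .
  qed
  show ?thesis
  proof (rule density_zero)
   have Bs: "?B : sets ?M" using BO by (intro sM) auto
   show int: "integrable ?M (%x. indicator ?B x *R d x)" by (rule integrable_mult_indicator[OF Bs d])
   fix A assume A: "A : sets ?M"
   then have Al: "A : sets lebesgue" using Ol by (auto simp: sets_restrict_space_iff)
   \<comment> \<open>A Lebesgue measurable set is a Borel set together with a null set: the Dynkin
     argument covers the first, and the second does not change the integral.\<close>
   obtain C N where CN: "C : sets borel" "N : null_sets lebesgue" "C \<union> N = A"
    using sets_lebesgue_almost_borel[OF Al] unfolding negligible_iff_null_sets by metis
   have "AE x in lebesgue. x \<notin> N" using CN(2) by (rule AE_not_in)
   then have aN: "AE x in ?M. x \<notin> N" using Ol by (subst AE_restrict_space_iff) (auto elim: eventually_mono)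
   have CB: "C \<inter> ?B : sets ?M" using CN BO by (intro sM) auto
   have "(LINT x:A|?M. indicator ?B x *R d x) = (LINT x:(C \<inter> ?B)|?M. d x)"
    unfolding set_lebesgue_integral_def
   proof (rule integral_cong_AE)
    show "(%x. indicator A x *R indicator ?B x *R d x) : borel_measurable ?M"
     using integrable_mult_indicator[OF A int] by (rule borel_measurable_integrable)
    show "(%x. indicator (C \<inter> ?B) x *R d x) : borel_measurable ?M"
     using integrable_mult_indicator[OF CB d] by (rule borel_measurable_integrable)
    show "AE x in ?M. indicator A x *R indicator ?B x *R d x = indicator (C \<inter> ?B) x *R d x"
     using aN by eventually_elim (use CN in "auto simp: indicator_def")
   qed
   then show "(LINT x:A|?M. indicator ?B x *R d x) = 0" using bor[OF CN(1)] by simp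
  qed
 qed
 obtain \<D> where D: "countable \<D>" "\<D> \<subseteq> Pow \<Omega>" "!!X. X : \<D> ==> EX a b. X = cbox a b" "\<Union>\<D> = \<Omega>"
  using open_countable_Union_open_cbox[OF O] by metis
 have "AE x in ?M. ALL X:\<D>. x : X \<longrightarrow> d x = 0"
 proof (subst AE_ball_countable[OF D(1)], rule ballI)
  fix X assume X: "X : \<D>"
  then obtain a b where ab: "X = cbox a b" using D(3) by blast
  have "cbox a b - box a b : null_sets lebesgue"
   using negligible_frontier_interval[of a b] by (simp add: negligible_iff_null_sets)
  then have "AE x in lebesgue. x \<notin> cbox a b - box a b" by (rule AE_not_in)
  then have "AE x in ?M. x \<notin> cbox a b - box a b" using Ol by (subst AE_restrict_space_iff) (auto elim: eventually_mono)
  moreover have "cbox a b \<subseteq> \<Omega>" using X D(2) ab by auto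
  ultimately show "AE x in ?M. x : X \<longrightarrow> d x = 0"
   using AEbox[of a b] by (auto simp: ab elim!: eventually_elim2)
 qed
 then show ?thesis
  using AE_space[of ?M] by eventually_elim (use D(4) in "auto simp: space_restrict_space")
qed

lemma testf_integrable:
 fixes u :: "'a::euclidean_space => complex"
 assumes p: "testf \<Omega> \<phi>" and u: "integrable (lebesgue_on \<Omega>) u" and i: "set is \<subseteq> Basis"
 shows "integrable (lebesgue_on \<Omega>) (%x. pderiv_list is \<phi> x *R u x)"
proof -
 let ?K = "closure {x. \<phi> x ~= 0}"
 have c: "continuous_on UNIV (pderiv_list is \<phi>)" using smooth_on_continuous[of UNIV \<phi> "is"] p i by (auto simp: testf_def)
 have "compact (pderiv_list is \<phi> ` ?K)" using c p by (intro compact_continuous_image) (auto intro: continuous_on_subset simp: testf_def)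
 then obtain B where B: "!!x. x : ?K ==> norm (pderiv_list is \<phi> x) <= B" by (meson bounded_iff compact_imp_bounded imageI)
 have le: "\<bar>pderiv_list is \<phi> x\<bar> <= max B 0" for x using B[of x] testf_pderiv(2)[OF p i, of x] by (cases "x : ?K") auto
 have [measurable]: "pderiv_list is \<phi> : borel_measurable (lebesgue_on \<Omega>)"
  by (intro borel_measurable_lebesgue_on borel_measurable_continuous_onI c)
 have [measurable]: "u : borel_measurable (lebesgue_on \<Omega>)" using u by simp
 show ?thesis
 proof (rule Bochner_Integration.integrable_bound)
  show "integrable (lebesgue_on \<Omega>) (%x. max B 0 * norm (u x))" using u by simp
  show "AE x in lebesgue_on \<Omega>. norm (pderiv_list is \<phi> x *R u x) <= norm (max B 0 * norm (u x))"
   using le by (intro AE_I2) (auto simp: abs_mult intro!: mult_right_mono)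
 qed measurable
qed

lemma weak_pderiv_unique:
 fixes u :: "'a::euclidean_space => complex"
 assumes O: "open \<Omega>" "bounded \<Omega>" and v: "v : L2M (lebesgue_on \<Omega>)" "w : L2M (lebesgue_on \<Omega>)"
  and wk: "weak_pderiv \<Omega> is u v" "weak_pderiv \<Omega> is u w"
 shows "AE x in lebesgue_on \<Omega>. v x = w x"
proof -
 have iv: "integrable (lebesgue_on \<Omega>) v" and iw: "integrable (lebesgue_on \<Omega>) w"
  using L2M_L1(1)[OF v(1) finite_lebesgue_on[OF O]] L2M_L1(1)[OF v(2) finite_lebesgue_on[OF O]] by auto
 have "AE x in lebesgue_on \<Omega>. v x - w x = 0"
 proof (rule fundamental_lemma[OF O])
  show "integrable (lebesgue_on \<Omega>) (%x. v x - w x)" using iv iw by simp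
  fix \<phi> assume p: "testf \<Omega> \<phi>"
  have "(LINT x|lebesgue_on \<Omega>. \<phi> x *R v x) = (LINT x|lebesgue_on \<Omega>. \<phi> x *R w x)"
   using wk p unfolding weak_pderiv_iff by simp
  then show "(LINT x|lebesgue_on \<Omega>. \<phi> x *R (v x - w x)) = 0"
   using testf_integrable[OF p iv, of "[]"] testf_integrable[OF p iw, of "[]"] by (simp add: scaleR_diff_right)
 qed
 then show ?thesis by eventually_elim simp
qed

text \<open>A name for the choice made in \<open>Hs_norm\<close>. The choice respects differences
  only almost everywhere, by \<open>weak_pderiv_unique\<close>, which is enough for the
  norms.\<close>

definition wd :: "'a::euclidean_space set => 'a list => ('a => complex) => 'a => complex" where
 "wd \<Omega> is u = (SOME v. L2_on \<Omega> v & weak_pderiv \<Omega> is u v)"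

lemma Hs_wd:
 assumes "u : Hs s \<Omega>" "set is \<subseteq> Basis" "length is <= s"
 shows "wd \<Omega> is u : L2M (lebesgue_on \<Omega>)" "weak_pderiv \<Omega> is u (wd \<Omega> is u)"
proof -
 have "EX v. L2_on \<Omega> v & weak_pderiv \<Omega> is u v" using assms by (auto simp: Hs_def)
 from someI_ex[OF this] show "wd \<Omega> is u : L2M (lebesgue_on \<Omega>)" "weak_pderiv \<Omega> is u (wd \<Omega> is u)"
  unfolding wd_def L2_on_iff by auto
qed

definition idx :: "nat => 'a::euclidean_space list set" where
 "idx s = {is. set is \<subseteq> Basis & length is <= s}"

lemma finite_idx: "finite (idx s)"
 unfolding idx_def by (rule finite_lists_length_le) simp

text \<open>In this form Minkowski's inequality for finite sums applies on top of the one for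
  \<open>l2n\<close>.\<close>

lemma Hs_norm_L2: "Hs_norm s \<Omega> u = L2_set (%is. l2n (lebesgue_on \<Omega>) (wd \<Omega> is u)) (idx s)"
 unfolding Hs_norm_def L2_set_def idx_def wd_def[symmetric] l2n_def by (simp add: integral_nonneg_AE)

lemma weak_pderiv_diff:
 fixes u :: "'a::euclidean_space => complex"
 assumes O: "open \<Omega>" "bounded \<Omega>" and i: "set is \<subseteq> Basis"
  and m: "u : L2M (lebesgue_on \<Omega>)" "u' : L2M (lebesgue_on \<Omega>)" "v : L2M (lebesgue_on \<Omega>)" "v' : L2M (lebesgue_on \<Omega>)"
  and wk: "weak_pderiv \<Omega> is u v" "weak_pderiv \<Omega> is u' v'"
 shows "weak_pderiv \<Omega> is (%x. u x - u' x) (%x. v x - v' x)"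
 unfolding weak_pderiv_iff
proof (intro allI impI)
 fix \<phi> assume p: "testf \<Omega> \<phi>"
 note L1 = L2M_L1(1)[OF _ finite_lebesgue_on[OF O]]
 note ti = testf_integrable[OF p L1]
 have "(LINT x|lebesgue_on \<Omega>. pderiv_list is \<phi> x *R (u x - u' x)) =
   (LINT x|lebesgue_on \<Omega>. pderiv_list is \<phi> x *R u x) - (LINT x|lebesgue_on \<Omega>. pderiv_list is \<phi> x *R u' x)"
  unfolding scaleR_diff_right using ti[OF m(1) i] ti[OF m(2) i] by (rule Bochner_Integration.integral_diff)
 moreover have "(LINT x|lebesgue_on \<Omega>. \<phi> x *R (v x - v' x)) =
   (LINT x|lebesgue_on \<Omega>. \<phi> x *R v x) - (LINT x|lebesgue_on \<Omega>. \<phi> x *R v' x)"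
  unfolding scaleR_diff_right using ti[OF m(3), of "[]"] ti[OF m(4), of "[]"] by (intro Bochner_Integration.integral_diff) auto
 ultimately show "(LINT x|lebesgue_on \<Omega>. pderiv_list is \<phi> x *R (u x - u' x)) =
   (-1) ^ length is * (LINT x|lebesgue_on \<Omega>. \<phi> x *R (v x - v' x))"
  using wk p unfolding weak_pderiv_iff by (simp add: right_diff_distrib)
qed

lemma Hs_diff:
 fixes u w :: "'a::euclidean_space => complex"
 assumes O: "open \<Omega>" "bounded \<Omega>" and u: "u : Hs s \<Omega>" and w: "w : Hs s \<Omega>"
 shows "(%x. u x - w x) : Hs s \<Omega>"
  and "Hs_norm s \<Omega> (%x. u x - w x) <= Hs_norm s \<Omega> u + Hs_norm s \<Omega> w"
proof -
 have L2: "u : L2M (lebesgue_on \<Omega>)" "w : L2M (lebesgue_on \<Omega>)" using u w by (auto simp: Hs_def L2_on_iff)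
 have wk: "weak_pderiv \<Omega> is (%x. u x - w x) (%x. wd \<Omega> is u x - wd \<Omega> is w x)"
  if i: "set is \<subseteq> Basis" "length is <= s" for "is"
  using weak_pderiv_diff[OF O i(1) L2 Hs_wd(1)[OF u i] Hs_wd(1)[OF w i] Hs_wd(2)[OF u i] Hs_wd(2)[OF w i]] .
 show H: "(%x. u x - w x) : Hs s \<Omega>"
  unfolding Hs_def L2_on_iff using L2M_diff(1)[OF L2] L2M_diff(1)[OF Hs_wd(1)[OF u] Hs_wd(1)[OF w]] wk by blast
 have le: "l2n (lebesgue_on \<Omega>) (wd \<Omega> is (%x. u x - w x)) <= l2n (lebesgue_on \<Omega>) (wd \<Omega> is u) + l2n (lebesgue_on \<Omega>) (wd \<Omega> is w)"
  if "is : idx s" for "is"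
 proof -
  have i: "set is \<subseteq> Basis" "length is <= s" using that by (auto simp: idx_def)
  note m = L2M_diff[OF Hs_wd(1)[OF u i] Hs_wd(1)[OF w i]]
  have "AE x in lebesgue_on \<Omega>. wd \<Omega> is (%x. u x - w x) x = wd \<Omega> is u x - wd \<Omega> is w x"
   by (rule weak_pderiv_unique[OF O Hs_wd(1)[OF H i] m(1) Hs_wd(2)[OF H i] wk[OF i]])
  then have "l2n (lebesgue_on \<Omega>) (wd \<Omega> is (%x. u x - w x)) = l2n (lebesgue_on \<Omega>) (%x. wd \<Omega> is u x - wd \<Omega> is w x)"
   using Hs_wd(1)[OF H i] m(1) by (intro l2n_cong_AE) (auto simp: L2M_def)
  then show ?thesis using m(2) by simp
 qed
 have "Hs_norm s \<Omega> (%x. u x - w x) <= L2_set (%is. l2n (lebesgue_on \<Omega>) (wd \<Omega> is u) + l2n (lebesgue_on \<Omega>) (wd \<Omega> is w)) (idx s)"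
  unfolding Hs_norm_L2 by (rule L2_set_mono) (use le in auto)
 also have "... <= Hs_norm s \<Omega> u + Hs_norm s \<Omega> w"
  unfolding Hs_norm_L2 by (rule L2_set_triangle_ineq)
 finally show "Hs_norm s \<Omega> (%x. u x - w x) <= Hs_norm s \<Omega> u + Hs_norm s \<Omega> w" .
qed

lemma Hs_norm_nonneg: "Hs_norm s \<Omega> u >= 0"
 unfolding Hs_norm_L2 by (rule L2_set_nonneg)

lemma Hs_norm_zero:
 fixes u :: "'a::euclidean_space => complex"
 assumes O: "open \<Omega>" "bounded \<Omega>"
 shows "(%x. 0) : Hs s \<Omega>" and "Hs_norm s \<Omega> (%x. 0) = 0"
proof -
 have wk: "weak_pderiv \<Omega> is (%x. 0) (%x. 0)" for "is" by (simp add: weak_pderiv_def)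
 have L: "(%x. 0) : L2M (lebesgue_on \<Omega>)" by (simp add: L2M_def)
 show H: "(%x. 0) : Hs s \<Omega>" unfolding Hs_def L2_on_iff using wk L by blast
 have "l2n (lebesgue_on \<Omega>) (wd \<Omega> is (%x. 0)) = 0" if "is : idx s" for "is"
 proof -
  have i: "set is \<subseteq> Basis" "length is <= s" using that by (auto simp: idx_def)
  have "AE x in lebesgue_on \<Omega>. wd \<Omega> is (%x. 0) x = 0"
   by (rule weak_pderiv_unique[OF O Hs_wd(1)[OF H i] L Hs_wd(2)[OF H i] wk])
  then have "l2n (lebesgue_on \<Omega>) (wd \<Omega> is (%x. 0)) = l2n (lebesgue_on \<Omega>) (%x. 0)"
   using Hs_wd(1)[OF H i] L by (intro l2n_cong_AE) (auto simp: L2M_def)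
  then show ?thesis by (simp add: l2n_def)
 qed
 then show "Hs_norm s \<Omega> (%x. 0) = 0" unfolding Hs_norm_L2 L2_set_def by simp
qed

lemma l2n_le_Hs_norm:
 fixes u :: "'a::euclidean_space => complex"
 assumes O: "open \<Omega>" "bounded \<Omega>" and u: "u : Hs s \<Omega>"
 shows "l2n (lebesgue_on \<Omega>) u <= Hs_norm s \<Omega> u"
proof -
 have L2: "u : L2M (lebesgue_on \<Omega>)" using u by (auto simp: Hs_def L2_on_iff)
 have "weak_pderiv \<Omega> [] u u" by (simp add: weak_pderiv_def)
 then have "AE x in lebesgue_on \<Omega>. u x = wd \<Omega> [] u x"
  by (intro weak_pderiv_unique[OF O L2 Hs_wd(1)[OF u] _ Hs_wd(2)[OF u]]) auto
 then have "l2n (lebesgue_on \<Omega>) u = l2n (lebesgue_on \<Omega>) (wd \<Omega> [] u)"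
  using L2 Hs_wd(1)[OF u, of "[]"] by (intro l2n_cong_AE) (auto simp: L2M_def)
 also have "... <= Hs_norm s \<Omega> u"
  unfolding Hs_norm_L2 by (rule member_le_L2_set[OF finite_idx]) (simp add: idx_def)
 finally show ?thesis .
qed

lemma smooth_bounded_Hs:
 fixes u :: "'a::euclidean_space => complex"
 assumes O: "open \<Omega>" "bounded \<Omega>" and u: "smooth_on \<Omega> u"
  and B: "!!is. set is \<subseteq> Basis ==> EX B. ALL x:\<Omega>. norm (pderiv_list is u x) <= B"
 shows "u : Hs s \<Omega>"
proof -
 have L: "pderiv_list is u : L2M (lebesgue_on \<Omega>)" if i: "set is \<subseteq> Basis" for "is"
 proof -
  interpret finite_measure "lebesgue_on \<Omega>" by (rule finite_lebesgue_on[OF O])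
  obtain B where B: "!!x. x : \<Omega> ==> norm (pderiv_list is u x) <= B" using assms(4)[OF i] by blast
  have [measurable]: "pderiv_list is u : borel_measurable (lebesgue_on \<Omega>)"
   by (rule continuous_imp_measurable_on_sets_lebesgue[OF smooth_on_continuous[OF u i]]) (use O in auto)
  have "integrable (lebesgue_on \<Omega>) (%x. (norm (pderiv_list is u x))\<^sup>2)"
  proof (rule integrable_const_bound[of _ "B\<^sup>2"])
   show "AE x in lebesgue_on \<Omega>. norm ((norm (pderiv_list is u x))\<^sup>2) <= B\<^sup>2"
    using B by (intro AE_I2) (auto simp: space_restrict_space intro!: power_mono)
  qed measurable
  then show ?thesis by (simp add: L2M_def)
 qed
 have "EX v. v : L2M (lebesgue_on \<Omega>) & weak_pderiv \<Omega> is u v" if "set is \<subseteq> Basis" for "is"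
  using L[of "rev is"] weak_pderiv_smooth[OF O(1) u that] that by auto
 then show ?thesis unfolding Hs_def L2_on_iff using L[of "[]"] by simp
qed

section \<open>Integration over the unit sphere\<close>

lemma space_sphere [simp]: "space (sphere_measure :: 'a::euclidean_space measure) = sphere 0 1"
 and sets_sphere [simp]: "sets (sphere_measure :: 'a::euclidean_space measure) = sets (restrict_space borel (sphere 0 1))"
 by (simp_all add: sphere_measure_def space_scale_measure space_restrict_space)

lemma sgn_sphere_measurable [measurable]:
 "sgn : measurable (restrict_space lborel (ball 0 1 - {0})) (restrict_space borel (sphere (0::'a::euclidean_space) 1))"
proof (rule measurable_restrict_space2)
 show "sgn : space (restrict_space lborel (ball 0 1 - {0})) \<rightarrow> sphere (0::'a) 1"
  by (auto simp: space_restrict_space norm_sgn)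
 have "sgn : borel_measurable (borel :: 'a measure)"
  unfolding sgn_div_norm[abs_def] by measurable
 then show "sgn : borel_measurable (restrict_space lborel (ball (0::'a) 1 - {0}))"
  by (intro measurable_restrict_space1) simp
qed

lemma nn_integral_sphere:
 fixes f :: "'a::euclidean_space => ennreal"
 assumes f: "f : borel_measurable (restrict_space borel (sphere 0 1))"
 shows "(\<integral>\<^sup>+\<theta>. f \<theta> \<partial>sphere_measure) = of_nat DIM('a) * (\<integral>\<^sup>+x. f (sgn x) * indicator (ball 0 1 - {0}) x \<partial>lborel)"
proof -
 have "(\<integral>\<^sup>+\<theta>. f \<theta> \<partial>sphere_measure) = of_nat DIM('a) *
   (\<integral>\<^sup>+\<theta>. f \<theta> \<partial>distr (restrict_space lborel (ball 0 1 - {0})) (restrict_space borel (sphere 0 1)) sgn)"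
  unfolding sphere_measure_def
  by (rule nn_integral_scale_measure, subst measurable_cong_sets[OF sets_distr refl], rule f)
 also have "(\<integral>\<^sup>+\<theta>. f \<theta> \<partial>distr (restrict_space lborel (ball 0 1 - {0})) (restrict_space borel (sphere 0 1)) sgn) =
   (\<integral>\<^sup>+x. f (sgn x) \<partial>restrict_space lborel (ball 0 1 - {0}))"
  using f by (intro nn_integral_distr sgn_sphere_measurable) (simp only: measurable_distr_eq1)
 also have "... = (\<integral>\<^sup>+x. f (sgn x) * indicator (ball 0 1 - {0}) x \<partial>lborel)"
  by (rule nn_integral_restrict_space) simp
 finally show ?thesis .
qed

lemma finite_sphere: "finite_measure (sphere_measure :: 'a::euclidean_space measure)"
proof (rule finite_measureI)
 have "emeasure sphere_measure (space (sphere_measure :: 'a measure)) = (\<integral>\<^sup>+\<theta>. 1 \<partial>(sphere_measure :: 'a measure))"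
  by simp
 also have "... = of_nat DIM('a) * (\<integral>\<^sup>+x. 1 * indicator (ball 0 1 - {0::'a}) x \<partial>lborel)"
  by (rule nn_integral_sphere) simp
 also have "(\<integral>\<^sup>+x. 1 * indicator (ball 0 1 - {0::'a}) x \<partial>lborel) = emeasure lborel (ball 0 1 - {0::'a})" by simp
 finally have e: "emeasure sphere_measure (space (sphere_measure :: 'a measure)) = of_nat DIM('a) * emeasure lborel (ball 0 1 - {0::'a})" .
 have "emeasure lborel (ball 0 1 - {0::'a}) <= emeasure lborel (ball 0 (1::real) :: 'a set)" by (rule emeasure_mono) auto
 also have "... < \<infinity>" using emeasure_lborel_ball_finite[of "0::'a" 1] by simp
 finally show "emeasure sphere_measure (space (sphere_measure :: 'a measure)) ~= \<infinity>"
  unfolding e by (auto simp: ennreal_mult_eq_top_iff ennreal_of_nat_eq_real_of_nat less_top)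
qed

lemma sphere_measurable:
 assumes "continuous_on (sphere 0 1) f" shows "f : borel_measurable (sphere_measure :: 'a::euclidean_space measure)"
 using borel_measurable_continuous_on_restrict[OF assms] measurable_cong_sets[OF sets_sphere refl] by blast

lemma sphere_integrable:
 fixes f :: "'a::euclidean_space => 'b::{banach, second_countable_topology}"
 assumes f: "continuous_on (sphere 0 1) f" shows "integrable sphere_measure f"
proof -
 interpret finite_measure "sphere_measure :: 'a measure" by (rule finite_sphere)
 have "compact (f ` sphere 0 1)" by (rule compact_continuous_image[OF f]) simp
 then obtain B where B: "!!x. x : sphere 0 1 ==> norm (f x) <= B" by (meson bounded_iff compact_imp_bounded imageI)
 show ?thesis
  by (rule integrable_const_bound[of _ B]) (use B sphere_measurable[OF f] in "auto intro!: AE_I2")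
qed

lemma nn_integral_scale_lborel:
 fixes f :: "'a::euclidean_space => ennreal"
 assumes [measurable]: "f : borel_measurable borel" and c: "c ~= 0"
 shows "(\<integral>\<^sup>+x. f x \<partial>lborel) = ennreal (\<bar>c\<bar> ^ DIM('a)) * (\<integral>\<^sup>+x. f (t + c *R x) \<partial>lborel)"
 by (subst lborel_affine[OF c, of t], subst nn_integral_density) (auto simp: nn_integral_distr nn_integral_cmult)

lemma nn_integral_inverse_power:
 assumes a: "a > 0" and n: "n >= 1"
 shows "(\<integral>\<^sup>+r. ennreal (inverse (r ^ (n + 1))) * indicator {a<..} r \<partial>lborel) = ennreal (inverse (real n * a ^ n))"
proof -
 have "(\<integral>\<^sup>+r. ennreal (inverse (r ^ (n + 1))) * indicator {a..} r \<partial>lborel) = ennreal (0 - (- (1 / real n) * (1 / a) ^ n))"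
 proof (rule nn_integral_FTC_atLeast)
  show "((%r. - (1 / real n) * (1 / r) ^ n) has_real_derivative inverse (r ^ (n + 1))) (at r)" if "a <= r" for r
  proof -
   have r: "r > 0" using a that by simp
   obtain m where m: "n = Suc m" using n by (cases n) auto
   have 1: "((%t. 1 / t) has_real_derivative - (1 / r)\<^sup>2) (at r)"
    using r by (auto intro!: derivative_eq_intros simp: power2_eq_square)
   show ?thesis
    by (rule DERIV_cong[OF DERIV_cmult[OF DERIV_power[OF 1, of n]]])
     (use r in "simp add: m power2_eq_square field_simps del: of_nat_Suc")
  qed
  have "((%r. - (1 / real n) * (1 / r) ^ n) ---> - (1 / real n) * 0 ^ n) at_top"
   by (intro tendsto_intros tendsto_divide_0[OF tendsto_const] filterlim_at_top_imp_at_infinity filterlim_ident)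
  then show "((%r. - (1 / real n) * (1 / r) ^ n) ---> 0) at_top" using n zero_power[of n, where 'a=real] by simp
 qed (use a in auto)
 also have "0 - (- (1 / real n) * (1 / a) ^ n) = inverse (real n * a ^ n)" by (simp add: field_simps)
 finally have "(\<integral>\<^sup>+r. ennreal (inverse (r ^ (n + 1))) * indicator {a..} r \<partial>lborel) = ennreal (inverse (real n * a ^ n))" .
 moreover have "(\<integral>\<^sup>+r. ennreal (inverse (r ^ (n + 1))) * indicator {a<..} r \<partial>lborel) = (\<integral>\<^sup>+r. ennreal (inverse (r ^ (n + 1))) * indicator {a..} r \<partial>lborel)"
 proof (rule nn_integral_cong_AE)
  show "AE r in lborel. ennreal (inverse (r ^ (n + 1))) * indicator {a<..} r = ennreal (inverse (r ^ (n + 1))) * indicator {a..} r"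
   using AE_lborel_singleton[of a] by eventually_elim (auto simp: indicator_def)
 qed
 ultimately show ?thesis by simp
qed

text \<open>\<open>sphere_measure\<close> is defined by cones. The sphere integral is therefore an
  integral over the unit ball of a function constant on rays, and two scalings, each followed by an
  exchange of integrals, remove \<open>sgn x\<close>. The weight is \<open>norm z\<close> to the
  power \<open>1 - n\<close>, since \<open>dr\<close> on the left carries no
  \<open>r ^ (n - 1)\<close>.\<close>

lemma polar:
 fixes q :: "'a::euclidean_space => ennreal"
 assumes q[measurable]: "q : borel_measurable borel"
 shows "(\<integral>\<^sup>+r. (\<integral>\<^sup>+\<theta>. q (r *R \<theta>) \<partial>sphere_measure) * indicator {0<..} r \<partial>lborel) =
  (\<integral>\<^sup>+z. q z * ennreal (norm z / norm z ^ DIM('a)) \<partial>lborel)"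
proof -
 let ?n = "DIM('a)"
 define B where "B = ball 0 1 - {0::'a}"
 let ?G = "%(r::real) x. of_nat ?n * ennreal (norm x) * q (r *R x) * indicator B x * indicator {0<..} r"
 let ?K = "%(r::real) z. of_nat ?n * (ennreal (norm z) * q z) * (ennreal (inverse (r ^ (?n + 1))) * indicator {norm z<..} r) * indicator (- {0}) z"
 let ?H = "%(r::real) x. of_nat ?n * q (r *R sgn x) * indicator B x * indicator {0<..} r"
 have [measurable]: "B : sets borel" unfolding B_def by simp
 have [measurable]: "sgn : borel_measurable (borel :: 'a measure)"
  unfolding sgn_div_norm[abs_def] by measurable
 have "(%x::'a \<times> real. indicator {norm (fst x)<..} (snd x) :: ennreal) = (%x. if norm (fst x) < snd x then 1 else 0)"
  "(%x::real \<times> 'a. indicator {norm (snd x)<..} (fst x) :: ennreal) = (%x. if norm (snd x) < fst x then 1 else 0)"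
  "(%x::'a \<times> real. indicator (- {0}) (fst x) :: ennreal) = (%x. if norm (fst x) = 0 then 0 else 1)"
  "(%x::real \<times> 'a. indicator (- {0}) (snd x) :: ennreal) = (%x. if norm (snd x) = 0 then 0 else 1)"
  by (auto simp: indicator_def)
 then have [measurable]: "(%x::'a \<times> real. indicator {norm (fst x)<..} (snd x) :: ennreal) : borel_measurable (lborel \<Otimes>\<^sub>M lborel)"
  "(%x::real \<times> 'a. indicator {norm (snd x)<..} (fst x) :: ennreal) : borel_measurable (lborel \<Otimes>\<^sub>M lborel)"
  "(%x::'a \<times> real. indicator (- {0}) (fst x) :: ennreal) : borel_measurable (lborel \<Otimes>\<^sub>M lborel)"
  "(%x::real \<times> 'a. indicator (- {0}) (snd x) :: ennreal) : borel_measurable (lborel \<Otimes>\<^sub>M lborel)" by simp_all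
 have "(\<integral>\<^sup>+r. (\<integral>\<^sup>+\<theta>. q (r *R \<theta>) \<partial>sphere_measure) * indicator {0<..} r \<partial>lborel) =
   (\<integral>\<^sup>+r. (of_nat ?n * (\<integral>\<^sup>+x. q (r *R sgn x) * indicator B x \<partial>lborel)) * indicator {0<..} r \<partial>lborel)"
  unfolding B_def by (subst nn_integral_sphere) (auto intro!: measurable_restrict_space1)
 also have "... = (\<integral>\<^sup>+r. (\<integral>\<^sup>+x. ?H r x \<partial>lborel) \<partial>lborel)"
 proof (rule nn_integral_cong)
  fix r :: real
  show "(of_nat ?n * (\<integral>\<^sup>+x. q (r *R sgn x) * indicator B x \<partial>lborel)) * indicator {0<..} r =
    (\<integral>\<^sup>+x. ?H r x \<partial>lborel)"
  proof -
   have "of_nat ?n * (\<integral>\<^sup>+x. q (r *R sgn x) * indicator B x \<partial>lborel) = (\<integral>\<^sup>+x. of_nat ?n * (q (r *R sgn x) * indicator B x) \<partial>lborel)"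
    by (rule nn_integral_cmult[symmetric]) measurable
   moreover have "... * indicator {0<..} r = (\<integral>\<^sup>+x. of_nat ?n * (q (r *R sgn x) * indicator B x) * indicator {0<..} r \<partial>lborel)"
    by (rule nn_integral_multc[symmetric]) measurable
   ultimately show ?thesis by (simp only: mult.assoc)
  qed
 qed
 also have "... = (\<integral>\<^sup>+x. (\<integral>\<^sup>+r. ?H r x \<partial>lborel) \<partial>lborel)"
  by (rule lborel_pair.Fubini') measurable
 \<comment> \<open>For fixed \<open>x\<close>, replacing \<open>r\<close> by
   \<open>norm x * r\<close> turns \<open>r *R sgn x\<close> into \<open>r *R x\<close>.\<close>
 also have "... = (\<integral>\<^sup>+x. (\<integral>\<^sup>+r. ?G r x \<partial>lborel) \<partial>lborel)"
 proof (rule nn_integral_cong)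
  fix x :: 'a
  show "(\<integral>\<^sup>+r. ?H r x \<partial>lborel) =
   (\<integral>\<^sup>+r. ?G r x \<partial>lborel)"
  proof (cases "x : B")
   case True
   then have x: "norm x > 0" by (simp add: B_def)
   have sx: "(norm x * r) *R sgn x = r *R x" for r using x by (simp add: sgn_div_norm)
   have "(\<integral>\<^sup>+r. ?H r x \<partial>lborel) =
     ennreal (norm x) * (\<integral>\<^sup>+r. of_nat ?n * q ((norm x * r) *R sgn x) * indicator B x * indicator {0<..} (norm x * r) \<partial>lborel)"
    using x by (subst nn_integral_real_affine[of _ "norm x" 0]) auto
   also have "... = (\<integral>\<^sup>+r. ennreal (norm x) * (of_nat ?n * q (r *R x) * indicator B x * indicator {0<..} r) \<partial>lborel)"
    using x unfolding sx by (subst nn_integral_cmult[symmetric]) (auto simp: indicator_def zero_less_mult_iff intro!: nn_integral_cong)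
   finally show ?thesis by (simp add: mult_ac)
  qed simp
 qed
 also have "... = (\<integral>\<^sup>+r. (\<integral>\<^sup>+x. ?G r x \<partial>lborel) \<partial>lborel)"
  by (rule lborel_pair.Fubini'[symmetric]) measurable
 \<comment> \<open>For fixed \<open>r\<close> the substitution \<open>z = r *R x\<close> has
   Jacobian \<open>r ^ n\<close>; with \<open>norm x = norm z / r\<close> this leaves
   \<open>r\<close> to the power \<open>- (n + 1)\<close>.\<close>
 also have "... = (\<integral>\<^sup>+r. (\<integral>\<^sup>+z. ?K r z \<partial>lborel) \<partial>lborel)"
 proof (rule nn_integral_cong)
  fix r :: real
  show "(\<integral>\<^sup>+x. ?G r x \<partial>lborel) =
   (\<integral>\<^sup>+z. ?K r z \<partial>lborel)"
  proof (cases "r > 0")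
   case True
   have "(\<integral>\<^sup>+z. ?K r z \<partial>lborel)
    = ennreal (\<bar>r\<bar> ^ ?n) * (\<integral>\<^sup>+x. ?K r (r *R x) \<partial>lborel)"
    by (subst nn_integral_scale_lborel[of _ r 0], measurable) (use True in auto)
   also have "... = (\<integral>\<^sup>+x. ennreal (\<bar>r\<bar> ^ ?n) * (?K r (r *R x)) \<partial>lborel)"
   proof (rule nn_integral_cmult[symmetric])
    have "(%x::'a. indicator {norm (r *R x)<..} r :: ennreal) = (%x. if norm (r *R x) < r then 1 else 0)"
     "(%x::'a. indicator (- {0}) (r *R x) :: ennreal) = (%x. if norm (r *R x) = 0 then 0 else 1)"
     by (auto simp: indicator_def)
    then have [measurable]: "(%x::'a. indicator {norm (r *R x)<..} r :: ennreal) : borel_measurable borel"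
     "(%x::'a. indicator (- {0}) (r *R x) :: ennreal) : borel_measurable borel" by simp_all
    show "(%x. ?K r (r *R x)) : borel_measurable lborel"
     by measurable
   qed
   also have "... = (\<integral>\<^sup>+x. ?G r x \<partial>lborel)"
   proof (rule nn_integral_cong)
    fix x :: 'a
    have i: "indicator {norm (r *R x)<..} r * indicator (- {0}) (r *R x) = (indicator B x * indicator {0<..} r :: ennreal)"
     using True by (auto simp: indicator_def B_def)
    have c: "ennreal (\<bar>r\<bar> ^ ?n) * ennreal (norm (r *R x)) * ennreal (inverse (r ^ (?n + 1))) = ennreal (norm x)"
     using True by (simp add: ennreal_mult[symmetric] field_simps)
    have "ennreal (\<bar>r\<bar> ^ ?n) * (?K r (r *R x))
     = of_nat ?n * (ennreal (\<bar>r\<bar> ^ ?n) * ennreal (norm (r *R x)) * ennreal (inverse (r ^ (?n + 1)))) * q (r *R x) * (indicator {norm (r *R x)<..} r * indicator (- {0}) (r *R x))"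
     by (simp only: mult_ac)
    then show "ennreal (\<bar>r\<bar> ^ ?n) * (?K r (r *R x))
     = ?G r x"
     unfolding i c by (simp only: mult_ac)
   qed
   finally show ?thesis ..
  next
   case False
   then have "\<not> norm z < r" for z :: 'a
    using norm_ge_zero[of z] by linarith
   then have "indicator {norm z<..} r = (0::ennreal)" for z :: 'a
    by (simp add: indicator_def)
   with False show ?thesis by simp
  qed
 qed
 also have "... = (\<integral>\<^sup>+z. (\<integral>\<^sup>+r. ?K r z \<partial>lborel) \<partial>lborel)"
  by (rule lborel_pair.Fubini') measurable
 \<comment> \<open>Integrating \<open>r\<close> from \<open>norm z\<close> to infinity produces
   \<open>1 / (n * norm z ^ n)\<close>, whose \<open>n\<close> cancels the normalisation of the
   surface measure.\<close>
 also have "... = (\<integral>\<^sup>+z. q z * ennreal (norm z / norm z ^ ?n) \<partial>lborel)"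
 proof (rule nn_integral_cong_AE)
  show "AE z in lborel. (\<integral>\<^sup>+r. ?K r z \<partial>lborel) = q z * ennreal (norm z / norm z ^ ?n)"
   using AE_lborel_singleton[of 0]
  proof eventually_elim
   case (elim z)
   have nz: "norm z > 0" using elim by simp
   have "(\<integral>\<^sup>+r. ?K r z \<partial>lborel)
    = of_nat ?n * (ennreal (norm z) * q z) * (\<integral>\<^sup>+r. ennreal (inverse (r ^ (?n + 1))) * indicator {norm z<..} r \<partial>lborel)"
    using elim by (subst nn_integral_cmult[symmetric]) auto
   also have "... = (of_nat ?n * ennreal (norm z) * ennreal (inverse (real ?n * norm z ^ ?n))) * q z"
    by (subst nn_integral_inverse_power[OF nz]) (simp_all only: mult_ac, simp add: Suc_leI)
   also have "of_nat ?n * ennreal (norm z) * ennreal (inverse (real ?n * norm z ^ ?n)) = ennreal (norm z / norm z ^ ?n)"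
    by (simp add: ennreal_of_nat_eq_real_of_nat ennreal_mult[symmetric] field_simps)
   finally show ?case by (simp add: mult.commute)
  qed
 qed
 finally show ?thesis .
qed

section \<open>Bounds for spherical harmonics\<close>

text \<open>The difference \<open>D\<close> has lower degree, because \<open>Q\<close> and its
  translate have the same leading coefficient. Pascal's rule turns the sum of order
  \<open>n + 1\<close> for \<open>Q\<close> into the sum of order \<open>n\<close> for
  \<open>D\<close>.\<close>

lemma poly_difference_zero:
 fixes Q :: "real poly"
 assumes "degree Q < n"
 shows "(\<Sum>j\<le>n. (-1) ^ j * real (n choose j) * poly Q (x + real j)) = 0"
 using assms
proof (induction n arbitrary: Q x)
 case (Suc n)
 define D where "D = Q - pcompose Q [:1, 1:]"
 have pD: "poly D x = poly Q x - poly Q (x + 1)" for x by (simp add: D_def poly_pcompose add.commute)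
 have s: "(\<Sum>j\<le>Suc n. (-1) ^ j * real (Suc n choose j) * poly Q (x + real j)) = (\<Sum>j\<le>n. (-1) ^ j * real (n choose j) * poly D (x + real j))"
 proof -
  have "(\<Sum>j\<le>Suc n. (-1) ^ j * real (Suc n choose j) * poly Q (x + real j)) =
    poly Q x + (\<Sum>j\<le>n. (-1) ^ Suc j * real (Suc n choose Suc j) * poly Q (x + real (Suc j)))"
   by (subst sum.atMost_Suc_shift) simp
  also have "(\<Sum>j\<le>n. (-1) ^ Suc j * real (Suc n choose Suc j) * poly Q (x + real (Suc j))) =
    (\<Sum>j\<le>n. (-1) ^ Suc j * real (n choose j) * poly Q (x + real (Suc j))) + (\<Sum>j\<le>n. (-1) ^ Suc j * real (n choose Suc j) * poly Q (x + real (Suc j)))"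
   by (simp add: sum.distrib[symmetric] algebra_simps)
  also have "poly Q x + ((\<Sum>j\<le>n. (-1) ^ Suc j * real (n choose j) * poly Q (x + real (Suc j))) + (\<Sum>j\<le>n. (-1) ^ Suc j * real (n choose Suc j) * poly Q (x + real (Suc j)))) =
    (poly Q x + (\<Sum>j\<le>n. (-1) ^ Suc j * real (n choose Suc j) * poly Q (x + real (Suc j)))) + (\<Sum>j\<le>n. (-1) ^ Suc j * real (n choose j) * poly Q (x + real (Suc j)))"
   by simp
  also have "poly Q x + (\<Sum>j\<le>n. (-1) ^ Suc j * real (n choose Suc j) * poly Q (x + real (Suc j))) = (\<Sum>j\<le>Suc n. (-1) ^ j * real (n choose j) * poly Q (x + real j))"
   using sum.atMost_Suc_shift[of "%j. (-1) ^ j * real (n choose j) * poly Q (x + real j)" n] by simp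
  also have "(\<Sum>j\<le>Suc n. (-1) ^ j * real (n choose j) * poly Q (x + real j)) = (\<Sum>j\<le>n. (-1) ^ j * real (n choose j) * poly Q (x + real j))"
   by simp
  finally show ?thesis by (simp add: pD sum.distrib[symmetric] sum_subtractf[symmetric] algebra_simps)
 qed
 show ?case
 proof (cases "degree Q = 0")
  case True
  then obtain c where "Q = [:c:]" by (rule degree_eq_zeroE)
  then have "D = 0" by (simp add: D_def)
  then show ?thesis unfolding s by simp
 next
  case False
  have le: "degree D <= degree Q" unfolding D_def by (rule order_trans[OF degree_diff_le_max]) (simp add: degree_pcompose)
  have "coeff D (degree Q) = 0"
  proof -
   have "degree (pcompose Q [:1, 1:]) = degree Q" by (simp add: degree_pcompose)
   moreover have "lead_coeff (pcompose Q [:1, 1:]) = lead_coeff Q" by (simp add: lead_coeff_comp)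
   ultimately show ?thesis by (simp add: D_def)
  qed
  then have "degree D ~= degree Q" using False by (metis degree_0 leading_coeff_0_iff)
  then have "degree D < n" using le Suc.prems by simp
  then show ?thesis unfolding s by (rule Suc.IH)
 qed
qed simp

text \<open>Homogeneity gives \<open>p (x + t *R v) = t ^ k * p (v + (1 / t) *R x)\<close>. With
  \<open>R'\<close> the reversal of the polynomial \<open>R\<close> of the second line this reads
  \<open>t ^ m * Q = t ^ k * R'\<close>, and comparison of degrees bounds that of \<open>Q\<close>
  by \<open>k\<close>.\<close>

lemma homogeneous_line_poly:
 fixes p :: "'a::euclidean_space => real"
 assumes p: "real_polynomial_function p" and hom: "!!c x. p (c *R x) = c ^ k * p x"
 shows "EX Q. degree Q <= k & (ALL t. p (x + t *R v) = poly Q t)"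
proof -
 have ex: "EX Q. ALL t. p (x + t *R v) = poly Q t" for x v :: 'a
 proof -
  have "polynomial_function (%t::real. x + t *R v)"
   by (intro polynomial_function_add polynomial_function_const polynomial_function_bounded_linear bounded_linear_scaleR_left)
  then have "real_polynomial_function (p \<circ> (%t::real. x + t *R v))"
   using p by (rule real_polynomial_function_compose)
  then obtain a n where "p \<circ> (%t::real. x + t *R v) = (%t. \<Sum>i\<le>n. a i * t ^ i)"
   unfolding real_polynomial_function_iff_sum by blast
  then have "p (x + t *R v) = poly (\<Sum>i\<le>n. monom (a i) i) t" for t
   by (simp add: fun_eq_iff poly_sum poly_monom)
  then show ?thesis by blast
 qed
 obtain Q where Q: "!!t. p (x + t *R v) = poly Q t" using ex by blast
 obtain R where R: "!!t. p (v + t *R x) = poly R t" using ex by blast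
 define m where "m = degree R"
 define R' where "R' = (\<Sum>i\<le>m. monom (coeff R i) (m - i))"
 have R't: "t ^ m * poly R (1 / t) = poly R' t" if "t ~= 0" for t
 proof -
  have "poly R (1 / t) = (\<Sum>i\<le>m. coeff R i * (1 / t) ^ i)" by (simp add: poly_altdef m_def)
  then have "t ^ m * poly R (1 / t) = (\<Sum>i\<le>m. coeff R i * (t ^ m * (1 / t) ^ i))" by (simp add: sum_distrib_left mult_ac)
  also have "... = (\<Sum>i\<le>m. coeff R i * t ^ (m - i))"
   using that by (intro sum.cong refl) (auto simp: power_diff field_simps)
  finally show ?thesis by (simp add: R'_def poly_sum poly_monom)
 qed
 have dR': "degree R' <= m" unfolding R'_def by (intro degree_sum_le) (auto intro: order_trans[OF degree_monom_le])
 have eq: "monom 1 m * Q = monom 1 k * R'"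
 proof -
  \<comment> \<open>The identity is known only for \<open>t ~= 0\<close>; the extra factor
    \<open>t\<close> makes it hold at \<open>0\<close> as well.\<close>
  have "poly (pCons 0 (monom 1 m * Q)) t = poly (pCons 0 (monom 1 k * R')) t" for t
  proof (cases "t = 0")
   case False
   have "p (x + t *R v) = p (t *R (v + (1 / t) *R x))" using False by (simp add: scaleR_add_right add.commute)
   also have "... = t ^ k * poly R (1 / t)" unfolding hom R ..
   finally have "t ^ m * poly Q t = t ^ k * (t ^ m * poly R (1 / t))" unfolding Q by simp
   then show ?thesis using R't[OF False] by (simp add: poly_monom)
  qed simp
  then have "pCons 0 (monom 1 m * Q) = pCons 0 (monom 1 k * R')" by (simp add: poly_eq_poly_eq_iff[symmetric] fun_eq_iff del: poly_pCons)
  then show ?thesis by simp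
 qed
 have "degree Q <= k"
 proof (cases "Q = 0")
  case False
  have "m + degree Q = degree (monom 1 m * Q)" using False by (simp add: degree_mult_eq degree_monom_eq)
  also have "... <= k + degree R'" unfolding eq using degree_mult_le[of "monom 1 k" R'] degree_monom_le[of "1::real" k] by linarith
  finally show ?thesis using dR' by linarith
 qed simp
 then show ?thesis using Q by blast
qed

text \<open>On the line through \<open>x\<close> with direction \<open>v\<close> the polynomial has degree at most \<open>k\<close>, so that its \<open>(k+1)\<close>-st difference vanishes.\<close>

lemma homogeneous_value_bound:
 fixes p :: "'a::euclidean_space => real"
 assumes p: "real_polynomial_function p" and hom: "!!c x. p (c *R x) = c ^ k * p x"
 shows "(p x)\<^sup>2 <= 4 ^ (k + 1) * (\<Sum>j=1..k+1. (p (x + real j *R v))\<^sup>2)"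
proof -
 obtain Q where Q: "degree Q <= k" "!!t. p (x + t *R v) = poly Q t"
  using homogeneous_line_poly[OF p hom] by blast
 have z: "(\<Sum>j\<le>k+1. (-1) ^ j * real ((k+1) choose j) * poly Q (0 + real j)) = 0"
  using Q(1) by (intro poly_difference_zero) simp
 have "{..k+1} = insert 0 {1..k+1}" by auto
 then have "poly Q 0 = - (\<Sum>j=1..k+1. (-1) ^ j * real ((k+1) choose j) * poly Q (real j))"
  using z by (simp add: eq_neg_iff_add_eq_0)
 then have "\<bar>poly Q 0\<bar> <= (\<Sum>j=1..k+1. \<bar>(-1) ^ j * real ((k+1) choose j) * poly Q (real j)\<bar>)" by (simp only: abs_minus_cancel sum_abs)
 also have "... = (\<Sum>j=1..k+1. real ((k+1) choose j) * \<bar>poly Q (real j)\<bar>)" by (simp add: abs_mult power_abs)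
 also have "... <= (\<Sum>j=1..k+1. real ((k+1) choose j) * sqrt (\<Sum>j=1..k+1. (poly Q (real j))\<^sup>2))"
 proof (intro sum_mono mult_left_mono)
  fix j assume j: "j : {1..k+1}"
  have "(poly Q (real j))\<^sup>2 <= (\<Sum>j=1..k+1. (poly Q (real j))\<^sup>2)" by (rule member_le_sum[OF j]) auto
  then show "\<bar>poly Q (real j)\<bar> <= sqrt (\<Sum>j=1..k+1. (poly Q (real j))\<^sup>2)" by (intro real_le_rsqrt) simp
 qed simp
 also have "... = (\<Sum>j=1..k+1. real ((k+1) choose j)) * sqrt (\<Sum>j=1..k+1. (poly Q (real j))\<^sup>2)" by (rule sum_distrib_right[symmetric])
 also have "... <= 2 ^ (k + 1) * sqrt (\<Sum>j=1..k+1. (poly Q (real j))\<^sup>2)"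
 proof (rule mult_right_mono)
  have "(\<Sum>j=1..k+1. real ((k+1) choose j)) <= (\<Sum>j\<le>k+1. real ((k+1) choose j))" by (intro sum_mono2) auto
  also have "... = real (\<Sum>j\<le>k+1. (k+1) choose j)" by simp
  also have "... = 2 ^ (k + 1)" by (simp only: choose_row_sum of_nat_power of_nat_numeral)
  finally show "(\<Sum>j=1..k+1. real ((k+1) choose j)) <= 2 ^ (k + 1)" .
 qed (intro real_sqrt_ge_zero sum_nonneg, simp)
 finally have "\<bar>poly Q 0\<bar> ^ 2 <= (2 ^ (k + 1) * sqrt (\<Sum>j=1..k+1. (poly Q (real j))\<^sup>2)) ^ 2" by (rule power_mono) simp
 also have "... = 4 ^ (k + 1) * (\<Sum>j=1..k+1. (poly Q (real j))\<^sup>2)"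
 proof -
  have "((2::real) ^ (k + 1))\<^sup>2 = 4 ^ (k + 1)" by (simp only: power_even_eq[symmetric] power_mult) simp
  moreover have "(\<Sum>j=1..k+1. (poly Q (real j))\<^sup>2) >= 0" by (intro sum_nonneg) simp
  ultimately show ?thesis by (simp only: power_mult_distrib real_sqrt_pow2)
 qed
 finally show ?thesis using Q(2)[of 0] by (simp add: Q(2))
qed

text \<open>The value bound is averaged over \<open>v\<close> in the ball of radius
  \<open>1 / (k + 1)\<close>, so that all points \<open>x + j *R v\<close> stay in the ball of
  radius \<open>2\<close>. By homogeneity the integral of the square there is
  \<open>2 ^ n * 4 ^ k\<close> times that over the unit ball, which the sphere dominates. Of the
  powers of \<open>k + 1\<close>, \<open>n\<close> come from the volume of the small ball and one
  from the number of terms.\<close>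

lemma homogeneous_sup_bound:
 fixes p :: "'a::euclidean_space => real"
 assumes p: "real_polynomial_function p" and hom: "!!c x. p (c *R x) = c ^ k * p x" and x: "norm x = 1"
 shows "(p x)\<^sup>2 <= (4 * 2 ^ DIM('a) / (real DIM('a) * measure lborel (ball (0::'a) 1))) * (real (k + 1) ^ (DIM('a) + 1) * 16 ^ k) *
   (LINT \<theta>|sphere_measure. (p \<theta>)\<^sup>2)"
proof -
 let ?n = "DIM('a)"
 define I where "I = (LINT \<theta>|sphere_measure. (p \<theta>)\<^sup>2)"
 have pc: "continuous_on S p" for S using p unfolding real_polynomial_function_eq by (rule continuous_on_polymonial_function)
 have [measurable]: "p : borel_measurable borel" using pc by (rule borel_measurable_continuous_onI)
 define \<phi> where "\<phi> z = ennreal ((p z)\<^sup>2)" for z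
 have [measurable]: "\<phi> : borel_measurable borel" unfolding \<phi>_def by measurable
 define r where "r = 1 / real (k + 1)"
 have r: "r > 0" "real (k + 1) * r = 1" by (auto simp: r_def)
 define bl where "bl = ball (0::'a)"
 have [measurable]: "bl s : sets borel" for s by (simp add: bl_def)
 define B1 where "B1 = (\<integral>\<^sup>+z. \<phi> z * indicator (bl 1) z \<partial>lborel)"
 have B1: "of_nat ?n * B1 <= ennreal I"
 proof -
  have int: "integrable sphere_measure (%\<theta>. (p \<theta>)\<^sup>2)" by (intro sphere_integrable continuous_intros pc)
  have "B1 <= (\<integral>\<^sup>+x. \<phi> (sgn x) * indicator (ball 0 1 - {0}) x \<partial>lborel)"
   unfolding B1_def
  proof (rule nn_integral_mono_AE)
   show "AE z in lborel. \<phi> z * indicator (bl 1) z <= \<phi> (sgn z) * indicator (ball 0 1 - {0}) z"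
    using AE_lborel_singleton[of 0]
   proof eventually_elim
    case (elim z)
    show ?case
    proof (cases "norm z < 1")
     case True
     have "p z = norm z ^ k * p (sgn z)" using hom[of "norm z" "sgn z"] elim by (simp add: sgn_div_norm)
     then have "(p z)\<^sup>2 = (norm z ^ k)\<^sup>2 * (p (sgn z))\<^sup>2" by (simp add: power_mult_distrib)
     also have "... <= 1 * (p (sgn z))\<^sup>2" using True by (intro mult_right_mono) (auto simp: power_le_one)
     finally show ?thesis using True elim by (simp add: \<phi>_def bl_def ennreal_leI)
    qed (simp add: bl_def)
   qed
  qed
  then have "of_nat ?n * B1 <= of_nat ?n * (\<integral>\<^sup>+x. \<phi> (sgn x) * indicator (ball 0 1 - {0}) x \<partial>lborel)" by (rule mult_left_mono) simp
  also have "... = (\<integral>\<^sup>+\<theta>. \<phi> \<theta> \<partial>sphere_measure)" by (rule nn_integral_sphere[symmetric]) (intro measurable_restrict_space1, measurable)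
  also have "... = ennreal I" unfolding \<phi>_def I_def by (rule nn_integral_eq_integral[OF int]) simp
  finally show ?thesis .
 qed
 have B2: "(\<integral>\<^sup>+z. \<phi> z * indicator (bl 2) z \<partial>lborel) = ennreal (2 ^ ?n * 4 ^ k) * B1"
 proof -
  have "(\<integral>\<^sup>+z. \<phi> z * indicator (bl 2) z \<partial>lborel) = ennreal (2 ^ ?n) * (\<integral>\<^sup>+z. \<phi> (0 + 2 *R z) * indicator (bl 2) (0 + 2 *R z) \<partial>lborel)"
   by (subst nn_integral_scale_lborel[of _ 2 0], measurable)
  also have "(\<integral>\<^sup>+z. \<phi> (0 + 2 *R z) * indicator (bl 2) (0 + 2 *R z) \<partial>lborel) = (\<integral>\<^sup>+z. ennreal (4 ^ k) * (\<phi> z * indicator (bl 1) z) \<partial>lborel)"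
  proof (rule nn_integral_cong)
   fix z :: 'a
   have "(p (2 *R z))\<^sup>2 = 4 ^ k * (p z)\<^sup>2"
   proof -
    have "((2::real) ^ k)\<^sup>2 = 4 ^ k" by (simp only: power_even_eq[symmetric] power_mult) simp
    then show ?thesis unfolding hom by (simp only: power_mult_distrib)
   qed
   moreover have "indicator (bl 2) (2 *R z) = (indicator (bl 1) z :: ennreal)" by (auto simp: indicator_def bl_def)
   ultimately show "\<phi> (0 + 2 *R z) * indicator (bl 2) (0 + 2 *R z) = ennreal (4 ^ k) * (\<phi> z * indicator (bl 1) z)"
    by (simp add: \<phi>_def ennreal_mult mult.assoc)
  qed
  also have "... = ennreal (4 ^ k) * B1" unfolding B1_def by (rule nn_integral_cmult) measurable
  finally show ?thesis by (simp add: ennreal_mult mult.assoc)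
 qed
 have shift: "(\<integral>\<^sup>+v. \<phi> (x + real j *R v) * indicator (bl r) v \<partial>lborel) <= (\<integral>\<^sup>+z. \<phi> z * indicator (bl 2) z \<partial>lborel)"
  if j: "j : {1..k+1}" for j
 proof -
  have "(\<integral>\<^sup>+z. \<phi> z * indicator (bl 2) z \<partial>lborel) = ennreal (\<bar>real j\<bar> ^ ?n) * (\<integral>\<^sup>+v. \<phi> (x + real j *R v) * indicator (bl 2) (x + real j *R v) \<partial>lborel)"
  proof -
   have "(%z. \<phi> z * indicator (bl 2) z) : borel_measurable borel" by measurable
   moreover have "real j ~= 0" using j by auto
   ultimately show ?thesis by (rule nn_integral_scale_lborel)
  qed
  moreover have "1 <= ennreal (\<bar>real j\<bar> ^ ?n)" using j by (simp add: one_le_power)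
  ultimately have "1 * (\<integral>\<^sup>+v. \<phi> (x + real j *R v) * indicator (bl 2) (x + real j *R v) \<partial>lborel) <= (\<integral>\<^sup>+z. \<phi> z * indicator (bl 2) z \<partial>lborel)"
   by (simp only:) (rule mult_right_mono, auto)
  moreover have "(\<integral>\<^sup>+v. \<phi> (x + real j *R v) * indicator (bl r) v \<partial>lborel) <= (\<integral>\<^sup>+v. \<phi> (x + real j *R v) * indicator (bl 2) (x + real j *R v) \<partial>lborel)"
  proof (intro nn_integral_mono mult_left_mono)
   fix v :: 'a
   have "norm (x + real j *R v) < 2" if "norm v < r"
   proof -
    have "real j * norm v <= real (k + 1) * norm v" using j by (intro mult_right_mono) auto
    also have "... < real (k + 1) * r" using that by (intro mult_strict_left_mono) auto
    finally show ?thesis using norm_triangle_ineq[of x "real j *R v"] x r(2) by simp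
   qed
   then show "indicator (bl r) v <= (indicator (bl 2) (x + real j *R v) :: ennreal)" by (auto simp: indicator_def bl_def)
  qed simp
  ultimately show ?thesis by simp
 qed
 have vol: "emeasure lborel (ball (0::'a) r) = ennreal (r ^ ?n * measure lborel (ball (0::'a) 1))"
 proof -
  have "emeasure lborel (ball (0::'a) r) = (\<integral>\<^sup>+z. indicator (ball 0 r) z \<partial>(lborel :: 'a measure))" by simp
  also have "... = ennreal (\<bar>r\<bar> ^ ?n) * (\<integral>\<^sup>+z. indicator (ball 0 r) (0 + r *R z :: 'a) \<partial>lborel)"
   using r by (intro nn_integral_scale_lborel borel_measurable_indicator borel_open open_ball) auto
  also have "(%z. indicator (ball 0 r) (0 + r *R z :: 'a)) = (indicator (ball 0 1) :: 'a => ennreal)"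
   using r by (auto simp: indicator_def fun_eq_iff)
  also have "(\<integral>\<^sup>+z. indicator (ball 0 1) z \<partial>(lborel :: 'a measure)) = ennreal (measure lborel (ball (0::'a) 1))"
   using emeasure_lborel_ball_finite[of "0::'a" 1] by (simp add: emeasure_eq_ennreal_measure less_top[symmetric])
  finally show ?thesis using r by (simp add: ennreal_mult)
 qed
 have "ennreal ((p x)\<^sup>2) * emeasure lborel (ball (0::'a) r) = (\<integral>\<^sup>+v. ennreal ((p x)\<^sup>2) * indicator (bl r) v \<partial>lborel)"
  unfolding bl_def by (rule nn_integral_cmult_indicator[symmetric]) simp
 also have "... <= (\<integral>\<^sup>+v. (\<Sum>j=1..k+1. ennreal (4 ^ (k + 1)) * (\<phi> (x + real j *R v) * indicator (bl r) v)) \<partial>lborel)"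
 proof (rule nn_integral_mono)
  fix v
  have "ennreal ((p x)\<^sup>2) <= ennreal (4 ^ (k + 1) * (\<Sum>j=1..k+1. (p (x + real j *R v))\<^sup>2))"
   by (rule ennreal_leI[OF homogeneous_value_bound[OF p hom]])
  also have "... = (\<Sum>j=1..k+1. ennreal (4 ^ (k + 1)) * \<phi> (x + real j *R v))"
   unfolding sum_distrib_left \<phi>_def by (subst sum_ennreal[symmetric]) (auto simp: ennreal_mult)
  finally have "ennreal ((p x)\<^sup>2) * indicator (bl r) v <= (\<Sum>j=1..k+1. ennreal (4 ^ (k + 1)) * \<phi> (x + real j *R v)) * indicator (bl r) v"
   by (rule mult_right_mono) simp
  then show "ennreal ((p x)\<^sup>2) * indicator (bl r) v <= (\<Sum>j=1..k+1. ennreal (4 ^ (k + 1)) * (\<phi> (x + real j *R v) * indicator (bl r) v))"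
   by (simp only: sum_distrib_right mult.assoc)
 qed
 also have "... = (\<Sum>j=1..k+1. ennreal (4 ^ (k + 1)) * (\<integral>\<^sup>+v. \<phi> (x + real j *R v) * indicator (bl r) v \<partial>lborel))"
  by (subst nn_integral_sum, measurable) (intro sum.cong refl nn_integral_cmult, measurable)
 also have "... <= (\<Sum>j=1..k+1. ennreal (4 ^ (k + 1)) * (ennreal (2 ^ ?n * 4 ^ k) * B1))"
  unfolding B2[symmetric] by (intro sum_mono mult_left_mono shift) auto
 also have "... = ennreal (real (k + 1) * 4 ^ (k + 1) * (2 ^ ?n * 4 ^ k)) * B1"
  by (simp add: ennreal_mult ennreal_of_nat_eq_real_of_nat mult_ac del: power_Suc of_nat_Suc)
 finally have 1: "ennreal ((p x)\<^sup>2) * emeasure lborel (ball (0::'a) r) <= ennreal (real (k + 1) * 4 ^ (k + 1) * (2 ^ ?n * 4 ^ k)) * B1" .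
 define C where "C = real (k + 1) * 4 ^ (k + 1) * (2 ^ ?n * 4 ^ k)"
 define V where "V = measure lborel (ball (0::'a) 1)"
 have V: "V > 0" unfolding V_def by (rule content_ball_pos) simp
 have C: "C >= 0" by (simp add: C_def)
 have I0: "I >= 0" unfolding I_def by (intro integral_nonneg_AE AE_I2) simp
 have "of_nat ?n * (ennreal ((p x)\<^sup>2) * ennreal (r ^ ?n * V)) <= ennreal C * (of_nat ?n * B1)"
  using mult_left_mono[OF 1[unfolded vol], of "of_nat ?n"] unfolding C_def V_def by (simp add: mult_ac)
 also have "... <= ennreal C * ennreal I" by (rule mult_left_mono[OF B1]) simp
 finally have "ennreal (real ?n * ((p x)\<^sup>2 * (r ^ ?n * V))) <= ennreal (C * I)"
  using C I0 V r by (simp add: ennreal_mult ennreal_of_nat_eq_real_of_nat)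
 then have 2: "real ?n * ((p x)\<^sup>2 * (r ^ ?n * V)) <= C * I" using C I0 by (simp add: ennreal_le_iff)
 have rn: "r ^ ?n * real (k + 1) ^ ?n = 1" using r by (simp add: power_mult_distrib[symmetric] mult.commute)
 have "(p x)\<^sup>2 * (real ?n * V) = real (k + 1) ^ ?n * (real ?n * ((p x)\<^sup>2 * (r ^ ?n * V)))"
 proof -
  have "real (k + 1) ^ ?n * (real ?n * ((p x)\<^sup>2 * (r ^ ?n * V))) = (r ^ ?n * real (k + 1) ^ ?n) * ((p x)\<^sup>2 * (real ?n * V))" by (simp only: mult_ac)
  then show ?thesis unfolding rn by simp
 qed
 also have "... <= real (k + 1) ^ ?n * (C * I)" using 2 by (rule mult_left_mono) simp
 also have "... = (4 * 2 ^ ?n) * (real (k + 1) ^ (?n + 1) * 16 ^ k) * I"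
 proof -
  have "(16::real) ^ k = 4 ^ k * 4 ^ k" by (simp add: power_mult_distrib[symmetric])
  then show ?thesis unfolding C_def by (simp add: mult_ac del: of_nat_Suc)
 qed
 finally have "(p x)\<^sup>2 <= ((4 * 2 ^ ?n) * (real (k + 1) ^ (?n + 1) * 16 ^ k) * I) / (real ?n * V)"
  using V by (simp add: pos_le_divide_eq)
 then show ?thesis unfolding I_def V_def by simp
qed

lemma spherical_harmonic_continuous:
 assumes "spherical_harmonic k Y" shows "continuous_on (sphere 0 1) Y"
proof -
 obtain p where p: "real_polynomial_function p" "!!\<theta>. \<theta> : sphere 0 1 ==> Y \<theta> = p \<theta>"
  using assms unfolding spherical_harmonic_def by blast
 have "continuous_on (sphere 0 1) p" using p(1) unfolding real_polynomial_function_eq by (rule continuous_on_polymonial_function)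
 then show ?thesis by (rule continuous_on_eq) (use p(2) in auto)
qed

lemma harmonic_basisD:
 assumes "harmonic_basis d Y"
 shows "!!k l. l : {1..d k} ==> spherical_harmonic k (Y k l)"
  and "!!k l. l : {1..d k} ==> continuous_on (sphere 0 1) (Y k l)"
  and "!!k k' l l'. l : {1..d k} ==> l' : {1..d k'} ==> sph_coeff (Y k l) (Y k' l') = (if k = k' & l = l' then 1 else 0)"
proof -
 show 1: "spherical_harmonic k (Y k l)" if "l : {1..d k}" for k l
  using assms that unfolding harmonic_basis_def by blast
 show "continuous_on (sphere 0 1) (Y k l)" if "l : {1..d k}" for k l
  by (rule spherical_harmonic_continuous[OF 1[OF that]])
 show "sph_coeff (Y k l) (Y k' l') = (if k = k' & l = l' then 1 else 0)" if "l : {1..d k}" "l' : {1..d k'}" for k k' l l'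
  using assms that unfolding harmonic_basis_def by blast
qed

lemma sphere_integral_double_sum:
 fixes Y :: "nat => nat => 'a::euclidean_space => real" and c :: "nat => nat => 'b::{banach, second_countable_topology}"
 assumes Y: "!!k l. l : {1..d k} ==> continuous_on (sphere 0 1) (Y k l)" and A: "continuous_on (sphere 0 1) A"
 shows "(LINT x|sphere_measure. A x *R (\<Sum>k\<le>K. \<Sum>l=1..d k. Y k l x *R c k l)) =
  (\<Sum>k\<le>K. \<Sum>l=1..d k. (LINT x|sphere_measure. A x * Y k l x) *R c k l)"
proof -
 have "(LINT x|sphere_measure. A x *R (\<Sum>k\<le>K. \<Sum>l=1..d k. Y k l x *R c k l)) =
  (LINT x|sphere_measure. (\<Sum>k\<le>K. \<Sum>l=1..d k. (A x * Y k l x) *R c k l))" by (simp add: scaleR_sum_right)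
 also have "... = (\<Sum>k\<le>K. LINT x|sphere_measure. (\<Sum>l=1..d k. (A x * Y k l x) *R c k l))"
  by (intro Bochner_Integration.integral_sum sphere_integrable continuous_intros Y A) auto
 also have "... = (\<Sum>k\<le>K. \<Sum>l=1..d k. LINT x|sphere_measure. (A x * Y k l x) *R c k l)"
  by (intro sum.cong refl Bochner_Integration.integral_sum sphere_integrable continuous_intros Y A) auto
 finally show ?thesis
  by (simp only:) (intro sum.cong refl integral_scaleR_left sphere_integrable continuous_intros Y A)
qed

text \<open>The square sum is the value at \<open>\<theta>\<close> of a homogeneous polynomial whose squared norm on the sphere is the same sum.\<close>

lemma harmonic_basis_sum_square_bound:
 fixes Y :: "nat => nat => 'a::euclidean_space => real"
 assumes hb: "harmonic_basis d Y"
 shows "EX C B. C > 0 & B >= 1 & (ALL k. ALL \<theta>:sphere 0 1. (\<Sum>l=1..d k. (Y k l \<theta>)\<^sup>2) <= C * B ^ k)"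
proof -
 let ?n = "DIM('a)"
 define C where "C = (4 * 2 ^ ?n / (real ?n * measure lborel (ball (0::'a) 1)))"
 define B :: real where "B = 2 ^ (?n + 1) * 16"
 have C: "C > 0" unfolding C_def using content_ball_pos[of 1 "0::'a"] by simp
 have "(\<Sum>l=1..d k. (Y k l \<theta>)\<^sup>2) <= C * B ^ k" if th: "\<theta> : sphere 0 1" for k \<theta>
 proof -
  define Z where "Z = (\<Sum>l=1..d k. (Y k l \<theta>)\<^sup>2)"
  have "ALL l:{1..d k}. EX p. real_polynomial_function p & (ALL c x. p (c *R x) = c ^ k * p x) & (ALL \<theta>:sphere 0 1. Y k l \<theta> = p \<theta>)"
  proof
   fix l assume "l : {1..d k}"
   from harmonic_basisD(1)[OF hb this, unfolded spherical_harmonic_def] obtain p where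
    "real_polynomial_function p" "ALL c x. p (c *R x) = c ^ k * p x" "ALL \<theta>:sphere 0 1. Y k l \<theta> = p \<theta>" by (elim exE conjE)
   then show "EX p. real_polynomial_function p & (ALL c x. p (c *R x) = c ^ k * p x) & (ALL \<theta>:sphere 0 1. Y k l \<theta> = p \<theta>)" by (intro exI conjI)
  qed
  from bchoice[OF this] obtain p where p0: "ALL l:{1..d k}. real_polynomial_function (p l) & (ALL c x. p l (c *R x) = c ^ k * p l x) & (ALL \<theta>:sphere 0 1. Y k l \<theta> = p l \<theta>)" by blast
  then have p: "!!l. l : {1..d k} ==> real_polynomial_function (p l)"
   "!!l c x. l : {1..d k} ==> p l (c *R x) = c ^ k * p l x"
   "!!l \<theta>. l : {1..d k} ==> \<theta> : sphere 0 1 ==> Y k l \<theta> = p l \<theta>"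
   by blast+
  define P where "P x = (\<Sum>l=1..d k. Y k l \<theta> * p l x)" for x
  have P1: "real_polynomial_function P" unfolding P_def using p(1) by (intro real_polynomial_function_sum) auto
  have P2: "P (c *R x) = c ^ k * P x" for c x unfolding P_def using p(2) by (simp add: sum_distrib_left mult_ac)
  have PS: "P \<omega> = (\<Sum>l=1..d k. Y k l \<theta> * Y k l \<omega>)" if "\<omega> : sphere 0 1" for \<omega>
   unfolding P_def using p(3) that by simp
  have Pt: "P \<theta> = Z" unfolding PS[OF th] Z_def by (simp add: power2_eq_square)
  have ii: "integrable sphere_measure (%\<omega>. Y k l \<omega> * Y k l' \<omega>)" if "l : {1..d k}" "l' : {1..d k}" for l l'
   using harmonic_basisD(2)[OF hb] that by (intro sphere_integrable continuous_intros) auto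
  have "(LINT \<omega>|sphere_measure. (P \<omega>)\<^sup>2) = (LINT \<omega>|sphere_measure. (\<Sum>l=1..d k. \<Sum>l'=1..d k. Y k l \<theta> * Y k l' \<theta> * (Y k l \<omega> * Y k l' \<omega>)))"
   by (intro Bochner_Integration.integral_cong refl) (simp add: PS space_sphere power2_eq_square sum_product mult_ac)
  also have "... = (\<Sum>l=1..d k. \<Sum>l'=1..d k. Y k l \<theta> * Y k l' \<theta> * (LINT \<omega>|sphere_measure. Y k l \<omega> * Y k l' \<omega>))"
  proof -
   have "(LINT \<omega>|sphere_measure. (\<Sum>l=1..d k. \<Sum>l'=1..d k. Y k l \<theta> * Y k l' \<theta> * (Y k l \<omega> * Y k l' \<omega>))) =
    (\<Sum>l=1..d k. LINT \<omega>|sphere_measure. (\<Sum>l'=1..d k. Y k l \<theta> * Y k l' \<theta> * (Y k l \<omega> * Y k l' \<omega>)))"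
    using ii by (intro Bochner_Integration.integral_sum Bochner_Integration.integrable_sum integrable_mult_right) auto
   also have "... = (\<Sum>l=1..d k. \<Sum>l'=1..d k. LINT \<omega>|sphere_measure. Y k l \<theta> * Y k l' \<theta> * (Y k l \<omega> * Y k l' \<omega>))"
    using ii by (intro sum.cong refl Bochner_Integration.integral_sum integrable_mult_right) auto
   finally show ?thesis by simp
  qed
  also have "... = (\<Sum>l=1..d k. \<Sum>l'=1..d k. Y k l \<theta> * Y k l' \<theta> * (if l = l' then 1 else 0))"
   using harmonic_basisD(3)[OF hb, of _ k _ k] by (intro sum.cong refl) (auto simp: sph_coeff_def)
  also have "... = Z" unfolding Z_def by (simp add: power2_eq_square if_distrib[of "%x. _ * x"] cong: if_cong)
  finally have I: "(LINT \<omega>|sphere_measure. (P \<omega>)\<^sup>2) = Z" .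
  have Z0: "Z >= 0" unfolding Z_def by (intro sum_nonneg) simp
  have "Z\<^sup>2 <= C * (real (k + 1) ^ (?n + 1) * 16 ^ k) * Z"
   using homogeneous_sup_bound[OF P1 P2, of \<theta>] th unfolding Pt I C_def by simp
  also have "... <= C * B ^ k * Z"
  proof (intro mult_right_mono mult_left_mono)
   \<comment> \<open>This absorbs the polynomial factor into the geometric one.\<close>
   have "real (k + 1) <= 2 ^ k" using of_nat_mono[OF Suc_leI[OF less_exp[of k]], where ?'a = real] by simp
   then have "real (k + 1) ^ (?n + 1) <= (2 ^ k) ^ (?n + 1)" by (rule power_mono) simp
   then have "real (k + 1) ^ (?n + 1) <= (2 ^ (?n + 1)) ^ k" by (simp only: power_mult[symmetric] mult.commute[of k])
   then show "real (k + 1) ^ (?n + 1) * 16 ^ k <= B ^ k" unfolding B_def power_mult_distrib[of _ 16] by (rule mult_right_mono) simp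
  qed (use C Z0 in auto)
  finally have "Z * Z <= (C * B ^ k) * Z" by (simp add: power2_eq_square)
  then show ?thesis unfolding Z_def[symmetric] using Z0 C by (cases "Z = 0") (auto simp: B_def intro!: mult_nonneg_nonneg)
 qed
 moreover have "B >= 1" unfolding B_def using one_le_power[of "2::real" "?n + 1"] by simp
 ultimately show ?thesis using C by blast
qed

section \<open>Homogeneous harmonic polynomials in the plane\<close>

definition zc :: "'a::real_inner => 'a => 'a => complex" where
 "zc e1 e2 x = Complex (x \<bullet> e1) (x \<bullet> e2)"

lemma dim2_basis:
 assumes "DIM('a::euclidean_space) = 2"
 obtains b1 b2 :: "'a::euclidean_space" where "Basis = {b1, b2}" "b1 ~= b2" "b1 : Basis" "b2 : Basis"
proof -
 obtain b1 b2 :: 'a where "Basis = {b1, b2}" "b1 ~= b2"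
  using assms by (metis card_2_iff)
 then show thesis using that by auto
qed

text \<open>For a homogeneous polynomial in two variables the Laplace equation is a two-step
  recursion of the coefficients, so \<open>c 0\<close> and \<open>c 1\<close> determine the rest.
  The coefficients of the \<open>k\<close>-th powers of \<open>zc\<close> and of its conjugate
  satisfy the same recursion.\<close>

lemma harmonic_2d:
 fixes p :: "'a::euclidean_space => real"
 assumes b: "Basis = {b1, b2 :: 'a}" "b1 ~= b2"
  and p: "real_polynomial_function p" and hom: "!!c x. p (c *R x) = c ^ k * p x"
  and lap: "!!x. (\<Sum>i\<in>Basis. pderiv_list [i, i] p x) = 0"
 shows "EX \<alpha> \<beta>. ALL x. complex_of_real (p x) = \<alpha> * zc b1 b2 x ^ k + \<beta> * cnj (zc b1 b2 x) ^ k"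
proof -
 have bb: "b1 : Basis" "b2 : Basis" using b by auto
 have ip: "b1 \<bullet> b1 = 1" "b2 \<bullet> b2 = 1" "b1 \<bullet> b2 = 0" "b2 \<bullet> b1 = 0" using bb b(2) by (auto simp: inner_Basis)
 obtain Q where Q: "degree Q <= k" "!!t. p (b1 + t *R b2) = poly Q t" using homogeneous_line_poly[OF p hom] by blast
 define c where "c j = coeff Q j" for j
 have c0: "c j = 0" if "j > k" for j unfolding c_def using that Q(1) by (intro coeff_eq_0) simp
 have Qs: "poly Q t = (\<Sum>j\<le>k. c j * t ^ j)" for t
 proof -
  have "poly Q t = (\<Sum>j\<le>degree Q. coeff Q j * t ^ j)" by (rule poly_altdef)
  also have "... = (\<Sum>j\<le>k. coeff Q j * t ^ j)" using Q(1) by (intro sum.mono_neutral_left) (auto simp: coeff_eq_0)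
  finally show ?thesis by (simp add: c_def)
 qed
 \<comment> \<open>Homogeneity gives the expansion for \<open>s ~= 0\<close> from the line
   \<open>s = 1\<close>; continuity adds \<open>s = 0\<close>.\<close>
 have P: "p (s *R b1 + t *R b2) = (\<Sum>j\<le>k. c j * s ^ (k - j) * t ^ j)" for s t
 proof -
  have ne: "p (s *R b1 + t *R b2) = (\<Sum>j\<le>k. c j * s ^ (k - j) * t ^ j)" if s: "s ~= 0" for s
  proof -
   have "p (s *R b1 + t *R b2) = p (s *R (b1 + (t / s) *R b2))" using s by (simp add: scaleR_add_right)
   also have "... = s ^ k * (\<Sum>j\<le>k. c j * (t / s) ^ j)" unfolding hom Q Qs ..
   also have "... = (\<Sum>j\<le>k. c j * s ^ (k - j) * t ^ j)"
    unfolding sum_distrib_left using s by (intro sum.cong refl) (auto simp: power_diff power_divide)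
   finally show ?thesis .
  qed
  show ?thesis
  proof (cases "s = 0")
   case True
   have pc: "continuous_on UNIV p" using p unfolding real_polynomial_function_eq by (rule continuous_on_polymonial_function)
   have "((%s. p (s *R b1 + t *R b2)) ---> p (0 *R b1 + t *R b2)) (at 0)"
   proof (rule continuous_on_tendsto_compose[OF pc])
    show "((%s. s *R b1 + t *R b2) ---> 0 *R b1 + t *R b2) (at 0)" by (intro tendsto_intros)
   qed auto
   moreover have "((%s. \<Sum>j\<le>k. c j * s ^ (k - j) * t ^ j) ---> (\<Sum>j\<le>k. c j * 0 ^ (k - j) * t ^ j)) (at 0)"
    by (intro tendsto_intros)
   then have "((%s. p (s *R b1 + t *R b2)) ---> (\<Sum>j\<le>k. c j * 0 ^ (k - j) * t ^ j)) (at 0)"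
    by (rule Lim_transform_eventually) (auto simp: eventually_at_filter ne)
   ultimately show ?thesis using tendsto_unique[of "at (0::real)"] True by auto
  qed (rule ne)
 qed
 have d1: "pderiv_list [b1] p (s *R b1 + t *R b2) = (\<Sum>j\<le>k. c j * (real (k - j) * s ^ (k - j - 1)) * t ^ j)" for s t
 proof -
  have "p (s *R b1 + t *R b2 + h *R b1) = (\<Sum>j\<le>k. c j * (s + h) ^ (k - j) * t ^ j)" for h
   using P[of "s + h" t] by (simp add: algebra_simps)
  moreover have "((%h. \<Sum>j\<le>k. c j * (s + h) ^ (k - j) * t ^ j) has_real_derivative (\<Sum>j\<le>k. c j * (real (k - j) * (s + 0) ^ (k - j - 1)) * t ^ j)) (at 0)"
   by (auto intro!: derivative_eq_intros sum.cong simp: mult_ac)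
  ultimately show ?thesis
   by (simp add: has_real_derivative_iff_has_vector_derivative vector_derivative_at)
 qed
 have d2: "pderiv_list [b2] p (s *R b1 + t *R b2) = (\<Sum>j\<le>k. c j * s ^ (k - j) * (real j * t ^ (j - 1)))" for s t
 proof -
  have "p (s *R b1 + t *R b2 + h *R b2) = (\<Sum>j\<le>k. c j * s ^ (k - j) * (t + h) ^ j)" for h
   using P[of s "t + h"] by (simp add: algebra_simps)
  moreover have "((%h. \<Sum>j\<le>k. c j * s ^ (k - j) * (t + h) ^ j) has_real_derivative (\<Sum>j\<le>k. c j * s ^ (k - j) * (real j * (t + 0) ^ (j - 1)))) (at 0)"
   by (auto intro!: derivative_eq_intros sum.cong simp: mult_ac)
  ultimately show ?thesis
   by (simp add: has_real_derivative_iff_has_vector_derivative vector_derivative_at)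
 qed
 \<comment> \<open>The second derivatives are evaluated on the line \<open>s = 1\<close> only; as a
   polynomial in \<open>t\<close>, their sum already gives the relation for every
   coefficient.\<close>
 have d11: "pderiv_list [b1, b1] p (1 *R b1 + t *R b2) = (\<Sum>j\<le>k. c j * (real (k - j) * real (k - j - 1)) * t ^ j)" for t
 proof -
  have "pderiv_list [b1] p (1 *R b1 + t *R b2 + h *R b1) = (\<Sum>j\<le>k. c j * (real (k - j) * (1 + h) ^ (k - j - 1)) * t ^ j)" for h
   using d1[of "1 + h" t] by (simp add: algebra_simps del: pderiv_list.simps)
  moreover have "((%h. \<Sum>j\<le>k. c j * (real (k - j) * (1 + h) ^ (k - j - 1)) * t ^ j) has_real_derivative (\<Sum>j\<le>k. c j * (real (k - j) * (real (k - j - 1) * (1 + 0) ^ (k - j - 1 - 1))) * t ^ j)) (at 0)"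
   by (auto intro!: derivative_eq_intros sum.cong simp: mult_ac)
  ultimately have "vector_derivative (%h. pderiv_list [b1] p (1 *R b1 + t *R b2 + h *R b1)) (at 0) = (\<Sum>j\<le>k. c j * (real (k - j) * real (k - j - 1)) * t ^ j)"
   by (simp add: has_real_derivative_iff_has_vector_derivative vector_derivative_at del: pderiv_list.simps)
  then show ?thesis by (simp only: pderiv_list.simps)
 qed
 have d22: "pderiv_list [b2, b2] p (1 *R b1 + t *R b2) = (\<Sum>j\<le>k. c j * (real j * real (j - 1) * t ^ (j - 2)))" for t
 proof -
  have "pderiv_list [b2] p (1 *R b1 + t *R b2 + h *R b2) = (\<Sum>j\<le>k. c j * (real j * (t + h) ^ (j - 1)))" for h
   using d2[of 1 "t + h"] by (simp add: algebra_simps del: pderiv_list.simps)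
  moreover have "((%h. \<Sum>j\<le>k. c j * (real j * (t + h) ^ (j - 1))) has_real_derivative (\<Sum>j\<le>k. c j * (real j * (real (j - 1) * (t + 0) ^ (j - 1 - 1))))) (at 0)"
   by (auto intro!: derivative_eq_intros sum.cong simp: mult_ac)
  ultimately have "vector_derivative (%h. pderiv_list [b2] p (1 *R b1 + t *R b2 + h *R b2)) (at 0) = (\<Sum>j\<le>k. c j * (real j * real (j - 1) * t ^ (j - 2)))"
   by (simp add: has_real_derivative_iff_has_vector_derivative vector_derivative_at mult.assoc numeral_2_eq_2 del: pderiv_list.simps)
  then show ?thesis by (simp only: pderiv_list.simps)
 qed
 define T where "T = (\<Sum>j\<le>k. monom (c j * (real (k - j) * real (k - j - 1))) j) + (\<Sum>j\<le>k. monom (c (j + 2) * (real (j + 2) * real (j + 1))) j)"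
 have "poly T t = 0" for t
 proof -
  have "(\<Sum>j\<le>k. c j * (real j * real (j - 1) * t ^ (j - 2))) = (\<Sum>j\<le>k+2. c j * (real j * real (j - 1) * t ^ (j - 2)))"
   by (intro sum.mono_neutral_left) (auto simp: c0)
  also have "... = (\<Sum>j\<le>k. c (j + 2) * (real (j + 2) * real (j + 1) * t ^ j))"
   by (simp add: numeral_2_eq_2 sum.atMost_Suc_shift del: sum.atMost_Suc)
  finally have "poly T t = (\<Sum>i\<in>Basis. pderiv_list [i, i] p (1 *R b1 + t *R b2))"
   unfolding b(1) using b(2) d11[of t] d22[of t] by (simp add: T_def poly_sum poly_monom mult.assoc del: pderiv_list.simps)
  then show ?thesis using lap by simp
 qed
 then have T0: "T = 0" by (simp add: poly_all_0_iff_0[symmetric])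
 have rec: "c (j + 2) * (real (j + 2) * real (j + 1)) = - (c j * (real (k - j) * real (k - j - 1)))" for j
 proof (cases "j <= k")
  case True
  have "coeff T j = c j * (real (k - j) * real (k - j - 1)) + c (j + 2) * (real (j + 2) * real (j + 1))"
   unfolding T_def using True by (simp add: coeff_sum if_distrib cong: if_cong)
  then show ?thesis using T0 by simp
 qed (simp add: c0)
 \<comment> \<open>For \<open>k > 0\<close> these solve \<open>\<alpha> + \<beta> = c 0\<close> and
   \<open>\<i> * (\<alpha> - \<beta>) = c 1 / k\<close>. For \<open>k = 0\<close> the two powers
   coincide and one constant suffices.\<close>
 define \<alpha> \<beta> where "\<alpha> = (if k = 0 then complex_of_real (c 0) else (complex_of_real (c 0) - \<i> * complex_of_real (c 1 / real k)) / 2)"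
  and "\<beta> = (if k = 0 then 0 else (complex_of_real (c 0) + \<i> * complex_of_real (c 1 / real k)) / 2)"
 have cj: "complex_of_real (c j) = of_nat (k choose j) * (\<alpha> * \<i> ^ j + \<beta> * (- \<i>) ^ j)" for j
 proof (induction j rule: less_induct)
  case (less j)
  consider "j = 0" | "j = 1" | i where "j = i + 2" by (metis add_2_eq_Suc' not0_implies_Suc One_nat_def)
  then show ?case
  proof cases
   case 1
   then show ?thesis by (simp add: \<alpha>_def \<beta>_def field_simps)
  next
   case 2
   show ?thesis
   proof (cases "k = 0")
    case True
    then show ?thesis using 2 c0[of 1] by simp
   next
    case False
    have "\<alpha> * \<i> ^ 1 + \<beta> * (- \<i>) ^ 1 = complex_of_real (c 1 / real k)"
     using False by (simp add: \<alpha>_def \<beta>_def field_simps)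
    then show ?thesis unfolding 2 using False by simp
   qed
  next
   case (3 i)
   have ch: "real (k choose (i + 2)) * (real (i + 2) * real (i + 1)) = real (k choose i) * (real (k - i) * real (k - i - 1))"
   proof -
    have ab: "Suc j * (k choose Suc j) = (k - j) * (k choose j)" for j
    proof (cases k)
     case (Suc m)
     show ?thesis unfolding Suc binomial_absorb_comp Suc_times_binomial by simp
    qed simp
    have "(k choose Suc (Suc i)) * (Suc (Suc i) * Suc i) = (Suc (Suc i) * (k choose Suc (Suc i))) * Suc i" by (simp only: mult_ac)
    also have "... = (k - Suc i) * (Suc i * (k choose Suc i))" unfolding ab[of "Suc i"] by (simp only: mult_ac)
    also have "... = (k choose i) * ((k - i) * (k - Suc i))" unfolding ab[of i] by (simp only: mult_ac)
    finally have "(k choose Suc (Suc i)) * (Suc (Suc i) * Suc i) = (k choose i) * ((k - i) * (k - Suc i))" .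
    then show ?thesis by (simp only: of_nat_mult[symmetric]) (simp add: numeral_2_eq_2)
   qed
   have "complex_of_real (c (i + 2) * (real (i + 2) * real (i + 1))) = - complex_of_real (c i) * complex_of_real (real (k - i) * real (k - i - 1))"
    unfolding rec by simp
   also have "... = - (\<alpha> * \<i> ^ i + \<beta> * (- \<i>) ^ i) * complex_of_real (real (k choose i) * (real (k - i) * real (k - i - 1)))"
   proof -
    define E where "E = \<alpha> * \<i> ^ i + \<beta> * (- \<i>) ^ i"
    have "complex_of_real (c i) = of_nat (k choose i) * E" using less.IH[of i] 3 unfolding E_def by simp
    then show ?thesis unfolding E_def[symmetric] by (simp add: mult_ac)
   qed
   also have "... = (\<alpha> * \<i> ^ (i + 2) + \<beta> * (- \<i>) ^ (i + 2)) * complex_of_real (real (k choose (i + 2)) * (real (i + 2) * real (i + 1)))"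
   proof -
    have "\<alpha> * \<i> ^ (i + 2) + \<beta> * (- \<i>) ^ (i + 2) = - (\<alpha> * \<i> ^ i + \<beta> * (- \<i>) ^ i)" by (simp add: power_add)
    then show ?thesis unfolding ch by (simp only:)
   qed
   finally have "complex_of_real (c (i + 2)) * complex_of_real (real (i + 2) * real (i + 1)) =
    (of_nat (k choose (i + 2)) * (\<alpha> * \<i> ^ (i + 2) + \<beta> * (- \<i>) ^ (i + 2))) * complex_of_real (real (i + 2) * real (i + 1))"
    by (simp only: of_real_mult of_real_of_nat_eq mult_ac)
   moreover have "complex_of_real (real (i + 2) * real (i + 1)) ~= 0" by (simp only: of_real_eq_0_iff) simp
   ultimately show ?thesis unfolding 3 by (simp only: mult_cancel_right) simp
  qed
 qed
 have "complex_of_real (p x) = \<alpha> * zc b1 b2 x ^ k + \<beta> * cnj (zc b1 b2 x) ^ k" for x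
 proof -
  define s t where "s = x \<bullet> b1" and "t = x \<bullet> b2"
  have x: "x = s *R b1 + t *R b2" using euclidean_representation[of x] b(2) unfolding b(1) by (simp add: s_def t_def)
  have z: "zc b1 b2 x = \<i> * complex_of_real t + complex_of_real s" "cnj (zc b1 b2 x) = (- \<i>) * complex_of_real t + complex_of_real s"
   by (simp_all add: zc_def s_def t_def complex_eq_iff)
  have "complex_of_real (p x) = (\<Sum>j\<le>k. complex_of_real (c j) * complex_of_real s ^ (k - j) * complex_of_real t ^ j)"
   unfolding x P by simp
  also have "... = \<alpha> * (\<Sum>j\<le>k. of_nat (k choose j) * (\<i> * complex_of_real t) ^ j * complex_of_real s ^ (k - j))
    + \<beta> * (\<Sum>j\<le>k. of_nat (k choose j) * ((- \<i>) * complex_of_real t) ^ j * complex_of_real s ^ (k - j))"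
   unfolding cj sum_distrib_left sum.distrib[symmetric] power_mult_distrib by (intro sum.cong refl) (simp add: algebra_simps)
  finally show ?thesis unfolding z(2) unfolding z(1) binomial_ring .
 qed
 then show ?thesis by blast
qed

section \<open>Spherical harmonics on the circle\<close>

lemma zc_eq: "zc e1 e2 x = complex_of_real (x \<bullet> e1) + \<i> * complex_of_real (x \<bullet> e2)"
 by (simp add: zc_def complex_eq_iff)

lemma continuous_on_zc [continuous_intros]:
 fixes e1 e2 :: "'a::euclidean_space" shows "continuous_on S (zc e1 e2)"
 unfolding zc_eq[abs_def] by (intro continuous_intros)

text \<open>The matrix of one frame in the other is orthogonal. Its determinant \<open>D\<close> is
  \<open>1\<close> for a rotation, which multiplies by \<open>u\<close>, and \<open>-1\<close> for a
  reflection, which also conjugates.\<close>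

lemma zc_frame:
 fixes e1 e2 b1 b2 :: "'a::euclidean_space"
 assumes b: "Basis = {b1, b2}" "b1 ~= b2" and e: "norm e1 = 1" "norm e2 = 1" "e1 \<bullet> e2 = 0"
 shows "EX u. cmod u = 1 & ((ALL x. zc e1 e2 x = u * zc b1 b2 x) | (ALL x. zc e1 e2 x = u * cnj (zc b1 b2 x)))"
proof -
 have ip: "x \<bullet> y = (x \<bullet> b1) * (y \<bullet> b1) + (x \<bullet> b2) * (y \<bullet> b2)" for x y :: 'a
  using euclidean_inner[of x y] b(2) unfolding b(1) by simp
 define a1 a2 c1 c2 where "a1 = e1 \<bullet> b1" and "a2 = e1 \<bullet> b2" and "c1 = e2 \<bullet> b1" and "c2 = e2 \<bullet> b2"
 have a: "a1\<^sup>2 + a2\<^sup>2 = 1" and c: "c1\<^sup>2 + c2\<^sup>2 = 1" and ac: "a1 * c1 + a2 * c2 = 0"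
  using e ip[of e1 e1] ip[of e2 e2] ip[of e1 e2]
  by (auto simp: a1_def a2_def c1_def c2_def norm_eq_sqrt_inner power2_eq_square)
 define D where "D = a1 * c2 - a2 * c1"
 have "D\<^sup>2 = (a1\<^sup>2 + a2\<^sup>2) * (c1\<^sup>2 + c2\<^sup>2) - (a1 * c1 + a2 * c2)\<^sup>2" unfolding D_def by algebra
 then have "D\<^sup>2 = 1" using a c ac by simp
 then have D: "D = 1 | D = -1" by (simp add: power2_eq_1_iff)
 have "c1 = (a1\<^sup>2 + a2\<^sup>2) * c1" "c2 = (a1\<^sup>2 + a2\<^sup>2) * c2" using a by auto
 moreover have "(a1\<^sup>2 + a2\<^sup>2) * c1 = a1 * (a1 * c1 + a2 * c2) - a2 * D" "(a1\<^sup>2 + a2\<^sup>2) * c2 = a2 * (a1 * c1 + a2 * c2) + a1 * D"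
  unfolding D_def by algebra+
 ultimately have c: "c1 = - a2 * D" "c2 = a1 * D" using ac by auto
 have x: "x \<bullet> e1 = (x \<bullet> b1) * a1 + (x \<bullet> b2) * a2" "x \<bullet> e2 = (x \<bullet> b1) * c1 + (x \<bullet> b2) * c2" for x
  using ip[of x e1] ip[of x e2] by (auto simp: a1_def a2_def c1_def c2_def)
 have n: "cmod (Complex a1 (- a2)) = 1" "cmod (Complex a1 a2) = 1" using a by (auto simp: cmod_def)
 show ?thesis using D
 proof
  assume "D = 1"
  then have "zc e1 e2 x = Complex a1 (- a2) * zc b1 b2 x" for x
   unfolding zc_def x c by (simp add: complex_eq_iff algebra_simps)
  then show ?thesis using n(1) by blast
 next
  assume "D = -1"
  then have "zc e1 e2 x = Complex a1 a2 * cnj (zc b1 b2 x)" for x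
   unfolding zc_def x c by (simp add: complex_eq_iff algebra_simps)
  then show ?thesis using n(2) by blast
 qed
qed

text \<open>The coordinate maps \<open>U\<close> and \<open>W\<close> match boxes with boxes and so
  carry Lebesgue measure to that of \<open>real^2\<close>, where orthogonal maps preserve the
  measure of a box. Agreement on boxes identifies the two measures.\<close>

lemma lborel_orthogonal_2d:
 fixes g :: "'a::euclidean_space => 'a"
 assumes DIM: "DIM('a) = 2" and g: "orthogonal_transformation g"
 shows "distr lborel borel g = lborel"
proof -
 obtain b1 b2 :: 'a where b: "Basis = {b1, b2}" "b1 ~= b2" using dim2_basis[OF DIM] by blast
 then have bB: "b1 : Basis" "b2 : Basis" by auto
 then have ip: "b1 \<bullet> b1 = 1" "b2 \<bullet> b2 = 1" "b1 \<bullet> b2 = 0" "b2 \<bullet> b1 = 0" using b(2) by (auto simp: inner_Basis)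
 have B2: "(Basis :: (real^2) set) = {axis 1 1, axis 2 1}" by (auto simp: Basis_vec_def UNIV_2)
 have ax: "axis 1 1 ~= (axis 2 1 :: real^2)" by (simp add: axis_eq_axis)
 define U :: "real^2 => 'a" where "U v = v $ 1 *R b1 + v $ 2 *R b2" for v
 define W :: "'a => real^2" where "W x = (\<chi> i. if i = 1 then x \<bullet> b1 else x \<bullet> b2)" for x
 have W: "W x $ 1 = x \<bullet> b1" "W x $ 2 = x \<bullet> b2" for x by (simp_all add: W_def)
 have UW: "U (W x) = x" for x using euclidean_representation[of x] b(2) unfolding b(1) by (simp add: U_def W)
 have WU: "W (U v) = v" for v by (simp add: vec_eq_iff forall_2 W U_def inner_add_left ip)
 have linU: "linear U" by (rule linearI) (simp_all add: U_def algebra_simps)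
 have linW: "linear W" by (rule linearI) (simp_all add: vec_eq_iff forall_2 W inner_add_left)
 have nW: "norm (W x) = norm x" for x
  using euclidean_inner[of x x] b(2) unfolding b(1) by (simp add: norm_eq_sqrt_inner inner_vec_def UNIV_2 W)
 have nU: "norm (U v) = norm v" for v using nW[of "U v"] WU by simp
 have [measurable]: "U : borel_measurable borel" "g : borel_measurable borel"
  using linU orthogonal_transformation_linear[OF g] by (auto intro: borel_measurable_continuous_onI linear_continuous_on linear_conv_bounded_linear[THEN iffD1])
 have box: "U -` box l u = box (W l) (W u)" for l u
  using ax b(2) by (auto simp: mem_box b(1) B2 inner_axis W U_def inner_add_left ip)
 have dU: "distr lborel borel U = lborel"
 proof (rule lborel_eqI[symmetric])
  fix l u :: 'a assume "!!b. b : Basis ==> l \<bullet> b <= u \<bullet> b"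
  then have le: "l \<bullet> b1 <= u \<bullet> b1" "l \<bullet> b2 <= u \<bullet> b2" using bB by auto
  have "emeasure (distr lborel borel U) (box l u) = emeasure lborel (box (W l) (W u))"
   by (subst emeasure_distr) (auto simp: box)
  also have "... = ennreal (\<Prod>b\<in>Basis. (W u - W l) \<bullet> b)"
   by (rule emeasure_lborel_box) (use le in "auto simp: B2 inner_axis W")
  finally show "emeasure (distr lborel borel U) (box l u) = ennreal (\<Prod>b\<in>Basis. (u - l) \<bullet> b)"
   using ax b(2) by (simp add: B2 b(1) inner_axis W inner_diff_left)
 qed simp
 have og: "orthogonal_transformation (inv g)" by (rule orthogonal_transformation_inv[OF g])
 have gi: "g (inv g x) = x" "inv g (g x) = x" for x
  using orthogonal_transformation_bij[OF g] by (simp_all add: bij_is_surj surj_f_inv_f bij_is_inj)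
 define h where "h = W \<circ> inv g \<circ> U"
 have h: "orthogonal_transformation h"
  unfolding orthogonal_transformation h_def
  using linear_compose[OF linear_compose[OF linU orthogonal_transformation_linear[OF og]] linW] nW nU orthogonal_transformation_norm[OF og]
  by (simp add: comp_assoc)
 show ?thesis
 proof (rule lborel_eqI[symmetric])
  fix l u :: 'a assume le: "!!b. b : Basis ==> l \<bullet> b <= u \<bullet> b"
  have gm: "g -` box l u : sets borel" using measurable_sets[of g borel borel "box l u"] by simp
  have "U -` g -` box l u = h ` box (W l) (W u)"
  proof -
   have "v : h ` box (W l) (W u)" if "g (U v) : box l u" for v
   proof
    show "v = h (W (g (U v)))" by (simp add: h_def UW WU gi)
    show "W (g (U v)) : box (W l) (W u)" using that unfolding box[symmetric] by (simp add: UW)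
   qed
   then show ?thesis unfolding box[symmetric] by (auto simp: h_def UW WU gi)
  qed
  then have e: "emeasure lborel (g -` box l u) = emeasure lborel (h ` box (W l) (W u))"
   using emeasure_distr[of U lborel borel "g -` box l u"] gm unfolding dU by simp
  have hb: "h ` box (W l) (W u) : sets borel"
   unfolding \<open>U -` g -` box l u = h ` box (W l) (W u)\<close>[symmetric] using measurable_sets[OF _ gm, of U borel] by simp
  have "h ` box (W l) (W u) : lmeasurable" "measure lebesgue (h ` box (W l) (W u)) = measure lebesgue (box (W l) (W u))"
   using measurable_orthogonal_image[OF h] measure_orthogonal_image[OF h] by auto
  then have "emeasure lebesgue (h ` box (W l) (W u)) = emeasure lebesgue (box (W l) (W u))"
   by (simp add: emeasure_eq_measure2)
  then have "emeasure lborel (g -` box l u) = emeasure lborel (box (W l) (W u))" unfolding e using hb by simp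
  also have "... = emeasure (distr lborel borel U) (box l u)" by (subst emeasure_distr) (auto simp: box)
  finally show "emeasure (distr lborel borel g) (box l u) = ennreal (\<Prod>b\<in>Basis. (u - l) \<bullet> b)"
   unfolding dU using emeasure_lborel_box[OF le] by (subst emeasure_distr) auto
 qed simp
qed

lemma cmod_zc_Basis:
 fixes b1 b2 :: "'a::euclidean_space"
 assumes b: "Basis = {b1, b2}" "b1 ~= b2" shows "cmod (zc b1 b2 x) = norm x"
 using euclidean_inner[of x x] b(2) unfolding b(1) by (simp add: zc_def cmod_def norm_eq_sqrt_inner power2_eq_square)

text \<open>An orthogonal map commutes with \<open>sgn\<close> and preserves the unit ball, so the
  cone measure inherits the invariance of Lebesgue measure.\<close>

lemma sphere_integral_orthogonal:
 fixes f :: "'a::euclidean_space => complex" and g :: "'a => 'a"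
 assumes DIM: "DIM('a) = 2" and g: "orthogonal_transformation g" and f: "continuous_on UNIV f"
 shows "(LINT x|sphere_measure. f (g x)) = (LINT x|sphere_measure. f x)"
proof -
 have lg: "linear g" by (rule orthogonal_transformation_linear[OF g])
 have ng: "norm (g x) = norm x" for x by (rule orthogonal_transformation_norm[OF g])
 then have g0: "g x = 0 \<longleftrightarrow> x = 0" for x using norm_eq_zero[of "g x"] norm_eq_zero[of x] by simp
 have [measurable]: "g : borel_measurable borel"
  using lg by (intro borel_measurable_continuous_onI) (simp add: linear_continuous_on linear_conv_bounded_linear)
 have [measurable]: "sgn : borel_measurable (borel :: 'a measure)" unfolding sgn_div_norm[abs_def] by measurable
 let ?S = "sphere_measure :: 'a measure"
 have gS: "g : measurable ?S ?S"
  unfolding measurable_cong_sets[OF sets_sphere sets_sphere] by (rule measurable_restrict_space3) (auto simp: ng)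
 have "distr ?S ?S g = ?S"
 proof (rule measure_eqI)
  fix A assume "A : sets (distr ?S ?S g)"
  then have A: "A : sets ?S" by simp
  then have [measurable]: "A : sets borel" by (simp add: sets_restrict_space_iff)
  define B where "B = ball 0 1 - {0::'a}"
  have [measurable]: "B : sets borel" by (simp add: B_def)
  let ?F = "%x::'a. indicator A (sgn x) * indicator B x :: ennreal"
  have "emeasure (distr ?S ?S g) A = (\<integral>\<^sup>+x. indicator A (g x) \<partial>?S)"
   using A gS by (simp add: nn_integral_indicator[symmetric] nn_integral_distr del: nn_integral_indicator sets_sphere)
  also have "... = of_nat DIM('a) * (\<integral>\<^sup>+x. indicator A (g (sgn x)) * indicator B x \<partial>lborel)"
   unfolding B_def by (rule nn_integral_sphere) (intro measurable_restrict_space1, measurable)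
  also have "(%x. indicator A (g (sgn x)) * indicator B x) = (%x. ?F (g x))"
   using ng g0 by (auto simp: fun_eq_iff indicator_def sgn_div_norm B_def linear_cmul[OF lg])
  also have "(\<integral>\<^sup>+x. ?F (g x) \<partial>lborel) = (\<integral>\<^sup>+x. ?F x \<partial>distr lborel borel g)" by (rule nn_integral_distr[symmetric]) measurable
  also have "of_nat DIM('a) * \<dots> = (\<integral>\<^sup>+x. indicator A x \<partial>?S)"
   unfolding lborel_orthogonal_2d[OF DIM g] B_def by (rule nn_integral_sphere[symmetric]) (intro measurable_restrict_space1, measurable)
  finally show "emeasure (distr ?S ?S g) A = emeasure ?S A" using A by simp
 qed simp
 moreover have "(LINT x|distr ?S ?S g. f x) = (LINT x|?S. f (g x))"
  by (rule integral_distr[OF gS]) (rule sphere_measurable[OF continuous_on_subset[OF f]], simp)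
 ultimately show ?thesis by simp
qed

lemma sphere_total_2d:
 assumes "DIM('a::euclidean_space) = 2"
 shows "(LINT x::'a|sphere_measure. 1::complex) = complex_of_real (2 * pi)"
proof -
 have i: "integrable sphere_measure (%x::'a. 1::real)" by (intro sphere_integrable continuous_intros)
 have "(\<integral>\<^sup>+x. 1 \<partial>(sphere_measure :: 'a measure)) = of_nat DIM('a) * (\<integral>\<^sup>+x. 1 * indicator (ball 0 1 - {0}) x \<partial>(lborel :: 'a measure))"
  by (rule nn_integral_sphere) simp
 also have "(\<integral>\<^sup>+x. 1 * indicator (ball 0 1 - {0}) x \<partial>(lborel :: 'a measure)) = emeasure lborel (ball (0::'a) 1 - {0})" by simp
 also have "... = emeasure lborel (ball (0::'a) 1)" by (intro emeasure_Diff_null_set) auto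
 also have "... = ennreal pi" using emeasure_ball[of 1 "0::'a"] assms by (simp add: unit_ball_vol_2)
 finally have "(\<integral>\<^sup>+x. ennreal 1 \<partial>(sphere_measure :: 'a measure)) = ennreal (2 * pi)"
  using assms by (simp add: ennreal_mult)
 then have "ennreal (LINT x::'a|sphere_measure. 1) = ennreal (2 * pi)"
  using nn_integral_eq_integral[OF i] by simp
 then have "(LINT x::'a|sphere_measure. 1::real) = 2 * pi" by (subst (asm) ennreal_inj) (auto intro!: integral_nonneg_AE)
 then have "complex_of_real (LINT x::'a|sphere_measure. 1::real) = complex_of_real (2 * pi)" by simp
 then show ?thesis unfolding integral_complex_of_real[symmetric] by simp
qed

locale plane_frame =
 fixes e1 e2 :: "'a::euclidean_space"
 assumes DIM: "DIM('a) = 2" and frame: "norm e1 = 1" "norm e2 = 1" "e1 \<bullet> e2 = 0"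
begin

definition z :: "'a => complex" where "z = zc e1 e2"

lemma continuous_z [continuous_intros]: "continuous_on S z"
 unfolding z_def by (rule continuous_on_zc)

lemma norm_z: "cmod (z x) = norm x"
proof -
 obtain b1 b2 :: 'a where b: "Basis = {b1, b2}" "b1 ~= b2" using dim2_basis[OF DIM] by blast
 from zc_frame[OF b frame] obtain u where "cmod u = 1" "(ALL x. zc e1 e2 x = u * zc b1 b2 x) | (ALL x. zc e1 e2 x = u * cnj (zc b1 b2 x))" by blast
 then have "cmod (zc e1 e2 x) = cmod (zc b1 b2 x)" by (auto simp: norm_mult)
 then show ?thesis unfolding z_def using cmod_zc_Basis[OF b] by simp
qed

text \<open>The rotation by \<open>pi / m\<close> changes the sign of \<open>z ^ m\<close> and
  preserves the measure, so the integral equals its negative. This takes the place of a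
  parametrisation of the circle.\<close>

lemma sphere_moment_zero:
 assumes m: "m >= 1" shows "(LINT x|sphere_measure. z x ^ m) = 0"
proof -
 define u where "u = cis (pi / real m)"
 define g where "g x = Re (u * z x) *R e1 + Im (u * z x) *R e2" for x
 have ee: "e1 \<bullet> e1 = 1" "e2 \<bullet> e2 = 1" "e2 \<bullet> e1 = 0" using frame by (auto simp: norm_eq_1 inner_commute)
 have zg: "z (g x) = u * z x" for x by (simp add: z_def zc_def g_def inner_add_left frame(3) ee complex_eq_iff)
 have "norm (g x) = norm x" for x using norm_z[of "g x"] norm_z[of x] by (simp add: zg norm_mult u_def)
 moreover have "linear g"
  by (rule linearI) (simp_all add: g_def z_def zc_def algebra_simps)
 ultimately have g: "orthogonal_transformation g" unfolding orthogonal_transformation by blast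
 have "(LINT x|sphere_measure. z (g x) ^ m) = (LINT x|sphere_measure. z x ^ m)"
  by (rule sphere_integral_orthogonal[OF DIM g]) (intro continuous_intros)
 moreover have "u ^ m = -1" using m unfolding u_def by (simp only: Complex.DeMoivre) simp
 ultimately show ?thesis by (simp add: zg power_mult_distrib)
qed

lemma z_cnj: "\<theta> : sphere 0 1 ==> z \<theta> * cnj (z \<theta>) = 1"
 using norm_z[of \<theta>] by (simp add: complex_norm_square[symmetric])

lemma sphere_moment:
 "(LINT x|sphere_measure. z x ^ i * cnj (z x) ^ j) = (if i = j then complex_of_real (2 * pi) else 0)"
proof -
 have zz: "z x ^ m * cnj (z x) ^ m = 1" if "x : sphere 0 1" for x m
  using z_cnj[OF that] by (simp only: power_mult_distrib[symmetric] power_one)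
 consider "i = j" | m where "i = j + m" "m >= 1" | m where "j = i + m" "m >= 1"
  by (metis less_imp_add_positive linorder_neqE_nat Suc_leI One_nat_def)
 then show ?thesis
 proof cases
  case 1
  have "(LINT x|sphere_measure. z x ^ i * cnj (z x) ^ j) = (LINT x::'a|sphere_measure. 1::complex)"
   unfolding 1 by (rule Bochner_Integration.integral_cong) (simp_all only: space_sphere zz)
  then show ?thesis using 1 sphere_total_2d[OF DIM] by simp
 next
  case (2 m)
  have "(LINT x|sphere_measure. z x ^ i * cnj (z x) ^ j) = (LINT x|sphere_measure. z x ^ m)"
  proof (rule Bochner_Integration.integral_cong[OF refl])
   fix x :: 'a assume "x : space sphere_measure"
   then have "z x ^ j * cnj (z x) ^ j = 1" by (simp only: space_sphere zz)
   then show "z x ^ i * cnj (z x) ^ j = z x ^ m" unfolding 2(1) power_add by (simp add: mult_ac)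
  qed
  then show ?thesis using 2 sphere_moment_zero[OF 2(2)] by simp
 next
  case (3 m)
  have "(LINT x|sphere_measure. z x ^ i * cnj (z x) ^ j) = (LINT x|sphere_measure. cnj (z x ^ m))"
  proof (rule Bochner_Integration.integral_cong[OF refl])
   fix x :: 'a assume "x : space sphere_measure"
   then have "z x ^ i * cnj (z x) ^ i = 1" by (simp only: space_sphere zz)
   then show "z x ^ i * cnj (z x) ^ j = cnj (z x ^ m)" unfolding 3(1) power_add by (simp only: mult.assoc[symmetric]) simp
  qed
  also have "... = cnj (LINT x|sphere_measure. z x ^ m)" by (rule Bochner_Integration.integral_cnj)
  finally show ?thesis using 3 sphere_moment_zero[OF 3(2)] by simp
 qed
qed

lemma harmonic_eq:
 assumes "spherical_harmonic k Y"
 obtains \<alpha> \<beta> where "!!x. x : sphere 0 1 ==> complex_of_real (Y x) = \<alpha> * z x ^ k + \<beta> * cnj (z x) ^ k"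
proof -
 obtain b1 b2 :: 'a where b: "Basis = {b1, b2}" "b1 ~= b2" using dim2_basis[OF DIM] by blast
 from assms[unfolded spherical_harmonic_def] obtain p where p: "real_polynomial_function p" "ALL c x. p (c *R x) = c ^ k * p x"
  "ALL x. (\<Sum>i\<in>Basis. pderiv_list [i, i] p x) = 0" "ALL \<theta>:sphere 0 1. Y \<theta> = p \<theta>" by (elim exE conjE)
 from harmonic_2d[OF b p(1) p(2)[rule_format] p(3)[rule_format]] obtain \<alpha> \<beta> where
  ab: "!!x. complex_of_real (p x) = \<alpha> * zc b1 b2 x ^ k + \<beta> * cnj (zc b1 b2 x) ^ k" by blast
 from zc_frame[OF b frame] obtain u where u: "cmod u = 1" "(ALL x. zc e1 e2 x = u * zc b1 b2 x) | (ALL x. zc e1 e2 x = u * cnj (zc b1 b2 x))" by blast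
 have uu: "cnj u * u = 1" using u(1) complex_norm_square[of u] by (simp add: mult.commute)
 from u(2) show thesis
 proof
  assume "ALL x. zc e1 e2 x = u * zc b1 b2 x"
  then have "zc b1 b2 x = cnj u * z x" for x using uu by (simp add: z_def mult.assoc[symmetric])
  then have "complex_of_real (Y x) = (\<alpha> * cnj u ^ k) * z x ^ k + (\<beta> * u ^ k) * cnj (z x) ^ k" if "x : sphere 0 1" for x
   using p(4) ab[of x] that by (simp add: power_mult_distrib)
  then show thesis by (rule that)
 next
  assume "ALL x. zc e1 e2 x = u * cnj (zc b1 b2 x)"
  then have "cnj (zc b1 b2 x) = cnj u * z x" for x using uu by (simp add: z_def mult.assoc[symmetric])
  then have "zc b1 b2 x = u * cnj (z x)" for x by (metis complex_cnj_cnj complex_cnj_mult)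
  then have "complex_of_real (Y x) = (\<beta> * cnj u ^ k) * z x ^ k + (\<alpha> * u ^ k) * cnj (z x) ^ k" if "x : sphere 0 1" for x
   using p(4) ab[of x] that by (simp add: power_mult_distrib)
  then show thesis by (rule that)
 qed
qed

text \<open>The kernel is the cosine of \<open>k\<close> times the angle between
  \<open>\<theta>\<close> and \<open>\<omega>\<close>: integration against it reproduces degree
  \<open>k\<close> up to the factor \<open>pi\<close> and annihilates every other degree. If both
  degrees are zero the factor is \<open>2 * pi\<close>, hence \<open>k + k' > 0\<close>.\<close>

lemma harmonic_projection:
 assumes Y: "spherical_harmonic k' Y" and k: "k + k' > 0" and th: "\<theta> : sphere 0 1"
 shows "(LINT \<omega>|sphere_measure. Re (z \<theta> ^ k * cnj (z \<omega>) ^ k) * Y \<omega>) = (if k = k' then pi * Y \<theta> else 0)"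
proof -
 obtain \<alpha> \<beta> where ab: "!!x. x : sphere 0 1 ==> complex_of_real (Y x) = \<alpha> * z x ^ k' + \<beta> * cnj (z x) ^ k'"
  using harmonic_eq[OF Y] by blast
 define a where "a = z \<theta> ^ k"
 have i: "integrable sphere_measure (%x. z x ^ i * cnj (z x) ^ j)" for i j by (intro sphere_integrable continuous_intros)
 have "complex_of_real (LINT \<omega>|sphere_measure. Re (a * cnj (z \<omega>) ^ k) * Y \<omega>) = (LINT \<omega>|sphere_measure. complex_of_real (Re (a * cnj (z \<omega>) ^ k) * Y \<omega>))"
  by (rule integral_complex_of_real[symmetric])
 also have "... = (LINT \<omega>|sphere_measure. (a * \<alpha> / 2) * (z \<omega> ^ k' * cnj (z \<omega>) ^ k) + (a * \<beta> / 2) * (z \<omega> ^ 0 * cnj (z \<omega>) ^ (k + k'))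
  + (cnj a * \<alpha> / 2) * (z \<omega> ^ (k + k') * cnj (z \<omega>) ^ 0) + (cnj a * \<beta> / 2) * (z \<omega> ^ k * cnj (z \<omega>) ^ k'))"
 proof (rule Bochner_Integration.integral_cong[OF refl])
  fix x :: 'a assume "x : space sphere_measure"
  then have x: "x : sphere 0 1" by (simp add: space_sphere)
  have e: "complex_of_real (Re (a * cnj (z x) ^ k)) = (a * cnj (z x) ^ k + cnj a * z x ^ k) / 2"
   using complex_add_cnj[of "a * cnj (z x) ^ k"] by simp
  show "complex_of_real (Re (a * cnj (z x) ^ k) * Y x) = (a * \<alpha> / 2) * (z x ^ k' * cnj (z x) ^ k) + (a * \<beta> / 2) * (z x ^ 0 * cnj (z x) ^ (k + k'))
  + (cnj a * \<alpha> / 2) * (z x ^ (k + k') * cnj (z x) ^ 0) + (cnj a * \<beta> / 2) * (z x ^ k * cnj (z x) ^ k')"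
   unfolding of_real_mult ab[OF x] e by (simp add: power_add field_simps)
 qed
 also have "... = (a * \<alpha> / 2) * (if k' = k then complex_of_real (2 * pi) else 0) + (cnj a * \<beta> / 2) * (if k = k' then complex_of_real (2 * pi) else 0)"
 proof -
  have "0 ~= k + k'" "k + k' ~= 0" using k by auto
  then show ?thesis by (simp only: Bochner_Integration.integral_add Bochner_Integration.integrable_add integrable_mult_right i integral_mult_right_zero sphere_moment if_False mult_zero_right add_0_right)
 qed
 also have "... = complex_of_real (if k = k' then pi * Y \<theta> else 0)"
  using ab[OF th] by (auto simp: a_def field_simps)
 finally show ?thesis unfolding a_def by (simp only: of_real_eq_iff)
qed

lemma z_cis: "\<theta> : sphere 0 1 ==> z \<theta> ^ k = cis (real k * polar_angle e1 e2 \<theta>)"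
proof -
 assume "\<theta> : sphere 0 1"
 then have "cmod (z \<theta>) = 1" using norm_z by simp
 then have "z \<theta> = cis (Arg (z \<theta>))" using cis_Arg[of "z \<theta>"] by (cases "z \<theta> = 0") (auto simp: sgn_div_norm)
 then have "z \<theta> ^ k = cis (Arg (z \<theta>)) ^ k" by (rule arg_cong)
 also have "... = cis (real k * Arg (z \<theta>))" by (rule Complex.DeMoivre)
 finally have "z \<theta> ^ k = cis (real k * Arg (z \<theta>))" .
 then show ?thesis by (simp add: polar_angle_def z_def zc_def)
qed

text \<open>The cosine and sine integrals add up to one integral against the kernel of
  \<open>harmonic_projection\<close>. So the trigonometric form of \<open>sigma\<close> in dimension
  two agrees with the expansion in the given, arbitrary basis \<open>Y\<close>.\<close>

lemma fourier_term:
 fixes f :: "'a => complex" and Y :: "nat => nat => 'a => real"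
 assumes Y: "!!k l. l : {1..d k} ==> spherical_harmonic k (Y k l)"
  and f: "!!\<omega>. \<omega> : sphere 0 1 ==> f (r *R \<omega>) = (\<Sum>k\<le>K. \<Sum>l=1..d k. Y k l \<omega> *R c k l)"
  and th: "\<theta> : sphere 0 1" and k: "k >= 1"
 shows "cos (real k * polar_angle e1 e2 \<theta>) *R fourier_cos e1 e2 f k r + sin (real k * polar_angle e1 e2 \<theta>) *R fourier_sin e1 e2 f k r
   = (if k <= K then \<Sum>l=1..d k. Y k l \<theta> *R c k l else 0)"
proof -
 define G where "G \<omega> = (\<Sum>k\<le>K. \<Sum>l=1..d k. Y k l \<omega> *R c k l)" for \<omega>
 define A where "A \<omega> = Re (z \<theta> ^ k * cnj (z \<omega>) ^ k)" for \<omega>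
 have cY: "continuous_on (sphere 0 1) (Y k l)" if "l : {1..d k}" for k l by (rule spherical_harmonic_continuous[OF Y[OF that]])
 have cG: "continuous_on (sphere 0 1) G" unfolding G_def by (intro continuous_intros cY) auto
 have co: "cos (real k * polar_angle e1 e2 \<omega>) = Re (z \<omega> ^ k)" "sin (real k * polar_angle e1 e2 \<omega>) = Im (z \<omega> ^ k)" if "\<omega> : sphere 0 1" for \<omega>
  using z_cis[OF that, of k] by simp_all
 have "fourier_cos e1 e2 f k r = (1 / pi) *R (LINT \<omega>|sphere_measure. Re (z \<omega> ^ k) *R G \<omega>)"
  unfolding fourier_cos_def by (intro arg_cong2[where f=scaleR] refl Bochner_Integration.integral_cong) (simp_all add: space_sphere co f G_def)
 moreover have "fourier_sin e1 e2 f k r = (1 / pi) *R (LINT \<omega>|sphere_measure. Im (z \<omega> ^ k) *R G \<omega>)"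
  unfolding fourier_sin_def by (intro arg_cong2[where f=scaleR] refl Bochner_Integration.integral_cong) (simp_all add: space_sphere co f G_def)
 moreover have iR: "integrable sphere_measure (%\<omega>. Re (z \<omega> ^ k) *R G \<omega>)" "integrable sphere_measure (%\<omega>. Im (z \<omega> ^ k) *R G \<omega>)"
  by (intro sphere_integrable continuous_intros cG)+
 moreover have "(LINT \<omega>|sphere_measure. A \<omega> *R G \<omega>) = (LINT \<omega>|sphere_measure. Re (z \<theta> ^ k) *R (Re (z \<omega> ^ k) *R G \<omega>) + Im (z \<theta> ^ k) *R (Im (z \<omega> ^ k) *R G \<omega>))"
 proof -
  have "A \<omega> = Re (z \<theta> ^ k) * Re (z \<omega> ^ k) + Im (z \<theta> ^ k) * Im (z \<omega> ^ k)" for \<omega>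
   unfolding A_def complex_cnj_power[symmetric] by (simp del: complex_cnj_power)
  then show ?thesis by (simp add: scaleR_add_left)
 qed
 moreover have "... = Re (z \<theta> ^ k) *R (LINT \<omega>|sphere_measure. Re (z \<omega> ^ k) *R G \<omega>) + Im (z \<theta> ^ k) *R (LINT \<omega>|sphere_measure. Im (z \<omega> ^ k) *R G \<omega>)"
  using iR by (simp only: Bochner_Integration.integral_add integrable_scaleR_right integral_scaleR_right)
 ultimately have "cos (real k * polar_angle e1 e2 \<theta>) *R fourier_cos e1 e2 f k r + sin (real k * polar_angle e1 e2 \<theta>) *R fourier_sin e1 e2 f k r
  = (1 / pi) *R (LINT \<omega>|sphere_measure. A \<omega> *R G \<omega>)"
  using co[OF th] by (simp only: scaleR_add_right scaleR_left_commute)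
 also have "(LINT \<omega>|sphere_measure. A \<omega> *R G \<omega>) = (\<Sum>k\<le>K. \<Sum>l=1..d k. (LINT \<omega>|sphere_measure. A \<omega> * Y k l \<omega>) *R c k l)"
  unfolding G_def A_def by (intro sphere_integral_double_sum cY continuous_intros)
 also have "... = (\<Sum>k'\<le>K. \<Sum>l=1..d k'. (if k' = k then pi * Y k' l \<theta> else 0) *R c k' l)"
 proof (intro sum.cong refl arg_cong2[where f=scaleR])
  fix k' l assume l: "l : {1..d k'}"
  show "(LINT \<omega>|sphere_measure. A \<omega> * Y k' l \<omega>) = (if k' = k then pi * Y k' l \<theta> else 0)"
   using harmonic_projection[OF Y[OF l] _ th, of k] k unfolding A_def by auto
 qed
 also have "... = (\<Sum>k'\<le>K. if k' = k then pi *R (\<Sum>l=1..d k'. Y k' l \<theta> *R c k' l) else 0)"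
  by (intro sum.cong refl) (auto simp: scaleR_sum_right)
 finally show ?thesis by (simp add: sum.delta)
qed

text \<open>Harmonics of degree zero are constant on the circle, so the mean value is the degree
  zero part at any point.\<close>

lemma fourier_term_0:
 fixes f :: "'a => complex" and Y :: "nat => nat => 'a => real"
 assumes Y: "!!k l. l : {1..d k} ==> spherical_harmonic k (Y k l)"
  and f: "!!\<omega>. \<omega> : sphere 0 1 ==> f (r *R \<omega>) = (\<Sum>k\<le>K. \<Sum>l=1..d k. Y k l \<omega> *R c k l)"
  and th: "\<theta> : sphere 0 1"
 shows "fourier_0 f r = (\<Sum>l=1..d 0. Y 0 l \<theta> *R c 0 l)"
proof -
 have cY: "continuous_on (sphere 0 1) (Y k l)" if "l : {1..d k}" for k l by (rule spherical_harmonic_continuous[OF Y[OF that]])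
 have int: "(LINT \<omega>|sphere_measure. Y k l \<omega>) = (if k = 0 then 2 * pi * Y k l \<theta> else 0)" if l: "l : {1..d k}" for k l
 proof (cases "k = 0")
  case True
  from Y[OF l, unfolded spherical_harmonic_def True] obtain p where p: "ALL c x. p (c *R x) = c ^ 0 * p x" "ALL \<theta>:sphere 0 1. Y 0 l \<theta> = p \<theta>" by (elim exE conjE)
  have "p x = p 0" for x using p(1)[rule_format, of 0 x] by simp
  then have "Y 0 l \<omega> = Y 0 l \<theta>" if "\<omega> : sphere 0 1" for \<omega> using p(2) th that by metis
  then have "(LINT \<omega>|sphere_measure. complex_of_real (Y 0 l \<omega>)) = (LINT \<omega>::'a|sphere_measure. complex_of_real (Y 0 l \<theta>) * 1)"
   by (intro Bochner_Integration.integral_cong refl) (simp add: space_sphere)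
  also have "... = complex_of_real (Y 0 l \<theta>) * complex_of_real (2 * pi)" unfolding integral_mult_right_zero sphere_total_2d[OF DIM] ..
  finally have "complex_of_real (LINT \<omega>|sphere_measure. Y 0 l \<omega>) = complex_of_real (Y 0 l \<theta> * (2 * pi))"
   unfolding integral_complex_of_real by simp
  then show ?thesis using True by (simp only: of_real_eq_iff) simp
 next
  case False
  then show ?thesis using harmonic_projection[OF Y[OF l] _ th, of 0] by simp
 qed
 have "(LINT \<omega>|sphere_measure. f (r *R \<omega>)) = (LINT \<omega>|sphere_measure. 1 *R (\<Sum>k\<le>K. \<Sum>l=1..d k. Y k l \<omega> *R c k l))"
  by (intro Bochner_Integration.integral_cong refl) (simp add: space_sphere f)
 also have "... = (\<Sum>k\<le>K. \<Sum>l=1..d k. (LINT \<omega>|sphere_measure. 1 * Y k l \<omega>) *R c k l)"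
  by (intro sphere_integral_double_sum cY continuous_intros)
 also have "... = (\<Sum>k\<le>K. \<Sum>l=1..d k. (if k = 0 then 2 * pi * Y k l \<theta> else 0) *R c k l)"
  by (intro sum.cong refl arg_cong2[where f=scaleR]) (simp add: int)
 also have "... = (\<Sum>k\<le>K. if k = 0 then (2 * pi) *R (\<Sum>l=1..d k. Y k l \<theta> *R c k l) else 0)"
  by (intro sum.cong refl) (auto simp: scaleR_sum_right)
 finally show ?thesis unfolding fourier_0_def by (simp add: sum.delta)
qed

end

section \<open>Functions with finite expansions near the origin\<close>

lemma I_op_zero_beyond:
 assumes F: "!!t. t > b ==> F t = 0" and y: "y > b"
 shows "I_op \<mu> F y = 0"
proof -
 have "indicator {y<..} t *R ((t - y) powr a *R Dn M F t) = 0" for a M t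
  using Dn_zero_beyond[of b F t M] F y by (cases "t > y") auto
 note z = this
 show ?thesis unfolding I_op_def Let_def set_lebesgue_integral_def z by simp
qed

text \<open>All these operators integrate from \<open>y\<close> upwards and so preserve vanishing
  beyond \<open>b\<close>. With the inversion formula this locates the support of the function
  behind \<open>radial_part\<close>.\<close>

lemma S_op_zero_beyond:
 assumes g: "!!t. t > b ==> g t = 0" and y: "y > b"
 shows "S_op \<nu> g y = 0"
 unfolding S_op_def
proof (rule I_op_zero_beyond[of b, OF _ y])
 fix t assume t: "t > b"
 let ?F = "%z. LINT t:{z<..}|lborel. ((t\<^sup>2 - z\<^sup>2) powr (\<nu> - 1/2) * t) *R g t"
 have F0: "?F z = 0" if "z > b" for z
 proof -
  have "indicator {z<..} t *R (((t\<^sup>2 - z\<^sup>2) powr (\<nu> - 1/2) * t) *R g t) = 0" for t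
   using g[of t] that by (cases "t > z") auto
  note z = this
  show ?thesis unfolding set_lebesgue_integral_def z by simp
 qed
 have "((%z. 0) has_vector_derivative 0) (at t)" by simp
 then have "(?F has_vector_derivative 0) (at t)"
  by (rule has_vector_derivative_transform_within_open[of _ _ _ "{b<..}"]) (use t F0 in auto)
 then show "S1_op \<nu> g t = 0" unfolding S1_op_def by (simp add: vector_derivative_at)
qed

lemma Dn_cong_pos:
 assumes h: "!!t. t > 0 ==> g t = h t" and f: "h : Cpos" and y: "y > 0"
 shows "Dn m g y = Dn m h y"
 by (rule Dn_tower(1)[of g "%m. Dn m h"]) (use h Cpos_deriv[OF f] y in auto)

lemma zero_Cinf_comp: "(%_. 0) : Cinf_comp"
proof -
 have D: "Dn m (%_::real. 0::complex) = (%_. 0)" for m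
  using Dn_zero_beyond[of "y - 1" "%_. 0" y m for y] by (auto simp: fun_eq_iff)
 show ?thesis unfolding Cinf_comp_def smooth_halfline_def mem_Collect_eq D by auto
qed

lemma P_op_zero: "y > 0 ==> P_op \<nu> (%_. 0) y = 0"
 using P_op_lin[of "%_. 0" "%_. 0" y \<nu> "-1"] Cinf_comp_Cpos[OF zero_Cinf_comp] by simp

lemma sph_coeff_sum:
 fixes Y :: "nat => nat => 'a::euclidean_space => real" and c :: "nat => nat => complex"
 assumes hb: "harmonic_basis d Y" and l: "l : {1..d k}"
 shows "sph_coeff (Y k l) (%\<theta>. \<Sum>k\<le>K. \<Sum>l=1..d k. Y k l \<theta> *R c k l) = (if k <= K then c k l else 0)"
proof -
 have "sph_coeff (Y k l) (%\<theta>. \<Sum>k\<le>K. \<Sum>l=1..d k. Y k l \<theta> *R c k l) = (\<Sum>k'\<le>K. \<Sum>l'=1..d k'. sph_coeff (Y k l) (Y k' l') *R c k' l')"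
  unfolding sph_coeff_def real_scaleR_def by (intro sphere_integral_double_sum harmonic_basisD(2)[OF hb] l)
 also have "... = (\<Sum>k'\<le>K. \<Sum>l'=1..d k'. (if k = k' & l = l' then 1 else 0) *R c k' l')"
  by (intro sum.cong refl arg_cong2[where f=scaleR]) (rule harmonic_basisD(3)[OF hb l])
 also have "... = (\<Sum>k'\<le>K. if k = k' then \<Sum>l'=1..d k'. if l = l' then c k' l' else 0 else 0)"
 proof (rule sum.cong[OF refl])
  show "(\<Sum>l'=1..d k'. (if k = k' & l = l' then 1 else 0) *R c k' l') = (if k = k' then \<Sum>l'=1..d k'. if l = l' then c k' l' else 0 else 0)" for k'
   by (cases "k = k'") (simp_all add: if_distrib[of "%x. x *R _"] cong: if_cong)
 qed
 also have "... = (if k <= K then \<Sum>l'=1..d k. if l = l' then c k l' else 0 else 0)"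
  by (simp add: sum.delta)
 also have "(\<Sum>l'=1..d k. if l = l' then c k l' else 0) = c k l" using l by (simp add: sum.delta)
 finally show ?thesis .
qed

section \<open>The setting, radial parts and their preimages\<close>

abbreviation nu :: "nat => nat => real" where "nu n k \<equiv> real n / 2 + real k - 1"

definition nu_const :: "real => real" where
 "nu_const \<nu> = sqrt pi / (2 powr (\<nu> + 1/2) * Gamma (\<nu> + 1))"

lemma nu_const_pos: "\<nu> >= 0 ==> nu_const \<nu> > 0"
 unfolding nu_const_def by (intro divide_pos_pos mult_pos_pos Gamma_real_pos) auto

locale trace_setting =
 fixes \<Omega> :: "'a::euclidean_space set" and R0 :: real and \<eta> :: "real => real"
  and d :: "nat => nat" and Y :: "nat => nat => 'a => real" and e1 e2 :: 'a and s :: nat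
 assumes dim: "DIM('a) >= 2"
  and dom: "smooth_bounded_domain \<Omega>"
  and R0: "R0 > 0" and ball: "cball 0 (2 * R0) \<subseteq> \<Omega>"
  and eta: "cutoff_function \<eta>"
  and hb: "harmonic_basis d Y"
  and frame: "DIM('a) = 2 ==> norm e1 = 1 & norm e2 = 1 & e1 \<bullet> e2 = 0"
  and s3: "DIM('a) >= 3 ==> s >= 1"
  and s2: "DIM('a) = 2 ==> s >= 2"
begin

abbreviation "T \<equiv> Tinf \<Omega> R0 \<eta> d Y"
abbreviation "N \<equiv> T_norm \<Omega> \<eta> d Y s"
abbreviation "HO R f \<equiv> Hs_norm s \<Omega> (outer_part \<eta> R f)"
abbreviation "rp R f \<equiv> radial_part \<eta> Y f R"

lemma nu_nonneg: "nu DIM('a) k >= 0"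
proof -
 have "real DIM('a) >= 2" using dim by simp
 then show ?thesis by simp
qed

lemma open_dom: "open \<Omega>" and bounded_dom: "bounded \<Omega>"
 using dom by (auto simp: smooth_bounded_domain_def)

lemma open_dom0: "open (\<Omega> - {0})" using open_dom by (intro open_Diff) auto

lemma eta_1: "0 <= r ==> r <= 1 ==> \<eta> r = 1" and eta_0: "r >= 2 ==> \<eta> r = 0"
 using eta by (auto simp: cutoff_function_def)

lemma eta_bounded: "EX B>0. ALL r>=0. \<bar>\<eta> r\<bar> <= B"
proof -
 have "Dn 0 \<eta> differentiable_on {0<..}" using eta unfolding cutoff_function_def smooth_halfline_def by blast
 then have "continuous_on {0<..} \<eta>" using differentiable_imp_continuous_on by (simp only: Dn_0)
 then have "continuous_on {1..2} \<eta>" by (rule continuous_on_subset) auto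
 then have "compact (\<eta> ` {1..2})" by (rule compact_continuous_image) simp
 then obtain B where B: "!!r. r : {1..2} ==> \<bar>\<eta> r\<bar> <= B" by (metis bounded_iff compact_imp_bounded imageI real_norm_def)
 have "\<bar>\<eta> r\<bar> <= max 1 B" if "r >= 0" for r
 proof -
  consider "r <= 1" | "r : {1..2}" | "r >= 2" by force
  then show ?thesis using eta_1[of r] eta_0[of r] B[of r] that by cases auto
 qed
 then show ?thesis by (intro exI[of _ "max 1 B"]) auto
qed

lemma in_dom: "0 < norm x ==> norm x <= 2 * R0 ==> x : \<Omega> - {0}"
 using ball by (auto simp: dist_norm)

lemma T_smooth: "f : T ==> smooth_on (\<Omega> - {0}) f"
 by (simp add: Tinf_def)

lemma T_continuous: "f : T ==> continuous_on (\<Omega> - {0}) f"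
 using smooth_on_continuous[OF T_smooth, of f "[]"] by simp

lemma T_continuous_sphere:
 assumes f: "f : T" and r: "0 < r" "r <= 2 * R0" shows "continuous_on (sphere 0 1) (%\<theta>. f (r *R \<theta>))"
proof (rule continuous_on_compose2[OF T_continuous[OF f]])
 show "(%\<theta>. r *R \<theta>) ` sphere 0 1 \<subseteq> \<Omega> - {0}"
 proof safe
  fix \<theta> :: 'a assume "\<theta> : sphere 0 1"
  then have "r *R \<theta> : \<Omega> - {0}" using r by (intro in_dom) auto
  then show "r *R \<theta> : \<Omega>" by simp
 qed (use r in auto)
qed (intro continuous_intros)

lemma fkl_diff:
 assumes f: "f : T" and g: "g : T" and r: "0 < r" "r <= 2 * R0" and l: "l : {1..d k}"
 shows "fkl Y (f - g) k l r = fkl Y f k l r - fkl Y g k l r"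
proof -
 have "integrable sphere_measure (%\<theta>. Y k l \<theta> *R f (r *R \<theta>))" "integrable sphere_measure (%\<theta>. Y k l \<theta> *R g (r *R \<theta>))"
  by (intro sphere_integrable continuous_intros harmonic_basisD(2)[OF hb l] T_continuous_sphere f g r)+
 then show ?thesis by (simp add: fkl_def sph_coeff_def scaleR_diff_right)
qed

lemma rp_zero: "R > 0 ==> r >= 2 * R ==> rp R f k l r = 0"
 unfolding radial_part_def using eta_0[of "r / R"] by (simp add: field_simps)

lemma rp_diff:
 assumes f: "f : T" and g: "g : T" and R: "0 < R" "R < R0" and r: "0 < r" and l: "l : {1..d k}"
 shows "rp R (f - g) k l r = rp R f k l r - rp R g k l r"
proof (cases "r >= 2 * R")
 case False
 then show ?thesis unfolding radial_part_def using fkl_diff[OF f g r _ l] R by (simp add: scaleR_diff_right)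
qed (simp add: rp_zero R)

text \<open>The expansion condition of \<open>Tinf\<close> with \<open>K\<close> made explicit, so
  that two functions can be given a common \<open>K\<close>.\<close>

definition expK :: "('a => complex) => nat => bool" where
 "expK f K \<longleftrightarrow> (ALL R:{0<..<R0}. ALL x:\<Omega> - {0}. \<eta> (norm x / R) *R f x =
  (\<Sum>k\<le>K. \<Sum>l=1..d k. (\<eta> (norm x / R) * Y k l (sgn x)) *R fkl Y f k l (norm x)))"

lemma expansion_sphere:
 assumes e: "expK f K" and R: "0 < R" "R < R0" and r: "0 < r" "\<eta> (r / R) ~= 0" and th: "\<theta> : sphere 0 1"
 shows "f (r *R \<theta>) = (\<Sum>k\<le>K. \<Sum>l=1..d k. Y k l \<theta> *R fkl Y f k l r)"
proof -
 have "r < 2 * R" using r eta_0[of "r / R"] R by (rule_tac ccontr) (auto simp: field_simps)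
 then have x: "r *R \<theta> : \<Omega> - {0}" using r th R by (intro in_dom) auto
 have n: "norm (r *R \<theta>) = r" "sgn (r *R \<theta>) = \<theta>" using r th by (auto simp: sgn_div_norm)
 have "\<eta> (r / R) *R f (r *R \<theta>) = (\<Sum>k\<le>K. \<Sum>l=1..d k. (\<eta> (r / R) * Y k l \<theta>) *R fkl Y f k l r)"
  using e[unfolded expK_def, rule_format, OF _ x, of R] R unfolding n by simp
 also have "... = \<eta> (r / R) *R (\<Sum>k\<le>K. \<Sum>l=1..d k. Y k l \<theta> *R fkl Y f k l r)"
  by (simp add: scaleR_sum_right)
 finally show ?thesis using r(2) by simp
qed

text \<open>Where the cutoff does not vanish, the function is a finite sum of harmonics of degree at
  most \<open>K\<close>, and orthonormality excludes the others.\<close>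

lemma fkl_high:
 assumes e: "expK f K" and R: "0 < R" "R < R0" and r: "0 < r" "\<eta> (r / R) ~= 0" and k: "k > K" and l: "l : {1..d k}"
 shows "fkl Y f k l r = 0"
proof -
 have "fkl Y f k l r = sph_coeff (Y k l) (%\<theta>. \<Sum>k\<le>K. \<Sum>l=1..d k. Y k l \<theta> *R fkl Y f k l r)"
  unfolding fkl_def[of Y f k l r] sph_coeff_def
  by (rule Bochner_Integration.integral_cong[OF refl]) (simp only: space_sphere expansion_sphere[OF e R r])
 also have "... = 0" unfolding sph_coeff_sum[OF hb l] using k by simp
 finally show ?thesis .
qed

lemma rp_high:
 assumes e: "expK f K" and R: "0 < R" "R < R0" and r: "0 < r" and k: "k > K" and l: "l : {1..d k}"
 shows "rp R f k l r = 0"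
 unfolding radial_part_def using fkl_high[OF e R r _ k l] by auto

lemma expK_mono:
 assumes e: "expK f K" and K: "K <= K'" shows "expK f K'"
 unfolding expK_def
proof (intro ballI)
 fix R x assume R: "R : {0<..<R0}" and x: "x : \<Omega> - {0}"
 have "(\<Sum>l=1..d k. (\<eta> (norm x / R) * Y k l (sgn x)) *R fkl Y f k l (norm x)) = 0" if "k > K" for k
  using fkl_high[OF e _ _ _ _ that, of R "norm x"] R x by (intro sum.neutral) auto
 then have "(\<Sum>k\<le>K. \<Sum>l=1..d k. (\<eta> (norm x / R) * Y k l (sgn x)) *R fkl Y f k l (norm x)) =
  (\<Sum>k\<le>K'. \<Sum>l=1..d k. (\<eta> (norm x / R) * Y k l (sgn x)) *R fkl Y f k l (norm x))"
  using K by (intro sum.mono_neutral_left) auto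
 then show "\<eta> (norm x / R) *R f x = (\<Sum>k\<le>K'. \<Sum>l=1..d k. (\<eta> (norm x / R) * Y k l (sgn x)) *R fkl Y f k l (norm x))"
  using e[unfolded expK_def, rule_format, OF R x] by simp
qed

lemma T_expK: "f : T ==> EX K. expK f K"
 unfolding Tinf_def expK_def by blast

text \<open>\<open>Tinf\<close> asks this for \<open>k\<close> up to \<open>K\<close>; beyond
  \<open>K\<close> the radial part is zero on the half-line, which is \<open>P_op\<close> of
  zero.\<close>

lemma rp_Cinf_nu:
 assumes f: "f : T" and R: "0 < R" "R < R0" and l: "l : {1..d k}"
 shows "rp R f k l : Cinf_nu (nu DIM('a) k)"
proof -
 have "EX K. expK f K & (ALL k<=K. ALL l:{1..d k}. ALL R:{0<..<R0}. rp R f k l : Cinf_nu (nu DIM('a) k))"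
  using f unfolding Tinf_def expK_def by blast
 then obtain K where K: "expK f K" "ALL k<=K. ALL l:{1..d k}. ALL R:{0<..<R0}. rp R f k l : Cinf_nu (nu DIM('a) k)" by (elim exE conjE)
 show ?thesis
 proof (cases "k <= K")
  case True
  then show ?thesis using K(2) R l by simp
 next
  case False
  then have "rp R f k l y = P_op (nu DIM('a) k) (%_. 0) y" if "y > 0" for y
   using rp_high[OF K(1) R that _ l] P_op_zero[OF that] by simp
  then show ?thesis unfolding Cinf_nu_def using zero_Cinf_comp by blast
 qed
qed

lemma T_diff:
 assumes f: "f : T" and g: "g : T" shows "f - g : T"
proof -
 have fg: "f - g = (%x. f x - g x)" by (simp add: fun_eq_iff)
 have 1: "smooth_on (\<Omega> - {0}) (f - g)" unfolding fg by (intro smooth_on_diff open_dom0 T_smooth f g)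
 have 2: "EX h. continuous_on (closure \<Omega> - {0}) h & (ALL x:\<Omega> - {0}. h x = pderiv_list is (f - g) x)" if i: "set is \<subseteq> Basis" for "is"
 proof -
  obtain h1 where h1: "continuous_on (closure \<Omega> - {0}) h1" "ALL x:\<Omega> - {0}. h1 x = pderiv_list is f x"
   using f i unfolding Tinf_def by blast
  obtain h2 where h2: "continuous_on (closure \<Omega> - {0}) h2" "ALL x:\<Omega> - {0}. h2 x = pderiv_list is g x"
   using g i unfolding Tinf_def by blast
  show ?thesis
  proof (intro exI[of _ "%x. h1 x - h2 x"] conjI ballI)
   fix x assume x: "x : \<Omega> - {0}"
   then show "h1 x - h2 x = pderiv_list is (f - g) x"
    unfolding fg pderiv_list_diff[OF open_dom0 T_smooth[OF f] T_smooth[OF g] i x] using h1 h2 by simp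
  qed (intro continuous_intros h1 h2)
 qed
 obtain K1 K2 where "expK f K1" "expK g K2" using T_expK f g by blast
 then have ef: "expK f (max K1 K2)" and eg: "expK g (max K1 K2)" by (auto intro: expK_mono)
 have e: "expK (f - g) (max K1 K2)" unfolding expK_def
 proof (intro ballI)
  fix R x assume R: "R : {0<..<R0}" and x: "x : \<Omega> - {0}"
  show "\<eta> (norm x / R) *R (f - g) x = (\<Sum>k\<le>max K1 K2. \<Sum>l=1..d k. (\<eta> (norm x / R) * Y k l (sgn x)) *R fkl Y (f - g) k l (norm x))"
  proof (cases "norm x >= 2 * R")
   case True
   then have "\<eta> (norm x / R) = 0" using R by (intro eta_0) (simp add: field_simps)
   then show ?thesis by simp
  next
   case False
   then have "fkl Y (f - g) k l (norm x) = fkl Y f k l (norm x) - fkl Y g k l (norm x)" if "l : {1..d k}" for k l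
    using x R by (intro fkl_diff f g that) auto
   then show ?thesis using ef[unfolded expK_def, rule_format, OF R x] eg[unfolded expK_def, rule_format, OF R x]
    by (simp add: scaleR_diff_right sum_subtractf)
  qed
 qed
 have 4: "rp R (f - g) k l : Cinf_nu (nu DIM('a) k)" if R: "R : {0<..<R0}" and l: "l : {1..d k}" for R k l
 proof -
  have R': "0 < R" "R < R0" using R by auto
  obtain \<phi> where p: "\<phi> : Cinf_comp" "ALL y>0. rp R f k l y = P_op (nu DIM('a) k) \<phi> y" using rp_Cinf_nu[OF f R' l] unfolding Cinf_nu_def by blast
  obtain \<psi> where q: "\<psi> : Cinf_comp" "ALL y>0. rp R g k l y = P_op (nu DIM('a) k) \<psi> y" using rp_Cinf_nu[OF g R' l] unfolding Cinf_nu_def by blast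
  have "rp R (f - g) k l y = P_op (nu DIM('a) k) (%t. \<phi> t + (-1) * \<psi> t) y" if "y > 0" for y
   using P_op_lin[OF Cinf_comp_Cpos[OF p(1)] Cinf_comp_Cpos[OF q(1)] that, of "nu DIM('a) k" "-1"] rp_diff[OF f g R' that l] p(2) q(2) that by simp
  then show ?thesis unfolding Cinf_nu_def using Cinf_comp_lin[OF p(1) q(1)] by blast
 qed
 show ?thesis unfolding Tinf_def mem_Collect_eq
  using 1 2 e[unfolded expK_def] 4 by blast
qed

text \<open>\<open>S_op\<close> recovers \<open>\<phi>\<close> from the radial part, which vanishes
  beyond \<open>2 * R\<close>; hence so does \<open>\<phi>\<close>, whereas \<open>Cinf_nu\<close>
  gives only some bounded support.\<close>

lemma src_exists:
 assumes f: "f : T" and R: "0 < R" "R < R0" and l: "l : {1..d k}"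
 shows "EX \<phi>. \<phi> : Cinf_comp & (ALL y>0. rp R f k l y = P_op (nu DIM('a) k) \<phi> y) & (ALL y>2 * R. \<phi> y = 0)"
proof -
 obtain \<phi> where p: "\<phi> : Cinf_comp" "ALL y>0. rp R f k l y = P_op (nu DIM('a) k) \<phi> y" using rp_Cinf_nu[OF f R l] unfolding Cinf_nu_def by blast
 have "\<phi> y = 0" if y: "y > 2 * R" for y
 proof -
  have "S_op (nu DIM('a) k) (rp R f k l) y = \<phi> y"
   using S_op_P_op[OF Cinf_comp_Cpos[OF p(1)] nu_nonneg, of y "rp R f k l"] p(2) y R by simp
  moreover have "S_op (nu DIM('a) k) (rp R f k l) y = 0" by (rule S_op_zero_beyond[OF _ y]) (simp add: rp_zero R)
  ultimately show ?thesis by simp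
 qed
 then show ?thesis using p by blast
qed

text \<open>The preimage of the radial part under \<open>P_op\<close>. On the half-line it is
  determined by \<open>S_op\<close>, hence compatible with differences there
  (\<open>Dn_src_diff\<close>) although obtained by choice.\<close>

definition src :: "real => ('a => complex) => nat => nat => real => complex" where
 "src R f k l = (SOME \<phi>. \<phi> : Cinf_comp & (ALL y>0. rp R f k l y = P_op (nu DIM('a) k) \<phi> y) & (ALL y>2 * R. \<phi> y = 0))"

lemma src:
 assumes f: "f : T" and R: "0 < R" "R < R0" and l: "l : {1..d k}"
 shows "src R f k l : Cinf_comp" "y > 0 ==> rp R f k l y = P_op (nu DIM('a) k) (src R f k l) y" "y > 2 * R ==> src R f k l y = 0"
 using someI_ex[OF src_exists[OF f R l]] unfolding src_def[symmetric] by auto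

lemma Dn_src_diff:
 assumes f: "f : T" and g: "g : T" and R: "0 < R" "R < R0" and l: "l : {1..d k}" and y: "y > 0"
 shows "Dn m (src R (f - g) k l) y = Dn m (src R f k l) y - Dn m (src R g k l) y"
proof -
 let ?h = "%t. src R f k l t + (-1) * src R g k l t"
 note fp = Cinf_comp_Cpos[OF src(1)[OF f R l]] note gp = Cinf_comp_Cpos[OF src(1)[OF g R l]]
 note hp = Cpos_lin[OF fp gp, of "-1"]
 have "src R (f - g) k l t = ?h t" if "t > 0" for t
 proof -
  have "S_op (nu DIM('a) k) (rp R (f - g) k l) t = src R (f - g) k l t"
   by (rule S_op_P_op[OF Cinf_comp_Cpos[OF src(1)[OF T_diff[OF f g] R l]] nu_nonneg that src(2)[OF T_diff[OF f g] R l]])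
  moreover have "S_op (nu DIM('a) k) (rp R (f - g) k l) t = ?h t"
  proof (rule S_op_P_op[OF hp nu_nonneg that])
   fix t :: real assume t: "t > 0"
   show "rp R (f - g) k l t = P_op (nu DIM('a) k) ?h t"
    unfolding P_op_lin[OF fp gp t] rp_diff[OF f g R t l] src(2)[OF f R l t] src(2)[OF g R l t] by simp
  qed
  ultimately show ?thesis by simp
 qed
 then have "Dn m (src R (f - g) k l) y = Dn m ?h y" by (rule Dn_cong_pos[OF _ hp y])
 then show ?thesis using Dn_lin[OF fp gp y, of m "-1"] by simp
qed

definition Hn :: "real => ('a => complex) => nat => nat => real" where
 "Hn R f k l = Hnu_norm s (nu DIM('a) k) (2 * R) (rp R f k l)"

lemma Hn_eq:
 assumes f: "f : T" and R: "0 < R" "R < R0" and l: "l : {1..d k}"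
 shows "Hn R f k l = nu_const (nu DIM('a) k) * l2n (segm (2 * R)) (Dn s (src R f k l))"
 unfolding Hn_def nu_const_def
 by (rule Hnu_norm_eq[OF Cinf_comp_Cpos[OF src(1)[OF f R l]] nu_nonneg src(2)[OF f R l]])

lemma Hn_nonneg: "Hn R f k l >= 0"
 unfolding Hn_def Hnu_norm_def using nu_nonneg[of k]
 by (intro mult_nonneg_nonneg divide_nonneg_nonneg less_imp_le[OF Gamma_real_pos] real_sqrt_ge_zero)
  (auto simp: set_lebesgue_integral_def intro!: integral_nonneg_AE)

lemma l2n_src_diff:
 assumes f: "f : T" and g: "g : T" and R: "0 < R" "R < R0" and l: "l : {1..d k}"
 shows "l2n (segm (2 * R)) (Dn s (src R (f - g) k l)) = l2n (segm (2 * R)) (%t. Dn s (src R f k l) t - Dn s (src R g k l) t)"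
 unfolding l2n_def
proof (rule arg_cong[of _ _ sqrt], rule Bochner_Integration.integral_cong[OF refl])
 fix x assume "x : space (segm (2 * R))"
 then have "x > 0" by (simp add: segm_def space_restrict_space)
 then show "(norm (Dn s (src R (f - g) k l) x))\<^sup>2 = (norm (Dn s (src R f k l) x - Dn s (src R g k l) x))\<^sup>2"
  using Dn_src_diff[OF f g R l] by simp
qed

lemma Hn_diff:
 assumes f: "f : T" and g: "g : T" and R: "0 < R" "R < R0" and l: "l : {1..d k}"
 shows "Hn R (f - g) k l <= Hn R f k l + Hn R g k l"
proof -
 have L: "Dn s (src R f k l) : L2M (segm (2 * R))" "Dn s (src R g k l) : L2M (segm (2 * R))"
  using R by (auto intro!: bcont_L2M Cinf_comp_bcont src(1) f g l)
 have "l2n (segm (2 * R)) (Dn s (src R (f - g) k l)) <= l2n (segm (2 * R)) (Dn s (src R f k l)) + l2n (segm (2 * R)) (Dn s (src R g k l))"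
  unfolding l2n_src_diff[OF f g R l] by (rule L2M_diff(2)[OF L])
 then show ?thesis unfolding Hn_eq[OF T_diff[OF f g] R l] Hn_eq[OF f R l] Hn_eq[OF g R l] distrib_left[symmetric]
  using nu_const_pos[OF nu_nonneg[of k]] by (intro mult_left_mono) auto
qed

lemma Hn_high:
 assumes e: "expK f K" and R: "0 < R" "R < R0" and k: "k > K" and l: "l : {1..d k}"
 shows "Hn R f k l = 0"
proof -
 have "Hn R f k l = nu_const (nu DIM('a) k) * l2n (segm (2 * R)) (Dn s (%_. 0))"
  unfolding Hn_def nu_const_def
  by (rule Hnu_norm_eq[OF Cinf_comp_Cpos[OF zero_Cinf_comp] nu_nonneg]) (simp add: rp_high[OF e R _ k l] P_op_zero)
 moreover have "Dn s (%_. 0 :: complex) = (%_. 0)"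
  using Dn_zero_beyond[of "y - 1" "%_. 0" y s for y] by (auto simp: fun_eq_iff)
 ultimately show ?thesis by (simp add: l2n_def)
qed

end

lemma pderiv_list_zero: "pderiv_list is (%_. 0 :: 'b::real_normed_vector) = (%_::'a::real_normed_vector. 0)"
 by (induction "is") auto

section \<open>Sobolev regularity away from the origin\<close>

context trace_setting
begin

lemma outer_part_ball: "R > 0 ==> norm x <= R ==> outer_part \<eta> R f x = 0"
 unfolding outer_part_def using eta_1[of "norm x / R"] by simp

lemma outer_part_outside: "R > 0 ==> norm x >= 2 * R ==> outer_part \<eta> R f x = f x"
 unfolding outer_part_def using eta_0[of "norm x / R"] by (simp add: field_simps)

text \<open>Near the origin the function is zero. Elsewhere it lies in an algebra generated by the
  derivatives of \<open>f\<close>, the coordinates, \<open>1 / norm x\<close> and the derivatives of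
  the cutoff at \<open>norm x / R\<close>. Partial derivatives stay in the algebra, and the
  generators are bounded outside the ball of radius \<open>R\<close>; for \<open>f\<close> this is
  the continuity up to the closure required in \<open>Tinf\<close>.\<close>

lemma outer_part_Hs:
 assumes f: "f : T" and R: "0 < R" "R < R0"
 shows "outer_part \<eta> R f : Hs s \<Omega>"
proof -
 define S where "S = \<Omega> - {0}"
 have S: "open S" unfolding S_def by (rule open_dom0)
 have S0: "x ~= 0" "norm x > 0" if "x : S" for x using that by (auto simp: S_def)
 have etaD: "Dn m \<eta> differentiable_on {0<..}" for m using eta unfolding cutoff_function_def smooth_halfline_def by blast
 define A where "A = {pderiv_list is f | is. set is \<subseteq> Basis}"
 define Bs :: "('a => complex) set" where "Bs = {%x. complex_of_real (x \<bullet> b) | b. b : Basis}"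
 define N :: "'a => complex" where "N x = complex_of_real (inverse (norm x))" for x
 define E :: "nat => 'a => complex" where "E m x = complex_of_real (Dn m \<eta> (norm x / R))" for m x
 define G where "G = A \<union> Bs \<union> {N} \<union> range E"
 have gA: "pderiv_list is f : alg G" if "set is \<subseteq> Basis" for "is" using that by (intro alg.gen) (auto simp: G_def A_def)
 have gB: "(%x. complex_of_real (x \<bullet> b)) : alg G" if "b : Basis" for b using that by (intro alg.gen) (auto simp: G_def Bs_def)
 have gN: "N : alg G" and gE: "E m : alg G" for m by (auto intro: alg.gen simp: G_def)
 have dN: "(N has_derivative (%v. complex_of_real (- (inverse (norm x) * (sgn x \<bullet> v) * inverse (norm x))))) (at x)" if x: "x : S" for x
 proof -
  have "((%x. inverse (norm x)) has_derivative (%v. - (inverse (norm x) * (sgn x \<bullet> v) * inverse (norm x)))) (at x)"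
   using Deriv.has_derivative_inverse[OF _ has_derivative_norm[OF S0(1)[OF x]]] S0[OF x] by (simp add: inner_commute)
  then show ?thesis unfolding N_def by (rule has_derivative_of_real)
 qed
 have dE: "(E m has_derivative (%v. complex_of_real (Dn (Suc m) \<eta> (norm x / R) * ((sgn x \<bullet> v) / R)))) (at x)" if x: "x : S" for x m
 proof -
  have "(Dn m \<eta> has_vector_derivative Dn (Suc m) \<eta> (norm x / R)) (at (norm x / R))"
   by (rule Dn_deriv[OF etaD]) (use S0[OF x] R in simp)
  then have 1: "(Dn m \<eta> has_derivative (%h. h * Dn (Suc m) \<eta> (norm x / R))) (at (norm x / R))"
   by (simp add: has_vector_derivative_def)
  have 2: "((%x. norm x / R) has_derivative (%v. (sgn x \<bullet> v) / R)) (at x)"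
   using has_derivative_mult_left[OF has_derivative_norm[OF S0(1)[OF x]], of "1 / R"] by (simp add: inner_commute)
  have "((%x. Dn m \<eta> (norm x / R)) has_derivative (%v. Dn (Suc m) \<eta> (norm x / R) * ((sgn x \<bullet> v) / R))) (at x)"
   using has_derivative_compose[OF 2 1] by (simp add: mult.commute)
  then show ?thesis unfolding E_def by (rule has_derivative_of_real)
 qed
 have dB: "((%x. complex_of_real (x \<bullet> b)) has_derivative (%v. complex_of_real (v \<bullet> b))) (at x)" for b and x :: 'a
  by (intro has_derivative_of_real has_derivative_inner_left has_derivative_ident)
 have diff: "g differentiable (at x)" if g: "g : G" and x: "x : S" for g x
 proof -
  consider "is" where "g = pderiv_list is f" "set is \<subseteq> Basis" | b where "g = (%x. complex_of_real (x \<bullet> b))" | "g = N" | m where "g = E m"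
   using g unfolding G_def A_def Bs_def by blast
  then show ?thesis
  proof cases
   case 1
   then show ?thesis using smooth_on_differentiable[OF T_smooth[OF f] open_dom0 1(2)] x by (simp add: S_def)
  qed (use dN[OF x] dE[OF x] dB in "auto simp: differentiable_def")
 qed
 have der: "EX h:alg G. ALL x:S. pderiv_list [i] g x = h x" if g: "g : G" and i: "i : Basis" for g i
 proof -
  have sgn: "complex_of_real (sgn x \<bullet> i) = complex_of_real (x \<bullet> i) * N x" for x by (simp add: sgn_div_norm N_def divide_inverse)
  consider "is" where "g = pderiv_list is f" "set is \<subseteq> Basis" | b where "g = (%x. complex_of_real (x \<bullet> b))" | "g = N" | m where "g = E m"
   using g unfolding G_def A_def Bs_def by blast
  then show ?thesis
  proof cases
   case (1 "is")
   have "pderiv_list (i # is) f : alg G" using 1 i by (intro gA) auto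
   moreover have "pderiv_list [i] g x = pderiv_list (i # is) f x" for x unfolding 1 by simp
   ultimately show ?thesis by blast
  next
   case (2 b)
   have "pderiv_list [i] g x = complex_of_real (i \<bullet> b)" for x unfolding 2 by (rule pderiv_has_derivative[OF dB])
   then show ?thesis using alg.const[of "complex_of_real (i \<bullet> b)" G] by (intro bexI[of _ "%_. complex_of_real (i \<bullet> b)"]) auto
  next
   case 3
   have "pderiv_list [i] g x = (-1) * (N x * (N x * (complex_of_real (x \<bullet> i) * N x)))" if "x : S" for x
    unfolding 3 pderiv_has_derivative[OF dN[OF that]] sgn[symmetric] by (simp add: N_def mult_ac)
   moreover have "(%x. (-1) * (N x * (N x * (complex_of_real (x \<bullet> i) * N x)))) : alg G"
    by (intro alg.mult alg.const gN gB i)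
   ultimately show ?thesis by (intro bexI[of _ "%x. (-1) * (N x * (N x * (complex_of_real (x \<bullet> i) * N x)))"]) auto
  next
   case (4 m)
   have "pderiv_list [i] g x = E (Suc m) x * (complex_of_real (1 / R) * (complex_of_real (x \<bullet> i) * N x))" if "x : S" for x
    unfolding 4 pderiv_has_derivative[OF dE[OF that]] sgn[symmetric] by (simp add: E_def mult_ac)
   moreover have "(%x. E (Suc m) x * (complex_of_real (1 / R) * (complex_of_real (x \<bullet> i) * N x))) : alg G"
    by (intro alg.mult alg.const gN gB gE i)
   ultimately show ?thesis by (intro bexI[of _ "%x. E (Suc m) x * (complex_of_real (1 / R) * (complex_of_real (x \<bullet> i) * N x))"]) auto
  qed
 qed
 define u where "u x = (1 + (-1) * E 0 x) * f x" for x
 have uG: "u : alg G" unfolding u_def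
  using gA[of "[]"] by (intro alg.mult alg.add alg.const gE) simp
 have ou: "outer_part \<eta> R f = u" by (auto simp: outer_part_def u_def E_def scaleR_conv_of_real fun_eq_iff)
 define T' where "T' = \<Omega> - ball 0 R"
 have bound: "EX B. ALL x:T'. norm (g x) <= B" if g: "g : G" for g
 proof -
  consider "is" where "g = pderiv_list is f" "set is \<subseteq> Basis" | b where "g = (%x. complex_of_real (x \<bullet> b))" "b : Basis" | "g = N" | m where "g = E m"
   using g unfolding G_def A_def Bs_def by blast
  then show ?thesis
  proof cases
   case (1 "is")
   obtain h where h: "continuous_on (closure \<Omega> - {0}) h" "ALL x:\<Omega> - {0}. h x = pderiv_list is f x"
    using f 1 unfolding Tinf_def by blast
   have "compact (closure \<Omega> - ball 0 R)" using bounded_dom by (intro compact_diff) (auto simp: compact_closure)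
   moreover have "continuous_on (closure \<Omega> - ball 0 R) h" using R by (intro continuous_on_subset[OF h(1)]) auto
   ultimately have "bounded (h ` (closure \<Omega> - ball 0 R))" by (intro compact_imp_bounded compact_continuous_image)
   then obtain B where B: "!!x. x : closure \<Omega> - ball 0 R ==> norm (h x) <= B" unfolding bounded_iff by blast
   have "norm (g x) <= B" if x: "x : T'" for x
   proof -
    have "x : \<Omega> - {0}" "x : closure \<Omega> - ball 0 R" using x R closure_subset[of \<Omega>] by (auto simp: T'_def)
    then show ?thesis using h(2) B[of x] 1(1) by simp
   qed
   then show ?thesis by blast
  next
   case (2 b)
   obtain B where B: "!!x. x : \<Omega> ==> norm x <= B" using bounded_dom by (auto simp: bounded_iff)
   have "norm (g x) <= B" if "x : T'" for x
    using B[of x] that Basis_le_norm[OF 2(2), of x] by (auto simp: 2(1) T'_def)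
   then show ?thesis by blast
  next
   case 3
   have "norm (g x) <= inverse R" if "x : T'" for x
    using that R by (auto simp: 3 N_def T'_def norm_inverse intro!: le_imp_inverse_le)
   then show ?thesis by blast
  next
   case (4 m)
   have "continuous_on {0<..} (Dn m \<eta>)" by (rule differentiable_imp_continuous_on[OF etaD])
   then have "continuous_on {1..3} (Dn m \<eta>)" by (rule continuous_on_subset) auto
   then have "bounded (Dn m \<eta> ` {1..3})" by (intro compact_imp_bounded compact_continuous_image) auto
   then obtain B where B: "!!r. r : {1..3} ==> \<bar>Dn m \<eta> r\<bar> <= B" unfolding bounded_iff real_norm_def by blast
   have z: "Dn m \<eta> r = 0" if "r > 2" for r
    by (rule Dn_zero_beyond[of 2]) (use eta_0 that in auto)
   have "norm (g x) <= max B 0" if x: "x : T'" for x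
   proof -
    have "norm x / R >= 1" using x R by (auto simp: T'_def field_simps)
    then have "norm x / R : {1..3} | norm x / R > 2" by auto
    then show ?thesis using B[of "norm x / R"] z[of "norm x / R"] by (auto simp: 4 E_def)
   qed
   then show ?thesis by blast
  qed
 qed
 have b0: "u x = 0" if "x : ball 0 R" for x using outer_part_ball[OF R(1), of x f] that unfolding ou by simp
 have Om: "\<Omega> = S \<union> ball 0 R" using ball R by (auto simp: S_def subset_iff)
 have "smooth_on (ball 0 R) (%_::'a. 0 :: complex)" unfolding smooth_on_def pderiv_list_zero by simp
 then have "smooth_on (ball 0 R) u" by (rule smooth_on_cong[rotated]) (use b0 in auto)
 then have "smooth_on \<Omega> u" unfolding Om by (intro smooth_on_Un S alg_smooth(2)[OF S diff der uG]) auto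
 moreover have "EX B. ALL x:\<Omega>. norm (pderiv_list is u x) <= B" if i: "set is \<subseteq> Basis" for "is"
 proof -
  obtain h where h: "h : alg G" "ALL x:S. pderiv_list is u x = h x" using alg_smooth(1)[OF S diff der uG i] by blast
  obtain B where B: "ALL x:T'. norm (h x) <= B" using alg_bounded[OF bound h(1)] by blast
  have "norm (pderiv_list is u x) <= max B 0" if x: "x : \<Omega>" for x
  proof (cases "x : ball 0 R")
   case True
   have "pderiv_list is u x = pderiv_list is (%_. 0) x" by (rule pderiv_list_cong[OF open_ball b0 True])
   then show ?thesis by (simp add: pderiv_list_zero)
  next
   case False
   then have "x : S" "x : T'" using x R by (auto simp: S_def T'_def)
   then show ?thesis using h(2) B by (simp add: max.coboundedI1)
  qed
  then show ?thesis by blast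
 qed
 ultimately show ?thesis unfolding ou by (intro smooth_bounded_Hs open_dom bounded_dom)
qed

lemma outer_part_diff: "outer_part \<eta> R (f - g) = (%x. outer_part \<eta> R f x - outer_part \<eta> R g x)"
 by (auto simp: outer_part_def scaleR_diff_right fun_eq_iff)

end

text \<open>Phrased with differences only, the operation under which \<open>Tinf\<close> and
  \<open>Ms\<close> are shown to be closed. Symmetry and the triangle inequality follow from
  rewritings such as \<open>f - g = (f - f) - (g - f)\<close>.\<close>

definition seminorm_on :: "'v::ab_group_add set => ('v => real) => bool" where
 "seminorm_on X p \<longleftrightarrow> (ALL f:X. ALL g:X. f - g : X & p (f - g) <= p f + p g) & (ALL f:X. p f >= 0 & p (f - f) = 0)"

lemma seminorm_onD:
 assumes "seminorm_on X p" and f: "f : X" and g: "g : X"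
 shows "f - g : X" "p (f - g) <= p f + p g" "p f >= 0" "p (f - f) = 0"
 using assms unfolding seminorm_on_def by auto

lemma seminorm_on_sym:
 assumes s: "seminorm_on X p" and f: "f : X" and g: "g : X"
 shows "p (f - g) = p (g - f)"
proof -
 have "p (f - g) <= p (g - f)" if f: "f : X" and g: "g : X" for f g
 proof -
  have "f - g = (f - f) - (g - f)" by simp
  then have "p (f - g) <= p (f - f) + p (g - f)"
   using seminorm_onD(2)[OF s seminorm_onD(1)[OF s f f] seminorm_onD(1)[OF s g f]] by simp
  then show ?thesis using seminorm_onD(4)[OF s f f] by simp
 qed
 then show ?thesis using f g by (intro antisym)
qed

lemma seminorm_on_triangle:
 assumes s: "seminorm_on X p" and f: "f : X" and g: "g : X" and h: "h : X"
 shows "p (f - h) <= p (f - g) + p (g - h)"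
proof -
 have "f - h = (f - g) - (h - g)" by simp
 then have "p (f - h) <= p (f - g) + p (h - g)"
  using seminorm_onD(2)[OF s seminorm_onD(1)[OF s f g] seminorm_onD(1)[OF s h g]] by simp
 then show ?thesis using seminorm_on_sym[OF s g h] by simp
qed

lemma seminorm_on_le:
 assumes s: "seminorm_on X p" and f: "f : X" and g: "g : X"
 shows "p f <= p (f - g) + p g"
proof -
 note gg = seminorm_onD(1)[OF s g g]
 have "f = (f - g) - ((g - g) - g)" by simp
 then have "p f <= p (f - g) + p ((g - g) - g)"
  using seminorm_onD(2)[OF s seminorm_onD(1)[OF s f g] seminorm_onD(1)[OF s gg g]] by simp
 also have "p ((g - g) - g) <= p (g - g) + p g" by (rule seminorm_onD(2)[OF s gg g])
 finally show ?thesis using seminorm_onD(4)[OF s g g] by simp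
qed

lemma seminorm_on_abs:
 assumes s: "seminorm_on X p" and f: "f : X" and g: "g : X"
 shows "\<bar>p f - p g\<bar> <= p (f - g)"
 using seminorm_on_le[OF s f g] seminorm_on_le[OF s g f] seminorm_on_sym[OF s f g] by linarith

section \<open>Norms and trace coefficients on \<open>Tinf\<close>\<close>

context trace_setting
begin

text \<open>A finite piece of the radial norm. It is the whole radial norm once \<open>K\<close> is
  an expansion bound of \<open>f\<close> (\<open>T_norm_eq\<close>); for fixed \<open>K\<close> it
  passes to limits componentwise.\<close>

definition AH :: "real => nat => ('a => complex) => real" where
 "AH R K f = L2_set (%(k, l). Hn R f k l) (SIGMA k:{..K}. {1..d k})"

lemma AH_square: "(AH R K f)\<^sup>2 = (\<Sum>k\<le>K. \<Sum>l=1..d k. (Hn R f k l)\<^sup>2)"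
proof -
 have "(AH R K f)\<^sup>2 = (\<Sum>(k, l)\<in>(SIGMA k:{..K}. {1..d k}). (Hn R f k l)\<^sup>2)"
  unfolding AH_def L2_set_def by (subst real_sqrt_pow2) (auto intro!: sum_nonneg sum.cong)
 then show ?thesis by (simp add: sum.Sigma)
qed

lemma T_norm_eq:
 assumes e: "expK f K" and R: "0 < R" "R < R0"
 shows "N R f = sqrt ((AH R K f)\<^sup>2 + (HO R f)\<^sup>2)"
proof -
 have "(\<Sum>k. \<Sum>l=1..d k. (Hn R f k l)\<^sup>2) = (\<Sum>k\<le>K. \<Sum>l=1..d k. (Hn R f k l)\<^sup>2)"
  by (rule suminf_finite) (auto intro!: sum.neutral Hn_high[OF e R])
 then show ?thesis unfolding T_norm_def Hn_def[symmetric] AH_square by simp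
qed

lemma AH_diff:
 assumes f: "f : T" and g: "g : T" and R: "0 < R" "R < R0"
 shows "AH R K (f - g) <= AH R K f + AH R K g"
proof -
 have "AH R K (f - g) <= L2_set (%x. (case x of (k, l) => Hn R f k l) + (case x of (k, l) => Hn R g k l)) (SIGMA k:{..K}. {1..d k})"
  unfolding AH_def by (rule L2_set_mono) (auto intro: Hn_diff[OF f g R] Hn_nonneg)
 also have "... <= AH R K f + AH R K g" unfolding AH_def by (rule L2_set_triangle_ineq)
 finally show ?thesis .
qed

lemma T_common:
 assumes "f : T" "g : T"
 obtains K where "K >= k" "expK f K" "expK g K"
proof -
 obtain K1 K2 where "expK f K1" "expK g K2" using T_expK assms by blast
 then have "expK f (k + K1 + K2)" "expK g (k + K1 + K2)" by (auto intro: expK_mono)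
 then show thesis by (intro that[of "k + K1 + K2"]) auto
qed

lemma T_seminorm:
 assumes R: "0 < R" "R < R0" shows "seminorm_on T (N R)"
 unfolding seminorm_on_def
proof (intro conjI ballI)
 fix f assume f: "f : T"
 obtain K where K: "expK f K" using T_expK f by blast
 show "N R f >= 0" unfolding T_norm_eq[OF K R] by simp
 obtain K' where K': "expK (f - f) K'" using T_expK T_diff[OF f f] by blast
 have "Hn R (f - f) k l = 0" if l: "l : {1..d k}" for k l
  unfolding Hn_eq[OF T_diff[OF f f] R l] l2n_src_diff[OF f f R l] by (simp add: l2n_def)
 then have "(AH R K' (f - f))\<^sup>2 = 0" unfolding AH_square by simp
 moreover have "HO R (f - f) = 0" unfolding outer_part_diff using Hs_norm_zero(2)[OF open_dom bounded_dom] by simp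
 ultimately show "N R (f - f) = 0" unfolding T_norm_eq[OF K' R] by simp
next
 fix f g assume f: "f : T" and g: "g : T"
 obtain K1 where K1: "expK (f - g) K1" using T_expK T_diff[OF f g] by blast
 obtain K where K: "K >= K1" "expK f K" "expK g K" by (rule T_common[OF f g])
 have Kd: "expK (f - g) K" by (rule expK_mono[OF K1 K(1)])
 show "N R (f - g) <= N R f + N R g"
  unfolding T_norm_eq[OF Kd R] T_norm_eq[OF K(2) R] T_norm_eq[OF K(3) R]
 proof (rule order_trans[OF _ real_sqrt_sum_squares_triangle_ineq], rule real_sqrt_le_mono, rule add_mono; rule power_mono)
  show "AH R K (f - g) <= AH R K f + AH R K g" by (rule AH_diff[OF f g R])
  show "HO R (f - g) <= HO R f + HO R g"
   unfolding outer_part_diff by (intro Hs_diff(2) open_dom bounded_dom outer_part_Hs f g R)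
 qed (auto simp: AH_def L2_set_nonneg Hs_norm_nonneg)
qed (rule T_diff)

lemma AH_le_T_norm:
 assumes f: "f : T" and R: "0 < R" "R < R0" shows "AH R K f <= N R f"
proof -
 obtain K' where K': "K' >= K" "expK f K'" by (rule T_common[OF f f])
 have "(AH R K f)\<^sup>2 <= (AH R K' f)\<^sup>2" unfolding AH_square by (intro sum_mono2 sum_nonneg) (use K' in auto)
 then show ?thesis unfolding T_norm_eq[OF K'(2) R] by (intro real_le_rsqrt) (simp add: add_increasing2)
qed

lemma Hn_le_T_norm:
 assumes f: "f : T" and R: "0 < R" "R < R0" and l: "l : {1..d k}" shows "Hn R f k l <= N R f"
proof -
 have "(case (k, l) of (k, l) => Hn R f k l) <= AH R k f"
  unfolding AH_def by (rule member_le_L2_set) (use l in auto)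
 then show ?thesis using AH_le_T_norm[OF f R, of k] by simp
qed

lemma T_norm_le:
 assumes e: "expK f K" and R: "0 < R" "R < R0"
 shows "N R f <= AH R K f + HO R f"
 unfolding T_norm_eq[OF e R] by (rule sqrt_sum_squares_le_sum) (auto simp: AH_def L2_set_nonneg Hs_norm_nonneg)

text \<open>The coefficient of \<open>Y k l\<close> in \<open>sigma\<close>: the weight
  \<open>r powr (2 * nu n k)\<close> times \<open>1 / r ^ k\<close> is the factor
  \<open>r ^ (n + k - 2)\<close>, and for \<open>n = 2\<close>, \<open>k = 0\<close> it is
  \<open>1 / ln r\<close>.\<close>

definition tq :: "('a => complex) => nat => nat => real => complex" where
 "tq f k l r = tweight (nu DIM('a) k) r *R ((1 / r ^ k) *R fkl Y f k l r)"

definition tc :: "('a => complex) => nat => nat => complex" where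
 "tc f k l = Lim (at_right 0) (tq f k l)"

text \<open>For \<open>r < R\<close> the cutoff is one, so the function \<open>tq\<close> does not
  involve \<open>R\<close> while the bound does. One and the same limit thus satisfies an estimate
  for each \<open>R\<close>, with a constant independent of \<open>k\<close>.\<close>

lemma tq_limit:
 assumes R: "0 < R" "R < R0"
 shows "EX C>0. ALL f:T. ALL k. ALL l:{1..d k}. EX \<psi>. (tq f k l ---> \<psi>) (at_right 0) & norm \<psi> <= C * (4 * R) ^ k * Hn R f k l"
proof -
 let ?n = "DIM('a)"
 define C1 where "C1 = (2 * R) ^ (s - 2) * (2 * R) * sqrt 2 / (Gamma (3/2) * sqrt pi)"
 define C2 where "C2 = 2 powr (real ?n / 2 - 1/2) * (2 * R) powr (real ?n / 2 + real s - 2) / 2"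
 have "C1 > 0" unfolding C1_def using R by (intro divide_pos_pos mult_pos_pos Gamma_real_pos) auto
 moreover have "C2 > 0" unfolding C2_def using R by simp
 ultimately have C: "max C1 C2 > 0" "C1 <= max C1 C2" "C2 <= max C1 C2" by auto
 have "EX \<psi>. (tq f k l ---> \<psi>) (at_right 0) & norm \<psi> <= max C1 C2 * (4 * R) ^ k * Hn R f k l"
  if f: "f : T" and l: "l : {1..d k}" for f k l
 proof -
  let ?\<nu> = "nu ?n k"
  have ev: "\<forall>\<^sub>F r in at_right 0. tweight ?\<nu> r *R rp R f k l r = tq f k l r"
   unfolding eventually_at_right_field
  proof (intro exI[of _ R] conjI allI impI)
   fix r :: real assume "0 < r" "r < R"
   then have "\<eta> (r / R) = 1" by (intro eta_1) auto
   then show "tweight ?\<nu> r *R rp R f k l r = tq f k l r" unfolding tq_def radial_part_def by simp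
  qed (rule R)
  have L: "2 * R > 0" using R by simp
  have ex: "EX \<psi>. ((%r. tweight ?\<nu> r *R rp R f k l r) ---> \<psi>) (at_right 0) & norm \<psi> <= max C1 C2 * (4 * R) ^ k * Hn R f k l"
  proof (cases "k = 0 & ?n = 2")
   case True
   then have n0: "nu ?n k = 0" and s2: "s >= 2" using s2 by auto
   have "EX \<psi>. ((%y. tweight 0 y *R rp R f k l y) ---> \<psi>) (at_right 0) & norm \<psi> <= C1 * Hnu_norm s 0 (2 * R) (rp R f k l)"
    unfolding C1_def by (rule P_op_trace_0[OF src(1)[OF f R l] L src(3)[OF f R l] s2 src(2)[OF f R l, unfolded n0]])
   moreover have "C1 * Hn R f k l <= max C1 C2 * (4 * R) ^ k * Hn R f k l"
    using True C Hn_nonneg[of R f k l] by (intro mult_right_mono) auto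
   ultimately show ?thesis unfolding n0 using Hn_def[of R f k l, unfolded n0] by (metis order_trans)
  next
   case False
   have "?\<nu> >= 1/2" and s1: "s >= 1"
   proof -
    have "?n >= 3 | (?n = 2 & k >= 1)" using dim False by auto
    then have "real ?n >= 3 | (real ?n = 2 & real k >= 1)" by auto
    then show "?\<nu> >= 1/2" by auto
    show "s >= 1" using s2 s3 dim by (cases "?n = 2") auto
   qed
   \<comment> \<open>The index \<open>k\<close> enters \<open>2 powr (nu + 1/2)\<close> as
     \<open>2 ^ k\<close> and the power of \<open>2 * R\<close> as \<open>(2 * R) ^ k\<close>; the
     product is \<open>(4 * R) ^ k\<close>.\<close>
   have c: "2 powr (?\<nu> + 1/2) * (2 * R) powr (?\<nu> + real s - 1) / 2 = C2 * (4 * R) ^ k"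
   proof -
    have a: "2 powr (?\<nu> + 1/2) = 2 powr (real ?n / 2 - 1/2) * 2 ^ k"
     by (simp add: powr_add[symmetric] powr_realpow[symmetric] algebra_simps)
    have b: "(2 * R) powr (?\<nu> + real s - 1) = (2 * R) powr (real ?n / 2 + real s - 2) * (2 * R) ^ k"
    proof -
     have "?\<nu> + real s - 1 = (real ?n / 2 + real s - 2) + real k" by simp
     then show ?thesis by (simp only: powr_add powr_realpow[OF L])
    qed
    have c: "(4 * R) ^ k = 2 ^ k * (2 * R) ^ k" by (simp only: power_mult_distrib[symmetric]) simp
    show ?thesis unfolding C2_def a b c by (simp only: mult_ac times_divide_eq_left times_divide_eq_right)
   qed
   have "EX \<psi>. ((%y. tweight ?\<nu> y *R rp R f k l y) ---> \<psi>) (at_right 0) & norm \<psi> <= (C2 * (4 * R) ^ k) * Hn R f k l"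
    unfolding c[symmetric] Hn_def
    by (rule P_op_trace[OF src(1)[OF f R l] L src(3)[OF f R l] \<open>?\<nu> >= 1/2\<close> s1 src(2)[OF f R l]])
   moreover have "(C2 * (4 * R) ^ k) * Hn R f k l <= max C1 C2 * (4 * R) ^ k * Hn R f k l"
    using C R Hn_nonneg[of R f k l] by (intro mult_right_mono) auto
   ultimately show ?thesis by (meson order_trans)
  qed
  then obtain \<psi> where "((%r. tweight ?\<nu> r *R rp R f k l r) ---> \<psi>) (at_right 0)" and n: "norm \<psi> <= max C1 C2 * (4 * R) ^ k * Hn R f k l" by blast
  then have "(tq f k l ---> \<psi>) (at_right 0)" using tendsto_cong[OF ev] by simp
  then show ?thesis using n by blast
 qed
 then show ?thesis using C(1) by (intro exI[of _ "max C1 C2"]) auto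
qed

lemma tc_tendsto:
 assumes f: "f : T" and l: "l : {1..d k}" shows "(tq f k l ---> tc f k l) (at_right 0)"
proof -
 have "0 < R0 / 2" "R0 / 2 < R0" using R0 by auto
 from tq_limit[OF this] obtain \<psi> where "(tq f k l ---> \<psi>) (at_right 0)" using f l by blast
 then show ?thesis unfolding tc_def by (simp add: tendsto_Lim)
qed

lemma tc_bound:
 assumes R: "0 < R" "R < R0"
 shows "EX C>0. ALL f:T. ALL k. ALL l:{1..d k}. norm (tc f k l) <= C * (4 * R) ^ k * Hn R f k l"
proof -
 from tq_limit[OF R] obtain C where C: "C > 0" and *: "!!f k l. f : T ==> l : {1..d k} ==> EX \<psi>. (tq f k l ---> \<psi>) (at_right 0) & norm \<psi> <= C * (4 * R) ^ k * Hn R f k l" by blast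
 have "norm (tc f k l) <= C * (4 * R) ^ k * Hn R f k l" if f: "f : T" and l: "l : {1..d k}" for f k l
 proof -
  obtain \<psi> where p: "(tq f k l ---> \<psi>) (at_right 0)" "norm \<psi> <= C * (4 * R) ^ k * Hn R f k l" using *[OF f l] by blast
  have "\<psi> = tc f k l" by (rule tendsto_unique[OF _ p(1) tc_tendsto[OF f l]]) simp
  then show ?thesis using p(2) by simp
 qed
 then show ?thesis using C by blast
qed

lemma tc_diff:
 assumes f: "f : T" and g: "g : T" and l: "l : {1..d k}" shows "tc (f - g) k l = tc f k l - tc g k l"
proof -
 have "\<forall>\<^sub>F r in at_right 0. tq f k l r - tq g k l r = tq (f - g) k l r"
  unfolding eventually_at_right_field
 proof (intro exI[of _ R0] conjI allI impI)
  fix r :: real assume "0 < r" "r < R0"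
  then show "tq f k l r - tq g k l r = tq (f - g) k l r" unfolding tq_def using fkl_diff[OF f g, of r l k] l by (simp add: scaleR_diff_right)
 qed (rule R0)
 from tendsto_cong[OF this] have "(tq (f - g) k l ---> tc f k l - tc g k l) (at_right 0)"
  using tendsto_diff[OF tc_tendsto[OF f l] tc_tendsto[OF g l]] by simp
 from tendsto_unique[OF _ tc_tendsto[OF T_diff[OF f g] l] this] show ?thesis by simp
qed

lemma tc_high:
 assumes f: "f : T" and e: "expK f K" and k: "k > K" and l: "l : {1..d k}" shows "tc f k l = 0"
proof -
 have R: "0 < R0 / 2" "R0 / 2 < R0" using R0 by auto
 from tc_bound[OF R] obtain C where "norm (tc f k l) <= C * (4 * (R0 / 2)) ^ k * Hn (R0 / 2) f k l" using f l by blast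
 then show ?thesis unfolding Hn_high[OF e R k l] by simp
qed

lemma sigma_eq:
 assumes e: "expK f K" and r: "0 < r" "r < R0" and th: "\<theta> : sphere 0 1"
 shows "sigma d Y e1 e2 f r \<theta> = (\<Sum>k\<le>K. \<Sum>l=1..d k. Y k l \<theta> *R tq f k l r)"
proof -
 \<comment> \<open>The expansion at radius \<open>r\<close> is used with the cutoff radius
   \<open>r\<close> itself, where \<open>\<eta> 1 = 1\<close>.\<close>
 have er: "\<eta> (r / r) ~= 0" using r eta_1[of 1] by simp
 have fh: "fkl Y f k l r = 0" if "k > K" "l : {1..d k}" for k l by (rule fkl_high[OF e r r(1) er that])
 show ?thesis
 proof (cases "DIM('a) = 2")
  case False
  then have n: "DIM('a) >= 3" using dim by simp
  have "sigma d Y e1 e2 f r \<theta> = (\<Sum>k. \<Sum>l=1..d k. (r ^ (DIM('a) + k - 2) * Y k l \<theta>) *R fkl Y f k l r)"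
   using False by (simp add: sigma_def)
  also have "... = (\<Sum>k\<le>K. \<Sum>l=1..d k. (r ^ (DIM('a) + k - 2) * Y k l \<theta>) *R fkl Y f k l r)"
   by (rule suminf_finite) (auto intro!: sum.neutral simp: fh)
  also have "... = (\<Sum>k\<le>K. \<Sum>l=1..d k. Y k l \<theta> *R tq f k l r)"
  proof (intro sum.cong refl)
   fix k l
   have rn: "real DIM('a) >= 3" using n by simp
   have "tweight (nu DIM('a) k) r = r powr real (DIM('a) + k - 2 + k)"
    using n rn by (simp add: tweight_def algebra_simps of_nat_diff)
   also have "... = r ^ (DIM('a) + k - 2) * r ^ k" using r by (simp only: powr_realpow power_add)
   finally show "(r ^ (DIM('a) + k - 2) * Y k l \<theta>) *R fkl Y f k l r = Y k l \<theta> *R tq f k l r"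
    unfolding tq_def using r by (simp add: mult_ac)
  qed
  finally show ?thesis .
 next
  case True
  interpret plane_frame e1 e2 by standard (use True frame in auto)
  note Ys = harmonic_basisD(1)[OF hb]
  note ex = expansion_sphere[OF e r r(1) er]
  have "sigma d Y e1 e2 f r \<theta> = fourier_0 f r /\<^sub>R ln r + (\<Sum>j. r ^ Suc j *R
     (cos (real (Suc j) * polar_angle e1 e2 \<theta>) *R fourier_cos e1 e2 f (Suc j) r + sin (real (Suc j) * polar_angle e1 e2 \<theta>) *R fourier_sin e1 e2 f (Suc j) r))"
   using True unfolding sigma_def Let_def by simp
  also have "... = fourier_0 f r /\<^sub>R ln r + (\<Sum>j. r ^ Suc j *R (if Suc j <= K then \<Sum>l=1..d (Suc j). Y (Suc j) l \<theta> *R fkl Y f (Suc j) l r else 0))"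
   by (subst fourier_term[OF Ys ex th]) auto
  also have "(\<Sum>j. r ^ Suc j *R (if Suc j <= K then \<Sum>l=1..d (Suc j). Y (Suc j) l \<theta> *R fkl Y f (Suc j) l r else 0))
   = (\<Sum>j<K. r ^ Suc j *R (if Suc j <= K then \<Sum>l=1..d (Suc j). Y (Suc j) l \<theta> *R fkl Y f (Suc j) l r else 0))"
   by (rule suminf_finite) auto
  also have "... = (\<Sum>j<K. \<Sum>l=1..d (Suc j). Y (Suc j) l \<theta> *R tq f (Suc j) l r)"
  proof (intro sum.cong refl)
   fix j assume "j : {..<K}"
   have "tweight (nu DIM('a) (Suc j)) r = r powr real (Suc j + Suc j)" using True by (simp add: tweight_def)
   also have "... = r ^ Suc j * r ^ Suc j" using r by (simp only: powr_realpow power_add)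
   finally have "Y (Suc j) l \<theta> *R tq f (Suc j) l r = r ^ Suc j *R (Y (Suc j) l \<theta> *R fkl Y f (Suc j) l r)" for l
    unfolding tq_def using r by (simp add: mult_ac del: power_Suc)
   then show "r ^ Suc j *R (if Suc j <= K then \<Sum>l=1..d (Suc j). Y (Suc j) l \<theta> *R fkl Y f (Suc j) l r else 0) = (\<Sum>l=1..d (Suc j). Y (Suc j) l \<theta> *R tq f (Suc j) l r)"
    using \<open>j : {..<K}\<close> by (simp add: scaleR_sum_right del: power_Suc)
  qed
  also have "fourier_0 f r /\<^sub>R ln r = (\<Sum>l=1..d 0. Y 0 l \<theta> *R tq f 0 l r)"
  proof -
   have f0: "fourier_0 f r = (\<Sum>l=1..d 0. Y 0 l \<theta> *R fkl Y f 0 l r)" by (rule fourier_term_0[OF Ys ex th])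
   show ?thesis unfolding f0 tq_def using True by (simp add: tweight_def scaleR_sum_right divide_inverse mult.commute)
  qed
  finally show ?thesis by (simp add: sum.atMost_shift)
 qed
qed

lemma sigma_tendsto:
 assumes f: "f : T" and e: "expK f K" and th: "\<theta> : sphere 0 1"
 shows "((%r. sigma d Y e1 e2 f r \<theta>) ---> (\<Sum>k\<le>K. \<Sum>l=1..d k. Y k l \<theta> *R tc f k l)) (at_right 0)"
proof -
 have "\<forall>\<^sub>F r in at_right 0. (\<Sum>k\<le>K. \<Sum>l=1..d k. Y k l \<theta> *R tq f k l r) = sigma d Y e1 e2 f r \<theta>"
  unfolding eventually_at_right_field using R0 sigma_eq[OF e _ _ th] by (intro exI[of _ R0]) auto
 moreover have "((%r. \<Sum>k\<le>K. \<Sum>l=1..d k. Y k l \<theta> *R tq f k l r) ---> (\<Sum>k\<le>K. \<Sum>l=1..d k. Y k l \<theta> *R tc f k l)) (at_right 0)"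
  by (intro tendsto_sum tendsto_scaleR tendsto_const tc_tendsto f)
 ultimately show ?thesis using tendsto_cong by force
qed

end

section \<open>Closability of the norms of \<open>Tinf\<close>\<close>

context trace_setting
begin

text \<open>\<open>R'\<close> is chosen with \<open>2 * R' <= c\<close>, so that the outer part for
  \<open>R'\<close> equals \<open>f\<close> where \<open>norm x > c\<close>. Polar coordinates bound
  the radial integral by one over a shell, on which the weight is bounded, and on a bounded domain
  the \<open>L\<^sub>1\<close> norm is controlled by the \<open>L\<^sub>2\<close> norm and hence by
  the Sobolev norm.\<close>

lemma rp_L1_bound:
 assumes R: "0 < R" "R < R0" and l: "l : {1..d k}" and c: "c > 0"
 shows "EX C R'. 0 < R' & R' < R0 & (ALL f:T. (LINT t|lborel. norm (tail c (rp R f k l) t)) <= C * HO R' f)"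
proof -
 let ?n = "DIM('a)"
 define R' where "R' = min (c / 2) (R0 / 2)"
 have R': "0 < R'" "R' < R0" "2 * R' <= c" using c R0 by (auto simp: R'_def)
 obtain B where B: "B > 0" "!!r. r >= 0 ==> \<bar>\<eta> r\<bar> <= B" using eta_bounded by blast
 have "bounded (Y k l ` sphere 0 1)" by (intro compact_imp_bounded compact_continuous_image harmonic_basisD(2)[OF hb l]) auto
 then obtain M where M: "!!\<theta>. \<theta> : sphere 0 1 ==> \<bar>Y k l \<theta>\<bar> <= M" unfolding bounded_iff real_norm_def by blast
 \<comment> \<open>The sphere contains a basis vector, which makes the bound \<open>M\<close>
   nonnegative.\<close>
 have "axis_sph : sphere 0 1" if "axis_sph = (SOME i. i : (Basis :: 'a set))" for axis_sph :: 'a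
  using someI_ex[of "%i. i : (Basis :: 'a set)"] nonempty_Basis that by auto
 then have M0: "M >= 0" using M[of "SOME i. i : (Basis :: 'a set)"] by force
 interpret fin: finite_measure "lebesgue_on \<Omega>" by (rule finite_lebesgue_on[OF open_dom bounded_dom])
 define V where "V = sqrt (measure (lebesgue_on \<Omega>) (space (lebesgue_on \<Omega>)))"
 define C where "C = (B / c ^ k * M) * (2 * R / c ^ ?n) * V"
 have "(LINT t|lborel. norm (tail c (rp R f k l) t)) <= C * HO R' f" if f: "f : T" for f
 proof -
  define u where "u = outer_part \<eta> R' f"
  have uH: "u : Hs s \<Omega>" unfolding u_def by (rule outer_part_Hs[OF f R'(1,2)])
  then have uL: "u : L2M (lebesgue_on \<Omega>)" by (auto simp: Hs_def L2_on_iff)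
  define A where "A = {z::'a. c < norm z & norm z < 2 * R}"
  have A: "open A" unfolding A_def by (intro open_Collect_conj open_Collect_less continuous_intros)
  have Ad: "A \<subseteq> \<Omega> - {0}"
  proof
   fix x assume "x : A"
   then show "x : \<Omega> - {0}" using R c by (intro in_dom) (auto simp: A_def)
  qed
  define q where "q z = ennreal (norm (indicator A z *R f z))" for z
  let ?Q = "%t. \<integral>\<^sup>+\<theta>. q (t *R \<theta>) \<partial>sphere_measure"
  let ?L = "%t. LINT \<theta>|sphere_measure. norm (f (t *R \<theta>))"
  have "(%z. indicator A z *R f z) : borel_measurable borel"
   by (rule borel_measurable_continuous_on_indicator) (use A in "auto intro: continuous_on_subset[OF T_continuous[OF f] Ad]")
  then have qm: "q : borel_measurable borel" unfolding q_def by measurable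
  have qA: "q z = ennreal (norm (f z))" if "z : A" for z using that by (simp add: q_def)
  have q0: "q z = 0" if "z \<notin> A" for z using that by (simp add: q_def)
  have bc: "bcont c (rp R f k l)"
  proof -
   have b: "bcont c (P_op (nu ?n k) (src R f k l))" by (rule P_op_bcont[OF Cinf_comp_Cpos[OF src(1)[OF f R l]] c])
   have e: "rp R f k l t = P_op (nu ?n k) (src R f k l) t" if "t > c" for t using src(2)[OF f R l, of t] that c by simp
   have "continuous_on {c<..} (rp R f k l) = continuous_on {c<..} (P_op (nu ?n k) (src R f k l))"
    by (rule continuous_on_cong) (use e in auto)
   moreover have "EX b. ALL t>b. rp R f k l t = 0" by (intro exI[of _ "2 * R"]) (use rp_zero[OF R(1)] in auto)
   ultimately show ?thesis using b e unfolding bcont_def by (metis)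
  qed
  have i: "integrable lborel (%t. norm (tail c (rp R f k l) t))" by (rule integrable_norm[OF bcont_integrable[OF bc]])
  have "ennreal (LINT t|lborel. norm (tail c (rp R f k l) t)) = (\<integral>\<^sup>+t. ennreal (norm (tail c (rp R f k l) t)) \<partial>lborel)"
   by (rule nn_integral_eq_integral[OF i, symmetric]) simp
  also have "... <= (\<integral>\<^sup>+t. ennreal (B / c ^ k * M) * (?Q t * indicator {0<..} t) \<partial>lborel)"
  proof (rule nn_integral_mono)
   fix t :: real
   show "ennreal (norm (tail c (rp R f k l) t)) <= ennreal (B / c ^ k * M) * (?Q t * indicator {0<..} t)"
   proof (cases "c < t & t < 2 * R")
    case True
    then have t: "c < t" "t < 2 * R" "0 < t" "t <= 2 * R0" using c R by auto
    have cf: "continuous_on (sphere 0 1) (%\<theta>. f (t *R \<theta>))" by (rule T_continuous_sphere[OF f t(3,4)])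
    have i2: "integrable sphere_measure (%\<theta>. norm (f (t *R \<theta>)))" by (intro sphere_integrable continuous_intros cf)
    have "norm (fkl Y f k l t) <= (LINT \<theta>|sphere_measure. norm (Y k l \<theta> *R f (t *R \<theta>)))"
     unfolding fkl_def sph_coeff_def by (rule integral_norm_bound)
    also have "... <= (LINT \<theta>|sphere_measure. M * norm (f (t *R \<theta>)))"
    proof (rule integral_mono)
     show "integrable sphere_measure (%\<theta>. norm (Y k l \<theta> *R f (t *R \<theta>)))"
      by (intro sphere_integrable continuous_intros harmonic_basisD(2)[OF hb l] cf)
     show "integrable sphere_measure (%\<theta>. M * norm (f (t *R \<theta>)))" by (rule integrable_mult_right[OF i2])
     fix \<theta> :: 'a assume "\<theta> : space sphere_measure"
     then show "norm (Y k l \<theta> *R f (t *R \<theta>)) <= M * norm (f (t *R \<theta>))" using M[of \<theta>] by (simp add: mult_right_mono)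
    qed
    also have "... = M * ?L t" by simp
    finally have fb: "norm (fkl Y f k l t) <= M * ?L t" .
    have "norm (rp R f k l t) = \<bar>\<eta> (t / R)\<bar> / t ^ k * norm (fkl Y f k l t)"
     unfolding radial_part_def using t by (simp add: abs_mult)
    also have "... <= B / c ^ k * (M * ?L t)"
     using t R c B(1) by (intro mult_mono frac_le fb B(2) power_mono) auto
    finally have 1: "norm (rp R f k l t) <= (B / c ^ k * M) * ?L t" by (simp only: mult.assoc)
    have "ennreal (?L t) = (\<integral>\<^sup>+\<theta>. ennreal (norm (f (t *R \<theta>))) \<partial>sphere_measure)"
     by (rule nn_integral_eq_integral[OF i2, symmetric]) simp
    also have "... = ?Q t"
     by (rule nn_integral_cong) (subst qA, use t in "auto simp: A_def")
    finally have 2: "ennreal (?L t) = ?Q t" .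
    have "ennreal (norm (tail c (rp R f k l) t)) <= ennreal ((B / c ^ k * M) * ?L t)"
     using 1 t by (intro ennreal_leI) (simp add: tail_def)
    also have "... = ennreal (B / c ^ k * M) * ?Q t"
     unfolding 2[symmetric] using B(1) c M0 by (intro ennreal_mult') simp
    finally show ?thesis using t by simp
   next
    case False
    then have "tail c (rp R f k l) t = 0" using rp_zero[OF R(1), of t f k l] by (auto simp: tail_def)
    then show ?thesis by simp
   qed
  qed
  also have "... = ennreal (B / c ^ k * M) * (\<integral>\<^sup>+t. ?Q t * indicator {0<..} t \<partial>lborel)"
  proof (rule nn_integral_cmult)
   interpret S: finite_measure "sphere_measure :: 'a measure" by (rule finite_sphere)
   have "(%(t, \<theta>). t *R \<theta>) : measurable (lborel \<Otimes>\<^sub>M sphere_measure) (borel :: 'a measure)"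
   proof -
    have [measurable]: "(%\<theta>. \<theta>) : measurable sphere_measure (borel :: 'a measure)" by (rule sphere_measurable) (rule continuous_on_id)
    show ?thesis by measurable
   qed
   then have "(%(t, \<theta>). q (t *R \<theta>)) : borel_measurable (lborel \<Otimes>\<^sub>M sphere_measure)"
    using measurable_compose[OF _ qm] by (simp add: case_prod_unfold)
   then have [measurable]: "(%t. \<integral>\<^sup>+\<theta>. q (t *R \<theta>) \<partial>sphere_measure) : borel_measurable lborel"
    by (rule S.borel_measurable_nn_integral)
   show "(%t. ?Q t * indicator {0<..} t) : borel_measurable lborel" by measurable
  qed
  also have "(\<integral>\<^sup>+t. ?Q t * indicator {0<..} t \<partial>lborel) = (\<integral>\<^sup>+z. q z * ennreal (norm z / norm z ^ ?n) \<partial>lborel)"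
   by (rule polar[OF qm])
  also have "... <= (\<integral>\<^sup>+z. ennreal (2 * R / c ^ ?n) * q z \<partial>lborel)"
  proof (rule nn_integral_mono)
   fix z :: 'a
   show "q z * ennreal (norm z / norm z ^ ?n) <= ennreal (2 * R / c ^ ?n) * q z"
   proof (cases "z : A")
    case True
    then have "norm z / norm z ^ ?n <= 2 * R / c ^ ?n" using c R unfolding A_def by (intro frac_le power_mono) auto
    then show ?thesis by (subst mult.commute) (intro mult_right_mono ennreal_leI, auto)
   qed (simp add: q0)
  qed
  also have "... = ennreal (2 * R / c ^ ?n) * (\<integral>\<^sup>+z. q z \<partial>lborel)" by (rule nn_integral_cmult) (use qm in simp)
  also have "(\<integral>\<^sup>+z. q z \<partial>lborel) <= ennreal (V * Hs_norm s \<Omega> u)"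
  proof -
   have "(\<integral>\<^sup>+z. q z \<partial>lborel) = (\<integral>\<^sup>+z. q z \<partial>lebesgue)" using qm by (simp add: nn_integral_completion)
   also have "... <= (\<integral>\<^sup>+z. ennreal (norm (u z)) * indicator \<Omega> z \<partial>lebesgue)"
   proof (rule nn_integral_mono)
    fix z :: 'a
    show "q z <= ennreal (norm (u z)) * indicator \<Omega> z"
    proof (cases "z : A")
     case True
     then have "u z = f z" unfolding u_def using R' by (intro outer_part_outside) (auto simp: A_def)
     then show ?thesis using True Ad by (auto simp: qA)
    qed (simp add: q0)
   qed
   also have "... = (\<integral>\<^sup>+z. ennreal (norm (u z)) \<partial>lebesgue_on \<Omega>)"
    by (rule nn_integral_restrict_space[symmetric]) (use open_dom in auto)
   also have "... = ennreal (LINT z|lebesgue_on \<Omega>. norm (u z))"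
    by (rule nn_integral_eq_integral[OF integrable_norm[OF L2M_L1(1)[OF uL fin.finite_measure_axioms]]]) simp
   also have "... <= ennreal (V * Hs_norm s \<Omega> u)"
   proof (rule ennreal_leI)
    have "(LINT z|lebesgue_on \<Omega>. norm (u z)) <= V * l2n (lebesgue_on \<Omega>) u" unfolding V_def by (rule L2M_L1(2)[OF uL fin.finite_measure_axioms])
    also have "... <= V * Hs_norm s \<Omega> u" by (intro mult_left_mono l2n_le_Hs_norm open_dom bounded_dom uH) (simp add: V_def)
    finally show "(LINT z|lebesgue_on \<Omega>. norm (u z)) <= V * Hs_norm s \<Omega> u" .
   qed
   finally show ?thesis .
  qed
  finally have "ennreal (LINT t|lborel. norm (tail c (rp R f k l) t)) <= ennreal (B / c ^ k * M) * (ennreal (2 * R / c ^ ?n) * ennreal (V * Hs_norm s \<Omega> u))"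
   by (simp add: mult_left_mono)
  also have "... = ennreal (C * Hs_norm s \<Omega> u)"
  proof -
   have p: "0 <= B / c ^ k * M" "0 <= 2 * R / c ^ ?n" "0 <= V * Hs_norm s \<Omega> u"
    using B(1) c M0 R by (auto simp: V_def Hs_norm_nonneg)
   show ?thesis unfolding C_def by (simp only: ennreal_mult[symmetric] p mult_nonneg_nonneg mult.assoc)
  qed
  finally have "(LINT t|lborel. norm (tail c (rp R f k l) t)) <= C * Hs_norm s \<Omega> u"
   by (subst (asm) ennreal_le_iff) (use B(1) c M0 R in "auto simp: C_def V_def Hs_norm_nonneg")
  then show ?thesis by (simp add: u_def)
 qed
 then show ?thesis using R'(1,2) by blast
qed

text \<open>Bridge to \<open>P_op_closable\<close>: the Cauchy condition at this \<open>R\<close>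
  passes to the preimages \<open>src\<close>, while convergence of the outer parts for all radii
  gives, by \<open>rp_L1_bound\<close>, the convergence away from the origin.\<close>

lemma Hn_closable:
 assumes H: "!!j. H j : T" and R: "0 < R" "R < R0" and l: "l : {1..d k}"
  and cau: "!!\<epsilon>. \<epsilon> > 0 ==> EX J. ALL i>=J. ALL j>=J. N R (H i - H j) < \<epsilon>"
  and out: "!!R. 0 < R ==> R < R0 ==> (%j. HO R (H j)) ----> 0"
 shows "(%j. Hn R (H j) k l) ----> 0"
proof -
 let ?n = "DIM('a)"
 let ?\<nu> = "nu ?n k"
 define f where "f j = src R (H j) k l" for j
 note fj = src(1)[OF H R l, folded f_def] src(2)[OF H R l, folded f_def] src(3)[OF H R l, folded f_def]
 have np: "nu_const ?\<nu> > 0" by (rule nu_const_pos[OF nu_nonneg])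
 have case1: "?\<nu> = 0 & s >= 2 | ?\<nu> >= 1/2 & s >= 1"
 proof (cases "k = 0 & ?n = 2")
  case False
  have "?n >= 3 | (?n = 2 & k >= 1)" using dim False by auto
  then have "real ?n >= 3 | (real ?n = 2 & real k >= 1)" by auto
  then have "?\<nu> >= 1/2" by auto
  moreover have "s >= 1" using s2 s3 dim by (cases "?n = 2") auto
  ultimately show ?thesis by blast
 qed (use s2 in auto)
 have L: "2 * R > 0" using R by simp
 have cau': "ALL e>0. EX J. ALL i>=J. ALL j>=J. l2n (segm (2 * R)) (%t. Dn s (f i) t - Dn s (f j) t) < e"
 proof (intro allI impI)
  fix e :: real assume e: "e > 0"
  then obtain J where J: "ALL i>=J. ALL j>=J. N R (H i - H j) < nu_const ?\<nu> * e" using cau[of "nu_const ?\<nu> * e"] np by auto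
  have "l2n (segm (2 * R)) (%t. Dn s (f i) t - Dn s (f j) t) < e" if "i >= J" "j >= J" for i j
  proof -
   have "nu_const ?\<nu> * l2n (segm (2 * R)) (%t. Dn s (f i) t - Dn s (f j) t) = Hn R (H i - H j) k l"
    unfolding Hn_eq[OF T_diff[OF H H] R l] l2n_src_diff[OF H H R l] f_def ..
   also have "... <= N R (H i - H j)" by (rule Hn_le_T_norm[OF T_diff[OF H H] R l])
   also have "... < nu_const ?\<nu> * e" using J that by blast
   finally show ?thesis using np by simp
  qed
  then show "EX J. ALL i>=J. ALL j>=J. l2n (segm (2 * R)) (%t. Dn s (f i) t - Dn s (f j) t) < e" by blast
 qed
 have conv: "(%j. LINT t|lborel. norm (tail c (P_op ?\<nu> (f j)) t)) ----> 0" if c: "c > 0" for c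
 proof -
  have e: "tail c (P_op ?\<nu> (f j)) = tail c (rp R (H j) k l)" for j using fj(2)[of _ j] c by (auto simp: tail_def fun_eq_iff)
  obtain C R' where C: "0 < R'" "R' < R0" "ALL f:T. (LINT t|lborel. norm (tail c (rp R f k l) t)) <= C * HO R' f"
   using rp_L1_bound[OF R l c] by blast
  show ?thesis unfolding e
  proof (rule tendsto_sandwich[OF _ _ tendsto_const])
   show "(%j. C * HO R' (H j)) ----> 0" using tendsto_mult_right_zero[OF out[OF C(1,2)]] .
  qed (use C(3) H in "auto intro!: always_eventually integral_nonneg_AE")
 qed
 have "(%j. l2n (segm (2 * R)) (Dn s (f j))) ----> 0"
  by (rule P_op_closable[OF case1 L fj(1) fj(3) cau'[rule_format] conv])
 then have "(%j. nu_const ?\<nu> * l2n (segm (2 * R)) (Dn s (f j))) ----> 0" by (rule tendsto_mult_right_zero)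
 then show ?thesis unfolding Hn_eq[OF H R l] f_def .
qed

text \<open>Each radial component tends to zero, but the degrees are not bounded along the sequence.
  The Cauchy condition bounds \<open>AH R K (H i)\<close> by
  \<open>\<epsilon> + AH R K (H j)\<close>; letting \<open>j\<close> grow with \<open>K\<close>
  fixed gives a bound uniform in \<open>K\<close>.\<close>

lemma T_norm_closable:
 assumes H: "!!j. H j : T" and R: "0 < R" "R < R0"
  and cau: "!!\<epsilon>. \<epsilon> > 0 ==> EX J. ALL i>=J. ALL j>=J. N R (H i - H j) < \<epsilon>"
  and out: "!!R. 0 < R ==> R < R0 ==> (%j. HO R (H j)) ----> 0"
 shows "(%j. N R (H j)) ----> 0"
proof -
 let ?N = "N R"
 note sem = T_seminorm[OF R]
 have AH0: "(%j. AH R K (H j)) ----> 0" for K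
 proof -
  have "(%j. (AH R K (H j))\<^sup>2) ----> (\<Sum>k\<le>K. \<Sum>l=1..d k. 0\<^sup>2)"
   unfolding AH_square by (intro tendsto_sum tendsto_power Hn_closable[OF H R _ cau out])
  then have "(%j. sqrt ((AH R K (H j))\<^sup>2)) ----> sqrt 0" by (intro tendsto_real_sqrt) simp
  then show ?thesis by (simp add: AH_def L2_set_nonneg)
 qed
 have AHb: "EX J. ALL i>=J. ALL K. AH R K (H i) <= \<epsilon>" if e: "\<epsilon> > 0" for \<epsilon>
 proof -
  obtain J where J: "ALL i>=J. ALL j>=J. ?N (H i - H j) < \<epsilon>" using cau[OF e] by blast
  have "AH R K (H i) <= \<epsilon>" if i: "i >= J" for i K
  proof (rule tendsto_lowerbound)
   show "(%j. \<epsilon> + AH R K (H j)) ----> \<epsilon>" using tendsto_add[OF tendsto_const AH0, of \<epsilon> K] by simp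
   have "AH R K (H i) <= \<epsilon> + AH R K (H j)" if j: "j >= J" for j
   proof -
    have "AH R K (H i) <= L2_set (%x. (case x of (k, l) => Hn R (H i - H j) k l) + (case x of (k, l) => Hn R (H j) k l)) (SIGMA k:{..K}. {1..d k})"
     unfolding AH_def
    proof (rule L2_set_mono)
     fix x assume "x : (SIGMA k:{..K}. {1..d k})"
     then obtain k l where x: "x = (k, l)" and l: "l : {1..d k}" by auto
     have "H i - H j = H i - H j" ..
     have s: "seminorm_on T (%f. Hn R f k l)" unfolding seminorm_on_def
     proof (intro conjI ballI)
      fix f g assume f: "f : T" and g: "g : T"
      show "f - g : T" by (rule T_diff[OF f g])
      show "Hn R (f - g) k l <= Hn R f k l + Hn R g k l" by (rule Hn_diff[OF f g R l])
     next
      fix f assume f: "f : T"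
      show "Hn R f k l >= 0" by (rule Hn_nonneg)
      show "Hn R (f - f) k l = 0" unfolding Hn_eq[OF T_diff[OF f f] R l] l2n_src_diff[OF f f R l] by (simp add: l2n_def)
     qed
     show "(case x of (k, l) => Hn R (H i) k l) <= (case x of (k, l) => Hn R (H i - H j) k l) + (case x of (k, l) => Hn R (H j) k l)"
      unfolding x using seminorm_on_le[OF s H H, of i j] by simp
    qed (auto simp: Hn_nonneg)
    also have "... <= AH R K (H i - H j) + AH R K (H j)" unfolding AH_def by (rule L2_set_triangle_ineq)
    also have "AH R K (H i - H j) <= ?N (H i - H j)" by (rule AH_le_T_norm[OF T_diff[OF H H] R])
    also have "?N (H i - H j) <= \<epsilon>" using J i j by (auto intro: less_imp_le)
    finally show ?thesis by simp
   qed
   then show "\<forall>\<^sub>F j in sequentially. AH R K (H i) <= \<epsilon> + AH R K (H j)" by (auto simp: eventually_sequentially)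
  qed simp
  then show ?thesis by blast
 qed
 show ?thesis
 proof (rule LIMSEQ_I)
  fix e :: real assume e: "e > 0"
  then have e2: "e / 2 > 0" by simp
  obtain J1 where J1: "!!i K. i >= J1 ==> AH R K (H i) <= e / 2" using AHb[OF e2] by blast
  obtain J2 where J2: "!!i. i >= J2 ==> norm (HO R (H i) - 0) < e / 2" using LIMSEQ_D[OF out[OF R] e2] by blast
  have "norm (?N (H i) - 0) < e" if "i >= max J1 J2" for i
  proof -
   obtain K where K: "expK (H i) K" using T_expK H by blast
   have "?N (H i) <= AH R K (H i) + HO R (H i)" by (rule T_norm_le[OF K R])
   moreover have "?N (H i) >= 0" by (rule seminorm_onD(3)[OF sem H H])
   ultimately show ?thesis using J1[of i K] J2[of i] that by simp
  qed
  then show "EX J. ALL i>=J. norm (?N (H i) - 0) < e" by blast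
 qed
qed

end

section \<open>Topologies given by seminorms\<close>

lemma norms_topology_topspace:
 assumes N: "\<N> ~= {}" and 0: "!!p f. p : \<N> ==> f : X ==> p (f - f) = 0"
 shows "topspace (norms_topology X \<N>) = X"
proof -
 obtain p where p: "p : \<N>" using N by blast
 have "f : {g\<in>X. p (g - f) < 1}" if "f : X" for f using 0[OF p that] that by simp
 then have "X \<subseteq> \<Union> {{g\<in>X. p (g - f) < \<epsilon>} | f p \<epsilon>. f : X & p : \<N> & \<epsilon> > (0::real)}"
  using p zero_less_one by blast
 then show ?thesis unfolding norms_topology_def topology_generated_by_topspace by blast
qed

lemma norms_topology_ball:
 "f : X ==> p : \<N> ==> \<epsilon> > 0 ==> openin (norms_topology X \<N>) {g\<in>X. p (g - f) < \<epsilon>}"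
 unfolding norms_topology_def by (rule topology_generated_by_Basis) blast

lemma limitin_norms_topologyD:
 assumes lim: "limitin (norms_topology X \<N>) F f sequentially" and p: "p : \<N>" and 0: "p (f - f) = 0" and f: "f : X" and e: "e > 0"
 shows "\<forall>\<^sub>F j in sequentially. F j : X & p (F j - f) < e"
 using lim norms_topology_ball[OF f p e] 0 f e unfolding limitin_def by auto

text \<open>Open sets are generated by balls about arbitrary centres. Induction over the generation
  reduces to one ball, and the triangle inequality recentres it at \<open>f\<close>.\<close>

lemma limitin_norms_topologyI:
 assumes N: "\<N> ~= {}" and 0: "!!p f. p : \<N> ==> f : X ==> p (f - f) = 0"
  and tri: "!!p a b c. p : \<N> ==> a : X ==> b : X ==> c : X ==> p (a - c) <= p (a - b) + p (b - c)"
  and f: "f : X" and F: "!!j. F j : X"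
  and lim: "!!p e. p : \<N> ==> e > 0 ==> \<forall>\<^sub>F j in sequentially. p (F j - f) < e"
 shows "limitin (norms_topology X \<N>) F f sequentially"
proof -
 have tX: "topspace (norms_topology X \<N>) = X" by (rule norms_topology_topspace) (use N 0 in auto)
 have nb: "\<forall>\<^sub>F j in sequentially. F j : U" if U: "openin (norms_topology X \<N>) U & f : U" for U
 proof -
 from U have "generate_topology_on {{g\<in>X. p (g - f) < \<epsilon>} | f p \<epsilon>. f : X & p : \<N> & \<epsilon> > (0::real)} U"
  unfolding norms_topology_def openin_topology_generated_by_iff by blast
 then have "f : U ==> \<forall>\<^sub>F j in sequentially. F j : U"
 proof induction
  case (Int a b)
  then show ?case by (auto intro: eventually_conj)
 next
  case (UN K)
  then obtain k where "k : K" "f : k" by blast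
  then have "\<forall>\<^sub>F j in sequentially. F j : k" using UN by blast
  then show ?case by (rule eventually_mono) (use \<open>k : K\<close> in blast)
 next
  case (Basis S)
  then obtain g p \<epsilon> where S: "S = {h\<in>X. p (h - g) < \<epsilon>}" and g: "g : X" and p: "p : \<N>" by blast
  then have "\<epsilon> - p (f - g) > 0" using Basis by simp
  from lim[OF p this] show ?case
  proof eventually_elim
   case (elim j)
   then show ?case unfolding S using tri[OF p F f g, of j] F by simp
  qed
 qed simp
 then show "\<forall>\<^sub>F j in sequentially. F j : U" using U by blast
 qed
 then show ?thesis unfolding limitin_def tX using f by blast
qed

lemma continuous_map_norms_topology:
 assumes N: "\<N> ~= {}" and 0: "!!p f. p : \<N> ==> f : X ==> p (f - f) = 0"
  and M: "\<M> ~= {}" and Z0: "!!q f. q : \<M> ==> f : Z ==> q (f - f) = 0"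
  and tri: "!!q a b c. q : \<M> ==> a : Z ==> b : Z ==> c : Z ==> q (a - c) <= q (a - b) + q (b - c)"
  and t: "!!f. f : X ==> t f : Z"
  and bd: "!!q. q : \<M> ==> EX p:\<N>. EX C>0. ALL f:X. ALL g:X. q (t g - t f) <= C * p (g - f)"
 shows "continuous_map (norms_topology X \<N>) (norms_topology Z \<M>) t"
proof -
 let ?S = "{{g\<in>Z. q (g - f) < \<epsilon>} | f q \<epsilon>. f : Z & q : \<M> & \<epsilon> > (0::real)}"
 have tX: "topspace (norms_topology X \<N>) = X" by (rule norms_topology_topspace) (use N 0 in auto)
 have tZ: "topspace (norms_topology Z \<M>) = Z" by (rule norms_topology_topspace) (use M Z0 in auto)
 have op: "openin (norms_topology X \<N>) (t -` U \<inter> X)" if U: "U : ?S" for U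
 proof (subst openin_subopen, intro ballI)
  fix f assume f: "f : t -` U \<inter> X"
  from U obtain \<phi> q \<epsilon> where U: "U = {g\<in>Z. q (g - \<phi>) < \<epsilon>}" and \<phi>: "\<phi> : Z" and q: "q : \<M>" by blast
  obtain p C where p: "p : \<N>" and C: "C > 0" "ALL f:X. ALL g:X. q (t g - t f) <= C * p (g - f)" using bd[OF q] by blast
  define e where "e = (\<epsilon> - q (t f - \<phi>)) / C"
  have e: "e > 0" using f C by (simp add: e_def U)
  let ?B = "{g\<in>X. p (g - f) < e}"
  have "openin (norms_topology X \<N>) ?B" using f p e by (intro norms_topology_ball) auto
  moreover have "f : ?B" using f e 0[OF p] by simp
  moreover have "?B \<subseteq> t -` U \<inter> X"
  proof
   fix g assume g: "g : ?B"
   have "q (t g - \<phi>) <= q (t g - t f) + q (t f - \<phi>)" using tri[OF q t t \<phi>] g f by simp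
   also have "q (t g - t f) <= C * p (g - f)" using C(2) f g by auto
   also have "C * p (g - f) < C * e" using g C(1) by simp
   also have "C * e = \<epsilon> - q (t f - \<phi>)" using C(1) by (simp add: e_def)
   finally show "g : t -` U \<inter> X" using g t by (simp add: U)
  qed
  ultimately show "EX T. openin (norms_topology X \<N>) T & f : T & T \<subseteq> t -` U \<inter> X" by blast
 qed
 have SZ: "\<Union> ?S = Z" using tZ unfolding norms_topology_def topology_generated_by_topspace .
 show ?thesis unfolding norms_topology_def[of Z \<M>]
 proof (rule continuous_on_generated_topo)
  show "openin (norms_topology X \<N>) (t -` U \<inter> topspace (norms_topology X \<N>))" if "U : ?S" for U
   unfolding tX by (rule op[OF that])
  show "t ` topspace (norms_topology X \<N>) \<subseteq> \<Union> ?S" unfolding tX SZ using t by blast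
 qed
qed

section \<open>Coefficient families and the space \<open>A(\<Theta>)\<close>\<close>

context trace_setting
begin

text \<open>The norm of \<open>A(\<Theta>)\<close> truncated at degree \<open>K\<close>, on
  coefficient families instead of functions. Being a finite sum it passes to limits of the
  coefficients.\<close>

definition PN :: "real => nat => (nat => nat => complex) => real" where
 "PN h K c = L2_set (%(k, l). norm (c k l) / h ^ k) (SIGMA k:{..K}. {1..d k})"

definition An :: "real => (nat => nat => complex) => real" where
 "An h c = sqrt (\<Sum>k. (\<Sum>l=1..d k. (norm (c k l))\<^sup>2) / h ^ (2 * k))"

definition Acoef :: "(nat => nat => complex) => bool" where
 "Acoef c \<longleftrightarrow> (ALL h:{0<..<1}. summable (%k. (\<Sum>l=1..d k. (norm (c k l))\<^sup>2) / h ^ (2 * k)))"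

lemma PN_square: "(PN h K c)\<^sup>2 = (\<Sum>k\<le>K. (\<Sum>l=1..d k. (norm (c k l))\<^sup>2) / h ^ (2 * k))"
proof -
 have "(PN h K c)\<^sup>2 = (\<Sum>(k, l)\<in>(SIGMA k:{..K}. {1..d k}). (norm (c k l) / h ^ k)\<^sup>2)"
  unfolding PN_def L2_set_def by (subst real_sqrt_pow2) (auto intro!: sum_nonneg sum.cong)
 also have "... = (\<Sum>k\<le>K. \<Sum>l=1..d k. (norm (c k l) / h ^ k)\<^sup>2)" by (simp add: sum.Sigma)
 finally show ?thesis by (simp add: power_divide sum_divide_distrib power_mult[symmetric] mult.commute)
qed

lemma PN_nonneg: "PN h K c >= 0" by (simp add: PN_def L2_set_nonneg)

lemma PN_triangle:
 assumes h: "h > 0" shows "PN h K (%k l. a k l + b k l) <= PN h K a + PN h K b"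
proof -
 have "PN h K (%k l. a k l + b k l) <= L2_set (%x. (case x of (k, l) => norm (a k l) / h ^ k) + (case x of (k, l) => norm (b k l) / h ^ k)) (SIGMA k:{..K}. {1..d k})"
  unfolding PN_def
  by (rule L2_set_mono) (use h in "auto simp: add_divide_distrib[symmetric] intro!: divide_right_mono norm_triangle_ineq")
 also have "... <= PN h K a + PN h K b" unfolding PN_def by (rule L2_set_triangle_ineq)
 finally show ?thesis .
qed

lemma PN_tendsto:
 assumes "!!k l. l : {1..d k} ==> (%j. a j k l) ----> b k l"
 shows "(%j. PN h K (a j)) ----> PN h K b"
proof -
 have "(%j. sqrt ((PN h K (a j))\<^sup>2)) ----> sqrt ((PN h K b)\<^sup>2)"
  unfolding PN_square divide_inverse by (intro tendsto_real_sqrt tendsto_sum tendsto_mult tendsto_const tendsto_power tendsto_norm assms)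
 then show ?thesis using PN_nonneg by simp
qed

text \<open>A bound uniform in \<open>K\<close> yields summability and the norm bound together, so
  estimates are proved for \<open>PN\<close> first.\<close>

lemma An_le:
 assumes h: "h > 0" and b: "!!K. PN h K c <= M"
 shows "summable (%k. (\<Sum>l=1..d k. (norm (c k l))\<^sup>2) / h ^ (2 * k))" "An h c <= M"
proof -
 have M: "M >= 0" using b[of 0] PN_nonneg[of h 0 c] by linarith
 have nn: "(\<Sum>l=1..d k. (norm (c k l))\<^sup>2) / h ^ (2 * k) >= 0" for k using h by (intro divide_nonneg_nonneg sum_nonneg) auto
 have bb: "(\<Sum>k<K. (\<Sum>l=1..d k. (norm (c k l))\<^sup>2) / h ^ (2 * k)) <= M\<^sup>2" for K
 proof -
  have "(\<Sum>k<K. (\<Sum>l=1..d k. (norm (c k l))\<^sup>2) / h ^ (2 * k)) <= (\<Sum>k\<le>K. (\<Sum>l=1..d k. (norm (c k l))\<^sup>2) / h ^ (2 * k))"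
   by (intro sum_mono2 nn) auto
  also have "... <= M\<^sup>2" unfolding PN_square[symmetric] by (intro power_mono b PN_nonneg)
  finally show ?thesis .
 qed
 show s: "summable (%k. (\<Sum>l=1..d k. (norm (c k l))\<^sup>2) / h ^ (2 * k))" by (rule summableI_nonneg_bounded[OF nn bb])
 show "An h c <= M" unfolding An_def by (rule real_le_lsqrt) (use M suminf_le_const[OF s bb] suminf_nonneg[OF s nn] in auto)
qed

lemma PN_le_An:
 assumes h: "h > 0" and s: "summable (%k. (\<Sum>l=1..d k. (norm (c k l))\<^sup>2) / h ^ (2 * k))"
 shows "PN h K c <= An h c"
proof -
 have nn: "(\<Sum>l=1..d k. (norm (c k l))\<^sup>2) / h ^ (2 * k) >= 0" for k using h by (intro divide_nonneg_nonneg sum_nonneg) auto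
 show ?thesis unfolding An_def by (rule real_le_rsqrt) (unfold PN_square, rule sum_le_suminf[OF s], auto intro: nn simp del: One_nat_def)
qed

lemma An_cong: "(!!k l. l : {1..d k} ==> a k l = b k l) ==> An h a = An h b"
 unfolding An_def by (intro arg_cong[where f=sqrt] suminf_cong arg_cong2[where f="(/)"] sum.cong refl) auto

text \<open>Outside the sphere the value is \<open>undefined\<close>, as membership in "A_space" requires.\<close>

definition synth :: "(nat => nat => complex) => 'a => complex" where
 "synth c = restrict (%\<theta>. \<Sum>k. \<Sum>l=1..d k. Y k l \<theta> *R c k l) (sphere 0 1)"

text \<open>Cauchy-Schwarz over \<open>l\<close> sets the growth \<open>B ^ k\<close> of the
  harmonics against coefficients that decay faster than any geometric sequence.\<close>

lemma synth_dominated: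
 assumes c: "Acoef c"
 shows "EX M>=0. ALL k. ALL \<theta>:sphere 0 1. norm (\<Sum>l=1..d k. Y k l \<theta> *R c k l) <= M * (1/2) ^ k"
proof -
 obtain C B where CB: "C > 0" "B >= 1" "!!k \<theta>. \<theta> : sphere 0 1 ==> (\<Sum>l=1..d k. (Y k l \<theta>)\<^sup>2) <= C * B ^ k"
  using harmonic_basis_sum_square_bound[OF hb] by blast
 \<comment> \<open>Since \<open>B >= 1\<close>, this gives \<open>B * h\<^sup>2 <= 1/4\<close>,
   whose square root is the ratio \<open>1/2\<close>.\<close>
 define h where "h = 1 / (2 * B)"
 have h: "0 < h" "h < 1" using CB by (auto simp: h_def)
 let ?a = "%k. (\<Sum>l=1..d k. (norm (c k l))\<^sup>2) / h ^ (2 * k)"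
 have s: "summable ?a" using c h unfolding Acoef_def by auto
 have nn: "?a k >= 0" for k using h by (intro divide_nonneg_nonneg sum_nonneg) auto
 define S where "S = suminf ?a"
 have S: "?a k <= S" for k unfolding S_def using sum_le_suminf[OF s, of "{k}"] nn by simp
 have S0: "S >= 0" using nn[of 0] S[of 0] by linarith
 have "norm (\<Sum>l=1..d k. Y k l \<theta> *R c k l) <= sqrt (C * S) * (1/2) ^ k" if th: "\<theta> : sphere 0 1" for k \<theta>
 proof -
  have "norm (\<Sum>l=1..d k. Y k l \<theta> *R c k l) <= (\<Sum>l=1..d k. \<bar>Y k l \<theta>\<bar> * \<bar>norm (c k l)\<bar>)"
   by (rule order_trans[OF norm_sum]) simp
  also have "... <= L2_set (%l. Y k l \<theta>) {1..d k} * L2_set (%l. norm (c k l)) {1..d k}" by (rule L2_set_mult_ineq)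
  also have "... = sqrt ((\<Sum>l=1..d k. (Y k l \<theta>)\<^sup>2) * (\<Sum>l=1..d k. (norm (c k l))\<^sup>2))" by (simp add: L2_set_def real_sqrt_mult)
  also have "... <= sqrt ((C * B ^ k) * (S * h ^ (2 * k)))"
  proof (intro real_sqrt_le_mono mult_mono CB th sum_nonneg)
   show "(\<Sum>l=1..d k. (norm (c k l))\<^sup>2) <= S * h ^ (2 * k)" using S[of k] h by (simp add: pos_divide_le_eq)
  qed (use CB in auto)
  also have "... <= sqrt ((C * S) * ((1/2) ^ k)\<^sup>2)"
  proof (rule real_sqrt_le_mono)
   have "B ^ k * h ^ (2 * k) = (B * h\<^sup>2) ^ k" by (simp only: power_mult power_mult_distrib)
   also have "... <= ((1/2)\<^sup>2) ^ k"
    using CB h by (intro power_mono) (auto simp: h_def power2_eq_square field_simps)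
   also have "... = ((1/2) ^ k)\<^sup>2" by (simp only: power_mult[symmetric] mult.commute)
   finally have "(C * S) * (B ^ k * h ^ (2 * k)) <= (C * S) * ((1/2) ^ k)\<^sup>2" using CB(1) S0 by (intro mult_left_mono) auto
   then show "(C * B ^ k) * (S * h ^ (2 * k)) <= (C * S) * ((1/2) ^ k)\<^sup>2" by (simp only: mult_ac)
  qed
  also have "... = sqrt (C * S) * (1/2) ^ k" by (simp add: real_sqrt_mult)
  finally show ?thesis .
 qed
 moreover have "sqrt (C * S) >= 0" using CB(1) S0 by simp
 ultimately show ?thesis by blast
qed

text \<open>The series converges uniformly by the M-test, so the sum is continuous and may be
  integrated term by term against each harmonic. With \<open>A_space_synth\<close> this identifies
  the families satisfying \<open>Acoef\<close> with the elements of
  \<open>A(\<Theta>)\<close>.\<close>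

lemma synth:
 assumes c: "Acoef c"
 shows "continuous_on (sphere 0 1) (synth c)"
  and "\<theta> : sphere 0 1 ==> (%k. \<Sum>l=1..d k. Y k l \<theta> *R c k l) sums synth c \<theta>"
  and "l : {1..d k} ==> sph_coeff (Y k l) (synth c) = c k l"
  and "synth c : A_space d Y"
proof -
 let ?t = "%k \<theta>. \<Sum>l=1..d k. Y k l \<theta> *R c k l"
 obtain M where M: "M >= 0" "!!k \<theta>. \<theta> : sphere 0 1 ==> norm (?t k \<theta>) <= M * (1/2) ^ k" using synth_dominated[OF c] by blast
 have sM: "summable (%k. M * (1/2) ^ k)" by (intro summable_mult summable_geometric) simp
 have ul: "uniform_limit (sphere 0 1) (%n \<theta>. \<Sum>k<n. ?t k \<theta>) (%\<theta>. suminf (%k. ?t k \<theta>)) sequentially"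
  by (rule Weierstrass_m_test[OF M(2) sM])
 have ct: "continuous_on (sphere 0 1) (%\<theta>. \<Sum>k<n. ?t k \<theta>)" for n
  by (intro continuous_intros harmonic_basisD(2)[OF hb]) auto
 have "continuous_on (sphere 0 1) (%\<theta>. suminf (%k. ?t k \<theta>))"
  by (rule uniform_limit_theorem[OF always_eventually[OF allI[OF ct]] ul]) simp
 then show cont: "continuous_on (sphere 0 1) (synth c)"
  by (rule continuous_on_eq) (simp add: synth_def)
 show sums: "(%k. ?t k \<theta>) sums synth c \<theta>" if th: "\<theta> : sphere 0 1" for \<theta>
  using summable_sums[OF summable_comparison_test'[OF sM M(2)[OF th]]] th by (simp add: synth_def)
 show coef: "sph_coeff (Y k l) (synth c) = c k l" if l: "l : {1..d k}" for k l
 proof -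
  have "bounded (Y k l ` sphere 0 1)" by (intro compact_imp_bounded compact_continuous_image harmonic_basisD(2)[OF hb l]) auto
  then obtain D where D: "!!\<theta>. \<theta> : sphere 0 1 ==> \<bar>Y k l \<theta>\<bar> <= D" unfolding bounded_iff real_norm_def by blast
  have cY: "continuous_on (sphere 0 1) (Y k l)" by (rule harmonic_basisD(2)[OF hb l])
  have "(%n. LINT \<theta>|sphere_measure. Y k l \<theta> *R (\<Sum>k<n. ?t k \<theta>)) ----> (LINT \<theta>|sphere_measure. Y k l \<theta> *R synth c \<theta>)"
  proof (rule integral_dominated_convergence)
   show "integrable sphere_measure (%\<theta>::'a. D * (M * 2))" by (intro sphere_integrable continuous_intros)
   show "AE \<theta> in sphere_measure. (%n. Y k l \<theta> *R (\<Sum>k<n. ?t k \<theta>)) ----> Y k l \<theta> *R synth c \<theta>"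
    by (rule AE_I2) (use sums in "auto intro!: tendsto_scaleR tendsto_const simp: sums_def")
   show "AE \<theta> in sphere_measure. norm (Y k l \<theta> *R (\<Sum>k<n. ?t k \<theta>)) <= D * (M * 2)" for n
   proof (rule AE_I2)
    fix \<theta> :: 'a assume "\<theta> : space sphere_measure"
    then have th: "\<theta> : sphere 0 1" by simp
    have "norm (\<Sum>k<n. ?t k \<theta>) <= (\<Sum>k<n. M * (1/2) ^ k)" by (rule sum_norm_le) (rule M(2)[OF th])
    also have "... <= (\<Sum>k. M * (1/2) ^ k)" by (rule sum_le_suminf[OF sM]) (use M(1) in auto)
    also have "... = M * 2" by (simp add: suminf_mult summable_geometric suminf_geometric)
    finally have "norm (\<Sum>k<n. ?t k \<theta>) <= M * 2" .
    then show "norm (Y k l \<theta> *R (\<Sum>k<n. ?t k \<theta>)) <= D * (M * 2)"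
     unfolding norm_scaleR using D[OF th] by (intro mult_mono) auto
   qed
  qed (auto intro!: sphere_measurable continuous_intros harmonic_basisD(2)[OF hb] cY cont simp del: One_nat_def)
  then have "(%n. sph_coeff (Y k l) (%\<theta>. \<Sum>k\<le>n. ?t k \<theta>)) ----> sph_coeff (Y k l) (synth c)"
   unfolding sph_coeff_def lessThan_Suc_atMost[symmetric] by (rule LIMSEQ_Suc)
  then have "(%n. if k <= n then c k l else 0) ----> sph_coeff (Y k l) (synth c)" unfolding sph_coeff_sum[OF hb l] .
  moreover have "(%n. if k <= n then c k l else 0) ----> c k l"
   by (rule tendsto_eventually) (auto simp: eventually_sequentially)
  ultimately show ?thesis by (rule LIMSEQ_unique)
 qed
 show "synth c : A_space d Y" unfolding A_space_def
 proof (intro CollectI conjI ballI)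
  show "synth c : extensional (sphere 0 1)" by (simp add: synth_def)
  show "synth c : L2_sphere" unfolding L2_sphere_def
   by (auto intro!: sphere_measurable sphere_integrable continuous_intros cont)
  show "summable (%k. (\<Sum>l=1..d k. (norm (sph_coeff (Y k l) (synth c)))\<^sup>2) / h ^ (2 * k))" if "h : {0<..<1}" for h
   using c that unfolding Acoef_def by (simp add: coef)
  show "(%k. \<Sum>l=1..d k. Y k l \<theta> *R sph_coeff (Y k l) (synth c)) sums synth c \<theta>" if "\<theta> : sphere 0 1" for \<theta>
   using sums[OF that] by (simp add: coef)
 qed
qed

abbreviation coef :: "('a => complex) => nat => nat => complex" where "coef \<psi> \<equiv> %k l. sph_coeff (Y k l) \<psi>"

lemma A_space_synth:
 assumes p: "\<psi> : A_space d Y" shows "Acoef (coef \<psi>)" "\<psi> = synth (coef \<psi>)"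
proof -
 show A: "Acoef (coef \<psi>)" using p unfolding A_space_def Acoef_def by blast
 have "\<psi> \<theta> = synth (coef \<psi>) \<theta>" if "\<theta> : sphere 0 1" for \<theta>
  using p synth(2)[OF A that] that sums_unique2 unfolding A_space_def by blast
 then show "\<psi> = synth (coef \<psi>)"
  using p unfolding A_space_def by (intro extensionalityI[of _ "sphere 0 1"]) (auto simp: synth_def)
qed

lemma A_coef_diff:
 assumes p: "\<psi> : A_space d Y" and q: "\<phi> : A_space d Y" and l: "l : {1..d k}"
 shows "coef (\<psi> - \<phi>) k l = coef \<psi> k l - coef \<phi> k l"
proof -
 have "continuous_on (sphere 0 1) \<psi>" "continuous_on (sphere 0 1) \<phi>"
  using synth(1)[OF A_space_synth(1)[OF p]] A_space_synth(2)[OF p] synth(1)[OF A_space_synth(1)[OF q]] A_space_synth(2)[OF q] by auto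
 then have "integrable sphere_measure (%\<theta>. Y k l \<theta> *R \<psi> \<theta>)" "integrable sphere_measure (%\<theta>. Y k l \<theta> *R \<phi> \<theta>)"
  by (auto intro!: sphere_integrable continuous_intros harmonic_basisD(2)[OF hb l])
 then show ?thesis unfolding sph_coeff_def by (simp add: scaleR_diff_right)
qed

lemma A_norm_diff:
 assumes p: "\<psi> : A_space d Y" and q: "\<phi> : A_space d Y"
 shows "A_norm d Y h (\<psi> - \<phi>) = An h (%k l. coef \<psi> k l - coef \<phi> k l)"
proof -
 have "A_norm d Y h (\<psi> - \<phi>) = An h (coef (\<psi> - \<phi>))" by (simp add: A_norm_def An_def)
 also have "... = An h (%k l. coef \<psi> k l - coef \<phi> k l)" by (rule An_cong) (rule A_coef_diff[OF p q])
 finally show ?thesis .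
qed

lemma Acoef_diff:
 assumes a: "Acoef a" and b: "Acoef b" shows "Acoef (%k l. a k l - b k l)"
 unfolding Acoef_def
proof
 fix h :: real assume h: "h : {0<..<1}"
 then have h0: "h > 0" by simp
 have "PN h K (%k l. a k l + - b k l) <= An h a + An h b" for K
 proof -
  have "PN h K (%k l. a k l + - b k l) <= PN h K a + PN h K (%k l. - b k l)" by (rule PN_triangle[OF h0])
  also have "PN h K (%k l. - b k l) = PN h K b" by (simp add: PN_def)
  also have "PN h K a + PN h K b <= An h a + An h b"
   using a b h unfolding Acoef_def by (intro add_mono PN_le_An h0) auto
  finally show ?thesis .
 qed
 from An_le(1)[OF h0 this] show "summable (%k. (\<Sum>l=1..d k. (norm (a k l - b k l))\<^sup>2) / h ^ (2 * k))" by simp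
qed

lemma A_triangle:
 assumes h: "h : {0<..<1}" and a: "a : A_space d Y" and b: "b : A_space d Y" and c: "c : A_space d Y"
 shows "A_norm d Y h (a - c) <= A_norm d Y h (a - b) + A_norm d Y h (b - c)"
proof -
 have h0: "h > 0" using h by simp
 have "PN h K (%k l. coef a k l - coef c k l) <= A_norm d Y h (a - b) + A_norm d Y h (b - c)" for K
 proof -
  have "PN h K (%k l. coef a k l - coef c k l) = PN h K (%k l. (coef a k l - coef b k l) + (coef b k l - coef c k l))" by simp
  also have "... <= PN h K (%k l. coef a k l - coef b k l) + PN h K (%k l. coef b k l - coef c k l)" by (rule PN_triangle[OF h0])
  also have "... <= A_norm d Y h (a - b) + A_norm d Y h (b - c)"
   unfolding A_norm_diff[OF a b] A_norm_diff[OF b c]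
   using Acoef_diff[OF A_space_synth(1)[OF a] A_space_synth(1)[OF b]] Acoef_diff[OF A_space_synth(1)[OF b] A_space_synth(1)[OF c]] h
   unfolding Acoef_def by (intro add_mono PN_le_An h0) auto
  finally show ?thesis .
 qed
 then show ?thesis unfolding A_norm_diff[OF a c] by (rule An_le(2)[OF h0])
qed

lemma A_norm_self: "\<psi> : A_space d Y ==> A_norm d Y h (\<psi> - \<psi>) = 0"
 by (subst A_norm_diff) (simp_all add: An_def)

text \<open>A single one of the norms already separates points: it controls every coefficient, and
  an element of \<open>A(\<Theta>)\<close> is the sum of its series.\<close>

lemma A_eqI:
 assumes p: "\<psi> : A_space d Y" and q: "\<phi> : A_space d Y" and 0: "A_norm d Y (1/2) (\<psi> - \<phi>) = 0"
 shows "\<psi> = \<phi>"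
proof -
 have "coef \<psi> k l = coef \<phi> k l" if l: "l : {1..d k}" for k l
 proof -
  let ?c = "%k l. coef \<psi> k l - coef \<phi> k l"
  have "summable (%k. (\<Sum>l=1..d k. (norm (?c k l))\<^sup>2) / (1/2) ^ (2 * k))"
   using Acoef_diff[OF A_space_synth(1)[OF p] A_space_synth(1)[OF q]] unfolding Acoef_def by auto
  from PN_le_An[OF _ this, of k] have "PN (1/2) k ?c <= 0" using 0 unfolding A_norm_diff[OF p q] by simp
  moreover have "(case (k, l) of (k, l) => norm (?c k l) / (1/2) ^ k) <= PN (1/2) k ?c"
   unfolding PN_def by (rule member_le_L2_set) (use l in auto)
  ultimately have "norm (?c k l) / (1/2) ^ k <= 0" by (simp only: prod.case)
  moreover have "(1/2 :: real) ^ k > 0" by simp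
  ultimately have "norm (?c k l) <= 0" by (simp only: pos_divide_le_eq mult_zero_left)
  then show ?thesis by simp
 qed
 then have "synth (coef \<psi>) = synth (coef \<phi>)" unfolding synth_def by (intro restrict_ext suminf_cong sum.cong) auto
 then show ?thesis using A_space_synth(2)[OF p] A_space_synth(2)[OF q] by simp
qed

end

section \<open>The completion and the trace\<close>

context trace_setting
begin

abbreviation "M \<equiv> Ms \<Omega> R0 \<eta> d Y s"
abbreviation "MN \<equiv> Ms_norm \<Omega> R0 \<eta> d Y s"
abbreviation "approx \<equiv> approximates \<Omega> R0 \<eta> d Y s"

lemma approxD:
 assumes "approx F f"
 shows "F j : T"
  and "0 < R ==> R < R0 ==> outer_part \<eta> R f : Hs s \<Omega>"
  and "0 < R ==> R < R0 ==> \<epsilon> > 0 ==> EX J. ALL i>=J. ALL j>=J. N R (F i - F j) < \<epsilon>"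
  and "0 < R ==> R < R0 ==> (%j. HO R (F j - f)) ----> 0"
 using assms unfolding approximates_def Hs_loc_def by auto

lemma approxI:
 assumes "!!j. F j : T" "!!R. 0 < R ==> R < R0 ==> outer_part \<eta> R f : Hs s \<Omega>"
  "!!R \<epsilon>. 0 < R ==> R < R0 ==> \<epsilon> > 0 ==> EX J. ALL i>=J. ALL j>=J. N R (F i - F j) < \<epsilon>"
  "!!R. 0 < R ==> R < R0 ==> (%j. HO R (F j - f)) ----> 0"
 shows "approx F f"
 unfolding approximates_def Hs_loc_def using assms by auto

lemma approx_const:
 assumes f: "f : T" shows "approx (%_. f) f"
proof (rule approxI)
 fix R assume R: "0 < R" "R < R0"
 show "outer_part \<eta> R f : Hs s \<Omega>" by (rule outer_part_Hs[OF f R])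
 show "EX J. ALL i>=J. ALL j>=J. N R (f - f) < \<epsilon>" if "\<epsilon> > 0" for \<epsilon> :: real
  using seminorm_onD(4)[OF T_seminorm[OF R] f f] that by simp
 have "HO R (f - f) = 0"
  unfolding outer_part_diff using Hs_norm_zero(2)[OF open_dom bounded_dom] by simp
 then show "(%j. HO R (f - f)) ----> 0" by (simp only:) (rule tendsto_const)
qed (rule f)

lemma approx_outer:
 assumes a: "approx F f" and R: "0 < R" "R < R0"
 shows "outer_part \<eta> R (F j - f) : Hs s \<Omega>"
 unfolding outer_part_diff by (intro Hs_diff(1) open_dom bounded_dom outer_part_Hs approxD[OF a] R)

lemma outer_part_diff_diff:
 assumes a: "approx F f" and b: "approx G g" and R: "0 < R" "R < R0"
 shows "(%j. HO R ((F j - G j) - (f - g))) ----> 0"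
proof (rule tendsto_sandwich[OF _ _ tendsto_const])
 have "HO R ((F j - G j) - (f - g)) \<le>
  HO R (F j - f) + HO R (G j - g)" for j
 proof -
  have "(F j - G j) - (f - g) = (F j - f) - (G j - g)" by simp
  then show ?thesis
   using Hs_diff(2)[OF open_dom bounded_dom approx_outer[OF a R, of j] approx_outer[OF b R, of j]]
   by (simp only: outer_part_diff[of _ "F j - f"])
 qed
 then show "\<forall>\<^sub>F j in sequentially. HO R ((F j - G j) - (f - g)) \<le>
  HO R (F j - f) + HO R (G j - g)" by (intro always_eventually allI)
 show "(%j. HO R (F j - f) + HO R (G j - g)) ----> 0"
  using tendsto_add[OF approxD(4)[OF a R] approxD(4)[OF b R]] by simp
qed (intro always_eventually allI Hs_norm_nonneg)

lemma approx_diff_cauchy: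
 assumes a: "approx F f" and b: "approx G g" and R: "0 < R" "R < R0" and e: "\<epsilon> > 0"
 shows "EX J. ALL i>=J. ALL j>=J. N R ((F i - G i) - (F j - G j)) < \<epsilon>"
proof -
 have e2: "\<epsilon> / 2 > 0" using e by simp
 obtain J1 where J1: "!!i j. i >= J1 ==> j >= J1 ==> N R (F i - F j) < \<epsilon> / 2" using approxD(3)[OF a R e2] by blast
 obtain J2 where J2: "!!i j. i >= J2 ==> j >= J2 ==> N R (G i - G j) < \<epsilon> / 2" using approxD(3)[OF b R e2] by blast
 have "N R ((F i - G i) - (F j - G j)) < \<epsilon>" if "i >= max J1 J2" "j >= max J1 J2" for i j
 proof -
  have "(F i - G i) - (F j - G j) = (F i - F j) - (G i - G j)" by simp
  then have "N R ((F i - G i) - (F j - G j)) <= N R (F i - F j) + N R (G i - G j)"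
   using seminorm_onD(2)[OF T_seminorm[OF R] T_diff[OF approxD(1)[OF a, of i] approxD(1)[OF a, of j]] T_diff[OF approxD(1)[OF b, of i] approxD(1)[OF b, of j]]]
   by (simp only:)
  then show ?thesis using J1[of i j] J2[of i j] that by simp
 qed
 then show ?thesis by blast
qed

lemma approx_diff:
 assumes a: "approx F f" and b: "approx G g"
 shows "approx (%j. F j - G j) (f - g)"
proof (rule approxI)
 fix R assume R: "0 < R" "R < R0"
 show "outer_part \<eta> R (f - g) : Hs s \<Omega>"
  unfolding outer_part_diff by (intro Hs_diff(1) open_dom bounded_dom approxD(2)[OF a R] approxD(2)[OF b R])
qed (intro T_diff approxD(1)[OF a] approxD(1)[OF b] approx_diff_cauchy[OF a b] outer_part_diff_diff[OF a b]; assumption)+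

text \<open>The difference of two approximating sequences is Cauchy and its outer parts tend to
  zero, which is the situation of \<open>T_norm_closable\<close>.\<close>

lemma approx_same:
 assumes a: "approx F f" and b: "approx G f" and R: "0 < R" "R < R0"
 shows "(%j. N R (F j - G j)) ----> 0"
proof (rule T_norm_closable[OF _ R])
 show "F j - G j : T" for j by (intro T_diff approxD(1)[OF a] approxD(1)[OF b])
 show "EX J. ALL i>=J. ALL j>=J. N R ((F i - G i) - (F j - G j)) < \<epsilon>" if "\<epsilon> > 0" for \<epsilon> by (rule approx_diff_cauchy[OF a b R that])
 show "(%j. HO R (F j - G j)) ----> 0" if "0 < R" "R < R0" for R
 proof -
  have "(F j - G j) - (f - f) = F j - G j" for j by simp
  then show ?thesis using outer_part_diff_diff[OF a b that] by (simp only:)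
 qed
qed

text \<open>By \<open>approx_same\<close> all approximating sequences give the same limit, so the
  \<open>THE\<close> in \<open>Ms_norm\<close> is meaningful.\<close>

lemma Ms_norm_lim:
 assumes a: "approx F f" and R: "0 < R" "R < R0"
 shows "(%j. N R (F j)) ----> MN R f"
proof -
 note sem = T_seminorm[OF R]
 have "Cauchy (%j. N R (F j))"
 proof (rule CauchyI)
  fix e :: real assume "e > 0"
  then obtain J where J: "!!i j. i >= J ==> j >= J ==> N R (F i - F j) < e" using approxD(3)[OF a R] by blast
  have "norm (N R (F i) - N R (F j)) < e" if "i >= J" "j >= J" for i j
   using seminorm_on_abs[OF sem approxD(1)[OF a, of i] approxD(1)[OF a, of j]] J[OF that] by simp
  then show "EX J. ALL i>=J. ALL j>=J. norm (N R (F i) - N R (F j)) < e" by blast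
 qed
 then obtain c where c: "(%j. N R (F j)) ----> c" using Cauchy_convergent_iff convergent_def by blast
 have all: "(%j. N R (G j)) ----> c" if b: "approx G f" for G
 proof -
  have "(%j. N R (G j) - N R (F j)) ----> 0"
  proof (rule Lim_null_comparison)
   show "\<forall>\<^sub>F j in sequentially. norm (N R (G j) - N R (F j)) <= N R (G j - F j)"
    using seminorm_on_abs[OF sem approxD(1)[OF b] approxD(1)[OF a]] by (intro always_eventually allI) simp
   show "(%j. N R (G j - F j)) ----> 0" by (rule approx_same[OF b a R])
  qed
  from tendsto_add[OF this c] show ?thesis by simp
 qed
 have "MN R f = c" unfolding Ms_norm_def
 proof (rule the_equality)
  show "ALL F. approx F f \<longrightarrow> (%j. N R (F j)) ----> c" using all by blast
  fix c' assume "ALL F. approx F f \<longrightarrow> (%j. N R (F j)) ----> c'"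
  then have "(%j. N R (F j)) ----> c'" using a by blast
  then show "c' = c" using c by (rule LIMSEQ_unique)
 qed
 then show ?thesis using c by simp
qed

lemma Ms_approx: "f : M ==> EX F. approx F f" and approx_Ms: "approx F f ==> f : M"
 unfolding Ms_def by auto

lemma T_subset_Ms: "f : T ==> f : M"
 by (rule approx_Ms[OF approx_const])

lemma Ms_seminorm:
 assumes R: "0 < R" "R < R0" shows "seminorm_on M (MN R)"
 unfolding seminorm_on_def
proof (intro conjI ballI)
 fix f g assume "f : M" "g : M"
 then obtain F G where a: "approx F f" and b: "approx G g" using Ms_approx by blast
 note ab = approx_diff[OF a b]
 show "f - g : M" by (rule approx_Ms[OF ab])
 show "MN R (f - g) <= MN R f + MN R g"
 proof (rule LIMSEQ_le[OF Ms_norm_lim[OF ab R] tendsto_add[OF Ms_norm_lim[OF a R] Ms_norm_lim[OF b R]]])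
  show "EX J. ALL j>=J. N R (F j - G j) <= N R (F j) + N R (G j)"
   using seminorm_onD(2)[OF T_seminorm[OF R] approxD(1)[OF a] approxD(1)[OF b]] by blast
 qed
next
 fix f assume "f : M"
 then obtain F where a: "approx F f" using Ms_approx by blast
 show "MN R f >= 0"
  using seminorm_onD(3)[OF T_seminorm[OF R] approxD(1)[OF a] approxD(1)[OF a]] by (intro LIMSEQ_le_const[OF Ms_norm_lim[OF a R]]) blast
 have "(%j. N R (F j - F j)) ----> 0"
  using seminorm_onD(4)[OF T_seminorm[OF R] approxD(1)[OF a] approxD(1)[OF a]] by (simp only:) (rule tendsto_const)
 then show "MN R (f - f) = 0" by (rule LIMSEQ_unique[OF Ms_norm_lim[OF approx_diff[OF a a] R]])
qed

text \<open>For fixed \<open>i\<close> the sequence of \<open>F i - F j\<close> in \<open>j\<close>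
  approximates \<open>F i - f\<close>, and the Cauchy condition bounds its norms.\<close>

lemma Ms_norm_approx:
 assumes a: "approx F f" and R: "0 < R" "R < R0" and e: "\<epsilon> > 0"
 shows "EX J. ALL j>=J. MN R (F j - f) <= \<epsilon>"
proof -
 obtain J where J: "!!i j. i >= J ==> j >= J ==> N R (F i - F j) < \<epsilon>" using approxD(3)[OF a R e] by blast
 have "MN R (F i - f) <= \<epsilon>" if i: "i >= J" for i
 proof (rule LIMSEQ_le_const2[OF Ms_norm_lim[OF approx_diff[OF approx_const[OF approxD(1)[OF a]] a] R]])
  show "EX J. ALL j>=J. N R (F i - F j) <= \<epsilon>" using J[OF i] less_imp_le by blast
 qed
 then show ?thesis by blast
qed

lemma approx_limitin:
 assumes a: "approx F f" shows "limitin (Ms_topology \<Omega> R0 \<eta> d Y s) F f sequentially"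
 unfolding Ms_topology_def
proof (rule limitin_norms_topologyI)
 show "MN ` {0<..<R0} ~= {}" using R0 by simp
 show "f : M" by (rule approx_Ms[OF a])
 show "F j : M" for j by (rule T_subset_Ms[OF approxD(1)[OF a]])
 show "p (f - f) = 0" if "p : MN ` {0<..<R0}" "f : M" for p f
  using that seminorm_onD(4)[OF Ms_seminorm that(2) that(2)] by auto
 show "p (a - c) <= p (a - b) + p (b - c)" if "p : MN ` {0<..<R0}" "a : M" "b : M" "c : M" for p a b c
  using that seminorm_on_triangle[OF Ms_seminorm that(2-4)] by auto
 fix p :: "('a => complex) => real" and e :: real assume "p : MN ` {0<..<R0}" and e: "e > 0"
 then obtain R where R: "0 < R" "R < R0" and p: "p = MN R" by auto
 have e2: "e / 2 > 0" using e by simp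
 obtain J where J: "!!j. j >= J ==> MN R (F j - f) <= e / 2" using Ms_norm_approx[OF a R e2] by blast
 have "p (F j - f) < e" if "j >= J" for j using J[OF that] e unfolding p by linarith
 then show "\<forall>\<^sub>F j in sequentially. p (F j - f) < e" unfolding eventually_sequentially by blast
qed

text \<open>A relation, since \<open>f\<close> has many approximating sequences. That they give the
  same coefficients for \<open>l\<close> in \<open>{1..d k}\<close> follows from
  \<open>trc_bound\<close> with \<open>f = g\<close>.\<close>

definition trc :: "('a => complex) => (nat => nat => complex) => bool" where
 "trc f c \<longleftrightarrow> (EX F. approx F f & (ALL k. ALL l:{1..d k}. (%j. tc (F j) k l) ----> c k l))"

lemma trc_T: "f : T ==> trc f (tc f)"
 unfolding trc_def using approx_const by (intro exI[of _ "%_. f"]) simp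

lemma trc_Ms: "trc f c ==> f : M"
 unfolding trc_def using approx_Ms by blast

lemma trc_exists:
 assumes f: "f : M" shows "EX c. trc f c"
proof -
 obtain F where a: "approx F f" using Ms_approx[OF f] by blast
 have R: "0 < R0 / 2" "R0 / 2 < R0" using R0 by auto
 obtain C where C: "C > 0" "!!f k l. f : T ==> l : {1..d k} ==> norm (tc f k l) <= C * (4 * (R0 / 2)) ^ k * Hn (R0 / 2) f k l"
  using tc_bound[OF R] by blast
 have conv: "convergent (%j. tc (F j) k l)" if l: "l : {1..d k}" for k l
 proof -
  define D where "D = C * (4 * (R0 / 2)) ^ k"
  have D: "D > 0" unfolding D_def using C(1) R0 by simp
  have "Cauchy (%j. tc (F j) k l)"
  proof (rule CauchyI)
   fix e :: real assume "e > 0"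
   then have "e / D > 0" using D by simp
   then obtain J where J: "!!i j. i >= J ==> j >= J ==> N (R0 / 2) (F i - F j) < e / D" using approxD(3)[OF a R] by blast
   have "norm (tc (F i) k l - tc (F j) k l) < e" if ij: "i >= J" "j >= J" for i j
   proof -
    note Fi = approxD(1)[OF a, of i] and Fj = approxD(1)[OF a, of j]
    have "norm (tc (F i) k l - tc (F j) k l) = norm (tc (F i - F j) k l)" by (simp only: tc_diff[OF Fi Fj l])
    also have "... <= D * Hn (R0 / 2) (F i - F j) k l" unfolding D_def by (rule C(2)[OF T_diff[OF Fi Fj] l])
    also have "... <= D * N (R0 / 2) (F i - F j)" using D by (intro mult_left_mono Hn_le_T_norm[OF T_diff[OF Fi Fj] R l]) auto
    also have "... < D * (e / D)" using J[OF ij] D by (intro mult_strict_left_mono)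
    finally show ?thesis using D by simp
   qed
   then show "EX J. ALL i>=J. ALL j>=J. norm (tc (F i) k l - tc (F j) k l) < e" by blast
  qed
  then show ?thesis by (simp add: Cauchy_convergent_iff)
 qed
 have "trc f (%k l. lim (%j. tc (F j) k l))"
  unfolding trc_def using a conv[unfolded convergent_LIMSEQ_iff] by blast
 then show ?thesis by blast
qed

text \<open>With \<open>4 * R <= h\<close> the factor \<open>(4 * R) ^ k\<close> of the trace
  estimate is absorbed by the weight \<open>h ^ k\<close>. This is where small cutoff radii
  enter.\<close>

lemma PN_tc_bound:
 assumes h: "h : {0<..<1}"
 shows "EX R C. 0 < R & R < R0 & C > 0 & (ALL f:T. ALL K. PN h K (tc f) <= C * N R f)"
proof -
 define R where "R = min (h / 4) (R0 / 2)"
 have R: "0 < R" "R < R0" "4 * R <= h" using h R0 by (auto simp: R_def)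
 obtain C where C: "C > 0" "!!f k l. f : T ==> l : {1..d k} ==> norm (tc f k l) <= C * (4 * R) ^ k * Hn R f k l"
  using tc_bound[OF R(1,2)] by blast
 have "PN h K (tc f) <= C * N R f" if f: "f : T" for f K
 proof -
  have "PN h K (tc f) <= L2_set (%x. C * (case x of (k, l) => Hn R f k l)) (SIGMA k:{..K}. {1..d k})"
   unfolding PN_def
  proof (rule L2_set_mono)
   fix x assume "x : (SIGMA k:{..K}. {1..d k})"
   then obtain k l where x: "x = (k, l)" and l: "l : {1..d k}" by auto
   have "norm (tc f k l) <= (C * Hn R f k l) * (4 * R) ^ k" using C(2)[OF f l] by (simp only: mult_ac)
   also have "... <= (C * Hn R f k l) * h ^ k"
    using R C(1) Hn_nonneg[of R f k l] by (intro mult_left_mono power_mono) auto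
   finally have "norm (tc f k l) / h ^ k <= C * Hn R f k l" using h by (simp add: pos_divide_le_eq)
   then show "(case x of (k, l) => norm (tc f k l) / h ^ k) <= C * (case x of (k, l) => Hn R f k l)" unfolding x by simp
  qed (use h in auto)
  also have "... = C * AH R K f" unfolding AH_def using C(1) by (intro L2_set_right_distrib[symmetric]) auto
  also have "... <= C * N R f" using C(1) by (intro mult_left_mono AH_le_T_norm f R) auto
  finally show ?thesis .
 qed
 then show ?thesis using R C(1) by blast
qed

text \<open>Stated for differences: with one function in \<open>Tinf\<close> it gives convergence of
  the traces along a sequence, with both in \<open>Ms\<close> the Lipschitz estimate behind
  continuity.\<close>

lemma trc_bound:
 assumes h: "h : {0<..<1}"
 shows "EX R C. 0 < R & R < R0 & C > 0 \<and>
  (ALL f g a b. trc f a \<longrightarrow> trc g b \<longrightarrow> (ALL K. PN h K (%k l. a k l - b k l) <= C * MN R (f - g)))"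
proof -
 obtain R C where R: "0 < R" "R < R0" and C: "C > 0" "!!f K. f : T ==> PN h K (tc f) <= C * N R f"
  using PN_tc_bound[OF h] by blast
 have "PN h K (%k l. a k l - b k l) <= C * MN R (f - g)" if ta: "trc f a" and tb: "trc g b" for f g a b K
 proof -
  obtain F where F: "approx F f" "!!k l. l : {1..d k} ==> (%j. tc (F j) k l) ----> a k l" using ta unfolding trc_def by blast
  obtain G where G: "approx G g" "!!k l. l : {1..d k} ==> (%j. tc (G j) k l) ----> b k l" using tb unfolding trc_def by blast
  have "(%j. tc (F j - G j) k l) ----> a k l - b k l" if l: "l : {1..d k}" for k l
   using tendsto_diff[OF F(2)[OF l] G(2)[OF l]] tc_diff[OF approxD(1)[OF F(1)] approxD(1)[OF G(1)] l] by (simp only:)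
  then have "(%j. PN h K (tc (F j - G j))) ----> PN h K (%k l. a k l - b k l)" by (rule PN_tendsto)
  moreover have "(%j. C * N R (F j - G j)) ----> C * MN R (f - g)"
   by (intro tendsto_mult tendsto_const Ms_norm_lim[OF approx_diff[OF F(1) G(1)] R])
  moreover have "PN h K (tc (F j - G j)) <= C * N R (F j - G j)" for j
   by (rule C(2)[OF T_diff[OF approxD(1)[OF F(1)] approxD(1)[OF G(1)]]])
  ultimately show ?thesis by (intro LIMSEQ_le) blast+
 qed
 then show ?thesis using R C(1) by blast
qed

lemma tc_Acoef: "f : T ==> Acoef (tc f)"
 unfolding Acoef_def
proof
 fix h :: real assume f: "f : T" and h: "h : {0<..<1}"
 then have h0: "h > 0" by simp
 obtain R C where "!!K. PN h K (tc f) <= C * N R f" using PN_tc_bound[OF h] f by blast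
 from An_le(1)[OF h0 this] show "summable (%k. (\<Sum>l=1..d k. (norm (tc f k l))\<^sup>2) / h ^ (2 * k))" .
qed

text \<open>The family is compared with that of one member of an approximating sequence, which
  \<open>PN_tc_bound\<close> covers.\<close>

lemma trc_Acoef:
 assumes t: "trc f c" shows "Acoef c"
 unfolding Acoef_def
proof
 fix h :: real assume h: "h : {0<..<1}"
 then have h0: "h > 0" by simp
 obtain F where F: "approx F f" using t unfolding trc_def by blast
 define g where "g = F 0"
 have g: "g : T" unfolding g_def by (rule approxD(1)[OF F])
 obtain R C where RC: "!!K. PN h K (%k l. c k l - tc g k l) <= C * MN R (f - g)"
  using trc_bound[OF h] t trc_T[OF g] by blast
 obtain R' C' where RC': "!!K. PN h K (tc g) <= C' * N R' g" using PN_tc_bound[OF h] g by blast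
 have "PN h K c <= C * MN R (f - g) + C' * N R' g" for K
  using PN_triangle[OF h0, of K "%k l. c k l - tc g k l" "tc g"] RC[of K] RC'[of K] by simp
 from An_le(1)[OF h0 this] show "summable (%k. (\<Sum>l=1..d k. (norm (c k l))\<^sup>2) / h ^ (2 * k))" .
qed

lemma synth_bound:
 assumes h: "h : {0<..<1}"
 shows "EX R C. 0 < R & R < R0 & C > 0 \<and>
  (ALL f g a b. trc f a \<longrightarrow> trc g b \<longrightarrow> A_norm d Y h (synth a - synth b) <= C * MN R (f - g))"
proof -
 obtain R C where R: "0 < R" "R < R0" "C > 0"
  and b: "!!f g a b K. trc f a ==> trc g b ==> PN h K (%k l. a k l - b k l) <= C * MN R (f - g)"
  using trc_bound[OF h] by blast
 have "A_norm d Y h (synth a - synth b) <= C * MN R (f - g)" if ta: "trc f a" and tb: "trc g b" for f g a b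
 proof -
  have h0: "h > 0" using h by simp
  have "A_norm d Y h (synth a - synth b) = An h (%k l. a k l - b k l)"
   unfolding A_norm_diff[OF synth(4)[OF trc_Acoef[OF ta]] synth(4)[OF trc_Acoef[OF tb]]]
   by (rule An_cong) (simp only: synth(3)[OF trc_Acoef[OF ta]] synth(3)[OF trc_Acoef[OF tb]])
  also have "... <= C * MN R (f - g)" by (rule An_le(2)[OF h0 b[OF ta tb]])
  finally show ?thesis .
 qed
 then show ?thesis using R by blast
qed

lemma sigma_limit_synth:
 assumes f: "f : T" shows "sigma_limit d Y e1 e2 f (synth (tc f))"
 unfolding sigma_limit_def
proof
 fix \<theta> :: 'a assume th: "\<theta> : sphere 0 1"
 obtain K where K: "expK f K" using T_expK[OF f] by blast
 have "synth (tc f) \<theta> = (\<Sum>k. \<Sum>l=1..d k. Y k l \<theta> *R tc f k l)" using th by (simp add: synth_def)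
 also have "... = (\<Sum>k\<le>K. \<Sum>l=1..d k. Y k l \<theta> *R tc f k l)"
  by (rule suminf_finite) (auto intro!: sum.neutral simp: tc_high[OF f K])
 finally show "((%r. sigma d Y e1 e2 f r \<theta>) ---> synth (tc f) \<theta>) (at_right 0)"
  using sigma_tendsto[OF f K th] by simp
qed

lemma sigma_limit_unique:
 assumes "sigma_limit d Y e1 e2 f \<psi>" "sigma_limit d Y e1 e2 f \<phi>" "\<psi> : A_space d Y" "\<phi> : A_space d Y"
 shows "\<psi> = \<phi>"
proof (rule extensionalityI[of _ "sphere 0 1"])
 show "\<psi> \<theta> = \<phi> \<theta>" if "\<theta> : sphere 0 1" for \<theta>
  using tendsto_unique[OF trivial_limit_at_right_real] assms(1,2) that unfolding sigma_limit_def by blast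
qed (use assms(3,4) in "auto simp: A_space_def")

lemma has_sigma_trace_synth:
 assumes t: "trc f c" shows "has_sigma_trace \<Omega> R0 \<eta> d Y e1 e2 s f (synth c)"
 unfolding has_sigma_trace_def
proof (intro conjI allI impI)
 show cA: "synth c : A_space d Y" by (rule synth(4)[OF trc_Acoef[OF t]])
 fix F assume F: "range F \<subseteq> T & limitin (Ms_topology \<Omega> R0 \<eta> d Y s) F f sequentially"
 then have FT: "F j : T" for j by auto
 show "EX \<Psi>. (ALL j. \<Psi> j : A_space d Y & sigma_limit d Y e1 e2 (F j) (\<Psi> j)) & limitin (A_topology d Y) \<Psi> (synth c) sequentially"
 proof (intro exI[of _ "%j. synth (tc (F j))"] conjI allI)
  show FA: "synth (tc (F j)) : A_space d Y" for j by (rule synth(4)[OF tc_Acoef[OF FT]])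
  show "sigma_limit d Y e1 e2 (F j) (synth (tc (F j)))" for j by (rule sigma_limit_synth[OF FT])
  show "limitin (A_topology d Y) (%j. synth (tc (F j))) (synth c) sequentially"
   unfolding A_topology_def
  proof (rule limitin_norms_topologyI)
   have "(1/2 :: real) : {0<..<1}" by simp
   then show "A_norm d Y ` {0<..<1} ~= {}" by blast
   show "p (f - f) = 0" if "p : A_norm d Y ` {0<..<1}" "f : A_space d Y" for p f
    using that A_norm_self by auto
   show "p (a - c) <= p (a - b) + p (b - c)" if "p : A_norm d Y ` {0<..<1}" "a : A_space d Y" "b : A_space d Y" "c : A_space d Y" for p a b c
    using that A_triangle by auto
   show "synth c : A_space d Y" by (rule cA)
   show "synth (tc (F j)) : A_space d Y" for j by (rule FA)
   fix p :: "('a => complex) => real" and e :: real assume "p : A_norm d Y ` {0<..<1}" and e: "e > 0"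
   then obtain h where h: "h : {0<..<1}" and p: "p = A_norm d Y h" by blast
   obtain R C where R: "0 < R" "R < R0" "C > 0"
    and b: "!!f g a b. trc f a ==> trc g b ==> A_norm d Y h (synth a - synth b) <= C * MN R (f - g)"
    using synth_bound[OF h] by blast
   have eC: "e / C > 0" using e R by simp
   have "\<forall>\<^sub>F j in sequentially. F j : M & MN R (F j - f) < e / C"
   proof (rule limitin_norms_topologyD[where p = "MN R" and X = M and \<N> = "MN ` {0<..<R0}"])
    show "limitin (norms_topology M (MN ` {0<..<R0})) F f sequentially" using F unfolding Ms_topology_def by blast
    show "MN R (f - f) = 0" by (rule seminorm_onD(4)[OF Ms_seminorm[OF R(1,2)] trc_Ms[OF t] trc_Ms[OF t]])
   qed (use R eC trc_Ms[OF t] in auto)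
   then show "\<forall>\<^sub>F j in sequentially. p (synth (tc (F j)) - synth c) < e"
   proof eventually_elim
    case (elim j)
    have "p (synth (tc (F j)) - synth c) <= C * MN R (F j - f)" unfolding p by (rule b[OF trc_T[OF FT] t])
    also have "... < C * (e / C)" using elim R by (intro mult_strict_left_mono) auto
    finally show ?case using R by simp
   qed
  qed
 qed
qed

lemma A_limit_unique:
 assumes "limitin (A_topology d Y) \<Psi> \<psi> sequentially" "limitin (A_topology d Y) \<Psi> \<phi> sequentially"
  and p: "\<psi> : A_space d Y" and q: "\<phi> : A_space d Y"
 shows "\<psi> = \<phi>"
proof (rule A_eqI[OF p q], rule ccontr)
 let ?n = "A_norm d Y (1/2)"
 assume nz: "?n (\<psi> - \<phi>) ~= 0"
 have h: "(1/2 :: real) : {0<..<1}" by simp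
 have "?n (\<psi> - \<psi>) <= ?n (\<psi> - \<phi>) + ?n (\<phi> - \<psi>)" by (rule A_triangle[OF h p q p])
 have sym: "?n (\<psi> - \<phi>) = ?n (\<phi> - \<psi>)" if "\<psi> : A_space d Y" "\<phi> : A_space d Y" for \<psi> \<phi>
  unfolding A_norm_diff[OF that] A_norm_diff[OF that(2,1)] An_def by (simp add: norm_minus_commute)
 define e where "e = ?n (\<psi> - \<phi>) / 2"
 have "?n (\<psi> - \<phi>) >= 0"
  using A_triangle[OF h p q p] A_norm_self[OF p, of "1/2"] sym[OF p q] by linarith
 then have e: "e > 0" using nz by (simp add: e_def)
 have 1: "\<forall>\<^sub>F j in sequentially. \<Psi> j : A_space d Y & ?n (\<Psi> j - \<psi>) < e"
  by (rule limitin_norms_topologyD[where p = ?n, OF assms(1)[unfolded A_topology_def] _ A_norm_self[OF p] p e]) (use h in blast)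
 have 2: "\<forall>\<^sub>F j in sequentially. \<Psi> j : A_space d Y & ?n (\<Psi> j - \<phi>) < e"
  by (rule limitin_norms_topologyD[where p = ?n, OF assms(2)[unfolded A_topology_def] _ A_norm_self[OF q] q e]) (use h in blast)
 from eventually_happens[OF eventually_conj[OF 1 2]] obtain j where j: "\<Psi> j : A_space d Y" "?n (\<Psi> j - \<psi>) < e" "?n (\<Psi> j - \<phi>) < e" by auto
 have "?n (\<psi> - \<phi>) <= ?n (\<psi> - \<Psi> j) + ?n (\<Psi> j - \<phi>)" by (rule A_triangle[OF h p j(1) q])
 then show False using j(2,3) sym[OF p j(1)] by (simp add: e_def)
qed

text \<open>An approximating sequence exists and converges in \<open>Ms_topology\<close>; each of
  its members has only one pointwise limit in \<open>A(\<Theta>)\<close>, and limits in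
  \<open>A_topology\<close> are unique.\<close>

lemma has_sigma_trace_unique:
 assumes f: "f : M" and p: "has_sigma_trace \<Omega> R0 \<eta> d Y e1 e2 s f \<psi>" and q: "has_sigma_trace \<Omega> R0 \<eta> d Y e1 e2 s f \<phi>"
 shows "\<psi> = \<phi>"
proof -
 obtain F where a: "approx F f" using Ms_approx[OF f] by blast
 have F: "range F \<subseteq> T & limitin (Ms_topology \<Omega> R0 \<eta> d Y s) F f sequentially"
  using approxD(1)[OF a] approx_limitin[OF a] by blast
 obtain P where P: "ALL j. P j : A_space d Y & sigma_limit d Y e1 e2 (F j) (P j)" "limitin (A_topology d Y) P \<psi> sequentially"
  using p F unfolding has_sigma_trace_def by blast
 obtain Q where Q: "ALL j. Q j : A_space d Y & sigma_limit d Y e1 e2 (F j) (Q j)" "limitin (A_topology d Y) Q \<phi> sequentially"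
  using q F unfolding has_sigma_trace_def by blast
 have "P j = Q j" for j using sigma_limit_unique P(1) Q(1) by blast
 then have "P = Q" by (rule ext)
 moreover have "\<psi> : A_space d Y" "\<phi> : A_space d Y" using p q unfolding has_sigma_trace_def by auto
 ultimately show ?thesis using A_limit_unique P(2) Q(2) by blast
qed

lemma sigma_trace_eq:
 assumes "trc f c" shows "sigma_trace \<Omega> R0 \<eta> d Y e1 e2 s f = synth c"
 unfolding sigma_trace_def
 by (rule the_equality[where P = "has_sigma_trace \<Omega> R0 \<eta> d Y e1 e2 s f"])
  (use has_sigma_trace_synth[OF assms] has_sigma_trace_unique[OF trc_Ms[OF assms]] in blast)+

lemma trace_theorem:
 "(ALL f:M. EX! \<psi>. has_sigma_trace \<Omega> R0 \<eta> d Y e1 e2 s f \<psi>) \<and>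
 continuous_map (Ms_topology \<Omega> R0 \<eta> d Y s) (A_topology d Y) (sigma_trace \<Omega> R0 \<eta> d Y e1 e2 s)"
proof
 show "ALL f:M. EX! \<psi>. has_sigma_trace \<Omega> R0 \<eta> d Y e1 e2 s f \<psi>"
  using trc_exists has_sigma_trace_synth has_sigma_trace_unique by blast
 show "continuous_map (Ms_topology \<Omega> R0 \<eta> d Y s) (A_topology d Y) (sigma_trace \<Omega> R0 \<eta> d Y e1 e2 s)"
  unfolding Ms_topology_def A_topology_def
 proof (rule continuous_map_norms_topology)
  show "MN ` {0<..<R0} ~= {}" using R0 by simp
  have "(1/2 :: real) : {0<..<1}" by simp
  then show "A_norm d Y ` {0<..<1} ~= {}" by blast
  show "p (f - f) = 0" if "p : MN ` {0<..<R0}" "f : M" for p f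
   using that seminorm_onD(4)[OF Ms_seminorm that(2) that(2)] by auto
  show "p (f - f) = 0" if "p : A_norm d Y ` {0<..<1}" "f : A_space d Y" for p f
   using that A_norm_self by auto
  show "p (a - c) <= p (a - b) + p (b - c)" if "p : A_norm d Y ` {0<..<1}" "a : A_space d Y" "b : A_space d Y" "c : A_space d Y" for p a b c
   using that A_triangle by auto
  show "sigma_trace \<Omega> R0 \<eta> d Y e1 e2 s f : A_space d Y" if fM: "f : M" for f
  proof -
   obtain c where c: "trc f c" using trc_exists[OF fM] by blast
   show ?thesis unfolding sigma_trace_eq[OF c] by (rule synth(4)[OF trc_Acoef[OF c]])
  qed
  fix q assume "q : A_norm d Y ` {0<..<1}"
  then obtain h where h: "h : {0<..<1}" and q: "q = A_norm d Y h" by blast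
  obtain R C where R: "0 < R" "R < R0" "C > 0"
   and b: "!!f g a b. trc f a ==> trc g b ==> A_norm d Y h (synth a - synth b) <= C * MN R (f - g)"
   using synth_bound[OF h] by blast
  have "q (sigma_trace \<Omega> R0 \<eta> d Y e1 e2 s g - sigma_trace \<Omega> R0 \<eta> d Y e1 e2 s f) <= C * MN R (g - f)" if fg: "f : M" "g : M" for f g
  proof -
   obtain a c where t: "trc f a" "trc g c" using trc_exists fg by blast
   show ?thesis unfolding q sigma_trace_eq[OF t(1)] sigma_trace_eq[OF t(2)] by (rule b[OF t(2,1)])
  qed
  moreover have "MN R : MN ` {0<..<R0}" using R by simp
  ultimately show "EX p:MN ` {0<..<R0}. EX C>0. ALL f:M. ALL g:M. q (sigma_trace \<Omega> R0 \<eta> d Y e1 e2 s g - sigma_trace \<Omega> R0 \<eta> d Y e1 e2 s f) <= C * p (g - f)"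
   using R(3) by blast
 qed
qed

end

theorem theorem5p1p4:
  fixes \<Omega> :: "'a::euclidean_space set" and R0 :: real and \<eta> :: "real \<Rightarrow> real"
    and d :: "nat \<Rightarrow> nat" and Y :: "nat \<Rightarrow> nat \<Rightarrow> 'a \<Rightarrow> real" and e1 e2 :: 'a and s :: nat
  assumes "DIM('a) \<ge> 2"
    and "smooth_bounded_domain \<Omega>" and "0 \<in> \<Omega>"
    and "R0 > 0" and "cball 0 (2 * R0) \<subseteq> \<Omega>"
    and "cutoff_function \<eta>"
    and "harmonic_basis d Y"
    and "DIM('a) = 2 \<Longrightarrow> norm e1 = 1 \<and> norm e2 = 1 \<and> e1 \<bullet> e2 = 0"
    and "DIM('a) \<ge> 3 \<Longrightarrow> s \<ge> 1"
    and "DIM('a) = 2 \<Longrightarrow> s \<ge> 2"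
  shows "(\<forall>f\<in>Ms \<Omega> R0 \<eta> d Y s. \<exists>!\<psi>. has_sigma_trace \<Omega> R0 \<eta> d Y e1 e2 s f \<psi>) \<and>
         continuous_map (Ms_topology \<Omega> R0 \<eta> d Y s) (A_topology d Y)
           (sigma_trace \<Omega> R0 \<eta> d Y e1 e2 s)"
proof -
 interpret trace_setting \<Omega> R0 \<eta> d Y e1 e2 s by unfold_locales (use assms in auto)
 show ?thesis by (rule trace_theorem)
qed

end
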